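(* Let $\mathbf{M}$ be a bicomplete closed symmetric monoidal category, $\overline{\mathbf{D}}=(\mathbf{D},\perp)$ an orthogonal category, $j:\mathbf{C}\to\mathbf{D}$ the embedding of a full subcategory, and $\overline{\mathbf{C}}=(\mathbf{C},j^*(\perp))$. Let $A\in\mathbf{Alg}_{\mathcal{O}_{\overline{\mathbf{C}}}}(\mathbf{M})$ be such that the left Kan extension $\mathrm{Lan}_j\,p_{\overline{\mathbf{C}}}^*(A)\in\mathbf{Alg}(\mathbf{M})^{\mathbf{D}}$ is $\perp$-commutative on $\overline{\mathbf{D}}$. Then there exists an isomorphism $$\mathrm{Lan}_j\,p_{\overline{\mathbf{C}}}^*(A)\;\cong\;p_{\overline{\mathbf{D}}}^*\,\mathcal{O}_{j\,!}(A)$$ in $\mathbf{Alg}(\mathbf{M})^{\mathbf{D}}$.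
   Context: Colored operads are symmetric and $\mathbf{Set}$-valued: a colored operad $\mathcal{O}$ has a set of colors, sets of operations $\mathcal{O}\binom{t}{\underline{c}}$, permutation maps $\mathcal{O}\binom{t}{\underline{c}}\to\mathcal{O}\binom{t}{\underline{c}\sigma}$ with $\underline{c}\sigma=(c_{\sigma(1)},\dots,c_{\sigma(n)})$, compositions $\gamma$ and units, subject to the usual axioms. A morphism consists of a map of color sets and compatible maps of operations. $\mathbf{Op}_{\mathfrak{C}}$ is the category of operads with color set $\mathfrak{C}$ and morphisms that are the identity on colors. Orthogonal category: a pair $\overline{\mathbf{C}}=(\mathbf{C},\perp)$ of a small category $\mathbf{C}$ and a set $\perp$ of pairs $(f_1,f_2)$ of $\mathbf{C}$-morphisms with common target (written $f_1\perp f_2$) that is symmetric and stable under post-composition ($f_1\perp f_2\Rightarrow gf_1\perp gf_2$) and pre-composition ($f_1\perp f_2\Rightarrow f_1h_1\perp f_2h_2$). An orthogonal functor is a functor preserving orthogonal pairs. The pullback of $\perp$ along $j:\mathbf{C}\to\mathbf{D}$ is $j^*(\perp)=\{(f_1,f_2)\text{ with common target}: j(f_1)\perp j(f_2)\}$. The operad $\mathcal{O}_{\mathbf{C}}$: the colors are the objects $\mathbf{C}_0$; $\mathcal{O}_{\mathbf{C}}\binom{t}{\underline{c}}=\Sigma_n\times\prod_{i=1}^n\mathbf{C}(c_i,t)$ with elements $(\sigma,\underline{f})$; permutations act by $(\sigma,\underline{f})\mapsto(\sigma\sigma',\underline{f}\sigma')$; composition is $\gamma\big((\sigma,\underline{f}),((\sigma_i,\underline{g}_i))_i\big)=\big(\sigma(\sigma_1,\dots,\sigma_m),(f_1g_{11},\dots,f_1g_{1k_1},\dots,f_mg_{m1},\dots,f_mg_{mk_m})\big)$,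 where $\sigma(\sigma_1,\dots,\sigma_m)$ is the composition in the associative operad (sum permutation $\sigma_1\oplus\cdots\oplus\sigma_m$ followed by the block permutation moving the $i$-th block to the $\sigma(i)$-th block position); units are $(e,\mathrm{id}_t)$. The operad $\mathcal{O}_{\overline{\mathbf{C}}}$, with quotient morphism $p_{\overline{\mathbf{C}}}:\mathcal{O}_{\mathbf{C}}\to\mathcal{O}_{\overline{\mathbf{C}}}$, is the coequalizer in $\mathbf{Op}_{\mathbf{C}_0}$ universally identifying $(e,(f_1,f_2))$ with $(\tau,(f_1,f_2))$ for all orthogonal pairs $(f_1,f_2)$, with $e,\tau\in\Sigma_2$ the identity and the transposition. An orthogonal functor $F:\overline{\mathbf{C}}\to\overline{\mathbf{D}}$ induces an operad morphism $\mathcal{O}_F:\mathcal{O}_{\overline{\mathbf{C}}}\to\mathcal{O}_{\overline{\mathbf{D}}}$, given by $F$ on colors and $[(\sigma,\underline{f})]\mapsto[(\sigma,F(\underline{f}))]$ on operations. Algebras: an $\mathcal{O}$-algebra $A$ in $\mathbf{M}$ consists of objects $A_t\in\mathbf{M}$ and morphisms $\alpha(o):A_{c_1}\otimes\cdots\otimes A_{c_n}\to A_t$ for all $o\in\mathcal{O}\binom{t}{\underline{c}}$, subject to the usual axioms. For an operad morphism $\phi:\mathcal{O}\to\mathcal{P}$, $\phi^*:\mathbf{Alg}_{\mathcal{P}}(\mathbf{M})\to\mathbf{Alg}_{\mathcal{O}}(\mathbf{M})$ is the pullback functor; it has a left adjoint $\phi_!$. $\mathbf{Alg}(\mathbf{M})$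 is the category of monoids in $\mathbf{M}$; $\mathbf{Alg}_{\mathcal{O}_{\mathbf{C}}}(\mathbf{M})$ is identified with the functor category $\mathbf{Alg}(\mathbf{M})^{\mathbf{C}}$, and $\mathbf{Alg}_{\mathcal{O}_{\overline{\mathbf{C}}}}(\mathbf{M})$ with its full subcategory of $\perp$-commutative functors, i.e. functors $\mathfrak{A}$ with $\mu_c(\mathfrak{A}(f_1)\otimes\mathfrak{A}(f_2))=\mu_c^{\mathrm{op}}(\mathfrak{A}(f_1)\otimes\mathfrak{A}(f_2))$ for all orthogonal pairs $(f_1,f_2)$ with target $c$; then $p_{\overline{\mathbf{C}}}^*$ is the inclusion functor. $\mathrm{Lan}_j:\mathbf{Alg}(\mathbf{M})^{\mathbf{C}}\to\mathbf{Alg}(\mathbf{M})^{\mathbf{D}}$ is the left adjoint of precomposition with $j$. *)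

theory Defs
  imports "HOL-Combinatorics.Permutations" "HOL-Library.FuncSet"
begin

section \<open>Categories, functors, adjunctions\<close>

record ('o, 'm) cat =
  Obj :: "'o set"
  Arr :: "'m set"
  Dom :: "'m \<Rightarrow> 'o"
  Cod :: "'m \<Rightarrow> 'o"
  Id :: "'o \<Rightarrow> 'm"
  Comp :: "'m \<Rightarrow> 'm \<Rightarrow> 'm"  (infixr "\<cdot>\<index>" 65)

definition hom :: "('o, 'm, 'z) cat_scheme \<Rightarrow> 'o \<Rightarrow> 'o \<Rightarrow> 'm set" where
  "hom C a b = {f \<in> Arr C. Dom C f = a \<and> Cod C f = b}"

locale category =
  fixes C :: "('o, 'm, 'z) cat_scheme" (structure)
  assumes dom_obj: "f \<in> Arr C \<Longrightarrow> Dom C f \<in> Obj C"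
    and cod_obj: "f \<in> Arr C \<Longrightarrow> Cod C f \<in> Obj C"
    and id_hom: "a \<in> Obj C \<Longrightarrow> Id C a \<in> hom C a a"
    and comp_hom: "f \<in> hom C a b \<Longrightarrow> g \<in> hom C b c \<Longrightarrow> g \<cdot> f \<in> hom C a c"
    and comp_id: "f \<in> hom C a b \<Longrightarrow> f \<cdot> Id C a = f"
    and id_comp: "f \<in> hom C a b \<Longrightarrow> Id C b \<cdot> f = f"
    and comp_assoc: "f \<in> hom C a b \<Longrightarrow> g \<in> hom C b c \<Longrightarrow> h \<in> hom C c d \<Longrightarrow>
                     (h \<cdot> g) \<cdot> f = h \<cdot> (g \<cdot> f)"

definition inverse_arrows :: "('o, 'm, 'z) cat_scheme \<Rightarrow> 'm \<Rightarrow> 'm \<Rightarrow> bool" where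
  "inverse_arrows C f g \<longleftrightarrow>
     f \<in> Arr C \<and> g \<in> hom C (Cod C f) (Dom C f) \<and>
     g \<cdot>\<^bsub>C\<^esub> f = Id C (Dom C f) \<and> f \<cdot>\<^bsub>C\<^esub> g = Id C (Cod C f)"

definition is_iso :: "('o, 'm, 'z) cat_scheme \<Rightarrow> 'm \<Rightarrow> bool" where
  "is_iso C f \<longleftrightarrow> (\<exists>g. inverse_arrows C f g)"

definition inv_arr :: "('o, 'm, 'z) cat_scheme \<Rightarrow> 'm \<Rightarrow> 'm" where
  "inv_arr C f = (THE g. inverse_arrows C f g)"

definition isomorphic :: "('o, 'm, 'z) cat_scheme \<Rightarrow> 'o \<Rightarrow> 'o \<Rightarrow> bool" where
  "isomorphic C a b \<longleftrightarrow> (\<exists>f \<in> hom C a b. is_iso C f)"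

text \<open>
  A category whose arrows are triples (source, raw arrow, target). The raw arrows need not
  determine their source and target.
\<close>
definition mk_cat ::
  "'x set \<Rightarrow> ('x \<Rightarrow> 'x \<Rightarrow> 'h set) \<Rightarrow> ('x \<Rightarrow> 'h) \<Rightarrow> ('h \<Rightarrow> 'h \<Rightarrow> 'h) \<Rightarrow> ('x, 'x \<times> 'h \<times> 'x) cat" where
  "mk_cat X H i c =
     \<lparr>Obj = X,
      Arr = {(a, h, b). a \<in> X \<and> b \<in> X \<and> h \<in> H a b},
      Dom = (\<lambda>(a, h, b). a),
      Cod = (\<lambda>(a, h, b). b),
      Id = (\<lambda>a. (a, i a, a)),
      Comp = (\<lambda>(a', g, b') (a, f, b). (a, c g f, b'))\<rparr>"

text \<open>Functors are extensional, so that equal functors are equal as records.\<close>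
record ('o1, 'm1, 'o2, 'm2) fctr =
  FO :: "'o1 \<Rightarrow> 'o2"
  FM :: "'m1 \<Rightarrow> 'm2"

definition is_functor ::
  "('o1, 'm1, 'z1) cat_scheme \<Rightarrow> ('o2, 'm2, 'z2) cat_scheme \<Rightarrow> ('o1, 'm1, 'o2, 'm2) fctr \<Rightarrow> bool" where
  "is_functor C D F \<longleftrightarrow>
     FO F \<in> Obj C \<rightarrow>\<^sub>E Obj D \<and> FM F \<in> Arr C \<rightarrow>\<^sub>E Arr D \<and>
     (\<forall>f \<in> Arr C. FM F f \<in> hom D (FO F (Dom C f)) (FO F (Cod C f))) \<and>
     (\<forall>a \<in> Obj C. FM F (Id C a) = Id D (FO F a)) \<and>
     (\<forall>f \<in> Arr C. \<forall>g \<in> Arr C. Cod C f = Dom C g \<longrightarrow>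
        FM F (g \<cdot>\<^bsub>C\<^esub> f) = FM F g \<cdot>\<^bsub>D\<^esub> FM F f)"

definition nat_trans ::
  "('o1, 'm1, 'z1) cat_scheme \<Rightarrow> ('o2, 'm2, 'z2) cat_scheme \<Rightarrow>
   ('o1, 'm1, 'o2, 'm2) fctr \<Rightarrow> ('o1, 'm1, 'o2, 'm2) fctr \<Rightarrow> ('o1 \<Rightarrow> 'm2) set" where
  "nat_trans C D F G =
     {\<eta> \<in> (\<Pi>\<^sub>E a \<in> Obj C. hom D (FO F a) (FO G a)).
        \<forall>f \<in> Arr C. \<eta> (Cod C f) \<cdot>\<^bsub>D\<^esub> FM F f = FM G f \<cdot>\<^bsub>D\<^esub> \<eta> (Dom C f)}"

definition fun_cat ::
  "('o1, 'm1, 'z1) cat_scheme \<Rightarrow> ('o2, 'm2, 'z2) cat_scheme \<Rightarrow>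
   (('o1, 'm1, 'o2, 'm2) fctr,
    ('o1, 'm1, 'o2, 'm2) fctr \<times> ('o1 \<Rightarrow> 'm2) \<times> ('o1, 'm1, 'o2, 'm2) fctr) cat" where
  "fun_cat C D =
     mk_cat {F. is_functor C D F} (nat_trans C D)
       (\<lambda>F. \<lambda>a \<in> Obj C. Id D (FO F a))
       (\<lambda>\<theta> \<eta>. \<lambda>a \<in> Obj C. \<theta> a \<cdot>\<^bsub>D\<^esub> \<eta> a)"

definition functor_comp ::
  "('o1, 'm1, 'z1) cat_scheme \<Rightarrow> ('o2, 'm2, 'o3, 'm3) fctr \<Rightarrow> ('o1, 'm1, 'o2, 'm2) fctr \<Rightarrow>
   ('o1, 'm1, 'o3, 'm3) fctr" where
  "functor_comp C G F =
     \<lparr>FO = (\<lambda>a \<in> Obj C. FO G (FO F a)), FM = (\<lambda>f \<in> Arr C. FM G (FM F f))\<rparr>"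

definition precomp ::
  "('o1, 'm1, 'z1) cat_scheme \<Rightarrow> ('o2, 'm2, 'z2) cat_scheme \<Rightarrow> ('o3, 'm3, 'z3) cat_scheme \<Rightarrow>
   ('o1, 'm1, 'o2, 'm2) fctr \<Rightarrow>
   (('o2, 'm2, 'o3, 'm3) fctr,
    ('o2, 'm2, 'o3, 'm3) fctr \<times> ('o2 \<Rightarrow> 'm3) \<times> ('o2, 'm2, 'o3, 'm3) fctr,
    ('o1, 'm1, 'o3, 'm3) fctr,
    ('o1, 'm1, 'o3, 'm3) fctr \<times> ('o1 \<Rightarrow> 'm3) \<times> ('o1, 'm1, 'o3, 'm3) fctr) fctr" where
  "precomp C D E j =
     \<lparr>FO = (\<lambda>G \<in> Obj (fun_cat D E). functor_comp C G j),
      FM = (\<lambda>(G, \<eta>, G') \<in> Arr (fun_cat D E).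
              (functor_comp C G j, \<lambda>a \<in> Obj C. \<eta> (FO j a), functor_comp C G' j))\<rparr>"

text \<open>\<open>L\<close> is left adjoint to \<open>G\<close>: there is a natural unit with the universal property.\<close>
definition left_adjoint ::
  "('o1, 'm1, 'z1) cat_scheme \<Rightarrow> ('o2, 'm2, 'z2) cat_scheme \<Rightarrow>
   ('o1, 'm1, 'o2, 'm2) fctr \<Rightarrow> ('o2, 'm2, 'o1, 'm1) fctr \<Rightarrow> bool" where
  "left_adjoint A B L G \<longleftrightarrow>
     is_functor A B L \<and> is_functor B A G \<and>
     (\<exists>\<eta>. (\<forall>x \<in> Obj A. \<eta> x \<in> hom A x (FO G (FO L x))) \<and>
          (\<forall>f \<in> Arr A. \<eta> (Cod A f) \<cdot>\<^bsub>A\<^esub> f = FM G (FM L f) \<cdot>\<^bsub>A\<^esub> \<eta> (Dom A f)) \<and>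
          (\<forall>x \<in> Obj A. \<forall>y \<in> Obj B. \<forall>f \<in> hom A x (FO G y).
             \<exists>!g. g \<in> hom B (FO L x) y \<and> FM G g \<cdot>\<^bsub>A\<^esub> \<eta> x = f))"

definition full_embedding ::
  "('o1, 'm1, 'z1) cat_scheme \<Rightarrow> ('o2, 'm2, 'z2) cat_scheme \<Rightarrow> ('o1, 'm1, 'o2, 'm2) fctr \<Rightarrow> bool" where
  "full_embedding C D j \<longleftrightarrow>
     is_functor C D j \<and> inj_on (FO j) (Obj C) \<and>
     (\<forall>a \<in> Obj C. \<forall>b \<in> Obj C. bij_betw (FM j) (hom C a b) (hom D (FO j a) (FO j b)))"


section \<open>Limits and colimits\<close>

definition has_limit ::
  "('j, 'k, 'z1) cat_scheme \<Rightarrow> ('o, 'm, 'z2) cat_scheme \<Rightarrow> ('j, 'k, 'o, 'm) fctr \<Rightarrow> bool" where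
  "has_limit J C F \<longleftrightarrow>
     (let cone = (\<lambda>x p. x \<in> Obj C \<and> (\<forall>i \<in> Obj J. p i \<in> hom C x (FO F i)) \<and>
                        (\<forall>f \<in> Arr J. FM F f \<cdot>\<^bsub>C\<^esub> p (Dom J f) = p (Cod J f)))
      in \<exists>l p. cone l p \<and>
           (\<forall>x q. cone x q \<longrightarrow> (\<exists>!u. u \<in> hom C x l \<and> (\<forall>i \<in> Obj J. p i \<cdot>\<^bsub>C\<^esub> u = q i))))"

definition has_colimit ::
  "('j, 'k, 'z1) cat_scheme \<Rightarrow> ('o, 'm, 'z2) cat_scheme \<Rightarrow> ('j, 'k, 'o, 'm) fctr \<Rightarrow> bool" where
  "has_colimit J C F \<longleftrightarrow>
     (let cocone = (\<lambda>x p. x \<in> Obj C \<and> (\<forall>i \<in> Obj J. p i \<in> hom C (FO F i) x) \<and>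
                          (\<forall>f \<in> Arr J. p (Cod J f) \<cdot>\<^bsub>C\<^esub> FM F f = p (Dom J f)))
      in \<exists>l p. cocone l p \<and>
           (\<forall>x q. cocone x q \<longrightarrow> (\<exists>!u. u \<in> hom C l x \<and> (\<forall>i \<in> Obj J. u \<cdot>\<^bsub>C\<^esub> p i = q i))))"

text \<open>
  The type \<open>'u\<close> plays the role of the universe of small sets: a small category is one whose
  objects and arrows are elements of \<open>'u\<close>.
\<close>
definition bicomplete :: "'u itself \<Rightarrow> ('o, 'm, 'z) cat_scheme \<Rightarrow> bool" where
  "bicomplete U C \<longleftrightarrow>
     (\<forall>(J :: ('u, 'u) cat) F. category J \<longrightarrow> is_functor J C F \<longrightarrow> has_limit J C F \<and> has_colimit J C F)"


section \<open>Symmetric monoidal categories\<close>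

record ('o, 'm) smc = "('o, 'm) cat" +
  TObj :: "'o \<Rightarrow> 'o \<Rightarrow> 'o"  (infixr "\<otimes>\<index>" 70)
  TArr :: "'m \<Rightarrow> 'm \<Rightarrow> 'm"  (infixr "\<odot>\<index>" 70)
  TUnit :: "'o"
  Assoc :: "'o \<Rightarrow> 'o \<Rightarrow> 'o \<Rightarrow> 'm"
  LUnit :: "'o \<Rightarrow> 'm"
  RUnit :: "'o \<Rightarrow> 'm"
  Sym :: "'o \<Rightarrow> 'o \<Rightarrow> 'm"

locale symmetric_monoidal_category = category M
  for M :: "('o, 'm, 'z) smc_scheme" (structure) +
  assumes tensor_obj: "a \<in> Obj M \<Longrightarrow> b \<in> Obj M \<Longrightarrow> a \<otimes> b \<in> Obj M"
    and tensor_hom: "f \<in> hom M a b \<Longrightarrow> g \<in> hom M c d \<Longrightarrow> f \<odot> g \<in> hom M (a \<otimes> c) (b \<otimes> d)"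
    and tensor_id: "a \<in> Obj M \<Longrightarrow> b \<in> Obj M \<Longrightarrow> Id M a \<odot> Id M b = Id M (a \<otimes> b)"
    and tensor_comp:
      "f \<in> hom M a b \<Longrightarrow> f' \<in> hom M b c \<Longrightarrow> g \<in> hom M a' b' \<Longrightarrow> g' \<in> hom M b' c' \<Longrightarrow>
       (f' \<cdot> f) \<odot> (g' \<cdot> g) = (f' \<odot> g') \<cdot> (f \<odot> g)"
    and unit_obj: "TUnit M \<in> Obj M"
    and assoc_hom: "a \<in> Obj M \<Longrightarrow> b \<in> Obj M \<Longrightarrow> c \<in> Obj M \<Longrightarrow>
       Assoc M a b c \<in> hom M ((a \<otimes> b) \<otimes> c) (a \<otimes> (b \<otimes> c))"
    and assoc_iso: "a \<in> Obj M \<Longrightarrow> b \<in> Obj M \<Longrightarrow> c \<in> Obj M \<Longrightarrow> is_iso M (Assoc M a b c)"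
    and assoc_natural:
      "f \<in> hom M a a' \<Longrightarrow> g \<in> hom M b b' \<Longrightarrow> h \<in> hom M c c' \<Longrightarrow>
       Assoc M a' b' c' \<cdot> ((f \<odot> g) \<odot> h) = (f \<odot> (g \<odot> h)) \<cdot> Assoc M a b c"
    and lunit_hom: "a \<in> Obj M \<Longrightarrow> LUnit M a \<in> hom M (TUnit M \<otimes> a) a"
    and lunit_iso: "a \<in> Obj M \<Longrightarrow> is_iso M (LUnit M a)"
    and lunit_natural: "f \<in> hom M a b \<Longrightarrow> LUnit M b \<cdot> (Id M (TUnit M) \<odot> f) = f \<cdot> LUnit M a"
    and runit_hom: "a \<in> Obj M \<Longrightarrow> RUnit M a \<in> hom M (a \<otimes> TUnit M) a"
    and runit_iso: "a \<in> Obj M \<Longrightarrow> is_iso M (RUnit M a)"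
    and runit_natural: "f \<in> hom M a b \<Longrightarrow> RUnit M b \<cdot> (f \<odot> Id M (TUnit M)) = f \<cdot> RUnit M a"
    and sym_hom: "a \<in> Obj M \<Longrightarrow> b \<in> Obj M \<Longrightarrow> Sym M a b \<in> hom M (a \<otimes> b) (b \<otimes> a)"
    and sym_natural: "f \<in> hom M a a' \<Longrightarrow> g \<in> hom M b b' \<Longrightarrow>
       Sym M a' b' \<cdot> (f \<odot> g) = (g \<odot> f) \<cdot> Sym M a b"
    and sym_sym: "a \<in> Obj M \<Longrightarrow> b \<in> Obj M \<Longrightarrow> Sym M b a \<cdot> Sym M a b = Id M (a \<otimes> b)"
    and pentagon:
      "a \<in> Obj M \<Longrightarrow> b \<in> Obj M \<Longrightarrow> c \<in> Obj M \<Longrightarrow> d \<in> Obj M \<Longrightarrow>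
       Assoc M a b (c \<otimes> d) \<cdot> Assoc M (a \<otimes> b) c d =
       (Id M a \<odot> Assoc M b c d) \<cdot> Assoc M a (b \<otimes> c) d \<cdot> (Assoc M a b c \<odot> Id M d)"
    and triangle:
      "a \<in> Obj M \<Longrightarrow> b \<in> Obj M \<Longrightarrow>
       (Id M a \<odot> LUnit M b) \<cdot> Assoc M a (TUnit M) b = RUnit M a \<odot> Id M b"
    and hexagon:
      "a \<in> Obj M \<Longrightarrow> b \<in> Obj M \<Longrightarrow> c \<in> Obj M \<Longrightarrow>
       Assoc M b c a \<cdot> Sym M a (b \<otimes> c) \<cdot> Assoc M a b c =
       (Id M b \<odot> Sym M a c) \<cdot> Assoc M b a c \<cdot> (Sym M a b \<odot> Id M c)"

definition closed_monoidal :: "('o, 'm, 'z) smc_scheme \<Rightarrow> bool" where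
  "closed_monoidal M \<longleftrightarrow>
     (\<forall>b \<in> Obj M. \<forall>c \<in> Obj M. \<exists>h \<in> Obj M. \<exists>ev \<in> hom M (h \<otimes>\<^bsub>M\<^esub> b) c.
        \<forall>a \<in> Obj M. \<forall>f \<in> hom M (a \<otimes>\<^bsub>M\<^esub> b) c.
          \<exists>!g. g \<in> hom M a h \<and> ev \<cdot>\<^bsub>M\<^esub> (g \<odot>\<^bsub>M\<^esub> Id M b) = f)"

text \<open>
  The \<open>n\<close>-fold tensor product of \<open>[x1, \<dots>, xn]\<close> is bracketed as
  \<open>x1 \<otimes> (x2 \<otimes> (\<dots> \<otimes> (xn \<otimes> I)))\<close>. In particular the empty tensor product is \<open>I\<close>, and the
  one-fold tensor product of \<open>x\<close> is \<open>x \<otimes> I\<close>, identified with \<open>x\<close> via the right unitor.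
\<close>
primrec tens :: "('o, 'm, 'z) smc_scheme \<Rightarrow> 'o list \<Rightarrow> 'o" where
  "tens M [] = TUnit M"
| "tens M (x # xs) = x \<otimes>\<^bsub>M\<^esub> tens M xs"

primrec tens_arr :: "('o, 'm, 'z) smc_scheme \<Rightarrow> 'm list \<Rightarrow> 'm" where
  "tens_arr M [] = Id M (TUnit M)"
| "tens_arr M (f # fs) = f \<odot>\<^bsub>M\<^esub> tens_arr M fs"

text \<open>The coherence isomorphism from \<open>tens M xs \<otimes> tens M ys\<close> to \<open>tens M (xs @ ys)\<close>.\<close>
primrec tens_append :: "('o, 'm, 'z) smc_scheme \<Rightarrow> 'o list \<Rightarrow> 'o list \<Rightarrow> 'm" where
  "tens_append M [] ys = LUnit M (tens M ys)"
| "tens_append M (x # xs) ys =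
     (Id M x \<odot>\<^bsub>M\<^esub> tens_append M xs ys) \<cdot>\<^bsub>M\<^esub> Assoc M x (tens M xs) (tens M ys)"

text \<open>The coherence isomorphism from \<open>tens M (map (tens M) xss)\<close> to \<open>tens M (concat xss)\<close>.\<close>
primrec tens_concat :: "('o, 'm, 'z) smc_scheme \<Rightarrow> 'o list list \<Rightarrow> 'm" where
  "tens_concat M [] = Id M (TUnit M)"
| "tens_concat M (xs # xss) =
     tens_append M xs (concat xss) \<cdot>\<^bsub>M\<^esub> (Id M (tens M xs) \<odot>\<^bsub>M\<^esub> tens_concat M xss)"

definition swap3 :: "('o, 'm, 'z) smc_scheme \<Rightarrow> 'o \<Rightarrow> 'o \<Rightarrow> 'o \<Rightarrow> 'm" where
  "swap3 M x y z = Assoc M y x z \<cdot>\<^bsub>M\<^esub> (Sym M x y \<odot>\<^bsub>M\<^esub> Id M z) \<cdot>\<^bsub>M\<^esub> inv_arr M (Assoc M x y z)"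

text \<open>
  Permutation isomorphisms, for factors \<open>X i\<close> labelled by distinct numbers \<open>i\<close>. The arrow
  \<open>pull_front M X j ks\<close> goes from \<open>tens M (map X ks)\<close> to
  \<open>X j \<otimes> tens M (map X (remove1 j ks))\<close>, for \<open>j \<in> set ks\<close>; the arrow \<open>reorder M X ks js\<close> goes
  from \<open>tens M (map X ks)\<close> to \<open>tens M (map X js)\<close>, for \<open>js\<close> a rearrangement of \<open>ks\<close>.
\<close>
primrec pull_front :: "('o, 'm, 'z) smc_scheme \<Rightarrow> (nat \<Rightarrow> 'o) \<Rightarrow> nat \<Rightarrow> nat list \<Rightarrow> 'm" where
  "pull_front M X j [] = undefined"
| "pull_front M X j (k # ks) =
     (if k = j then Id M (tens M (map X (k # ks)))
      else swap3 M (X k) (X j) (tens M (map X (remove1 j ks))) \<cdot>\<^bsub>M\<^esub>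
             (Id M (X k) \<odot>\<^bsub>M\<^esub> pull_front M X j ks))"

primrec reorder :: "('o, 'm, 'z) smc_scheme \<Rightarrow> (nat \<Rightarrow> 'o) \<Rightarrow> nat list \<Rightarrow> nat list \<Rightarrow> 'm" where
  "reorder M X ks [] = Id M (TUnit M)"
| "reorder M X ks (j # js) =
     (Id M (X j) \<odot>\<^bsub>M\<^esub> reorder M X (remove1 j ks) js) \<cdot>\<^bsub>M\<^esub> pull_front M X j ks"

text \<open>The symmetry isomorphism from \<open>tens M xs\<close> to \<open>tens M (permute_list \<sigma> xs)\<close>.\<close>
definition tens_perm :: "('o, 'm, 'z) smc_scheme \<Rightarrow> (nat \<Rightarrow> nat) \<Rightarrow> 'o list \<Rightarrow> 'm" where
  "tens_perm M \<sigma> xs = reorder M (\<lambda>i. xs ! i) [0..<length xs] (map \<sigma> [0..<length xs])"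


section \<open>Monoids\<close>

record ('o, 'm) mon =
  Car :: "'o"
  Mul :: "'m"
  One :: "'m"

definition is_mon :: "('o, 'm, 'z) smc_scheme \<Rightarrow> ('o, 'm) mon \<Rightarrow> bool" where
  "is_mon M A \<longleftrightarrow>
     Car A \<in> Obj M \<and> Mul A \<in> hom M (Car A \<otimes>\<^bsub>M\<^esub> Car A) (Car A) \<and> One A \<in> hom M (TUnit M) (Car A) \<and>
     Mul A \<cdot>\<^bsub>M\<^esub> (Mul A \<odot>\<^bsub>M\<^esub> Id M (Car A)) =
       Mul A \<cdot>\<^bsub>M\<^esub> (Id M (Car A) \<odot>\<^bsub>M\<^esub> Mul A) \<cdot>\<^bsub>M\<^esub> Assoc M (Car A) (Car A) (Car A) \<and>
     Mul A \<cdot>\<^bsub>M\<^esub> (One A \<odot>\<^bsub>M\<^esub> Id M (Car A)) = LUnit M (Car A) \<and>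
     Mul A \<cdot>\<^bsub>M\<^esub> (Id M (Car A) \<odot>\<^bsub>M\<^esub> One A) = RUnit M (Car A)"

definition mon_hom :: "('o, 'm, 'z) smc_scheme \<Rightarrow> ('o, 'm) mon \<Rightarrow> ('o, 'm) mon \<Rightarrow> 'm set" where
  "mon_hom M A B =
     {f \<in> hom M (Car A) (Car B).
        f \<cdot>\<^bsub>M\<^esub> Mul A = Mul B \<cdot>\<^bsub>M\<^esub> (f \<odot>\<^bsub>M\<^esub> f) \<and> f \<cdot>\<^bsub>M\<^esub> One A = One B}"

definition Mon ::
  "('o, 'm, 'z) smc_scheme \<Rightarrow> (('o, 'm) mon, ('o, 'm) mon \<times> 'm \<times> ('o, 'm) mon) cat" where
  "Mon M = mk_cat {A. is_mon M A} (mon_hom M) (\<lambda>A. Id M (Car A)) (Comp M)"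


section \<open>Colored operads\<close>

text \<open>
  Operations carry their profile: \<open>o \<in> Ops P\<close> with \<open>Inp P o = cs\<close> and \<open>Out P o = t\<close> is an operation
  from \<open>cs\<close> to \<open>t\<close>. Positions are counted from 0, so that the symmetric group on \<open>n\<close> letters is
  \<open>{\<sigma>. \<sigma> permutes {..<n}}\<close>, and \<open>permute_list \<sigma> cs = [cs ! \<sigma> 0, \<dots>, cs ! \<sigma> (n - 1)]\<close>.
\<close>
record ('c, 'x) operad =
  Colors :: "'c set"
  Ops :: "'x set"
  Inp :: "'x \<Rightarrow> 'c list"
  Out :: "'x \<Rightarrow> 'c"
  Act :: "'x \<Rightarrow> (nat \<Rightarrow> nat) \<Rightarrow> 'x"
  Gam :: "'x \<Rightarrow> 'x list \<Rightarrow> 'x"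
  OpUnit :: "'c \<Rightarrow> 'x"

definition composable :: "('c, 'x, 'z) operad_scheme \<Rightarrow> 'x \<Rightarrow> 'x list \<Rightarrow> bool" where
  "composable P x ys \<longleftrightarrow> x \<in> Ops P \<and> set ys \<subseteq> Ops P \<and> Inp P x = map (Out P) ys"

text \<open>
  For blocks of lengths \<open>ks\<close>, the position \<open>p < sum_list ks\<close> is the entry \<open>block_ent ks p\<close> of the
  block \<open>block_idx ks p\<close>.
\<close>
definition block_idx :: "nat list \<Rightarrow> nat \<Rightarrow> nat" where
  "block_idx ks p = (LEAST i. p < sum_list (take (Suc i) ks))"

definition block_ent :: "nat list \<Rightarrow> nat \<Rightarrow> nat" where
  "block_ent ks p = p - sum_list (take (block_idx ks p) ks)"

text \<open>The \<open>i\<close>-th block, of length \<open>ks ! i\<close>, is moved to the \<open>\<sigma> i\<close>-th block position.\<close>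
definition block_perm :: "(nat \<Rightarrow> nat) \<Rightarrow> nat list \<Rightarrow> nat \<Rightarrow> nat" where
  "block_perm \<sigma> ks p =
     (if p < sum_list ks
      then (\<Sum>i | i < length ks \<and> \<sigma> i < \<sigma> (block_idx ks p). ks ! i) + block_ent ks p
      else p)"

text \<open>The sum of the permutations \<open>\<sigma>s ! i\<close> of \<open>{..<ks ! i}\<close>.\<close>
definition sum_perm :: "nat list \<Rightarrow> (nat \<Rightarrow> nat) list \<Rightarrow> nat \<Rightarrow> nat" where
  "sum_perm ks \<sigma>s p =
     (if p < sum_list ks
      then sum_list (take (block_idx ks p) ks) + (\<sigma>s ! block_idx ks p) (block_ent ks p)
      else p)"

locale colored_operad =
  fixes P :: "('c, 'x, 'z) operad_scheme" (structure)
  assumes out_color: "x \<in> Ops P \<Longrightarrow> Out P x \<in> Colors P"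
    and inp_color: "x \<in> Ops P \<Longrightarrow> set (Inp P x) \<subseteq> Colors P"
    and act_ops: "x \<in> Ops P \<Longrightarrow> \<sigma> permutes {..<length (Inp P x)} \<Longrightarrow>
      Act P x \<sigma> \<in> Ops P \<and> Out P (Act P x \<sigma>) = Out P x \<and> Inp P (Act P x \<sigma>) = permute_list \<sigma> (Inp P x)"
    and gam_ops: "composable P x ys \<Longrightarrow>
      Gam P x ys \<in> Ops P \<and> Out P (Gam P x ys) = Out P x \<and> Inp P (Gam P x ys) = concat (map (Inp P) ys)"
    and un_ops: "c \<in> Colors P \<Longrightarrow> OpUnit P c \<in> Ops P \<and> Out P (OpUnit P c) = c \<and> Inp P (OpUnit P c) = [c]"
    and act_id: "x \<in> Ops P \<Longrightarrow> Act P x id = x"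
    and act_act: "x \<in> Ops P \<Longrightarrow> \<sigma> permutes {..<length (Inp P x)} \<Longrightarrow> \<tau> permutes {..<length (Inp P x)} \<Longrightarrow>
      Act P (Act P x \<sigma>) \<tau> = Act P x (\<sigma> \<circ> \<tau>)"
    and gam_assoc: "composable P x ys \<Longrightarrow> list_all2 (composable P) ys zss \<Longrightarrow>
      Gam P (Gam P x ys) (concat zss) = Gam P x (map2 (Gam P) ys zss)"
    and gam_un_left: "x \<in> Ops P \<Longrightarrow> Gam P (OpUnit P (Out P x)) [x] = x"
    and gam_un_right: "x \<in> Ops P \<Longrightarrow> Gam P x (map (OpUnit P) (Inp P x)) = x"
    and equivariance_top: "composable P x ys \<Longrightarrow> \<sigma> permutes {..<length ys} \<Longrightarrow>
      Gam P (Act P x \<sigma>) (permute_list \<sigma> ys) =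
      Act P (Gam P x ys) (block_perm \<sigma> (map (\<lambda>y. length (Inp P y)) (permute_list \<sigma> ys)))"
    and equivariance_bottom: "composable P x ys \<Longrightarrow>
      list_all2 (\<lambda>y \<tau>. \<tau> permutes {..<length (Inp P y)}) ys \<tau>s \<Longrightarrow>
      Gam P x (map2 (Act P) ys \<tau>s) =
      Act P (Gam P x ys) (sum_perm (map (\<lambda>y. length (Inp P y)) ys) \<tau>s)"

record ('c, 'x, 'd, 'y) operad_map =
  ColMap :: "'c \<Rightarrow> 'd"
  OpMap :: "'x \<Rightarrow> 'y"

definition operad_morphism ::
  "('c, 'x, 'z1) operad_scheme \<Rightarrow> ('d, 'y, 'z2) operad_scheme \<Rightarrow> ('c, 'x, 'd, 'y) operad_map \<Rightarrow> bool" where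
  "operad_morphism P Q \<phi> \<longleftrightarrow>
     ColMap \<phi> \<in> Colors P \<rightarrow>\<^sub>E Colors Q \<and> OpMap \<phi> \<in> Ops P \<rightarrow>\<^sub>E Ops Q \<and>
     (\<forall>x \<in> Ops P. Out Q (OpMap \<phi> x) = ColMap \<phi> (Out P x) \<and> Inp Q (OpMap \<phi> x) = map (ColMap \<phi>) (Inp P x)) \<and>
     (\<forall>x \<in> Ops P. \<forall>\<sigma>. \<sigma> permutes {..<length (Inp P x)} \<longrightarrow> OpMap \<phi> (Act P x \<sigma>) = Act Q (OpMap \<phi> x) \<sigma>) \<and>
     (\<forall>x ys. composable P x ys \<longrightarrow> OpMap \<phi> (Gam P x ys) = Gam Q (OpMap \<phi> x) (map (OpMap \<phi>) ys)) \<and>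
     (\<forall>c \<in> Colors P. OpMap \<phi> (OpUnit P c) = OpUnit Q (ColMap \<phi> c))"

text \<open>Quotients of operads with a fixed set of colors.\<close>

definition operad_congruence :: "('c, 'x, 'z) operad_scheme \<Rightarrow> ('x \<times> 'x) set \<Rightarrow> bool" where
  "operad_congruence P r \<longleftrightarrow>
     equiv (Ops P) r \<and>
     (\<forall>(x, y) \<in> r. Out P x = Out P y \<and> Inp P x = Inp P y) \<and>
     (\<forall>(x, y) \<in> r. \<forall>\<sigma>. \<sigma> permutes {..<length (Inp P x)} \<longrightarrow> (Act P x \<sigma>, Act P y \<sigma>) \<in> r) \<and>
     (\<forall>x y xs ys. composable P x xs \<longrightarrow> (x, y) \<in> r \<longrightarrow> list_all2 (\<lambda>a b. (a, b) \<in> r) xs ys \<longrightarrow>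
        (Gam P x xs, Gam P y ys) \<in> r)"

definition generated_congruence :: "('c, 'x, 'z) operad_scheme \<Rightarrow> ('x \<times> 'x) set \<Rightarrow> ('x \<times> 'x) set" where
  "generated_congruence P R = \<Inter>{r. operad_congruence P r \<and> R \<subseteq> r}"

definition quotient_operad :: "('c, 'x, 'z) operad_scheme \<Rightarrow> ('x \<times> 'x) set \<Rightarrow> ('c, 'x set) operad" where
  "quotient_operad P r =
     \<lparr>Colors = Colors P,
      Ops = Ops P // r,
      Inp = (\<lambda>q. the_elem (Inp P ` q)),
      Out = (\<lambda>q. the_elem (Out P ` q)),
      Act = (\<lambda>q \<sigma>. r `` ((\<lambda>x. Act P x \<sigma>) ` q)),
      Gam = (\<lambda>q qs. r `` {Gam P x xs | x xs. x \<in> q \<and> xs \<in> listset qs}),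
      OpUnit = (\<lambda>c. r `` {OpUnit P c})\<rparr>"

definition quotient_map ::
  "('c, 'x, 'z) operad_scheme \<Rightarrow> ('x \<times> 'x) set \<Rightarrow> ('c, 'x, 'c, 'x set) operad_map" where
  "quotient_map P r = \<lparr>ColMap = (\<lambda>c \<in> Colors P. c), OpMap = (\<lambda>x \<in> Ops P. r `` {x})\<rparr>"


section \<open>The operads of a category and of an orthogonal category\<close>

locale orthogonal_category = category C
  for C :: "('o, 'm, 'z) cat_scheme" (structure) and perp :: "('m \<times> 'm) set" +
  assumes perp_arr: "(f1, f2) \<in> perp \<Longrightarrow> f1 \<in> Arr C \<and> f2 \<in> Arr C \<and> Cod C f1 = Cod C f2"
    and perp_sym: "(f1, f2) \<in> perp \<Longrightarrow> (f2, f1) \<in> perp"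
    and perp_post: "(f1, f2) \<in> perp \<Longrightarrow> g \<in> Arr C \<Longrightarrow> Dom C g = Cod C f1 \<Longrightarrow> (g \<cdot> f1, g \<cdot> f2) \<in> perp"
    and perp_pre: "(f1, f2) \<in> perp \<Longrightarrow> h1 \<in> Arr C \<Longrightarrow> h2 \<in> Arr C \<Longrightarrow> Cod C h1 = Dom C f1 \<Longrightarrow>
                   Cod C h2 = Dom C f2 \<Longrightarrow> (f1 \<cdot> h1, f2 \<cdot> h2) \<in> perp"

definition pullback_perp ::
  "('o1, 'm1, 'z) cat_scheme \<Rightarrow> ('o1, 'm1, 'o2, 'm2) fctr \<Rightarrow> ('m2 \<times> 'm2) set \<Rightarrow> ('m1 \<times> 'm1) set" where
  "pullback_perp C j perp =
     {(f1, f2). f1 \<in> Arr C \<and> f2 \<in> Arr C \<and> Cod C f1 = Cod C f2 \<and> (FM j f1, FM j f2) \<in> perp}"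

type_synonym ('o, 'm) cat_op = "'o \<times> (nat \<Rightarrow> nat) \<times> 'm list"

text \<open>
  The triple \<open>(t, \<sigma>, fs)\<close> is the operation \<open>(\<sigma>, fs)\<close> with output \<open>t\<close>; recording \<open>t\<close> is necessary
  only if \<open>fs\<close> is empty.
\<close>
definition cat_operad :: "('o, 'm, 'z) cat_scheme \<Rightarrow> ('o, ('o, 'm) cat_op) operad" where
  "cat_operad C =
     \<lparr>Colors = Obj C,
      Ops = {(t, \<sigma>, fs). t \<in> Obj C \<and> \<sigma> permutes {..<length fs} \<and> (\<forall>f \<in> set fs. f \<in> Arr C \<and> Cod C f = t)},
      Inp = (\<lambda>(t, \<sigma>, fs). map (Dom C) fs),
      Out = (\<lambda>(t, \<sigma>, fs). t),
      Act = (\<lambda>(t, \<sigma>, fs) \<sigma>'. (t, \<sigma> \<circ> \<sigma>', permute_list \<sigma>' fs)),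
      Gam = (\<lambda>(t, \<sigma>, fs) ys.
               let ks = map (\<lambda>(t', \<sigma>', gs). length gs) ys
               in (t, block_perm \<sigma> ks \<circ> sum_perm ks (map (\<lambda>(t', \<sigma>', gs). \<sigma>') ys),
                   concat (map2 (\<lambda>f (t', \<sigma>', gs). map (\<lambda>g. f \<cdot>\<^bsub>C\<^esub> g) gs) fs ys))),
      OpUnit = (\<lambda>t. (t, id, [Id C t]))\<rparr>"

definition perp_generators ::
  "('o, 'm, 'z) cat_scheme \<Rightarrow> ('m \<times> 'm) set \<Rightarrow> (('o, 'm) cat_op \<times> ('o, 'm) cat_op) set" where
  "perp_generators C perp =
     {((Cod C f1, id, [f1, f2]), (Cod C f1, transpose 0 1, [f1, f2])) | f1 f2. (f1, f2) \<in> perp}"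

definition perp_congruence ::
  "('o, 'm, 'z) cat_scheme \<Rightarrow> ('m \<times> 'm) set \<Rightarrow> (('o, 'm) cat_op \<times> ('o, 'm) cat_op) set" where
  "perp_congruence C perp = generated_congruence (cat_operad C) (perp_generators C perp)"

text \<open>
  The quotient by the generated congruence is the coequalizer; its universal property is
  \<open>orth_operad_coequalizer\<close> below.
\<close>
definition orth_operad ::
  "('o, 'm, 'z) cat_scheme \<Rightarrow> ('m \<times> 'm) set \<Rightarrow> ('o, ('o, 'm) cat_op set) operad" where
  "orth_operad C perp = quotient_operad (cat_operad C) (perp_congruence C perp)"

definition orth_proj ::
  "('o, 'm, 'z) cat_scheme \<Rightarrow> ('m \<times> 'm) set \<Rightarrow> ('o, ('o, 'm) cat_op, 'o, ('o, 'm) cat_op set) operad_map"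
  where
  "orth_proj C perp = quotient_map (cat_operad C) (perp_congruence C perp)"

text \<open>The operad morphism induced by an orthogonal functor: \<open>[(\<sigma>, fs)]\<close> is sent to \<open>[(\<sigma>, F fs)]\<close>.\<close>
definition orth_operad_map ::
  "('o1, 'm1, 'z1) cat_scheme \<Rightarrow> ('m1 \<times> 'm1) set \<Rightarrow> ('o2, 'm2, 'z2) cat_scheme \<Rightarrow> ('m2 \<times> 'm2) set \<Rightarrow>
   ('o1, 'm1, 'o2, 'm2) fctr \<Rightarrow>
   ('o1, ('o1, 'm1) cat_op set, 'o2, ('o2, 'm2) cat_op set) operad_map" where
  "orth_operad_map C perpC D perpD F =
     \<lparr>ColMap = (\<lambda>c \<in> Obj C. FO F c),
      OpMap = (\<lambda>q \<in> Ops (orth_operad C perpC).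
              perp_congruence D perpD `` ((\<lambda>(t, \<sigma>, fs). (FO F t, \<sigma>, map (FM F) fs)) ` q))\<rparr>"


section \<open>Algebras over colored operads\<close>

record ('c, 'x, 'o, 'm) alg =
  ACar :: "'c \<Rightarrow> 'o"
  AOp :: "'x \<Rightarrow> 'm"

definition is_algebra ::
  "('c, 'x, 'z1) operad_scheme \<Rightarrow> ('o, 'm, 'z2) smc_scheme \<Rightarrow> ('c, 'x, 'o, 'm) alg \<Rightarrow> bool" where
  "is_algebra P M A \<longleftrightarrow>
     ACar A \<in> Colors P \<rightarrow>\<^sub>E Obj M \<and>
     AOp A \<in> (\<Pi>\<^sub>E x \<in> Ops P. hom M (tens M (map (ACar A) (Inp P x))) (ACar A (Out P x))) \<and>
     (\<forall>x \<in> Ops P. \<forall>\<sigma>. \<sigma> permutes {..<length (Inp P x)} \<longrightarrow>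
        AOp A (Act P x \<sigma>) \<cdot>\<^bsub>M\<^esub> tens_perm M \<sigma> (map (ACar A) (Inp P x)) = AOp A x) \<and>
     (\<forall>x ys. composable P x ys \<longrightarrow>
        AOp A (Gam P x ys) \<cdot>\<^bsub>M\<^esub> tens_concat M (map (\<lambda>y. map (ACar A) (Inp P y)) ys) =
        AOp A x \<cdot>\<^bsub>M\<^esub> tens_arr M (map (AOp A) ys)) \<and>
     (\<forall>c \<in> Colors P. AOp A (OpUnit P c) = RUnit M (ACar A c))"

definition alg_hom ::
  "('c, 'x, 'z1) operad_scheme \<Rightarrow> ('o, 'm, 'z2) smc_scheme \<Rightarrow>
   ('c, 'x, 'o, 'm) alg \<Rightarrow> ('c, 'x, 'o, 'm) alg \<Rightarrow> ('c \<Rightarrow> 'm) set" where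
  "alg_hom P M A B =
     {\<phi> \<in> (\<Pi>\<^sub>E c \<in> Colors P. hom M (ACar A c) (ACar B c)).
        \<forall>x \<in> Ops P. \<phi> (Out P x) \<cdot>\<^bsub>M\<^esub> AOp A x = AOp B x \<cdot>\<^bsub>M\<^esub> tens_arr M (map \<phi> (Inp P x))}"

definition Alg ::
  "('c, 'x, 'z1) operad_scheme \<Rightarrow> ('o, 'm, 'z2) smc_scheme \<Rightarrow>
   (('c, 'x, 'o, 'm) alg, ('c, 'x, 'o, 'm) alg \<times> ('c \<Rightarrow> 'm) \<times> ('c, 'x, 'o, 'm) alg) cat" where
  "Alg P M =
     mk_cat {A. is_algebra P M A} (alg_hom P M)
       (\<lambda>A. \<lambda>c \<in> Colors P. Id M (ACar A c))
       (\<lambda>\<psi> \<phi>. \<lambda>c \<in> Colors P. \<psi> c \<cdot>\<^bsub>M\<^esub> \<phi> c)"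

definition pull_alg ::
  "('c, 'x, 'z1) operad_scheme \<Rightarrow> ('c, 'x, 'd, 'y) operad_map \<Rightarrow>
   ('d, 'y, 'o, 'm) alg \<Rightarrow> ('c, 'x, 'o, 'm) alg" where
  "pull_alg P \<phi> B = \<lparr>ACar = (\<lambda>c \<in> Colors P. ACar B (ColMap \<phi> c)), AOp = (\<lambda>x \<in> Ops P. AOp B (OpMap \<phi> x))\<rparr>"

definition alg_pullback ::
  "('c, 'x, 'z1) operad_scheme \<Rightarrow> ('d, 'y, 'z2) operad_scheme \<Rightarrow> ('o, 'm, 'z3) smc_scheme \<Rightarrow>
   ('c, 'x, 'd, 'y) operad_map \<Rightarrow>
   (('d, 'y, 'o, 'm) alg, ('d, 'y, 'o, 'm) alg \<times> ('d \<Rightarrow> 'm) \<times> ('d, 'y, 'o, 'm) alg,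
    ('c, 'x, 'o, 'm) alg, ('c, 'x, 'o, 'm) alg \<times> ('c \<Rightarrow> 'm) \<times> ('c, 'x, 'o, 'm) alg) fctr" where
  "alg_pullback P Q M \<phi> =
     \<lparr>FO = (\<lambda>B \<in> Obj (Alg Q M). pull_alg P \<phi> B),
      FM = (\<lambda>(B, \<beta>, B') \<in> Arr (Alg Q M).
              (pull_alg P \<phi> B, \<lambda>c \<in> Colors P. \<beta> (ColMap \<phi> c), pull_alg P \<phi> B'))\<rparr>"

text \<open>
  The identification of algebras over \<open>cat_operad C\<close> with functors from \<open>C\<close> to monoids: the monoid
  at \<open>c\<close> is the object at \<open>c\<close> with the actions of \<open>(e, (id, id))\<close> and \<open>(e, ())\<close>, and the arrow
  \<open>f\<close> is sent to the action of \<open>(e, f)\<close>. The right unitors appear because of the bracketing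
  convention of \<open>tens\<close>.
\<close>
definition alg_monoid ::
  "('c, 'k, 'z1) cat_scheme \<Rightarrow> ('o, 'm, 'z2) smc_scheme \<Rightarrow> ('c, ('c, 'k) cat_op, 'o, 'm) alg \<Rightarrow>
   'c \<Rightarrow> ('o, 'm) mon" where
  "alg_monoid C M A c =
     \<lparr>Car = ACar A c,
      Mul = AOp A (c, id, [Id C c, Id C c]) \<cdot>\<^bsub>M\<^esub> (Id M (ACar A c) \<odot>\<^bsub>M\<^esub> inv_arr M (RUnit M (ACar A c))),
      One = AOp A (c, id, [])\<rparr>"

definition alg_diagram ::
  "('c, 'k, 'z1) cat_scheme \<Rightarrow> ('o, 'm, 'z2) smc_scheme \<Rightarrow> ('c, ('c, 'k) cat_op, 'o, 'm) alg \<Rightarrow>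
   ('c, 'k, ('o, 'm) mon, ('o, 'm) mon \<times> 'm \<times> ('o, 'm) mon) fctr" where
  "alg_diagram C M A =
     \<lparr>FO = (\<lambda>c \<in> Obj C. alg_monoid C M A c),
      FM = (\<lambda>f \<in> Arr C.
              (alg_monoid C M A (Dom C f),
               AOp A (Cod C f, id, [f]) \<cdot>\<^bsub>M\<^esub> inv_arr M (RUnit M (ACar A (Dom C f))),
               alg_monoid C M A (Cod C f)))\<rparr>"

text \<open>The pullback of an algebra along \<open>orth_proj C perp\<close>, as a functor from \<open>C\<close> to monoids.\<close>
definition orth_alg_diagram ::
  "('c, 'k, 'z1) cat_scheme \<Rightarrow> ('k \<times> 'k) set \<Rightarrow> ('o, 'm, 'z2) smc_scheme \<Rightarrow>
   ('c, ('c, 'k) cat_op set, 'o, 'm) alg \<Rightarrow>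
   ('c, 'k, ('o, 'm) mon, ('o, 'm) mon \<times> 'm \<times> ('o, 'm) mon) fctr" where
  "orth_alg_diagram C perp M A =
     alg_diagram C M (FO (alg_pullback (cat_operad C) (orth_operad C perp) M (orth_proj C perp)) A)"

text \<open>The arrow of \<open>M\<close> that underlies a morphism of monoids.\<close>
definition mon_arr :: "('o, 'm) mon \<times> 'm \<times> ('o, 'm) mon \<Rightarrow> 'm" where
  "mon_arr = (\<lambda>(A, f, B). f)"

definition perp_commutative ::
  "('c, 'k, 'z1) cat_scheme \<Rightarrow> ('k \<times> 'k) set \<Rightarrow> ('o, 'm, 'z2) smc_scheme \<Rightarrow>
   ('c, 'k, ('o, 'm) mon, ('o, 'm) mon \<times> 'm \<times> ('o, 'm) mon) fctr \<Rightarrow> bool" where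
  "perp_commutative C perp M F \<longleftrightarrow>
     (\<forall>(f1, f2) \<in> perp.
        let \<mu> = Mul (FO F (Cod C f1));
            a = Car (FO F (Cod C f1));
            g = mon_arr (FM F f1) \<odot>\<^bsub>M\<^esub> mon_arr (FM F f2)
        in \<mu> \<cdot>\<^bsub>M\<^esub> g = (\<mu> \<cdot>\<^bsub>M\<^esub> Sym M a a) \<cdot>\<^bsub>M\<^esub> g)"


section \<open>The operad of an orthogonal category is a coequalizer\<close>

text \<open>The position at which the \<open>i\<close>-th block begins.\<close>
abbreviation block_off :: "nat list \<Rightarrow> nat \<Rightarrow> nat" where
  "block_off ks i \<equiv> sum_list (take i ks)"

lemma off_mono: "i \<le> j \<Longrightarrow> block_off ks i \<le> block_off ks j"
  by (metis le_add1 le_add_diff_inverse sum_list_append take_add)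

lemma off_Suc: "i < length ks \<Longrightarrow> block_off ks (Suc i) = block_off ks i + ks ! i"
  by (simp add: take_Suc_conv_app_nth)

lemma block_idx_off:
  assumes "i < length ks" "j < ks ! i"
  shows "block_idx ks (block_off ks i + j) = i" "block_ent ks (block_off ks i + j) = j" "block_off ks i + j < sum_list ks"
proof -
  show 1: "block_idx ks (block_off ks i + j) = i" unfolding block_idx_def
  proof (rule Least_equality)
    show "block_off ks i + j < block_off ks (Suc i)" using assms by (simp add: off_Suc)
    fix y assume "block_off ks i + j < block_off ks (Suc y)"
    then show "i \<le> y" using off_mono[of "Suc y" i ks] by (meson leI le_add1 not_less order_trans Suc_leI less_le_trans)
  qed
  show "block_ent ks (block_off ks i + j) = j" by (simp add: block_ent_def 1)
  have "block_off ks (Suc i) \<le> block_off ks (length ks)" by (rule off_mono) (use assms in simp)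
  then show "block_off ks i + j < sum_list ks" using assms by (simp add: off_Suc)
qed

lemma off_cases:
  assumes "p < sum_list ks"
  obtains i j where "i < length ks" "j < ks ! i" "p = block_off ks i + j"
proof -
  have "\<exists>i j. i < length ks \<and> j < ks ! i \<and> p = block_off ks i + j" using assms
  proof (induction ks arbitrary: p)
    case Nil then show ?case by simp
  next
    case (Cons k ks)
    show ?case
    proof (cases "p < k")
      case True then show ?thesis by (intro exI[of _ 0] exI[of _ p]) simp
    next
      case False
      then have "p - k < sum_list ks" using Cons.prems by simp
      then obtain i j where "i < length ks" "j < ks ! i" "p - k = block_off ks i + j" using Cons.IH by blast
      then show ?thesis using False by (intro exI[of _ "Suc i"] exI[of _ j]) auto
    qed
  qed
  then show thesis using that by blast
qed

lemma off_less:
  assumes "i < length ks" "j < ks ! i" "i < i'" shows "block_off ks i + j < block_off ks i' + j'"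
proof -
  have "block_off ks i + j < block_off ks (Suc i)" using assms by (simp add: off_Suc)
  also have "\<dots> \<le> block_off ks i'" using assms by (intro off_mono) simp
  finally show ?thesis by simp
qed

lemma off_less_iff:
  assumes "i < length ks" "j < ks ! i" "i' < length ks" "j' < ks ! i'"
  shows "block_off ks i + j < block_off ks i' + j' \<longleftrightarrow> i < i' \<or> (i = i' \<and> j < j')"
  using off_less[OF assms(1,2), of i' j'] off_less[OF assms(3,4), of i j] by (cases i i' rule: linorder_cases) auto

lemma off_eq_iff:
  assumes "i < length ks" "j < ks ! i" "i' < length ks" "j' < ks ! i'"
  shows "block_off ks i + j = block_off ks i' + j' \<longleftrightarrow> i = i' \<and> j = j'"
  using off_less[OF assms(1,2), of i' j'] off_less[OF assms(3,4), of i j] by (cases i i' rule: linorder_cases) auto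

lemma permutes_ltI:
  assumes "\<And>p. p < n \<Longrightarrow> f p < n" "\<And>p q. p < n \<Longrightarrow> q < n \<Longrightarrow> f p = f q \<Longrightarrow> p = q" "\<And>p. \<not> p < n \<Longrightarrow> f p = p"
  shows "f permutes {..<(n::nat)}"
proof (rule bij_imp_permutes)
  have "inj_on f {..<n}" using assms(2) by (auto simp: inj_on_def)
  moreover have "f ` {..<n} \<subseteq> {..<n}" using assms(1) by auto
  ultimately show "bij_betw f {..<n} {..<n}"
    by (simp add: bij_betw_def endo_inj_surj)
qed (use assms(3) in auto)

lemma sum_perm_off:
  assumes "i < length ks" "j < ks ! i"
  shows "sum_perm ks \<sigma>s (block_off ks i + j) = block_off ks i + (\<sigma>s ! i) j"
  using block_idx_off[OF assms] by (simp add: sum_perm_def)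

lemma block_perm_off:
  assumes "\<sigma> permutes {..<length ks}" "i < length ks" "j < ks ! i"
  shows "block_perm \<sigma> ks (block_off ks i + j) = block_off (permute_list (inv \<sigma>) ks) (\<sigma> i) + j"
proof -
  let ?n = "length ks"
  have i: "\<sigma> i < ?n" using assms(2) permutes_in_image[OF assms(1), of i] by simp
  have "block_off (permute_list (inv \<sigma>) ks) (\<sigma> i) = (\<Sum>k<\<sigma> i. permute_list (inv \<sigma>) ks ! k)"
    using i by (simp add: sum_list_sum_nth atLeast0LessThan)
  also have "\<dots> = (\<Sum>k<\<sigma> i. ks ! inv \<sigma> k)"
    using i assms(1) by (intro sum.cong) (auto simp: permute_list_nth permutes_inv)
  also have "\<dots> = (\<Sum>i' | i' < ?n \<and> \<sigma> i' < \<sigma> i. ks ! i')"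
  proof (rule sum.reindex_bij_witness[of _ \<sigma> "inv \<sigma>"])
    fix k assume k: "k \<in> {..<\<sigma> i}"
    show "\<sigma> (inv \<sigma> k) = k" using assms(1) by (simp add: permutes_inverses)
    then show "inv \<sigma> k \<in> {i'. i' < ?n \<and> \<sigma> i' < \<sigma> i}"
      using k i permutes_in_image[OF permutes_inv[OF assms(1)], of k] by simp
  qed (use assms(1) in \<open>auto simp: permutes_inverses\<close>)
  finally show ?thesis using block_idx_off[OF assms(2,3)] by (simp add: block_perm_def)
qed

lemma permute_inv_nth:
  assumes "\<sigma> permutes {..<length ks}" "i < length ks"
  shows "permute_list (inv \<sigma>) ks ! \<sigma> i = ks ! i" "\<sigma> i < length ks"
proof -
  show 1: "\<sigma> i < length ks" using assms permutes_in_image[of \<sigma> "{..<length ks}" i] by simp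
  show "permute_list (inv \<sigma>) ks ! \<sigma> i = ks ! i"
    using assms 1 by (simp add: permute_list_nth permutes_inv permutes_inverses)
qed

lemma permutes_lt: "\<sigma> permutes {..<n} \<Longrightarrow> (\<sigma> i < n) = (i < (n::nat))"
  using permutes_in_image[of \<sigma> "{..<n}" i] by simp

lemma permutes_eq: "\<sigma> permutes S \<Longrightarrow> (\<sigma> i = \<sigma> j) = (i = j)"
  by (meson injD permutes_inj)

lemma sum_perm_permutes:
  assumes "length \<sigma>s = length ks" "\<And>i. i < length ks \<Longrightarrow> \<sigma>s ! i permutes {..<ks ! i}"
  shows "sum_perm ks \<sigma>s permutes {..<sum_list ks}"
proof (rule permutes_ltI)
  fix p assume "p < sum_list ks"
  then obtain i j where ij: "i < length ks" "j < ks ! i" "p = block_off ks i + j" by (rule off_cases)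
  then have "(\<sigma>s ! i) j < ks ! i" using assms(2) by (simp add: permutes_lt)
  then show "sum_perm ks \<sigma>s p < sum_list ks" using ij by (simp add: sum_perm_off block_idx_off)
next
  fix p q assume "p < sum_list ks" "q < sum_list ks" and eq: "sum_perm ks \<sigma>s p = sum_perm ks \<sigma>s q"
  then obtain i j i' j' where ij: "i < length ks" "j < ks ! i" "p = block_off ks i + j"
    and ij': "i' < length ks" "j' < ks ! i'" "q = block_off ks i' + j'" by (metis off_cases)
  then have "block_off ks i + (\<sigma>s ! i) j = block_off ks i' + (\<sigma>s ! i') j'" using eq by (simp add: sum_perm_off)
  then have "i = i' \<and> (\<sigma>s ! i) j = (\<sigma>s ! i') j'"
    using ij ij' assms(2) by (subst (asm) off_eq_iff) (auto simp: permutes_lt)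
  then show "p = q" using ij ij' assms(2) by (metis permutes_eq)
qed (simp add: sum_perm_def)

lemma block_perm_lt:
  assumes "\<sigma> permutes {..<length ks}" "i < length ks" "j < ks ! i" "i' < length ks" "j' < ks ! i'"
  shows "block_perm \<sigma> ks (block_off ks i + j) < block_perm \<sigma> ks (block_off ks i' + j') \<longleftrightarrow> \<sigma> i < \<sigma> i' \<or> (i = i' \<and> j < j')"
  using assms by (simp add: block_perm_off off_less_iff permute_inv_nth permutes_eq)

lemma block_perm_permutes:
  assumes "\<sigma> permutes {..<length ks}"
  shows "block_perm \<sigma> ks permutes {..<sum_list ks}"
proof (rule permutes_ltI)
  let ?ks = "permute_list (inv \<sigma>) ks"
  fix p assume "p < sum_list ks"
  then obtain i j where ij: "i < length ks" "j < ks ! i" "p = block_off ks i + j" by (rule off_cases)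
  have "block_perm \<sigma> ks p = block_off ?ks (\<sigma> i) + j" using ij assms by (simp add: block_perm_off)
  also have "\<dots> < sum_list ?ks" using ij assms by (intro block_idx_off) (auto simp: permute_inv_nth)
  also have "sum_list ?ks = sum_list ks"
    using assms by (metis mset_permute_list permutes_inv sum_mset_sum_list)
  finally show "block_perm \<sigma> ks p < sum_list ks" .
next
  fix p q assume "p < sum_list ks" "q < sum_list ks" and eq: "block_perm \<sigma> ks p = block_perm \<sigma> ks q"
  then obtain i j i' j' where ij: "i < length ks" "j < ks ! i" "p = block_off ks i + j"
    and ij': "i' < length ks" "j' < ks ! i'" "q = block_off ks i' + j'" by (metis off_cases)
  show "p = q"
    using block_perm_lt[OF assms ij(1,2) ij'(1,2)] block_perm_lt[OF assms ij'(1,2) ij(1,2)] eq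
      permutes_eq[OF assms, of i i'] unfolding ij(3) ij'(3)
    by (metis less_irrefl linorder_less_linear)
qed (simp add: block_perm_def)

lemma permutes_order_eqI:
  assumes "\<sigma> permutes {..<n}" "\<tau> permutes {..<(n::nat)}"
    and lt: "\<And>p q. p < n \<Longrightarrow> q < n \<Longrightarrow> \<sigma> p < \<sigma> q \<longleftrightarrow> \<tau> p < \<tau> q"
  shows "\<sigma> = \<tau>"
proof
  have rank: "\<pi> p = card {q. q < n \<and> \<pi> q < \<pi> p}" if "\<pi> permutes {..<n}" "p < n" for \<pi> p
  proof -
    have "\<pi> ` {q. q < n \<and> \<pi> q < \<pi> p} = {..<\<pi> p}"
    proof (intro equalityI subsetI)
      fix k assume 2: "k \<in> {..<\<pi> p}"
      have "\<pi> p < n" using that by (simp add: permutes_lt)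
      then have "inv \<pi> k < n" "\<pi> (inv \<pi> k) = k"
        using 2 that(1) permutes_lt[OF permutes_inv[OF that(1)], of k] by (auto simp: permutes_inverses)
      then show "k \<in> \<pi> ` {q. q < n \<and> \<pi> q < \<pi> p}" using 2 by (metis (mono_tags, lifting) imageI lessThan_iff mem_Collect_eq)
    qed auto
    moreover have "inj_on \<pi> {q. q < n \<and> \<pi> q < \<pi> p}" using that(1) by (simp add: inj_on_def permutes_eq)
    ultimately show ?thesis by (metis card_image card_lessThan)
  qed
  fix p show "\<sigma> p = \<tau> p"
  proof (cases "p < n")
    case True
    have "{q. q < n \<and> \<sigma> q < \<sigma> p} = {q. q < n \<and> \<tau> q < \<tau> p}" using lt True by auto
    then show ?thesis using rank[OF assms(1) True] rank[OF assms(2) True] by simp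
  next
    case False then show ?thesis using assms(1,2) by (simp add: permutes_not_in)
  qed
qed

text \<open>The composition of the associative operad.\<close>
definition as_comp :: "(nat \<Rightarrow> nat) \<Rightarrow> nat list \<Rightarrow> (nat \<Rightarrow> nat) list \<Rightarrow> nat \<Rightarrow> nat" where
  "as_comp \<sigma> ks \<sigma>s = block_perm \<sigma> ks \<circ> sum_perm ks \<sigma>s"

lemma as_comp_permutes:
  assumes "\<sigma> permutes {..<length ks}" "length \<sigma>s = length ks" "\<And>i. i < length ks \<Longrightarrow> \<sigma>s ! i permutes {..<ks ! i}"
  shows "as_comp \<sigma> ks \<sigma>s permutes {..<sum_list ks}"
  unfolding as_comp_def using assms by (intro permutes_compose sum_perm_permutes block_perm_permutes)

lemma as_comp_lt:
  assumes "\<sigma> permutes {..<length ks}" "\<And>i. i < length ks \<Longrightarrow> \<sigma>s ! i permutes {..<ks ! i}"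
    "i < length ks" "j < ks ! i" "i' < length ks" "j' < ks ! i'"
  shows "as_comp \<sigma> ks \<sigma>s (block_off ks i + j) < as_comp \<sigma> ks \<sigma>s (block_off ks i' + j') \<longleftrightarrow>
    \<sigma> i < \<sigma> i' \<or> (i = i' \<and> (\<sigma>s ! i) j < (\<sigma>s ! i) j')"
  using assms by (auto simp: as_comp_def sum_perm_off block_perm_lt permutes_lt)

lemma as_comp_top:
  assumes "\<sigma> permutes {..<length ks}" "\<rho> permutes {..<length ks}"
    "length \<sigma>s = length ks" "\<And>i. i < length ks \<Longrightarrow> \<sigma>s ! i permutes {..<ks ! i}"
  shows "as_comp (\<sigma> \<circ> \<rho>) (permute_list \<rho> ks) (permute_list \<rho> \<sigma>s)
         = as_comp \<sigma> ks \<sigma>s \<circ> block_perm \<rho> (permute_list \<rho> ks)"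
proof -
  let ?ks = "permute_list \<rho> ks"
  have s: "sum_list ?ks = sum_list ks" using assms(2) by (metis mset_permute_list sum_mset_sum_list)
  have inv: "permute_list (inv \<rho>) ?ks = ks"
    by (metis assms(2) permute_list_compose permute_list_id permutes_inv permutes_inv_o(1))
  have nth: "?ks ! i = ks ! \<rho> i" "permute_list \<rho> \<sigma>s ! i = \<sigma>s ! \<rho> i" "\<rho> i < length ks" if "i < length ks" for i
    using that assms by (auto simp: permute_list_nth permutes_lt)
  show ?thesis
  proof (rule permutes_order_eqI[of _ "sum_list ks"])
    show "as_comp (\<sigma> \<circ> \<rho>) ?ks (permute_list \<rho> \<sigma>s) permutes {..<sum_list ks}"
      unfolding s[symmetric] using assms nth by (intro as_comp_permutes) (auto intro: permutes_compose)
    show "as_comp \<sigma> ks \<sigma>s \<circ> block_perm \<rho> ?ks permutes {..<sum_list ks}"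
      using assms block_perm_permutes[of \<rho> ?ks] s by (intro permutes_compose as_comp_permutes) auto
    fix p q assume "p < sum_list ks" "q < sum_list ks"
    then obtain i j i' j' where ij: "i < length ?ks" "j < ?ks ! i" "p = block_off ?ks i + j"
      and ij': "i' < length ?ks" "j' < ?ks ! i'" "q = block_off ?ks i' + j'" by (metis off_cases s)
    have 1: "as_comp (\<sigma> \<circ> \<rho>) ?ks (permute_list \<rho> \<sigma>s) p < as_comp (\<sigma> \<circ> \<rho>) ?ks (permute_list \<rho> \<sigma>s) q \<longleftrightarrow>
       \<sigma> (\<rho> i) < \<sigma> (\<rho> i') \<or> (i = i' \<and> (\<sigma>s ! \<rho> i) j < (\<sigma>s ! \<rho> i) j')"
      unfolding ij(3) ij'(3) using ij ij' assms nth
      by (subst as_comp_lt) (auto intro: permutes_compose)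
    have 2: "(as_comp \<sigma> ks \<sigma>s \<circ> block_perm \<rho> ?ks) p < (as_comp \<sigma> ks \<sigma>s \<circ> block_perm \<rho> ?ks) q \<longleftrightarrow>
       \<sigma> (\<rho> i) < \<sigma> (\<rho> i') \<or> (i = i' \<and> (\<sigma>s ! \<rho> i) j < (\<sigma>s ! \<rho> i) j')"
      unfolding ij(3) ij'(3) using ij ij' assms nth permutes_eq[OF assms(2)]
      by (simp add: block_perm_off inv as_comp_lt)
    show "as_comp (\<sigma> \<circ> \<rho>) ?ks (permute_list \<rho> \<sigma>s) p < as_comp (\<sigma> \<circ> \<rho>) ?ks (permute_list \<rho> \<sigma>s) q \<longleftrightarrow>
      (as_comp \<sigma> ks \<sigma>s \<circ> block_perm \<rho> ?ks) p < (as_comp \<sigma> ks \<sigma>s \<circ> block_perm \<rho> ?ks) q"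
      unfolding 1 2 ..
  qed
qed

lemma as_comp_bottom:
  assumes "length \<tau>s = length ks" "length \<sigma>s = length ks" "\<And>i. i < length ks \<Longrightarrow> \<tau>s ! i permutes {..<ks ! i}"
  shows "as_comp \<sigma> ks (map2 (\<circ>) \<sigma>s \<tau>s) = as_comp \<sigma> ks \<sigma>s \<circ> sum_perm ks \<tau>s"
proof
  fix p show "as_comp \<sigma> ks (map2 (\<circ>) \<sigma>s \<tau>s) p = (as_comp \<sigma> ks \<sigma>s \<circ> sum_perm ks \<tau>s) p"
  proof (cases "p < sum_list ks")
    case True
    then obtain i j where ij: "i < length ks" "j < ks ! i" "p = block_off ks i + j" by (rule off_cases)
    have "(\<tau>s ! i) j < ks ! i" using ij assms(3)[of i] by (simp add: permutes_lt)
    then show ?thesis using ij assms by (simp add: as_comp_def sum_perm_off)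
  qed (simp add: as_comp_def sum_perm_def block_perm_def)
qed

lemma off_concat:
  assumes "i < length kss" "j \<le> length (kss ! i)"
  shows "block_off (concat kss) (block_off (map length kss) i + j) = block_off (map sum_list kss) i + block_off (kss ! i) j"
  using assms
proof (induction kss arbitrary: i)
  case (Cons ks kss)
  then show ?case by (cases i) (auto simp: add.assoc)
qed simp

lemma concat_nth_off:
  assumes "i < length xss" "j < length (xss ! i)"
  shows "concat xss ! (block_off (map length xss) i + j) = xss ! i ! j"
  using assms
proof (induction xss arbitrary: i)
  case (Cons xs xss)
  then show ?case by (cases i) (auto simp: nth_append add.assoc)
qed simp

lemma as_comp_assoc:
  assumes \<sigma>: "\<sigma> permutes {..<length kss}" and l: "length \<sigma>s = length kss" "length \<tau>ss = length kss"
    and ll: "\<And>i. i < length kss \<Longrightarrow> length (\<tau>ss ! i) = length (kss ! i)"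
    and \<sigma>s: "\<And>i. i < length kss \<Longrightarrow> \<sigma>s ! i permutes {..<length (kss ! i)}"
    and \<tau>s: "\<And>i j. i < length kss \<Longrightarrow> j < length (kss ! i) \<Longrightarrow> \<tau>ss ! i ! j permutes {..<kss ! i ! j}"
  shows "as_comp (as_comp \<sigma> (map length kss) \<sigma>s) (concat kss) (concat \<tau>ss) =
         as_comp \<sigma> (map sum_list kss) (map (\<lambda>i. as_comp (\<sigma>s ! i) (kss ! i) (\<tau>ss ! i)) [0..<length kss])"
proof -
  let ?l = "map length kss"
  let ?s = "map sum_list kss"
  let ?\<pi> = "as_comp \<sigma> ?l \<sigma>s"
  let ?\<rho> = "map (\<lambda>i. as_comp (\<sigma>s ! i) (kss ! i) (\<tau>ss ! i)) [0..<length kss]"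
  have lt: "?l = map length \<tau>ss" using l ll by (auto intro: nth_equalityI)
  have s: "sum_list (concat kss) = sum_list ?s" by (induction kss) auto
  have lc: "length (concat kss) = sum_list ?l" "length (concat \<tau>ss) = sum_list ?l"
    by (simp add: length_concat) (simp add: length_concat lt)
  have \<pi>: "?\<pi> permutes {..<length (concat kss)}" unfolding lc using assms by (intro as_comp_permutes) auto
  have \<rho>: "?\<rho> ! i permutes {..<?s ! i}" if "i < length ?s" for i
    using that as_comp_permutes[of "\<sigma>s ! i" "kss ! i" "\<tau>ss ! i"] ll \<sigma>s \<tau>s by simp
  have \<tau>: "concat \<tau>ss ! i permutes {..<concat kss ! i}" if "i < length (concat kss)" for i
  proof -
    have "i < sum_list ?l" using that lc by simp
    then obtain a b where ab: "a < length ?l" "b < ?l ! a" "i = block_off ?l a + b" by (rule off_cases)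
    then have "concat kss ! i = kss ! a ! b" "concat \<tau>ss ! i = \<tau>ss ! a ! b"
      using concat_nth_off[of a kss b] concat_nth_off[of a \<tau>ss b] ll l by (simp_all add: lt[symmetric])
    then show ?thesis using ab \<tau>s by simp
  qed
  show ?thesis
  proof (rule permutes_order_eqI[of _ "sum_list ?s"])
    show "as_comp ?\<pi> (concat kss) (concat \<tau>ss) permutes {..<sum_list ?s}"
      unfolding s[symmetric] using \<pi> \<tau> lc by (intro as_comp_permutes) auto
    show "as_comp \<sigma> ?s ?\<rho> permutes {..<sum_list ?s}"
      using \<rho> \<sigma> by (intro as_comp_permutes) auto
    have ex: "\<exists>i j k. i < length kss \<and> j < length (kss ! i) \<and> k < kss ! i ! j \<and>
        p = block_off ?s i + (block_off (kss ! i) j + k)" if p: "p < sum_list ?s" for p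
    proof -
      obtain i m where 1: "i < length ?s" "m < ?s ! i" "p = block_off ?s i + m" using p by (rule off_cases)
      then have "m < sum_list (kss ! i)" by simp
      then obtain j k where "j < length (kss ! i)" "k < kss ! i ! j" "m = block_off (kss ! i) j + k" by (rule off_cases)
      then show ?thesis using 1 by auto
    qed
    fix p q assume "p < sum_list ?s" "q < sum_list ?s"
    then obtain i j k i' j' k' where
      p: "i < length kss" "j < length (kss ! i)" "k < kss ! i ! j" "p = block_off ?s i + (block_off (kss ! i) j + k)" and
      q: "i' < length kss" "j' < length (kss ! i')" "k' < kss ! i' ! j'" "q = block_off ?s i' + (block_off (kss ! i') j' + k')"
      using ex by metis
    have p': "p = block_off (concat kss) (block_off ?l i + j) + k" using p off_concat[of i kss j] by simp
    have q': "q = block_off (concat kss) (block_off ?l i' + j') + k'" using q off_concat[of i' kss j'] by simp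
    have b: "block_off ?l i + j < length (concat kss)" "block_off ?l i' + j' < length (concat kss)"
      unfolding lc using p q by (auto intro!: block_idx_off)
    have n: "concat kss ! (block_off ?l i + j) = kss ! i ! j" "concat kss ! (block_off ?l i' + j') = kss ! i' ! j'"
      "concat \<tau>ss ! (block_off ?l i + j) = \<tau>ss ! i ! j" "concat \<tau>ss ! (block_off ?l i' + j') = \<tau>ss ! i' ! j'"
      using p q concat_nth_off[of i kss j] concat_nth_off[of i' kss j']
        concat_nth_off[of i \<tau>ss j] concat_nth_off[of i' \<tau>ss j'] l ll lt by simp_all
    have e: "block_off ?l i + j = block_off ?l i' + j' \<longleftrightarrow> i = i' \<and> j = j'" using p q by (subst off_eq_iff) auto
    have L1: "?\<pi> (block_off ?l i + j) < ?\<pi> (block_off ?l i' + j') \<longleftrightarrow> \<sigma> i < \<sigma> i' \<or> (i = i' \<and> (\<sigma>s ! i) j < (\<sigma>s ! i) j')"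
      by (rule as_comp_lt) (use \<sigma> \<sigma>s p q in simp_all)
    have L2: "as_comp ?\<pi> (concat kss) (concat \<tau>ss) (block_off (concat kss) (block_off ?l i + j) + k) < as_comp ?\<pi> (concat kss) (concat \<tau>ss) (block_off (concat kss) (block_off ?l i' + j') + k') \<longleftrightarrow>
       ?\<pi> (block_off ?l i + j) < ?\<pi> (block_off ?l i' + j') \<or> (block_off ?l i + j = block_off ?l i' + j' \<and>
          (concat \<tau>ss ! (block_off ?l i + j)) k < (concat \<tau>ss ! (block_off ?l i + j)) k')"
      by (rule as_comp_lt[OF \<pi> \<tau> b(1) _ b(2)]) (use p(3) q(3) n in simp_all)
    have L: "as_comp ?\<pi> (concat kss) (concat \<tau>ss) p < as_comp ?\<pi> (concat kss) (concat \<tau>ss) q \<longleftrightarrow>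
       (\<sigma> i < \<sigma> i' \<or> (i = i' \<and> (\<sigma>s ! i) j < (\<sigma>s ! i) j')) \<or> (i = i' \<and> j = j' \<and> (\<tau>ss ! i ! j) k < (\<tau>ss ! i ! j) k')"
      unfolding p' q' L2 L1 e n by blast
    have in1: "block_off (kss ! i) j + k < ?s ! i" "block_off (kss ! i') j' + k' < ?s ! i'" using p q by (auto intro!: block_idx_off)
    have R1: "as_comp (\<sigma>s ! i) (kss ! i) (\<tau>ss ! i) (block_off (kss ! i) j + k) < as_comp (\<sigma>s ! i) (kss ! i) (\<tau>ss ! i) (block_off (kss ! i) j' + k') \<longleftrightarrow>
       (\<sigma>s ! i) j < (\<sigma>s ! i) j' \<or> (j = j' \<and> (\<tau>ss ! i ! j) k < (\<tau>ss ! i ! j) k')" if "i = i'"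
      by (rule as_comp_lt) (use p q that \<sigma>s \<tau>s in simp_all)
    have R: "as_comp \<sigma> ?s ?\<rho> p < as_comp \<sigma> ?s ?\<rho> q \<longleftrightarrow>
       \<sigma> i < \<sigma> i' \<or> (i = i' \<and> ((\<sigma>s ! i) j < (\<sigma>s ! i) j' \<or> (j = j' \<and> (\<tau>ss ! i ! j) k < (\<tau>ss ! i ! j) k')))"
    proof -
      have "as_comp \<sigma> ?s ?\<rho> (block_off ?s i + (block_off (kss ! i) j + k)) < as_comp \<sigma> ?s ?\<rho> (block_off ?s i' + (block_off (kss ! i') j' + k')) \<longleftrightarrow>
        \<sigma> i < \<sigma> i' \<or> (i = i' \<and> (?\<rho> ! i) (block_off (kss ! i) j + k) < (?\<rho> ! i) (block_off (kss ! i') j' + k'))"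
        by (rule as_comp_lt[OF _ \<rho>]) (use p q in1 \<sigma> in simp_all)
      then show ?thesis unfolding p(4) q(4) using R1 p(1) by auto
    qed
    show "as_comp ?\<pi> (concat kss) (concat \<tau>ss) p < as_comp ?\<pi> (concat kss) (concat \<tau>ss) q \<longleftrightarrow>
       as_comp \<sigma> ?s ?\<rho> p < as_comp \<sigma> ?s ?\<rho> q"
      unfolding L R by auto
  qed
qed

lemma list_eq_offI:
  assumes "length ys = sum_list ks" "length xs = sum_list ks"
    "\<And>i j. i < length ks \<Longrightarrow> j < ks ! i \<Longrightarrow> xs ! (block_off ks i + j) = ys ! (block_off ks i + j)"
  shows "xs = ys"
proof (rule nth_equalityI)
  show "length xs = length ys" using assms by simp
  fix p assume "p < length xs"
  then have "p < sum_list ks" using assms by simp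
  then obtain i j where "i < length ks" "j < ks ! i" "p = block_off ks i + j" by (rule off_cases)
  then show "xs ! p = ys ! p" using assms by simp
qed

lemma permute_block:
  assumes "\<sigma> permutes {..<length xss}"
  shows "permute_list (block_perm \<sigma> (map length (permute_list \<sigma> xss))) (concat xss) = concat (permute_list \<sigma> xss)"
proof -
  let ?ks = "map length (permute_list \<sigma> xss)"
  let ?b = "block_perm \<sigma> ?ks"
  have s: "sum_list ?ks = length (concat xss)"
    by (metis assms length_concat mset_map mset_permute_list sum_mset_sum_list)
  have b: "?b permutes {..<length (concat xss)}" unfolding s[symmetric] using assms by (intro block_perm_permutes) simp
  have inv: "permute_list (inv \<sigma>) ?ks = map length xss"
    by (metis assms permute_list_compose permute_list_id permutes_inv permutes_inv_o(1) permute_list_map length_map)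
  show ?thesis
  proof (rule list_eq_offI[of _ ?ks])
    show "length (concat (permute_list \<sigma> xss)) = sum_list ?ks" by (simp add: length_concat)
    show "length (permute_list ?b (concat xss)) = sum_list ?ks" using s by simp
    fix i j assume ij: "i < length ?ks" "j < ?ks ! i"
    then have i: "i < length xss" "\<sigma> i < length xss" and j: "j < length (xss ! \<sigma> i)"
      using assms by (simp_all add: permutes_lt permute_list_nth)
    have "block_off ?ks i + j < length (concat xss)" unfolding s[symmetric] using ij by (rule block_idx_off)
    then have "permute_list ?b (concat xss) ! (block_off ?ks i + j) = concat xss ! ?b (block_off ?ks i + j)"
      using b by (simp add: permute_list_nth)
    also have "\<dots> = concat xss ! (block_off (map length xss) (\<sigma> i) + j)"
      using ij assms by (subst block_perm_off) (auto simp: inv)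
    also have "\<dots> = xss ! \<sigma> i ! j" using i j by (simp add: concat_nth_off)
    also have "\<dots> = concat (permute_list \<sigma> xss) ! (block_off ?ks i + j)"
      using i j assms by (subst concat_nth_off) (auto simp: permute_list_nth)
    finally show "permute_list ?b (concat xss) ! (block_off ?ks i + j) = concat (permute_list \<sigma> xss) ! (block_off ?ks i + j)" .
  qed
qed

lemma permute_sum:
  assumes "length \<tau>s = length xss" "\<And>i. i < length xss \<Longrightarrow> \<tau>s ! i permutes {..<length (xss ! i)}"
  shows "permute_list (sum_perm (map length xss) \<tau>s) (concat xss) = concat (map2 permute_list \<tau>s xss)"
proof -
  let ?ks = "map length xss"
  let ?b = "sum_perm ?ks \<tau>s"
  have ks: "map length (map2 permute_list \<tau>s xss) = ?ks" using assms by (auto intro: nth_equalityI)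
  have b: "?b permutes {..<length (concat xss)}" unfolding length_concat using assms by (intro sum_perm_permutes) auto
  show ?thesis
  proof (rule list_eq_offI[of _ ?ks])
    show "length (concat (map2 permute_list \<tau>s xss)) = sum_list ?ks" unfolding length_concat ks ..
    show "length (permute_list ?b (concat xss)) = sum_list ?ks" by (simp add: length_concat)
    fix i j assume ij: "i < length ?ks" "j < ?ks ! i"
    then have j: "(\<tau>s ! i) j < length (xss ! i)"
      using assms(2)[of i] by (simp_all add: permutes_lt)
    have "block_off ?ks i + j < length (concat xss)" unfolding length_concat using ij by (rule block_idx_off)
    then have "permute_list ?b (concat xss) ! (block_off ?ks i + j) = concat xss ! (block_off ?ks i + (\<tau>s ! i) j)"
      using b ij by (simp add: permute_list_nth sum_perm_off)
    also have "\<dots> = xss ! i ! (\<tau>s ! i) j" using ij j by (simp add: concat_nth_off)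
    also have "\<dots> = concat (map2 permute_list \<tau>s xss) ! (block_off ?ks i + j)"
      using ij assms by (subst ks[symmetric], subst concat_nth_off) (auto simp: permute_list_nth)
    finally show "permute_list ?b (concat xss) ! (block_off ?ks i + j) = concat (map2 permute_list \<tau>s xss) ! (block_off ?ks i + j)" .
  qed
qed

abbreviation "len3 \<equiv> \<lambda>(t', \<sigma>', gs). length gs"
abbreviation "prm3 \<equiv> \<lambda>(t', \<sigma>', gs). \<sigma>'"
abbreviation "post C \<equiv> \<lambda>f (t', \<sigma>', gs). map (\<lambda>g. Comp C f g) gs"

lemma cat_operad_sel [simp]:
  "Colors (cat_operad C) = Obj C"
  "(t, \<sigma>, fs) \<in> Ops (cat_operad C) \<longleftrightarrow> t \<in> Obj C \<and> \<sigma> permutes {..<length fs} \<and> (\<forall>f \<in> set fs. f \<in> Arr C \<and> Cod C f = t)"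
  "Inp (cat_operad C) (t, \<sigma>, fs) = map (Dom C) fs"
  "Out (cat_operad C) (t, \<sigma>, fs) = t"
  "Act (cat_operad C) (t, \<sigma>, fs) \<sigma>' = (t, \<sigma> \<circ> \<sigma>', permute_list \<sigma>' fs)"
  "Gam (cat_operad C) (t, \<sigma>, fs) ys =
     (t, as_comp \<sigma> (map len3 ys) (map prm3 ys), concat (map2 (post C) fs ys))"
  "OpUnit (cat_operad C) t = (t, id, [Id C t])"
  by (simp_all add: cat_operad_def Let_def as_comp_def)

lemma in_ops_D:
  assumes "y \<in> Ops (cat_operad C)"
  shows "prm3 y permutes {..<len3 y}" "length (Inp (cat_operad C) y) = len3 y"
  using assms by (cases y, simp)+

lemma set_permute: "\<sigma> permutes {..<length xs} \<Longrightarrow> set (permute_list \<sigma> xs) = set xs"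
  by (rule set_permute_list)

lemma comp_cat:
  assumes "composable (cat_operad C) (t, \<sigma>, fs) ys"
  shows "length ys = length fs" "\<And>i. i < length fs \<Longrightarrow> ys ! i \<in> Ops (cat_operad C)"
    "\<And>i. i < length fs \<Longrightarrow> Out (cat_operad C) (ys ! i) = Dom C (fs ! i)"
proof -
  have e: "map (Dom C) fs = map (Out (cat_operad C)) ys" using assms by (simp add: composable_def)
  then show l: "length ys = length fs" by (metis length_map)
  show "ys ! i \<in> Ops (cat_operad C)" if "i < length fs" for i
    using that l assms by (auto simp: composable_def)
  show "Out (cat_operad C) (ys ! i) = Dom C (fs ! i)" if "i < length fs" for i
    using that l e by (metis nth_map)
qed

context category begin

lemma len_post: "length ys = length fs \<Longrightarrow> map length (map2 (post C) fs ys) = map len3 ys"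
  by (auto intro!: nth_equalityI split: prod.splits)

lemma cat_gam_assoc:
  assumes "list_all2 (composable (cat_operad C)) ys zss" "length fs = length ys"
   "\<And>i. i < length ys \<Longrightarrow> fs ! i \<in> Arr C \<and> Dom C (fs ! i) = Out (cat_operad C) (ys ! i)"
  shows "concat (map2 (post C) (concat (map2 (post C) fs ys)) (concat zss)) =
         concat (map2 (post C) fs (map2 (Gam (cat_operad C)) ys zss))"
  using assms
proof (induction ys zss arbitrary: fs rule: list_all2_induct)
  case Nil then show ?case by simp
next
  case (Cons y ys zs zss)
  obtain f fs' where fs: "fs = f # fs'" "length fs' = length ys" using Cons.prems(1) by (cases fs) auto
  obtain t \<sigma> gs where y: "y = (t, \<sigma>, gs)" by (cases y)
  have f: "f \<in> Arr C" "Dom C f = t" using Cons.prems(2)[of 0] fs y by auto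
  have IH: "concat (map2 (post C) (concat (map2 (post C) fs' ys)) (concat zss)) =
         concat (map2 (post C) fs' (map2 (Gam (cat_operad C)) ys zss))"
    by (rule Cons.IH) (use fs Cons.prems(2)[of "Suc i" for i] in auto)
  have l: "length zs = length gs" by (rule comp_cat(1)[OF Cons.hyps(1)[unfolded y]])
  have g: "g \<in> Arr C \<and> Cod C g = t" if "g \<in> set gs" for g
    using Cons.hyps(1) that by (auto simp: composable_def y)
  have h: "h \<in> Arr C \<and> Cod C h = Dom C (gs ! i)" if "i < length gs" "h \<in> set (snd (snd (zs ! i)))" for i h
    using comp_cat(2,3)[OF Cons.hyps(1)[unfolded y] that(1)] that(2) by (cases "zs ! i") auto
  have "map2 (post C) (map (Comp C f) gs) zs = map (map (Comp C f)) (map2 (post C) gs zs)"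
  proof (rule nth_equalityI)
    fix i assume "i < length (map2 (post C) (map (Comp C f) gs) zs)"
    then have i: "i < length gs" by simp
    obtain a b hs where z: "zs ! i = (a, b, hs)" by (cases "zs ! i")
    have "Comp C (Comp C f (gs ! i)) h' = Comp C f (Comp C (gs ! i) h')" if "h' \<in> set hs" for h'
      by (rule comp_assoc[of _ "Dom C h'" "Dom C (gs ! i)" _ t _ "Cod C f"])
         (use h[OF i, of h'] z that g[OF nth_mem[OF i]] f in \<open>auto simp: hom_def\<close>)
    then show "map2 (post C) (map (Comp C f) gs) zs ! i = map (map (Comp C f)) (map2 (post C) gs zs) ! i"
      using i l z by simp
  qed simp
  then have "concat (map2 (post C) (map (Comp C f) gs) zs) = map (Comp C f) (concat (map2 (post C) gs zs))"
    by (simp add: map_concat)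
  then show ?case using IH l by (simp add: fs y zip_append)
qed

lemma id_arr: "a \<in> Obj C \<Longrightarrow> Id C a \<in> Arr C \<and> Dom C (Id C a) = a \<and> Cod C (Id C a) = a"
  using id_hom by (auto simp: hom_def)

lemma comp_arr: "f \<in> Arr C \<Longrightarrow> g \<in> Arr C \<Longrightarrow> Cod C f = Dom C g \<Longrightarrow>
  Comp C g f \<in> Arr C \<and> Dom C (Comp C g f) = Dom C f \<and> Cod C (Comp C g f) = Cod C g"
  using comp_hom[of f "Dom C f" "Cod C f" g "Cod C g"] by (auto simp: hom_def)

theorem cat_operad: "colored_operad (cat_operad C)"
proof
  let ?P = "cat_operad C"
  fix x assume x: "x \<in> Ops ?P"
  obtain t \<sigma> fs where [simp]: "x = (t, \<sigma>, fs)" by (cases x)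
  show "Out ?P x \<in> Colors ?P" using x by simp
  show "set (Inp ?P x) \<subseteq> Colors ?P" using x dom_obj by auto
  show "Act ?P x id = x" by simp
  show "Gam ?P (OpUnit ?P (Out ?P x)) [x] = x"
  proof -
    have "map (Comp C (Id C t)) fs = fs"
      using x id_comp[of f "Dom C f" t for f] by (intro map_idI) (auto simp: hom_def)
    moreover have "as_comp id [length fs] [\<sigma>] = \<sigma>"
    proof
      fix p show "as_comp id [length fs] [\<sigma>] p = \<sigma> p"
      proof (cases "p < length fs")
        case True
        then have "\<sigma> p < length fs" using x by (simp add: permutes_lt)
        then show ?thesis using True sum_perm_off[of 0 "[length fs]" p] block_perm_off[of id "[length fs]" 0 "\<sigma> p"]
          by (simp add: as_comp_def permutes_id)
      next
        case False
        have "\<sigma> p = p" using x False by (intro permutes_not_in[of \<sigma> "{..<length fs}"]) auto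
        then show ?thesis using False by (simp add: as_comp_def sum_perm_def block_perm_def)
      qed
    qed
    ultimately show ?thesis by simp
  qed
  show "Gam ?P x (map (OpUnit ?P) (Inp ?P x)) = x"
  proof -
    let ?n = "length fs"
    have 1: "concat (map2 (post C) fs (map (OpUnit ?P) (Inp ?P x))) = fs"
    proof -
      have "map2 (post C) fs (map (OpUnit ?P) (Inp ?P x)) = map (\<lambda>f. [f]) fs"
        using x comp_id[of f "Dom C f" t for f] by (intro nth_equalityI) (auto simp: hom_def)
      then show ?thesis by (simp only: concat_map_singleton map_ident)
    qed
    have l: "map len3 (map (OpUnit ?P) (Inp ?P x)) = replicate ?n 1"
      by (auto intro!: nth_equalityI)
    have pr: "map prm3 (map (OpUnit ?P) (Inp ?P x)) = replicate ?n id"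
      by (auto intro!: nth_equalityI)
    have block_off: "block_off (replicate ?n 1) i = i" if "i \<le> ?n" for i using that by (simp add: sum_list_replicate min_def)
    have "as_comp \<sigma> (replicate ?n 1) (replicate ?n id) = \<sigma>"
    proof (rule permutes_order_eqI[of _ ?n])
      have s: "sum_list (replicate ?n (1::nat)) = ?n" by (simp add: sum_list_replicate)
      have "as_comp \<sigma> (replicate ?n 1) (replicate ?n id) permutes {..<sum_list (replicate ?n 1)}"
        using x by (intro as_comp_permutes) (auto simp: permutes_id)
      then show "as_comp \<sigma> (replicate ?n 1) (replicate ?n id) permutes {..<?n}" unfolding s .
      show "\<sigma> permutes {..<?n}" using x by simp
      fix p q assume pq: "p < ?n" "q < ?n"
      then show "as_comp \<sigma> (replicate ?n 1) (replicate ?n id) p < as_comp \<sigma> (replicate ?n 1) (replicate ?n id) q \<longleftrightarrow> \<sigma> p < \<sigma> q"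
        using as_comp_lt[of \<sigma> "replicate ?n 1" "replicate ?n id" p 0 q 0] block_off[of p] block_off[of q] x by (simp add: permutes_id)
    qed
    then show ?thesis using 1 l pr by simp
  qed
  fix \<tau> assume \<tau>: "\<tau> permutes {..<length (Inp ?P x)}"
  show "Act ?P x \<tau> \<in> Ops ?P \<and> Out ?P (Act ?P x \<tau>) = Out ?P x \<and> Inp ?P (Act ?P x \<tau>) = permute_list \<tau> (Inp ?P x)"
    using x \<tau> by (auto simp: permutes_compose permute_list_map)
  fix \<rho> assume \<rho>: "\<rho> permutes {..<length (Inp ?P x)}"
  show "Act ?P (Act ?P x \<rho>) \<tau> = Act ?P x (\<rho> \<circ> \<tau>)"
    using \<tau> \<rho> by (simp add: permute_list_compose o_assoc)
next
  let ?P = "cat_operad C"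
  fix c assume "c \<in> Colors ?P"
  then show "OpUnit ?P c \<in> Ops ?P \<and> Out ?P (OpUnit ?P c) = c \<and> Inp ?P (OpUnit ?P c) = [c]"
    by (simp add: id_arr permutes_id)
next
  let ?P = "cat_operad C"
  fix x ys assume c: "composable ?P x ys"
  obtain t \<sigma> fs where [simp]: "x = (t, \<sigma>, fs)" by (cases x)
  note cc = comp_cat[OF c[simplified]]
  have x: "x \<in> Ops ?P" using c by (simp add: composable_def)
  have \<sigma>: "\<sigma> permutes {..<length ys}" using x cc by simp
  have f: "f \<in> Arr C \<and> Cod C f = t" if "f \<in> set fs" for f using x that by auto
  have yp: "\<And>i. i < length ys \<Longrightarrow> prm3 (ys ! i) permutes {..<len3 (ys ! i)}" using cc in_ops_D by metis
  have slen: "sum_list (map len3 ys) = length (concat (map2 (post C) fs ys))"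
    unfolding length_concat len_post[OF cc(1)] ..
  have A: "as_comp \<sigma> (map len3 ys) (map prm3 ys) permutes {..<length (concat (map2 (post C) fs ys))}"
    unfolding slen[symmetric] using \<sigma> yp by (intro as_comp_permutes) auto
  have B: "h \<in> Arr C \<and> Cod C h = t" if h: "h \<in> set (concat (map2 (post C) fs ys))" for h
  proof -
    obtain i g where i: "i < length fs" "g \<in> set (snd (snd (ys ! i)))" "h = Comp C (fs ! i) g"
      using h by (auto simp: set_zip split: prod.splits) (metis snd_conv)
    then have "g \<in> Arr C \<and> Cod C g = Dom C (fs ! i)" using cc(2,3)[OF i(1)] by (cases "ys ! i") auto
    then show ?thesis using f[OF nth_mem[OF i(1)]] i(3) comp_arr by metis
  qed
  have D: "map (Dom C) (concat (map2 (post C) fs ys)) = concat (map (Inp ?P) ys)"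
  proof -
    have "map (map (Dom C)) (map2 (post C) fs ys) = map (Inp ?P) ys"
    proof (rule nth_equalityI)
      fix i assume "i < length (map (map (Dom C)) (map2 (post C) fs ys))"
      then have i: "i < length fs" by simp
      obtain a b gs where y: "ys ! i = (a, b, gs)" by (cases "ys ! i")
      show "map (map (Dom C)) (map2 (post C) fs ys) ! i = map (Inp ?P) ys ! i"
        using i cc(1) cc(2,3)[OF i] y f[OF nth_mem[OF i]] comp_arr by simp
    qed (use cc in simp)
    then show ?thesis by (metis map_concat)
  qed
  show "Gam ?P x ys \<in> Ops ?P \<and> Out ?P (Gam ?P x ys) = Out ?P x \<and> Inp ?P (Gam ?P x ys) = concat (map (Inp ?P) ys)"
    using A B D x by simp
  fix zss assume z: "list_all2 (composable ?P) ys zss"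
  have l: "length zss = length ys" using z by (simp add: list_all2_lengthD)
  have zi: "composable ?P (ys ! i) (zss ! i)" if "i < length ys" for i using z that by (simp add: list_all2_conv_all_nth)
  show "Gam ?P (Gam ?P x ys) (concat zss) = Gam ?P x (map2 (Gam ?P) ys zss)"
  proof -
    let ?kss = "map (map len3) zss"
    have li: "length (zss ! i) = len3 (ys ! i)" if "i < length ys" for i
      using zi[OF that] comp_cat(1) by (cases "ys ! i") force
    have k1: "map length ?kss = map len3 ys" using l li by (auto intro!: nth_equalityI)
    have zij: "zss ! i ! m \<in> Ops ?P" if "i < length ys" "m < length (zss ! i)" for i m
      using zi[OF that(1)] that(2) by (auto simp: composable_def)
    have k2: "map sum_list ?kss = map len3 (map2 (Gam ?P) ys zss)"
    proof (rule nth_equalityI)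
      fix i assume "i < length (map sum_list ?kss)"
      then have i: "i < length ys" using l by simp
      obtain a b gs where y: "ys ! i = (a, b, gs)" by (cases "ys ! i")
      have "length (zss ! i) = length gs" using li[OF i] y by simp
      then show "map sum_list ?kss ! i = map len3 (map2 (Gam ?P) ys zss) ! i"
        using i l y len_post[of "zss ! i" gs] by (simp add: length_concat)
    qed (use l in simp)
    have k3: "map prm3 (map2 (Gam ?P) ys zss) =
      map (\<lambda>i. as_comp (map prm3 ys ! i) (?kss ! i) (map (map prm3) zss ! i)) [0..<length ?kss]"
      using l by (auto intro!: nth_equalityI split: prod.splits)
    have "as_comp (as_comp \<sigma> (map length ?kss) (map prm3 ys)) (concat ?kss) (concat (map (map prm3) zss)) =
       as_comp \<sigma> (map sum_list ?kss) (map (\<lambda>i. as_comp (map prm3 ys ! i) (?kss ! i) (map (map prm3) zss ! i)) [0..<length ?kss])"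
    proof (rule as_comp_assoc)
      show "map (map prm3) zss ! i ! m permutes {..<?kss ! i ! m}" if "i < length ?kss" "m < length (?kss ! i)" for i m
        using that l in_ops_D(1)[OF zij[of i m]] by simp
      show "map prm3 ys ! i permutes {..<length (?kss ! i)}" if "i < length ?kss" for i
        using that l li[of i] yp[of i] by simp
    qed (use \<sigma> l in simp_all)
    then show ?thesis
      using cat_gam_assoc[OF z, of fs] cc f unfolding k1 k2 k3[symmetric]
      by (simp add: map_concat[symmetric] del: map_map)
  qed
next
  let ?P = "cat_operad C"
  fix x ys \<rho> assume c: "composable ?P x ys" and \<rho>: "\<rho> permutes {..<length ys}"
  obtain t \<sigma> fs where [simp]: "x = (t, \<sigma>, fs)" by (cases x)
  note cc = comp_cat[OF c[simplified]]
  have x: "x \<in> Ops ?P" using c by (simp add: composable_def)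
  have \<sigma>: "\<sigma> permutes {..<length ys}" using x cc by simp
  have ysO: "set ys \<subseteq> Ops ?P" using c by (simp add: composable_def)
  have yp: "\<And>i. i < length ys \<Longrightarrow> prm3 (ys ! i) permutes {..<len3 (ys ! i)}" using cc in_ops_D by metis
  have ks: "map (\<lambda>y. length (Inp ?P y)) (permute_list \<rho> ys) = map len3 (permute_list \<rho> ys)"
    using ysO set_permute[OF \<rho>] in_ops_D(2) by (intro map_cong) auto
  have z: "map2 (post C) (permute_list \<rho> fs) (permute_list \<rho> ys) = permute_list \<rho> (map2 (post C) fs ys)"
    using \<rho> cc by (simp add: permute_list_map permute_list_zip)
  have len: "map length (permute_list \<rho> (map2 (post C) fs ys)) = map len3 (permute_list \<rho> ys)"
    using permute_list_map[of \<rho> "map2 (post C) fs ys" length] permute_list_map[of \<rho> ys len3] \<rho> cc(1)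
    by (simp only: len_post[OF cc(1)]) simp
  show "Gam ?P (Act ?P x \<rho>) (permute_list \<rho> ys) =
      Act ?P (Gam ?P x ys) (block_perm \<rho> (map (\<lambda>y. length (Inp ?P y)) (permute_list \<rho> ys)))"
    unfolding ks
    using as_comp_top[of \<sigma> "map len3 ys" \<rho> "map prm3 ys"] \<sigma> \<rho> yp cc
      permute_block[of \<rho> "map2 (post C) fs ys"] len
    by (simp add: permute_list_map z)
next
  let ?P = "cat_operad C"
  fix x ys \<tau>s assume c: "composable ?P x ys" and \<tau>s: "list_all2 (\<lambda>y \<tau>. \<tau> permutes {..<length (Inp ?P y)}) ys \<tau>s"
  obtain t \<sigma> fs where [simp]: "x = (t, \<sigma>, fs)" by (cases x)
  note cc = comp_cat[OF c[simplified]]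
  have ysO: "set ys \<subseteq> Ops ?P" using c by (simp add: composable_def)
  have ks: "map (\<lambda>y. length (Inp ?P y)) ys = map len3 ys"
    using ysO in_ops_D(2) by (intro map_cong) auto
  have l: "length \<tau>s = length ys" using \<tau>s by (simp add: list_all2_lengthD)
  have t: "\<tau>s ! i permutes {..<len3 (ys ! i)}" if "i < length ys" for i
    using list_all2_nthD[OF \<tau>s that] unfolding in_ops_D(2)[OF subsetD[OF ysO nth_mem[OF that]]] .
  have 1: "map len3 (map2 (Act ?P) ys \<tau>s) = map len3 ys"
    using l by (intro nth_equalityI) (simp_all add: split_def cat_operad_def)
  have 2: "map prm3 (map2 (Act ?P) ys \<tau>s) = map2 (\<circ>) (map prm3 ys) \<tau>s"
    using l by (intro nth_equalityI) (simp_all add: split_def cat_operad_def)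
  have 3: "map2 (post C) fs (map2 (Act ?P) ys \<tau>s) = map2 permute_list \<tau>s (map2 (post C) fs ys)"
  proof (rule nth_equalityI)
    fix i assume "i < length (map2 (post C) fs (map2 (Act ?P) ys \<tau>s))"
    then have i: "i < length ys" using cc by simp
    obtain a b gs where y: "ys ! i = (a, b, gs)" by (cases "ys ! i")
    show "map2 (post C) fs (map2 (Act ?P) ys \<tau>s) ! i = map2 permute_list \<tau>s (map2 (post C) fs ys) ! i"
      using i l cc y t[OF i] by (simp add: permute_list_map)
  qed (use l cc in simp)
  show "Gam ?P x (map2 (Act ?P) ys \<tau>s) = Act ?P (Gam ?P x ys) (sum_perm (map (\<lambda>y. length (Inp ?P y)) ys) \<tau>s)"
  proof -
    have "as_comp \<sigma> (map len3 ys) (map2 (\<circ>) (map prm3 ys) \<tau>s) = as_comp \<sigma> (map len3 ys) (map prm3 ys) \<circ> sum_perm (map len3 ys) \<tau>s"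
      by (rule as_comp_bottom) (use l t in simp_all)
    moreover have "permute_list (sum_perm (map len3 ys) \<tau>s) (concat (map2 (post C) fs ys)) = concat (map2 permute_list \<tau>s (map2 (post C) fs ys))"
      unfolding len_post[OF cc(1), symmetric]
    proof (rule permute_sum)
      fix i assume "i < length (map2 (post C) fs ys)"
      then have i: "i < length ys" by simp
      have "length (map2 (post C) fs ys ! i) = len3 (ys ! i)" using i cc(1) by (simp add: split_def)
      then show "\<tau>s ! i permutes {..<length (map2 (post C) fs ys ! i)}" using t[OF i] by simp
    qed (use l cc in simp)
    ultimately show ?thesis unfolding ks \<open>x = _\<close> cat_operad_sel 1 2 3 by simp
  qed
qed

end

lemma in_listset: "xs \<in> listset As \<longleftrightarrow> list_all2 (\<in>) xs As"
proof (induction As arbitrary: xs)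
  case (Cons A As)
  then show ?case by (cases xs) (auto simp: set_Cons_def)
qed simp

context colored_operad begin

definition "same_profile = {(x, y). x \<in> Ops P \<and> y \<in> Ops P \<and> Out P x = Out P y \<and> Inp P x = Inp P y}"

lemma same_profile_list:
  assumes "list_all2 (\<lambda>a b. (a, b) \<in> same_profile) xs ys"
  shows "map (Out P) xs = map (Out P) ys" "map (Inp P) xs = map (Inp P) ys" "set ys \<subseteq> Ops P" "set xs \<subseteq> Ops P"
  using assms by (induction rule: list_all2_induct) (auto simp: same_profile_def)

lemma same_profile_cong: "operad_congruence P same_profile"
  unfolding operad_congruence_def
proof (intro conjI allI impI ballI, goal_cases)
  case 1 show ?case by (rule equivI) (auto simp: same_profile_def refl_on_def sym_def trans_def)
next
  case 4
  then show ?case using same_profile_list[OF 4(3)] gam_ops[OF 4(1)] gam_ops[of y ys for y ys]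
    by (auto simp: same_profile_def composable_def)
qed (auto simp: same_profile_def act_ops)

lemma gen_cong:
  assumes "R \<subseteq> same_profile"
  shows "operad_congruence P (generated_congruence P R)" "R \<subseteq> generated_congruence P R"
proof -
  let ?S = "{r. operad_congruence P r \<and> R \<subseteq> r}"
  have ne: "same_profile \<in> ?S" using assms same_profile_cong by simp
  show "R \<subseteq> generated_congruence P R" by (auto simp: generated_congruence_def)
  have eq: "equiv (Ops P) r" if "r \<in> ?S" for r using that by (simp add: operad_congruence_def)
  have G: "generated_congruence P R = \<Inter>?S" by (simp add: generated_congruence_def)
  show "operad_congruence P (generated_congruence P R)"
    unfolding operad_congruence_def[of P "generated_congruence P R"] unfolding G
  proof (intro conjI allI impI ballI, goal_cases)
    case 1
    show ?case
    proof (rule equivI)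
      show "\<Inter>?S \<subseteq> Ops P \<times> Ops P" using ne by (auto simp: same_profile_def)
      show "refl_on (Ops P) (\<Inter>?S)" using eq by (auto simp: equiv_def refl_on_def)
      show "sym (\<Inter>?S)" using eq unfolding equiv_def sym_def by blast
      show "trans (\<Inter>?S)" using eq unfolding equiv_def trans_def by blast
    qed
  next
    case (2 x) then show ?case using ne by (auto simp: same_profile_def)
  next
    case (3 z)
    then have z: "z \<in> \<Inter>?S" .
    show ?case
    proof (clarify)
      fix x y \<sigma> r assume a: "z = (x, y)" "\<sigma> permutes {..<length (Inp P x)}" "operad_congruence P r" "R \<subseteq> r"
      then have "(x, y) \<in> r" using z by blast
      then show "(Act P x \<sigma>, Act P y \<sigma>) \<in> r" using a unfolding operad_congruence_def by blast
    qed
  next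
    case (4 x y xs ys)
    show ?case
    proof (rule InterI)
      fix r assume r: "r \<in> ?S"
      then have "(x, y) \<in> r" using 4 by blast
      moreover have "list_all2 (\<lambda>a b. (a, b) \<in> r) xs ys"
        using 4(3) r by (elim list_all2_mono) blast
      ultimately show "(Gam P x xs, Gam P y ys) \<in> r" using r 4(1) by (simp add: operad_congruence_def)
    qed
  qed
qed

end

locale op_cong = colored_operad P for P :: "('c, 'x, 'z) operad_scheme" + fixes r
  assumes cong: "operad_congruence P r"
begin

abbreviation "Q \<equiv> quotient_operad P r"
abbreviation "cls x \<equiv> r `` {x}"

lemma eqv: "equiv (Ops P) r" using cong by (simp add: operad_congruence_def)
lemma r_ops: "(x, y) \<in> r \<Longrightarrow> x \<in> Ops P \<and> y \<in> Ops P" using eqv unfolding equiv_def by blast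
lemma r_prof: "(x, y) \<in> r \<Longrightarrow> Out P x = Out P y \<and> Inp P x = Inp P y" using cong unfolding operad_congruence_def by blast
lemma r_act: "(x, y) \<in> r \<Longrightarrow> \<sigma> permutes {..<length (Inp P x)} \<Longrightarrow> (Act P x \<sigma>, Act P y \<sigma>) \<in> r"
  using cong unfolding operad_congruence_def by blast
lemma r_gam: "composable P x xs \<Longrightarrow> (x, y) \<in> r \<Longrightarrow> list_all2 (\<lambda>a b. (a, b) \<in> r) xs ys \<Longrightarrow> (Gam P x xs, Gam P y ys) \<in> r"
  using cong unfolding operad_congruence_def by blast
lemma r_refl: "x \<in> Ops P \<Longrightarrow> (x, x) \<in> r" using eqv unfolding equiv_def refl_on_def by blast
lemma cls_eq: "x \<in> Ops P \<Longrightarrow> y \<in> Ops P \<Longrightarrow> cls x = cls y \<longleftrightarrow> (x, y) \<in> r"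
  using eq_equiv_class_iff[OF eqv] by blast

lemma Q_ops: "q \<in> Ops Q \<longleftrightarrow> (\<exists>x \<in> Ops P. q = cls x)"
  by (auto simp: quotient_operad_def quotient_def)
lemma Q_out: "x \<in> Ops P \<Longrightarrow> Out Q (cls x) = Out P x"
proof -
  assume x: "x \<in> Ops P"
  have "x \<in> cls x" using r_refl[OF x] by simp
  moreover have "Out P y = Out P x" if "y \<in> cls x" for y using r_prof[of x y] that by simp
  ultimately have "Out P ` cls x = {Out P x}" by blast
  then show ?thesis by (simp add: quotient_operad_def)
qed
lemma Q_inp: "x \<in> Ops P \<Longrightarrow> Inp Q (cls x) = Inp P x"
proof -
  assume x: "x \<in> Ops P"
  have "x \<in> cls x" using r_refl[OF x] by simp
  moreover have "Inp P y = Inp P x" if "y \<in> cls x" for y using r_prof[of x y] that by simp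
  ultimately have "Inp P ` cls x = {Inp P x}" by blast
  then show ?thesis by (simp add: quotient_operad_def)
qed
lemma Image_cls: "S \<noteq> {} \<Longrightarrow> (\<And>y. y \<in> S \<Longrightarrow> (x, y) \<in> r) \<Longrightarrow> r `` S = cls x"
  using eqv unfolding equiv_def sym_def trans_def by blast
lemma Q_act: "x \<in> Ops P \<Longrightarrow> \<sigma> permutes {..<length (Inp P x)} \<Longrightarrow> Act Q (cls x) \<sigma> = cls (Act P x \<sigma>)"
  unfolding quotient_operad_def operad.simps
proof (rule Image_cls)
  show "(\<lambda>x. Act P x \<sigma>) ` cls x \<noteq> {}" if "x \<in> Ops P" using r_refl[OF that] by blast
qed (use r_act in auto)
lemma Q_gam:
  assumes "composable P x xs"
  shows "Gam Q (cls x) (map cls xs) = cls (Gam P x xs)"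
  unfolding quotient_operad_def operad.simps
proof (rule Image_cls)
  have "x \<in> cls x" "list_all2 (\<in>) xs (map cls xs)"
    using assms r_refl by (auto simp: composable_def list_all2_conv_all_nth subset_iff)
  then show "{Gam P y ys |y ys. y \<in> cls x \<and> ys \<in> listset (map cls xs)} \<noteq> {}"
    by (auto simp: in_listset)
  fix g assume "g \<in> {Gam P y ys |y ys. y \<in> cls x \<and> ys \<in> listset (map cls xs)}"
  then obtain y ys where g: "g = Gam P y ys" "(x, y) \<in> r" "list_all2 (\<in>) ys (map cls xs)" by (auto simp: in_listset)
  then have "list_all2 (\<lambda>a b. (a, b) \<in> r) xs ys" by (auto simp: list_all2_conv_all_nth)
  then show "(Gam P x xs, g) \<in> r" using r_gam assms g by blast
qed
lemma Q_un: "OpUnit Q c = cls (OpUnit P c)" by (simp add: quotient_operad_def)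
lemma Q_un': "OpUnit Q = (\<lambda>c. cls (OpUnit P c))" by (simp add: quotient_operad_def)
lemma Q_col: "Colors Q = Colors P" by (simp add: quotient_operad_def)

lemma Q_list: "set qs \<subseteq> Ops Q \<Longrightarrow> \<exists>xs. qs = map cls xs \<and> set xs \<subseteq> Ops P"
proof (induction qs)
  case Nil then show ?case by simp
next
  case (Cons q qs)
  then obtain xs x where "qs = map cls xs" "set xs \<subseteq> Ops P" "x \<in> Ops P" "q = cls x" by (auto simp: Q_ops)
  then show ?case by (intro exI[of _ "x # xs"]) simp
qed

lemma Q_comp: "x \<in> Ops P \<Longrightarrow> set xs \<subseteq> Ops P \<Longrightarrow> composable Q (cls x) (map cls xs) \<longleftrightarrow> composable P x xs"
proof -
  assume a: "x \<in> Ops P" "set xs \<subseteq> Ops P"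
  have "map (Out Q) (map cls xs) = map (Out P) xs" using a Q_out by auto
  then show ?thesis using a by (auto simp: composable_def Q_inp) (auto simp: Q_ops)
qed

lemma Q_compE:
  assumes "composable Q q qs"
  obtains x xs where "q = cls x" "qs = map cls xs" "composable P x xs"
proof -
  obtain x where x: "x \<in> Ops P" "q = cls x" using assms by (auto simp: composable_def Q_ops)
  obtain xs where xs: "qs = map cls xs" "set xs \<subseteq> Ops P" using Q_list assms unfolding composable_def by blast
  show thesis using that x xs Q_comp assms by blast
qed

lemma comp_ops: "composable P x xs \<Longrightarrow> x \<in> Ops P \<and> set xs \<subseteq> Ops P" by (simp add: composable_def)

lemma Q_list2: "list_all2 (composable Q) (map cls ys) zss \<Longrightarrow> set ys \<subseteq> Ops P \<Longrightarrow>
  \<exists>wss. zss = map (map cls) wss \<and> list_all2 (composable P) ys wss"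
proof (induction ys arbitrary: zss)
  case Nil then show ?case by simp
next
  case (Cons y ys)
  then obtain z zs where z: "zss = z # zs" "composable Q (cls y) z" "list_all2 (composable Q) (map cls ys) zs"
    by (auto simp: list_all2_Cons1)
  then obtain wss where w: "zs = map (map cls) wss" "list_all2 (composable P) ys wss" using Cons by auto
  obtain ws where ws: "z = map cls ws" "set ws \<subseteq> Ops P" using z(2) Q_list unfolding composable_def by blast
  then have "composable P y ws" using z(2) Q_comp Cons.prems by auto
  then show ?case using w ws z by (intro exI[of _ "ws # wss"]) simp
qed

theorem quotient_colored_operad: "colored_operad Q"
proof
  fix q assume "q \<in> Ops Q"
  then obtain x where x: "x \<in> Ops P" and [simp]: "q = cls x" by (auto simp: Q_ops)
  note [simp] = Q_out[OF x] Q_inp[OF x] Q_col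
  show "Out Q q \<in> Colors Q" using out_color x by simp
  show "set (Inp Q q) \<subseteq> Colors Q" using inp_color x by simp
  show "Act Q q id = q" using Q_act[OF x, of id] x by (simp add: act_id permutes_id)
  have "composable P (OpUnit P (Out P x)) [x]" using x un_ops out_color by (simp add: composable_def)
  from Q_gam[OF this] show "Gam Q (OpUnit Q (Out Q q)) [q] = q" by (simp add: Q_un gam_un_left x)
  have "composable P x (map (OpUnit P) (Inp P x))" using x un_ops inp_color by (auto simp: composable_def subset_iff intro!: nth_equalityI)
  from Q_gam[OF this] show "Gam Q q (map (OpUnit Q) (Inp Q q)) = q" by (simp add: Q_un' gam_un_right x comp_def)
  fix \<tau> assume t: "\<tau> permutes {..<length (Inp Q q)}"
  show "Act Q q \<tau> \<in> Ops Q \<and> Out Q (Act Q q \<tau>) = Out Q q \<and> Inp Q (Act Q q \<tau>) = permute_list \<tau> (Inp Q q)"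
    using t act_ops[OF x, of \<tau>] Q_act[OF x] Q_out Q_inp Q_ops by auto
  fix \<rho> assume s: "\<rho> permutes {..<length (Inp Q q)}"
  have "Act Q q \<rho> = cls (Act P x \<rho>)" using s Q_act[OF x] by simp
  moreover have "Act Q (cls (Act P x \<rho>)) \<tau> = cls (Act P (Act P x \<rho>) \<tau>)"
    using act_ops[OF x, of \<rho>] s t by (intro Q_act) auto
  ultimately show "Act Q (Act Q q \<rho>) \<tau> = Act Q q (\<rho> \<circ> \<tau>)"
    using act_act[OF x, of \<rho> \<tau>] s t Q_act[OF x, of "\<rho> \<circ> \<tau>"] by (simp add: permutes_compose)
next
  fix c assume "c \<in> Colors Q"
  then show "OpUnit Q c \<in> Ops Q \<and> Out Q (OpUnit Q c) = c \<and> Inp Q (OpUnit Q c) = [c]"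
    using un_ops[of c] by (auto simp: Q_un Q_out Q_inp Q_ops Q_col)
next
  fix q qs assume c: "composable Q q qs"
  then obtain x xs where [simp]: "q = cls x" "qs = map cls xs" and cx: "composable P x xs" by (rule Q_compE)
  have x: "x \<in> Ops P" "set xs \<subseteq> Ops P" using comp_ops[OF cx] by auto
  have m: "map (Inp Q) (map cls xs) = map (Inp P) xs" using x Q_inp by auto
  show "Gam Q q qs \<in> Ops Q \<and> Out Q (Gam Q q qs) = Out Q q \<and> Inp Q (Gam Q q qs) = concat (map (Inp Q) qs)"
  proof -
    have g: "Gam P x xs \<in> Ops P" "Out P (Gam P x xs) = Out P x" "Inp P (Gam P x xs) = concat (map (Inp P) xs)"
      using gam_ops[OF cx] by auto
    show ?thesis unfolding \<open>q = _\<close> \<open>qs = _\<close> Q_gam[OF cx] m Q_out[OF g(1)] Q_inp[OF g(1)] Q_out[OF x(1)] Q_ops g(2,3)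
      using g(1) by blast
  qed
  fix zss assume "list_all2 (composable Q) qs zss"
  then obtain wss where [simp]: "zss = map (map cls) wss" and w: "list_all2 (composable P) xs wss"
    using Q_list2 x by auto
  have 1: "map2 (Gam Q) (map cls xs) (map (map cls) wss) = map cls (map2 (Gam P) xs wss)"
    using w by (induction rule: list_all2_induct) (simp_all add: Q_gam)
  have wo: "map (Out P) (concat wss) = concat (map (Inp P) xs)" "set (concat wss) \<subseteq> Ops P"
    "map (Out P) (map2 (Gam P) xs wss) = map (Out P) xs" "set (map2 (Gam P) xs wss) \<subseteq> Ops P"
    using w by (induction rule: list_all2_induct) (auto simp: composable_def gam_ops)
  have c1: "composable P (Gam P x xs) (concat wss)" using gam_ops[OF cx] wo by (simp add: composable_def)
  have c2: "composable P x (map2 (Gam P) xs wss)" using cx wo by (simp add: composable_def)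
  show "Gam Q (Gam Q q qs) (concat zss) = Gam Q q (map2 (Gam Q) qs zss)"
    unfolding \<open>q = _\<close> \<open>qs = _\<close> \<open>zss = _\<close> 1 map_concat[symmetric] Q_gam[OF cx] Q_gam[OF c1] Q_gam[OF c2] gam_assoc[OF cx w] ..
next
  fix q qs \<sigma> assume c: "composable Q q qs" and s: "\<sigma> permutes {..<length qs}"
  then obtain x xs where [simp]: "q = cls x" "qs = map cls xs" and cx: "composable P x xs" by (metis Q_compE)
  have x: "x \<in> Ops P" "set xs \<subseteq> Ops P" "length (Inp P x) = length xs" using cx by (auto simp: composable_def)
  have sx: "set (permute_list \<sigma> xs) = set xs" using s by simp
  have cp: "composable P (Act P x \<sigma>) (permute_list \<sigma> xs)"
    using cx act_ops[of x \<sigma>] s x sx by (simp add: composable_def permute_list_map)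
  have k: "map (\<lambda>y. length (Inp Q y)) (permute_list \<sigma> qs) = map (\<lambda>y. length (Inp P y)) (permute_list \<sigma> xs)"
    using s x sx Q_inp by (auto simp: permute_list_map)
  let ?b = "block_perm \<sigma> (map (\<lambda>y. length (Inp P y)) (permute_list \<sigma> xs))"
  have "sum_list (map (\<lambda>y. length (Inp P y)) (permute_list \<sigma> xs)) = sum_list (map (\<lambda>y. length (Inp P y)) xs)"
    using s by (simp add: sum_mset_sum_list[symmetric] del: sum_mset_sum_list)
  then have b: "?b permutes {..<length (Inp P (Gam P x xs))}"
    using block_perm_permutes[of \<sigma> "map (\<lambda>y. length (Inp P y)) (permute_list \<sigma> xs)"] s gam_ops[OF cx]
    by (simp add: length_concat comp_def)
  show "Gam Q (Act Q q \<sigma>) (permute_list \<sigma> qs) = Act Q (Gam Q q qs) (block_perm \<sigma> (map (\<lambda>y. length (Inp Q y)) (permute_list \<sigma> qs)))"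
  proof -
    have s': "\<sigma> permutes {..<length xs}" using s by simp
    have s'': "\<sigma> permutes {..<length (Inp P x)}" unfolding x(3) by fact
    have g: "Gam P x xs \<in> Ops P" using gam_ops[OF cx] by simp
    show ?thesis unfolding k
      unfolding \<open>q = _\<close> \<open>qs = _\<close> permute_list_map[OF s'] Q_act[OF x(1) s''] Q_gam[OF cp] Q_gam[OF cx] Q_act[OF g b]
      unfolding equivariance_top[OF cx s'] ..
  qed
next
  fix q qs \<tau>s assume c: "composable Q q qs" and t: "list_all2 (\<lambda>y \<tau>. \<tau> permutes {..<length (Inp Q y)}) qs \<tau>s"
  then obtain x xs where [simp]: "q = cls x" "qs = map cls xs" and cx: "composable P x xs" by (metis Q_compE)
  have x: "x \<in> Ops P" "set xs \<subseteq> Ops P" using cx by (auto simp: composable_def)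
  have t': "list_all2 (\<lambda>y \<tau>. \<tau> permutes {..<length (Inp P y)}) xs \<tau>s"
    using t x Q_inp by (auto simp: list_all2_conv_all_nth subset_iff)
  have 1: "map2 (Act Q) (map cls xs) \<tau>s = map cls (map2 (Act P) xs \<tau>s) \<and> set (map2 (Act P) xs \<tau>s) \<subseteq> Ops P \<and>
     map (Out P) (map2 (Act P) xs \<tau>s) = map (Out P) xs"
    using t' x by (induction rule: list_all2_induct) (auto simp: Q_act act_ops)
  have k: "map (\<lambda>y. length (Inp Q y)) qs = map (\<lambda>y. length (Inp P y)) xs"
    using x Q_inp by auto
  have c1: "composable P x (map2 (Act P) xs \<tau>s)" using cx 1 by (simp add: composable_def)
  have b: "sum_perm (map (\<lambda>y. length (Inp P y)) xs) \<tau>s permutes {..<length (Inp P (Gam P x xs))}"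
    using sum_perm_permutes[of \<tau>s "map (\<lambda>y. length (Inp P y)) xs"] t' gam_ops[OF cx]
    by (simp add: list_all2_conv_all_nth length_concat comp_def)
  show "Gam Q q (map2 (Act Q) qs \<tau>s) = Act Q (Gam Q q qs) (sum_perm (map (\<lambda>y. length (Inp Q y)) qs) \<tau>s)"
  proof -
    have g: "Gam P x xs \<in> Ops P" using gam_ops[OF cx] by simp
    have 2: "map2 (Act Q) (map cls xs) \<tau>s = map cls (map2 (Act P) xs \<tau>s)" using 1 by blast
    show ?thesis unfolding k
      unfolding \<open>q = _\<close> \<open>qs = _\<close> 2 Q_gam[OF c1] Q_gam[OF cx] Q_act[OF g b]
      unfolding equivariance_bottom[OF cx t'] ..
  qed
qed

theorem quotient_map_morphism: "operad_morphism P Q (quotient_map P r)"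
  unfolding operad_morphism_def
proof (intro conjI ballI allI impI, goal_cases)
  case (6 x ys)
  have "map (OpMap (quotient_map P r)) ys = map cls ys" using comp_ops[OF 6] by (auto simp: quotient_map_def)
  moreover have "OpMap (quotient_map P r) x = cls x" if "x \<in> Ops P" for x using that by (simp add: quotient_map_def)
  ultimately show ?case using gam_ops[OF 6] comp_ops[OF 6] Q_gam[OF 6] by (simp cong: map_cong)
next
  case (3 x)
  then show ?case using out_color by (simp add: quotient_map_def Q_out)
next
  case (4 x)
  then show ?case using inp_color[of x] by (auto simp: quotient_map_def Q_inp intro!: map_idI[symmetric])
qed (auto simp: quotient_map_def Q_col Q_un Q_ops Q_act act_ops un_ops out_color)

end

theorem (in colored_operad) quotient_universal:
  assumes R: "R \<subseteq> same_profile" and O: "colored_operad P'" and \<phi>: "operad_morphism P P' \<phi>"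
    and eq: "\<And>x y. (x, y) \<in> R \<Longrightarrow> OpMap \<phi> x = OpMap \<phi> y"
    and id: "\<And>c. c \<in> Colors P \<Longrightarrow> ColMap \<phi> c = c"
  shows "\<exists>!\<psi>. operad_morphism (quotient_operad P (generated_congruence P R)) P' \<psi> \<and>
     ColMap \<psi> = ColMap \<phi> \<and>
     (\<forall>x \<in> Ops P. OpMap \<psi> (OpMap (quotient_map P (generated_congruence P R)) x) = OpMap \<phi> x)"
proof -
  let ?r = "generated_congruence P R"
  interpret op_cong P ?r by unfold_locales (rule gen_cong[OF R])
  interpret P': colored_operad P' by fact
  define K where "K = {(x, y) \<in> same_profile. OpMap \<phi> x = OpMap \<phi> y}"
  note m = \<phi>[unfolded operad_morphism_def]
  have mA: "OpMap \<phi> (Act P x \<sigma>) = Act P' (OpMap \<phi> x) \<sigma>" if "x \<in> Ops P" "\<sigma> permutes {..<length (Inp P x)}" for x \<sigma>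
    using m that by blast
  have mG: "OpMap \<phi> (Gam P x xs) = Gam P' (OpMap \<phi> x) (map (OpMap \<phi>) xs)" if "composable P x xs" for x xs
    using m that by blast
  have K: "operad_congruence P K"
    unfolding operad_congruence_def
  proof (intro conjI allI impI ballI, goal_cases)
    case 1 show ?case by (rule equivI) (auto simp: K_def same_profile_def refl_on_def sym_def trans_def)
  next
    case (3 z) then show ?case by (auto simp: K_def same_profile_def act_ops mA)
  next
    case (4 x y xs ys)
    have l: "list_all2 (\<lambda>a b. (a, b) \<in> same_profile) xs ys" using 4(3) by (elim list_all2_mono) (simp add: K_def)
    have "map (OpMap \<phi>) xs = map (OpMap \<phi>) ys" using 4(3) by (induction rule: list_all2_induct) (auto simp: K_def)
    moreover have c: "composable P y ys" using 4 same_profile_list[OF l] by (auto simp: K_def same_profile_def composable_def)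
    ultimately show ?case using 4 mG[OF 4(1)] mG[OF c] gam_ops[OF 4(1)] gam_ops[OF c] same_profile_list[OF l]
      by (auto simp: K_def same_profile_def)
  qed (auto simp: K_def same_profile_def)
  have "R \<subseteq> K" using eq R by (auto simp: K_def)
  then have rK: "?r \<subseteq> K" using K by (auto simp: generated_congruence_def)
  let ?\<psi> = "\<lparr>ColMap = ColMap \<phi>, OpMap = (\<lambda>q \<in> Ops Q. OpMap \<phi> (SOME x. x \<in> q))\<rparr>"
  have val: "OpMap ?\<psi> (cls x) = OpMap \<phi> x" if x: "x \<in> Ops P" for x
  proof -
    have "(SOME y. y \<in> cls x) \<in> cls x" using r_refl[OF x] by (metis Image_singleton_iff someI)
    then have "(x, SOME y. y \<in> cls x) \<in> K" using rK by auto
    then show ?thesis using x Q_ops by (auto simp: K_def)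
  qed
  have qm: "OpMap (quotient_map P ?r) x = cls x" if "x \<in> Ops P" for x using that by (simp add: quotient_map_def)
  have mor: "operad_morphism Q P' ?\<psi>"
    unfolding operad_morphism_def
  proof (intro conjI ballI allI impI, goal_cases)
    case 1 show ?case using m by (simp add: Q_col)
  next
    case 2 show ?case
    proof (rule PiE_I)
      fix q assume "q \<in> Ops Q"
      then obtain x where x: "x \<in> Ops P" "q = cls x" by (auto simp: Q_ops)
      show "OpMap ?\<psi> q \<in> Ops P'" unfolding x(2) val[OF x(1)] using m x(1) by auto
    qed simp
  next
    case (3 q) then obtain x where x: "x \<in> Ops P" "q = cls x" by (auto simp: Q_ops)
    show ?case unfolding x(2) val[OF x(1)] using m x(1) by (simp add: Q_out)
  next
    case (4 q) then obtain x where x: "x \<in> Ops P" "q = cls x" by (auto simp: Q_ops)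
    show ?case unfolding x(2) val[OF x(1)] using m x(1) by (simp add: Q_inp)
  next
    case (5 q \<sigma>) then obtain x where x: "x \<in> Ops P" "q = cls x" by (auto simp: Q_ops)
    have s: "\<sigma> permutes {..<length (Inp P x)}" using 5 x by (simp add: Q_inp)
    have a: "Act P x \<sigma> \<in> Ops P" using act_ops x s by blast
    show ?case unfolding x(2) val[OF x(1)] Q_act[OF x(1) s] val[OF a] using mA[OF x(1) s] .
  next
    case (6 q qs) then obtain x xs where x: "q = cls x" "qs = map cls xs" "composable P x xs" by (rule Q_compE)
    have a: "Gam P x xs \<in> Ops P" using gam_ops x by blast
    have b: "map (OpMap ?\<psi>) (map cls xs) = map (OpMap \<phi>) xs" using comp_ops[OF x(3)] val by (simp add: subset_iff)
    show ?case unfolding x(1,2) Q_gam[OF x(3)] val[OF a] b val[OF comp_ops[OF x(3), THEN conjunct1]] using mG[OF x(3)] .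
  next
    case (7 c)
    then have c: "c \<in> Colors P" by (simp add: Q_col)
    then have a: "OpUnit P c \<in> Ops P" using un_ops by blast
    show ?case unfolding Q_un val[OF a] using m c by simp
  qed
  show ?thesis
  proof (rule ex1I[of _ ?\<psi>])
    show "operad_morphism Q P' ?\<psi> \<and> ColMap ?\<psi> = ColMap \<phi> \<and>
     (\<forall>x \<in> Ops P. OpMap ?\<psi> (OpMap (quotient_map P ?r) x) = OpMap \<phi> x)" using mor val qm by simp
    fix \<psi> assume p: "operad_morphism Q P' \<psi> \<and> ColMap \<psi> = ColMap \<phi> \<and>
     (\<forall>x \<in> Ops P. OpMap \<psi> (OpMap (quotient_map P ?r) x) = OpMap \<phi> x)"
    have "OpMap \<psi> = OpMap ?\<psi>"
    proof
      fix q show "OpMap \<psi> q = OpMap ?\<psi> q"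
      proof (cases "q \<in> Ops Q")
        case True
        then obtain x where x: "x \<in> Ops P" "q = cls x" by (auto simp: Q_ops)
        then have "OpMap \<psi> q = OpMap \<phi> x" using p qm by metis
        then show ?thesis using x val by simp
      next
        case False
        have "OpMap \<psi> \<in> extensional (Ops Q)" using p unfolding operad_morphism_def by (auto simp: PiE_def)
        then show ?thesis using False by (simp add: extensional_def)
      qed
    qed
    then show "\<psi> = ?\<psi>" using p by simp
  qed
qed

context orthogonal_category begin

lemma perp_generators_prof: "perp_generators C perp \<subseteq> colored_operad.same_profile (cat_operad C)"
proof -
  interpret P: colored_operad "cat_operad C" by (rule cat_operad)
  have t: "transpose (0::nat) 1 permutes {..<2}" by (rule permutes_swap_id) auto
  show ?thesis
    using perp_arr cod_obj t by (auto simp: perp_generators_def P.same_profile_def permutes_id numeral_2_eq_2)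
qed

theorem orth_operad_coequalizer:
  shows "colored_operad (orth_operad C perp)"
    and "operad_morphism (cat_operad C) (orth_operad C perp) (orth_proj C perp)"
    and "\<And>f1 f2. (f1, f2) \<in> perp \<Longrightarrow>
           OpMap (orth_proj C perp) (Cod C f1, id, [f1, f2]) =
           OpMap (orth_proj C perp) (Cod C f1, transpose 0 1, [f1, f2])"
    and "\<And>P \<phi>. colored_operad P \<Longrightarrow> operad_morphism (cat_operad C) P \<phi> \<Longrightarrow>
           (\<And>c. c \<in> Obj C \<Longrightarrow> ColMap \<phi> c = c) \<Longrightarrow>
           (\<And>f1 f2. (f1, f2) \<in> perp \<Longrightarrow>
              OpMap \<phi> (Cod C f1, id, [f1, f2]) = OpMap \<phi> (Cod C f1, transpose 0 1, [f1, f2])) \<Longrightarrow>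
           \<exists>!\<psi>. operad_morphism (orth_operad C perp) P \<psi> \<and> ColMap \<psi> = ColMap \<phi> \<and>
             (\<forall>x \<in> Ops (cat_operad C). OpMap \<psi> (OpMap (orth_proj C perp) x) = OpMap \<phi> x)"
proof -
  interpret P: colored_operad "cat_operad C" by (rule cat_operad)
  have r: "perp_congruence C perp = generated_congruence (cat_operad C) (perp_generators C perp)"
    by (simp add: perp_congruence_def perp_generators_def)
  interpret Q: op_cong "cat_operad C" "perp_congruence C perp"
    unfolding r by unfold_locales (rule P.gen_cong[OF perp_generators_prof])
  show "colored_operad (orth_operad C perp)"
    unfolding orth_operad_def by (rule Q.quotient_colored_operad)
  show "operad_morphism (cat_operad C) (orth_operad C perp) (orth_proj C perp)"
    unfolding orth_operad_def orth_proj_def by (rule Q.quotient_map_morphism)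
  { fix f1 f2 assume "(f1, f2) \<in> perp"
    then have "((Cod C f1, id, [f1, f2]), (Cod C f1, transpose 0 1, [f1, f2])) \<in> perp_congruence C perp"
      using P.gen_cong(2)[OF perp_generators_prof] unfolding r by (auto simp: perp_generators_def)
    then show "OpMap (orth_proj C perp) (Cod C f1, id, [f1, f2]) =
           OpMap (orth_proj C perp) (Cod C f1, transpose 0 1, [f1, f2])"
      using Q.r_ops Q.cls_eq by (simp add: orth_proj_def quotient_map_def del: cat_operad_sel) }
  show "\<exists>!\<psi>. operad_morphism (orth_operad C perp) P \<psi> \<and> ColMap \<psi> = ColMap \<phi> \<and>
             (\<forall>x \<in> Ops (cat_operad C). OpMap \<psi> (OpMap (orth_proj C perp) x) = OpMap \<phi> x)"
    if "colored_operad P" "operad_morphism (cat_operad C) P \<phi>" "\<And>c. c \<in> Obj C \<Longrightarrow> ColMap \<phi> c = c"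
       "\<And>f1 f2. (f1, f2) \<in> perp \<Longrightarrow>
              OpMap \<phi> (Cod C f1, id, [f1, f2]) = OpMap \<phi> (Cod C f1, transpose 0 1, [f1, f2])" for P \<phi>
    unfolding orth_operad_def orth_proj_def r
    by (rule P.quotient_universal[OF perp_generators_prof that(1,2)]) (use that(3,4) in \<open>auto simp: perp_generators_def\<close>)
qed
end

end

theory Submission
  imports Defs
begin

text \<open>
  For every functor \<open>F\<close> from \<open>D\<close> to monoids, the universal properties of \<open>Lan\<close> and of \<open>Oj_shriek\<close>
  identify both \<open>Hom(Lan (p A), F)\<close> and, when \<open>F\<close> comes from an algebra over the operad of the
  orthogonal category, \<open>Hom(p (Oj_shriek A), F)\<close> with natural transformations from \<open>p A\<close> to the
  restriction of \<open>F\<close> along \<open>j\<close>; this uses that passing from algebras to diagrams is fully faithful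
  and commutes with restriction along \<open>j\<close>. The two objects are therefore isomorphic as soon as
  \<open>Lan (p A)\<close> itself comes from an algebra. A diagram of monoids carries operations
  \<open>(\<sigma>, f1, \<dots>, fn)\<close>: permute the factors by \<open>\<sigma>\<close>, apply the \<open>fi\<close> and multiply. Compatibility with operadic
  composition is the coherence of permutations with concatenation of blocks, which is reduced to
  naturality, involutivity and the hexagon for the exchange \<open>x \<otimes> (y \<otimes> z) \<rightarrow> y \<otimes> (x \<otimes> z)\<close>.
  Commutativity on orthogonal pairs says precisely that the generating relations hold, so that the
  algebra descends to the quotient operad.
\<close>

section \<open>Calculus in a symmetric monoidal category\<close>

text \<open>No general coherence theorem is invoked: only the diagrams that the operad axioms
  produce are proved. Symmetries are indexed by lists of distinct numbers rather than by
  permutations, because such a reordering is determined by its source list and target list;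
  composites then need no bookkeeping of permutations, and every list of objects, even one with
  repetitions, is the image of a list of distinct labels. Since \<open>tens\<close> ends in the unit
  object, a one-fold product is \<open>x \<otimes> unit\<close>, and right unitors occur wherever a
  single arrow or a binary product is extracted from an operation. The generated congruence is never
  described explicitly: whatever must be constant on its classes is handled by exhibiting a
  congruence that contains the generators. The comparison of adjoints relies on strict equalities:
  restriction of diagrams and pullback of algebras commute on the nose with the passage to diagrams,
  and a commutative diagram equals the diagram of an algebra instead of being merely isomorphic to
  one.\<close>

lemma hom_iff: "f \<in> hom C a b \<longleftrightarrow> f \<in> Arr C \<and> Dom C f = a \<and> Cod C f = b"
  by (simp add: hom_def)

lemma homI: "f \<in> Arr C \<Longrightarrow> f \<in> hom C (Dom C f) (Cod C f)"
  by (simp add: hom_def)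

context category begin

lemma comp_arr' [simp]:
  assumes "f \<in> Arr C" "g \<in> Arr C" "Cod C f = Dom C g"
  shows "g \<cdot> f \<in> Arr C" "Dom C (g \<cdot> f) = Dom C f" "Cod C (g \<cdot> f) = Cod C g"
  using comp_arr[OF assms] by auto

lemma id_arr' [simp]:
  assumes "a \<in> Obj C"
  shows "Id C a \<in> Arr C" "Dom C (Id C a) = a" "Cod C (Id C a) = a"
  using id_arr[OF assms] by auto

lemma comp_id' [simp]: "f \<in> Arr C \<Longrightarrow> Dom C f = a \<Longrightarrow> f \<cdot> Id C a = f"
  using comp_id[of f a "Cod C f"] by (simp add: hom_iff)

lemma id_comp' [simp]: "f \<in> Arr C \<Longrightarrow> Cod C f = a \<Longrightarrow> Id C a \<cdot> f = f"
  using id_comp[of f "Dom C f" a] by (simp add: hom_iff)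

text \<open>As a simplification rule this keeps composites nested to the right. An equation needed
  in the middle of a composite is therefore first composed with the remaining arrow, which is the
  purpose of the many \<open>arg_cong\<close> steps below.\<close>

lemma comp_assoc' [simp]:
  assumes "f \<in> Arr C" "g \<in> Arr C" "h \<in> Arr C" "Cod C f = Dom C g" "Cod C g = Dom C h"
  shows "(h \<cdot> g) \<cdot> f = h \<cdot> (g \<cdot> f)"
  using assms comp_assoc[of f "Dom C f" "Dom C g" g "Dom C h" h "Cod C h"] by (simp add: hom_iff)

declare dom_obj [simp] cod_obj [simp]

lemma inverse_arrows_unique:
  assumes "inverse_arrows C f g" "inverse_arrows C f h"
  shows "g = h"
proof -
  have f: "f \<in> Arr C" and g: "g \<in> Arr C" "Dom C g = Cod C f" "Cod C g = Dom C f" "g \<cdot> f = Id C (Dom C f)"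
    and h: "h \<in> Arr C" "Dom C h = Cod C f" "Cod C h = Dom C f" "f \<cdot> h = Id C (Cod C f)"
    using assms by (auto simp: inverse_arrows_def hom_iff)
  have "g = g \<cdot> (f \<cdot> h)" using f g h by simp
  also have "\<dots> = (g \<cdot> f) \<cdot> h" using f g(1-3) h(1-3) by simp
  also have "\<dots> = h" using g h by simp
  finally show ?thesis .
qed

lemma inv_arr:
  assumes "is_iso C f"
  shows "f \<in> Arr C" "inv_arr C f \<in> Arr C" "Dom C (inv_arr C f) = Cod C f" "Cod C (inv_arr C f) = Dom C f"
    "inv_arr C f \<cdot> f = Id C (Dom C f)" "f \<cdot> inv_arr C f = Id C (Cod C f)"
proof -
  have "\<exists>!g. inverse_arrows C f g" using assms inverse_arrows_unique by (auto simp: is_iso_def)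
  then have "inverse_arrows C f (inv_arr C f)" unfolding inv_arr_def by (rule theI')
  then show "f \<in> Arr C" "inv_arr C f \<in> Arr C" "Dom C (inv_arr C f) = Cod C f" "Cod C (inv_arr C f) = Dom C f"
    "inv_arr C f \<cdot> f = Id C (Dom C f)" "f \<cdot> inv_arr C f = Id C (Cod C f)"
    by (auto simp: inverse_arrows_def hom_iff)
qed

lemma isoI:
  assumes "f \<in> Arr C" "g \<in> Arr C" "Dom C g = Cod C f" "Cod C g = Dom C f"
    "g \<cdot> f = Id C (Dom C f)" "f \<cdot> g = Id C (Cod C f)"
  shows "is_iso C f"
  using assms by (auto simp: is_iso_def inverse_arrows_def hom_iff)

lemma inv_arr_cancel [simp]:
  assumes "is_iso C f"
  shows "h \<in> Arr C \<Longrightarrow> Cod C h = Dom C f \<Longrightarrow> inv_arr C f \<cdot> (f \<cdot> h) = h"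
    and "h \<in> Arr C \<Longrightarrow> Cod C h = Cod C f \<Longrightarrow> f \<cdot> (inv_arr C f \<cdot> h) = h"
proof -
  note i = inv_arr[OF assms]
  show "inv_arr C f \<cdot> (f \<cdot> h) = h" if "h \<in> Arr C" "Cod C h = Dom C f"
    using comp_assoc'[of h f "inv_arr C f"] that i by simp
  show "f \<cdot> (inv_arr C f \<cdot> h) = h" if "h \<in> Arr C" "Cod C h = Cod C f"
    using comp_assoc'[of h "inv_arr C f" f] that i by simp
qed

lemma iso_id [simp]: "a \<in> Obj C \<Longrightarrow> is_iso C (Id C a)"
  by (intro isoI[of _ "Id C a"]) auto

lemma iso_comp [simp]:
  assumes "is_iso C f" "is_iso C g" "Cod C f = Dom C g"
  shows "is_iso C (g \<cdot> f)"
  using inv_arr[OF assms(1)] inv_arr[OF assms(2)] assms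
  by (intro isoI[of _ "inv_arr C f \<cdot> inv_arr C g"]) auto

text \<open>Most coherence equations below are proved after composing with an isomorphism at the
  source, so that inverses of associators and unitors hardly ever have to be manipulated.\<close>

lemma iso_epi:
  assumes "f \<cdot> e = g \<cdot> e" "is_iso C e" "f \<in> Arr C" "g \<in> Arr C" "Dom C f = Cod C e" "Dom C g = Cod C e"
  shows "f = g"
proof -
  note i = inv_arr[OF assms(2)]
  have "(f \<cdot> e) \<cdot> inv_arr C e = (g \<cdot> e) \<cdot> inv_arr C e" using assms by simp
  then show ?thesis using i assms(3-) by simp
qed

lemma iso_mono:
  assumes "e \<cdot> f = e \<cdot> g" "is_iso C e" "f \<in> Arr C" "g \<in> Arr C" "Cod C f = Dom C e" "Cod C g = Dom C e"
  shows "f = g"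
proof -
  have "inv_arr C e \<cdot> (e \<cdot> f) = inv_arr C e \<cdot> (e \<cdot> g)" using assms by simp
  then show ?thesis using assms(2-) by simp
qed

end

section \<open>Typing rules, interchange law and unit coherence in a symmetric monoidal
  category\<close>

context symmetric_monoidal_category begin

abbreviation "unit \<equiv> TUnit M"
abbreviation "T \<equiv> tens M"
abbreviation "app \<equiv> tens_append M"

declare tensor_obj [simp] tensor_id [simp] unit_obj [simp] assoc_iso [simp] lunit_iso [simp] runit_iso [simp] sym_sym [simp]

lemma tensor_arr [simp]:
  assumes "f \<in> Arr M" "g \<in> Arr M"
  shows "f \<odot> g \<in> Arr M" "Dom M (f \<odot> g) = Dom M f \<otimes> Dom M g" "Cod M (f \<odot> g) = Cod M f \<otimes> Cod M g"
  using tensor_hom[OF homI[OF assms(1)] homI[OF assms(2)]] by (auto simp: hom_iff)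

lemma assoc_arr [simp]:
  assumes "a \<in> Obj M" "b \<in> Obj M" "c \<in> Obj M"
  shows "Assoc M a b c \<in> Arr M" "Dom M (Assoc M a b c) = (a \<otimes> b) \<otimes> c" "Cod M (Assoc M a b c) = a \<otimes> b \<otimes> c"
    "inv_arr M (Assoc M a b c) \<in> Arr M" "Dom M (inv_arr M (Assoc M a b c)) = a \<otimes> b \<otimes> c"
    "Cod M (inv_arr M (Assoc M a b c)) = (a \<otimes> b) \<otimes> c"
    "inv_arr M (Assoc M a b c) \<cdot> Assoc M a b c = Id M ((a \<otimes> b) \<otimes> c)"
    "Assoc M a b c \<cdot> inv_arr M (Assoc M a b c) = Id M (a \<otimes> b \<otimes> c)"
  using assoc_hom[OF assms] inv_arr[OF assoc_iso[OF assms]] by (auto simp: hom_iff)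

lemma lunit_arr [simp]:
  assumes "a \<in> Obj M"
  shows "LUnit M a \<in> Arr M" "Dom M (LUnit M a) = unit \<otimes> a" "Cod M (LUnit M a) = a"
    "inv_arr M (LUnit M a) \<in> Arr M" "Dom M (inv_arr M (LUnit M a)) = a" "Cod M (inv_arr M (LUnit M a)) = unit \<otimes> a"
    "inv_arr M (LUnit M a) \<cdot> LUnit M a = Id M (unit \<otimes> a)" "LUnit M a \<cdot> inv_arr M (LUnit M a) = Id M a"
  using lunit_hom[OF assms] inv_arr[OF lunit_iso[OF assms]] by (auto simp: hom_iff)

lemma runit_arr [simp]:
  assumes "a \<in> Obj M"
  shows "RUnit M a \<in> Arr M" "Dom M (RUnit M a) = a \<otimes> unit" "Cod M (RUnit M a) = a"
    "inv_arr M (RUnit M a) \<in> Arr M" "Dom M (inv_arr M (RUnit M a)) = a" "Cod M (inv_arr M (RUnit M a)) = a \<otimes> unit"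
    "inv_arr M (RUnit M a) \<cdot> RUnit M a = Id M (a \<otimes> unit)" "RUnit M a \<cdot> inv_arr M (RUnit M a) = Id M a"
  using runit_hom[OF assms] inv_arr[OF runit_iso[OF assms]] by (auto simp: hom_iff)

lemma sym_arr [simp]:
  assumes "a \<in> Obj M" "b \<in> Obj M"
  shows "Sym M a b \<in> Arr M" "Dom M (Sym M a b) = a \<otimes> b" "Cod M (Sym M a b) = b \<otimes> a"
  using sym_hom[OF assms] by (auto simp: hom_iff)

lemma sym_sym' [simp]:
  "a \<in> Obj M \<Longrightarrow> b \<in> Obj M \<Longrightarrow> f \<in> Arr M \<Longrightarrow> Cod M f = a \<otimes> b \<Longrightarrow> Sym M b a \<cdot> Sym M a b \<cdot> f = f"
  using comp_assoc'[of f "Sym M a b" "Sym M b a"] by simp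

lemma sym_iso [simp]: "a \<in> Obj M \<Longrightarrow> b \<in> Obj M \<Longrightarrow> is_iso M (Sym M a b)"
  by (rule isoI[of _ "Sym M b a"]) auto

text \<open>The interchange law, used from left to right to fuse adjacent tensor products. In a
  composite nested to the right the two factors are not a subterm of their own, whence the second
  equation.\<close>

lemma merge:
  assumes "f \<in> Arr M" "g \<in> Arr M" "f' \<in> Arr M" "g' \<in> Arr M" "Cod M f = Dom M f'" "Cod M g = Dom M g'"
  shows "(f' \<odot> g') \<cdot> (f \<odot> g) = (f' \<cdot> f) \<odot> (g' \<cdot> g)"
    "h \<in> Arr M \<Longrightarrow> Cod M h = Dom M f \<otimes> Dom M g \<Longrightarrow> (f' \<odot> g') \<cdot> (f \<odot> g) \<cdot> h = ((f' \<cdot> f) \<odot> (g' \<cdot> g)) \<cdot> h"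
proof -
  show 1: "(f' \<odot> g') \<cdot> (f \<odot> g) = (f' \<cdot> f) \<odot> (g' \<cdot> g)"
    using assms tensor_comp[of f "Dom M f" "Cod M f" f' "Cod M f'" g "Dom M g" "Cod M g" g' "Cod M g'"] by (simp add: hom_iff)
  show "(f' \<odot> g') \<cdot> (f \<odot> g) \<cdot> h = ((f' \<cdot> f) \<odot> (g' \<cdot> g)) \<cdot> h" if "h \<in> Arr M" "Cod M h = Dom M f \<otimes> Dom M g"
    unfolding 1[symmetric] using assms that by simp
qed

lemma iso_tensor [simp]:
  assumes "is_iso M f" "is_iso M g" shows "is_iso M (f \<odot> g)"
  using inv_arr[OF assms(1)] inv_arr[OF assms(2)]
  by (intro isoI[of _ "inv_arr M f \<odot> inv_arr M g"]) (auto simp: merge)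

lemma assoc_nat:
  assumes "f \<in> Arr M" "g \<in> Arr M" "h \<in> Arr M"
  shows "Assoc M (Cod M f) (Cod M g) (Cod M h) \<cdot> ((f \<odot> g) \<odot> h) = (f \<odot> (g \<odot> h)) \<cdot> Assoc M (Dom M f) (Dom M g) (Dom M h)"
  using assoc_natural[OF homI[OF assms(1)] homI[OF assms(2)] homI[OF assms(3)]] .

lemma sym_nat:
  assumes "f \<in> Arr M" "g \<in> Arr M"
  shows "Sym M (Cod M f) (Cod M g) \<cdot> (f \<odot> g) = (g \<odot> f) \<cdot> Sym M (Dom M f) (Dom M g)"
  using sym_natural[OF homI[OF assms(1)] homI[OF assms(2)]] .

lemma lunit_nat: "f \<in> Arr M \<Longrightarrow> LUnit M (Cod M f) \<cdot> (Id M unit \<odot> f) = f \<cdot> LUnit M (Dom M f)"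
  using lunit_natural[OF homI] .

lemma runit_nat: "f \<in> Arr M \<Longrightarrow> RUnit M (Cod M f) \<cdot> (f \<odot> Id M unit) = f \<cdot> RUnit M (Dom M f)"
  using runit_natural[OF homI] .

text \<open>By naturality of the unitors, tensoring with the unit is the identity up to invertible
  arrows, hence faithful. Kelly's derivation of the remaining unit axioms rests on this.\<close>

lemma tensor_unit_cancel:
  assumes "f \<in> Arr M" "g \<in> Arr M" "Dom M f = Dom M g" "Cod M f = Cod M g"
  shows "Id M unit \<odot> f = Id M unit \<odot> g \<Longrightarrow> f = g" "f \<odot> Id M unit = g \<odot> Id M unit \<Longrightarrow> f = g"
proof -
  assume "Id M unit \<odot> f = Id M unit \<odot> g"
  then have "f \<cdot> LUnit M (Dom M f) = g \<cdot> LUnit M (Dom M f)" using lunit_nat[of f] lunit_nat[of g] assms by metis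
  then show "f = g" by (rule iso_epi) (use assms in auto)
next
  assume "f \<odot> Id M unit = g \<odot> Id M unit"
  then have "f \<cdot> RUnit M (Dom M f) = g \<cdot> RUnit M (Dom M f)" using runit_nat[of f] runit_nat[of g] assms by metis
  then show "f = g" by (rule iso_epi) (use assms in auto)
qed

text \<open>Kelly's argument: once tensored with the unit on the left and composed with the
  isomorphism \<open>?x\<close>, both sides agree by the pentagon at \<open>unit\<close>,
  \<open>unit\<close>, \<open>a\<close>, \<open>b\<close>, two triangles and naturality of the
  associator. Then \<open>?x\<close> and the unit are cancelled.\<close>

lemma lunit_tensor:
  assumes [simp]: "a \<in> Obj M" "b \<in> Obj M"
  shows "LUnit M (a \<otimes> b) \<cdot> Assoc M unit a b = LUnit M a \<odot> Id M b"
proof -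
  let ?I = unit and ?\<alpha> = "Assoc M" and ?id = "Id M"
  let ?x = "?\<alpha> ?I (?I \<otimes> a) b \<cdot> (?\<alpha> ?I ?I a \<odot> ?id b)"
  have "(?id ?I \<odot> LUnit M (a \<otimes> b)) \<cdot> (?id ?I \<odot> ?\<alpha> ?I a b) \<cdot> ?x = (?id ?I \<odot> LUnit M (a \<otimes> b)) \<cdot> ?\<alpha> ?I ?I (a \<otimes> b) \<cdot> ?\<alpha> (?I \<otimes> ?I) a b"
    using pentagon[of ?I ?I a b] by simp
  also have "\<dots> = (RUnit M ?I \<odot> ?id (a \<otimes> b)) \<cdot> ?\<alpha> (?I \<otimes> ?I) a b"
    using arg_cong[OF triangle[of ?I "a \<otimes> b"], of "\<lambda>f. f \<cdot> ?\<alpha> (?I \<otimes> ?I) a b"] by simp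
  also have "\<dots> = ?\<alpha> ?I a b \<cdot> ((RUnit M ?I \<odot> ?id a) \<odot> ?id b)"
    using assoc_nat[of "RUnit M ?I" "?id a" "?id b"] by simp
  also have "\<dots> = ?\<alpha> ?I a b \<cdot> ((?id ?I \<odot> LUnit M a) \<odot> ?id b) \<cdot> (?\<alpha> ?I ?I a \<odot> ?id b)"
    using triangle[of ?I a] by (simp add: merge)
  also have "\<dots> = (?id ?I \<odot> (LUnit M a \<odot> ?id b)) \<cdot> ?x"
    using arg_cong[OF assoc_nat[of "?id ?I" "LUnit M a" "?id b"], of "\<lambda>f. f \<cdot> (?\<alpha> ?I ?I a \<odot> ?id b)"] by simp
  finally have "(?id ?I \<odot> (LUnit M (a \<otimes> b) \<cdot> ?\<alpha> ?I a b)) \<cdot> ?x = (?id ?I \<odot> (LUnit M a \<odot> ?id b)) \<cdot> ?x"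
    by (simp add: merge)
  then have "?id ?I \<odot> (LUnit M (a \<otimes> b) \<cdot> ?\<alpha> ?I a b) = ?id ?I \<odot> (LUnit M a \<odot> ?id b)"
    by (rule iso_epi) simp_all
  then show ?thesis by (rule tensor_unit_cancel(1)[rotated 4]) simp_all
qed

text \<open>The mirror argument: both sides are tensored with the unit on the right, the pentagon is
  taken at \<open>a\<close>, \<open>b\<close>, \<open>unit\<close>, \<open>unit\<close>, and the
  associator to be cancelled now stands at the target.\<close>

lemma runit_tensor:
  assumes [simp]: "a \<in> Obj M" "b \<in> Obj M"
  shows "(Id M a \<odot> RUnit M b) \<cdot> Assoc M a b unit = RUnit M (a \<otimes> b)"
proof -
  let ?I = unit and ?\<alpha> = "Assoc M" and ?id = "Id M"
  have "?\<alpha> a b ?I \<cdot> (RUnit M (a \<otimes> b) \<odot> ?id ?I) = ?\<alpha> a b ?I \<cdot> (?id (a \<otimes> b) \<odot> LUnit M ?I) \<cdot> ?\<alpha> (a \<otimes> b) ?I ?I"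
    using triangle[of "a \<otimes> b" ?I] by simp
  also have "\<dots> = (?id a \<odot> (?id b \<odot> LUnit M ?I)) \<cdot> ?\<alpha> a b (?I \<otimes> ?I) \<cdot> ?\<alpha> (a \<otimes> b) ?I ?I"
    using arg_cong[OF assoc_nat[of "?id a" "?id b" "LUnit M ?I"], of "\<lambda>f. f \<cdot> ?\<alpha> (a \<otimes> b) ?I ?I"] by simp
  also have "\<dots> = (?id a \<odot> (RUnit M b \<odot> ?id ?I)) \<cdot> ?\<alpha> a (b \<otimes> ?I) ?I \<cdot> (?\<alpha> a b ?I \<odot> ?id ?I)"
    using pentagon[of a b ?I ?I] triangle[of b ?I] by (simp add: merge)
  also have "\<dots> = ?\<alpha> a b ?I \<cdot> ((?id a \<odot> RUnit M b) \<odot> ?id ?I) \<cdot> (?\<alpha> a b ?I \<odot> ?id ?I)"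
    using arg_cong[OF assoc_nat[of "?id a" "RUnit M b" "?id ?I"], of "\<lambda>f. f \<cdot> (?\<alpha> a b ?I \<odot> ?id ?I)"] by simp
  finally have "?\<alpha> a b ?I \<cdot> (RUnit M (a \<otimes> b) \<odot> ?id ?I) = ?\<alpha> a b ?I \<cdot> (((?id a \<odot> RUnit M b) \<cdot> ?\<alpha> a b ?I) \<odot> ?id ?I)"
    by (simp add: merge)
  then have "RUnit M (a \<otimes> b) \<odot> ?id ?I = ((?id a \<odot> RUnit M b) \<cdot> ?\<alpha> a b ?I) \<odot> ?id ?I"
    by (rule iso_mono) simp_all
  then show ?thesis by (rule tensor_unit_cancel(2)[symmetric, rotated 4]) simp_all
qed

text \<open>The hexagon at \<open>a\<close>, \<open>unit\<close>, \<open>unit\<close>, with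
  naturality of the symmetry against \<open>LUnit M unit\<close>, gives the equation tensored with
  the unit and followed by the invertible arrow \<open>Sym M a unit\<close>.\<close>

lemma lunit_sym:
  assumes [simp]: "a \<in> Obj M"
  shows "LUnit M a \<cdot> Sym M a unit = RUnit M a"
proof -
  let ?I = unit and ?\<alpha> = "Assoc M" and ?id = "Id M"
  have "Sym M a ?I \<cdot> (RUnit M a \<odot> ?id ?I) = Sym M a ?I \<cdot> (?id a \<odot> LUnit M ?I) \<cdot> ?\<alpha> a ?I ?I"
    using triangle[of a ?I] by simp
  also have "\<dots> = (LUnit M ?I \<odot> ?id a) \<cdot> Sym M a (?I \<otimes> ?I) \<cdot> ?\<alpha> a ?I ?I"
    using arg_cong[OF sym_nat[of "?id a" "LUnit M ?I"], of "\<lambda>f. f \<cdot> ?\<alpha> a ?I ?I"] by simp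
  also have "\<dots> = LUnit M (?I \<otimes> a) \<cdot> ?\<alpha> ?I ?I a \<cdot> Sym M a (?I \<otimes> ?I) \<cdot> ?\<alpha> a ?I ?I"
    using arg_cong[OF lunit_tensor[of ?I a], of "\<lambda>f. f \<cdot> Sym M a (?I \<otimes> ?I) \<cdot> ?\<alpha> a ?I ?I"] by simp
  also have "\<dots> = LUnit M (?I \<otimes> a) \<cdot> (?id ?I \<odot> Sym M a ?I) \<cdot> ?\<alpha> ?I a ?I \<cdot> (Sym M a ?I \<odot> ?id ?I)"
    using hexagon[of a ?I ?I] by simp
  also have "\<dots> = Sym M a ?I \<cdot> LUnit M (a \<otimes> ?I) \<cdot> ?\<alpha> ?I a ?I \<cdot> (Sym M a ?I \<odot> ?id ?I)"
    using arg_cong[OF lunit_nat[of "Sym M a ?I"], of "\<lambda>f. f \<cdot> ?\<alpha> ?I a ?I \<cdot> (Sym M a ?I \<odot> ?id ?I)"] by simp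
  also have "\<dots> = Sym M a ?I \<cdot> ((LUnit M a \<cdot> Sym M a ?I) \<odot> ?id ?I)"
    using arg_cong[OF lunit_tensor[of a ?I], of "\<lambda>f. f \<cdot> (Sym M a ?I \<odot> ?id ?I)"] by (simp add: merge)
  finally have "RUnit M a \<odot> ?id ?I = (LUnit M a \<cdot> Sym M a ?I) \<odot> ?id ?I"
    by (rule iso_mono) simp_all
  then show ?thesis by (rule tensor_unit_cancel(2)[symmetric, rotated 4]) simp_all
qed


section \<open>The exchange isomorphism x \<otimes> (y \<otimes> z) \<rightarrow> y \<otimes> (x
  \<otimes> z)\<close>

abbreviation "sw \<equiv> swap3 M"

lemma swap3_arr [simp]:
  assumes "a \<in> Obj M" "b \<in> Obj M" "c \<in> Obj M"
  shows "sw a b c \<in> Arr M" "Dom M (sw a b c) = a \<otimes> b \<otimes> c" "Cod M (sw a b c) = b \<otimes> a \<otimes> c"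
  using assms by (auto simp: swap3_def)

text \<open>This form avoids the inverse associator hidden in \<open>swap3\<close>; naturality and
  the hexagon identities of the exchange are derived from it by cancelling associators.\<close>

lemma swap3_assoc:
  assumes [simp]: "a \<in> Obj M" "b \<in> Obj M" "c \<in> Obj M"
  shows "sw a b c \<cdot> Assoc M a b c = Assoc M b a c \<cdot> (Sym M a b \<odot> Id M c)"
  by (simp add: swap3_def)

lemma swap3_nat:
  assumes [simp]: "f \<in> Arr M" "g \<in> Arr M" "h \<in> Arr M"
  shows "sw (Cod M f) (Cod M g) (Cod M h) \<cdot> (f \<odot> (g \<odot> h)) = (g \<odot> (f \<odot> h)) \<cdot> sw (Dom M f) (Dom M g) (Dom M h)"
proof (rule iso_epi[where e = "Assoc M (Dom M f) (Dom M g) (Dom M h)"])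
  let ?\<alpha> = "Assoc M"
  have "(sw (Cod M f) (Cod M g) (Cod M h) \<cdot> (f \<odot> (g \<odot> h))) \<cdot> ?\<alpha> (Dom M f) (Dom M g) (Dom M h) =
    sw (Cod M f) (Cod M g) (Cod M h) \<cdot> ?\<alpha> (Cod M f) (Cod M g) (Cod M h) \<cdot> ((f \<odot> g) \<odot> h)"
    by (simp add: assoc_nat)
  also have "\<dots> = ?\<alpha> (Cod M g) (Cod M f) (Cod M h) \<cdot> (Sym M (Cod M f) (Cod M g) \<odot> Id M (Cod M h)) \<cdot> ((f \<odot> g) \<odot> h)"
    using arg_cong[OF swap3_assoc[of "Cod M f" "Cod M g" "Cod M h"], of "\<lambda>x. x \<cdot> ((f \<odot> g) \<odot> h)"] by simp
  also have "\<dots> = ?\<alpha> (Cod M g) (Cod M f) (Cod M h) \<cdot> ((g \<odot> f) \<odot> h) \<cdot> (Sym M (Dom M f) (Dom M g) \<odot> Id M (Dom M h))"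
    by (simp add: merge sym_nat)
  also have "\<dots> = (g \<odot> (f \<odot> h)) \<cdot> ?\<alpha> (Dom M g) (Dom M f) (Dom M h) \<cdot> (Sym M (Dom M f) (Dom M g) \<odot> Id M (Dom M h))"
    using arg_cong[OF assoc_nat[of g f h], of "\<lambda>x. x \<cdot> (Sym M (Dom M f) (Dom M g) \<odot> Id M (Dom M h))"] by simp
  also have "\<dots> = ((g \<odot> (f \<odot> h)) \<cdot> sw (Dom M f) (Dom M g) (Dom M h)) \<cdot> ?\<alpha> (Dom M f) (Dom M g) (Dom M h)"
    by (simp add: swap3_assoc)
  finally show "(sw (Cod M f) (Cod M g) (Cod M h) \<cdot> (f \<odot> (g \<odot> h))) \<cdot> ?\<alpha> (Dom M f) (Dom M g) (Dom M h) =
    ((g \<odot> (f \<odot> h)) \<cdot> sw (Dom M f) (Dom M g) (Dom M h)) \<cdot> ?\<alpha> (Dom M f) (Dom M g) (Dom M h)" .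
qed simp_all

lemma swap3_swap3 [simp]:
  assumes [simp]: "a \<in> Obj M" "b \<in> Obj M" "c \<in> Obj M"
  shows "sw b a c \<cdot> sw a b c = Id M (a \<otimes> b \<otimes> c)"
    and "h \<in> Arr M \<Longrightarrow> Cod M h = a \<otimes> b \<otimes> c \<Longrightarrow> sw b a c \<cdot> sw a b c \<cdot> h = h"
proof -
  show 1: "sw b a c \<cdot> sw a b c = Id M (a \<otimes> b \<otimes> c)"
    by (simp add: swap3_def merge)
  show "sw b a c \<cdot> sw a b c \<cdot> h = h" if "h \<in> Arr M" "Cod M h = a \<otimes> b \<otimes> c"
    using arg_cong[OF 1, of "\<lambda>x. x \<cdot> h"] that by simp
qed

lemma swap3_iso [simp]: "a \<in> Obj M \<Longrightarrow> b \<in> Obj M \<Longrightarrow> c \<in> Obj M \<Longrightarrow> is_iso M (sw a b c)"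
  by (rule isoI[of _ "sw b a c"]) auto

text \<open>After cancelling an associator, this is the triangle combined with
  \<open>lunit_sym\<close> and \<open>lunit_tensor\<close>. It is the base case for moving a factor
  past an empty block.\<close>

lemma swap3_lunit:
  assumes [simp]: "a \<in> Obj M" "b \<in> Obj M"
  shows "(Id M a \<odot> LUnit M b) \<cdot> sw unit a b = LUnit M (a \<otimes> b)"
    and "LUnit M (a \<otimes> b) \<cdot> sw a unit b = Id M a \<odot> LUnit M b"
proof -
  have s: "RUnit M a \<cdot> Sym M unit a = LUnit M a"
    using arg_cong[OF lunit_sym[of a], of "\<lambda>f. f \<cdot> Sym M unit a"] by simp
  have "((Id M a \<odot> LUnit M b) \<cdot> sw unit a b) \<cdot> Assoc M unit a b = (Id M a \<odot> LUnit M b) \<cdot> Assoc M a unit b \<cdot> (Sym M unit a \<odot> Id M b)"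
    by (simp add: swap3_assoc)
  also have "\<dots> = (RUnit M a \<odot> Id M b) \<cdot> (Sym M unit a \<odot> Id M b)"
    using arg_cong[OF triangle[of a b], of "\<lambda>f. f \<cdot> (Sym M unit a \<odot> Id M b)"] by simp
  also have "\<dots> = LUnit M (a \<otimes> b) \<cdot> Assoc M unit a b" by (simp add: merge s lunit_tensor)
  finally show 1: "(Id M a \<odot> LUnit M b) \<cdot> sw unit a b = LUnit M (a \<otimes> b)" by (rule iso_epi) simp_all
  show "LUnit M (a \<otimes> b) \<cdot> sw a unit b = Id M a \<odot> LUnit M b"
    using arg_cong[OF 1, of "\<lambda>f. f \<cdot> sw a unit b"] by simp
qed

text \<open>With the unit in third place the exchange is the plain symmetry up to right unitors.
  This is how the transposed binary operation is later recognised as a multiplication preceded by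
  \<open>Sym\<close>.\<close>

lemma swap3_runit:
  assumes [simp]: "a \<in> Obj M" "b \<in> Obj M"
  shows "(Id M b \<odot> RUnit M a) \<cdot> sw a b unit = Sym M a b \<cdot> (Id M a \<odot> RUnit M b)"
proof (rule iso_epi[where e = "Assoc M a b unit"])
  have "((Id M b \<odot> RUnit M a) \<cdot> sw a b unit) \<cdot> Assoc M a b unit = (Id M b \<odot> RUnit M a) \<cdot> Assoc M b a unit \<cdot> (Sym M a b \<odot> Id M unit)"
    by (simp add: swap3_assoc)
  also have "\<dots> = RUnit M (b \<otimes> a) \<cdot> (Sym M a b \<odot> Id M unit)"
    using arg_cong[OF runit_tensor[of b a], of "\<lambda>f. f \<cdot> (Sym M a b \<odot> Id M unit)"] by simp
  also have "\<dots> = (Sym M a b \<cdot> (Id M a \<odot> RUnit M b)) \<cdot> Assoc M a b unit"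
    using runit_nat[of "Sym M a b"] by (simp add: runit_tensor)
  finally show "((Id M b \<odot> RUnit M a) \<cdot> sw a b unit) \<cdot> Assoc M a b unit = (Sym M a b \<cdot> (Id M a \<odot> RUnit M b)) \<cdot> Assoc M a b unit" .
qed simp_all

lemma pentagon':
  assumes [simp]: "a \<in> Obj M" "b \<in> Obj M" "c \<in> Obj M" "d \<in> Obj M" "h \<in> Arr M" "Cod M h = ((a \<otimes> b) \<otimes> c) \<otimes> d"
  shows "Assoc M a b (c \<otimes> d) \<cdot> Assoc M (a \<otimes> b) c d \<cdot> h =
       (Id M a \<odot> Assoc M b c d) \<cdot> Assoc M a (b \<otimes> c) d \<cdot> (Assoc M a b c \<odot> Id M d) \<cdot> h"
  using arg_cong[OF pentagon[of a b c d], of "\<lambda>f. f \<cdot> h"] by simp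

lemma assoc_nat':
  assumes "f \<in> Arr M" "g \<in> Arr M" "h \<in> Arr M" "x \<in> Arr M" "Cod M x = (Dom M f \<otimes> Dom M g) \<otimes> Dom M h"
  shows "Assoc M (Cod M f) (Cod M g) (Cod M h) \<cdot> ((f \<odot> g) \<odot> h) \<cdot> x = (f \<odot> (g \<odot> h)) \<cdot> Assoc M (Dom M f) (Dom M g) (Dom M h) \<cdot> x"
  using arg_cong[OF assoc_nat[of f g h], of "\<lambda>f. f \<cdot> x"] assms by simp

lemma swap3_nat':
  assumes "f \<in> Arr M" "g \<in> Arr M" "h \<in> Arr M" "x \<in> Arr M" "Cod M x = Dom M f \<otimes> Dom M g \<otimes> Dom M h"
  shows "sw (Cod M f) (Cod M g) (Cod M h) \<cdot> (f \<odot> (g \<odot> h)) \<cdot> x = (g \<odot> (f \<odot> h)) \<cdot> sw (Dom M f) (Dom M g) (Dom M h) \<cdot> x"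
  using arg_cong[OF swap3_nat[of f g h], of "\<lambda>f. f \<cdot> x"] assms by simp

lemma swap3_assoc':
  assumes [simp]: "a \<in> Obj M" "b \<in> Obj M" "c \<in> Obj M" "x \<in> Arr M" "Cod M x = (a \<otimes> b) \<otimes> c"
  shows "sw a b c \<cdot> Assoc M a b c \<cdot> x = Assoc M b a c \<cdot> (Sym M a b \<odot> Id M c) \<cdot> x"
  using arg_cong[OF swap3_assoc[of a b c], of "\<lambda>f. f \<cdot> x"] assms by simp

text \<open>The hexagon at \<open>c\<close>, \<open>a\<close>, \<open>b\<close> solved for the other
  symmetry: \<open>Sym M c (a \<otimes> b)\<close> is its inverse, so it suffices to compose both
  sides with that arrow.\<close>

lemma sym_tensor:
  assumes [simp]: "a \<in> Obj M" "b \<in> Obj M" "c \<in> Obj M"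
  shows "Sym M (a \<otimes> b) c = Assoc M c a b \<cdot> (Sym M a c \<odot> Id M b) \<cdot> inv_arr M (Assoc M a c b) \<cdot> (Id M a \<odot> Sym M b c) \<cdot> Assoc M a b c"
    (is "_ = ?R")
proof (rule iso_mono[where e = "Assoc M a b c \<cdot> Sym M c (a \<otimes> b)"])
  have "(Assoc M a b c \<cdot> Sym M c (a \<otimes> b)) \<cdot> ?R =
    (Assoc M a b c \<cdot> Sym M c (a \<otimes> b) \<cdot> Assoc M c a b) \<cdot> (Sym M a c \<odot> Id M b) \<cdot> inv_arr M (Assoc M a c b) \<cdot> (Id M a \<odot> Sym M b c) \<cdot> Assoc M a b c"
    by simp
  also have "\<dots> = Assoc M a b c"
    unfolding hexagon[OF assms(3,1,2)] by (simp add: merge)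
  finally show "(Assoc M a b c \<cdot> Sym M c (a \<otimes> b)) \<cdot> Sym M (a \<otimes> b) c = (Assoc M a b c \<cdot> Sym M c (a \<otimes> b)) \<cdot> ?R" by simp
qed simp_all

text \<open>The hexagon in exchange form: \<open>c\<close> moves past the block
  \<open>a \<otimes> b\<close> by moving past \<open>b\<close> and then past \<open>a\<close>. Once
  the symmetry is expanded by \<open>sym_tensor\<close>, only pentagons and naturality
  remain.\<close>

lemma swap3_tensor_left:
  assumes [simp]: "a \<in> Obj M" "b \<in> Obj M" "c \<in> Obj M" "z \<in> Obj M"
  shows "(Id M c \<odot> Assoc M a b z) \<cdot> sw (a \<otimes> b) c z = sw a c (b \<otimes> z) \<cdot> (Id M a \<odot> sw b c z) \<cdot> Assoc M a b (c \<otimes> z)"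
proof (rule iso_epi[where e = "Assoc M (a \<otimes> b) c z"])
  let ?\<alpha> = "Assoc M" and ?id = "Id M"
  let ?s = "(?id a \<odot> Sym M b c) \<cdot> ?\<alpha> a b c"
  let ?t = "(Sym M a c \<odot> ?id b) \<cdot> inv_arr M (?\<alpha> a c b)"
  have "((?id c \<odot> ?\<alpha> a b z) \<cdot> sw (a \<otimes> b) c z) \<cdot> ?\<alpha> (a \<otimes> b) c z =
    (?id c \<odot> ?\<alpha> a b z) \<cdot> ?\<alpha> c (a \<otimes> b) z \<cdot> (Sym M (a \<otimes> b) c \<odot> ?id z)"
    by (simp add: swap3_assoc)
  also have "\<dots> = (?id c \<odot> ?\<alpha> a b z) \<cdot> ?\<alpha> c (a \<otimes> b) z \<cdot> (?\<alpha> c a b \<odot> ?id z) \<cdot> ((?t \<cdot> ?s) \<odot> ?id z)"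
    unfolding sym_tensor[OF assms(1-3)] by (simp add: merge)
  also have "\<dots> = ?\<alpha> c a (b \<otimes> z) \<cdot> ?\<alpha> (c \<otimes> a) b z \<cdot> ((?t \<cdot> ?s) \<odot> ?id z)"
    by (simp add: pentagon'[symmetric])
  also have "\<dots> = ?\<alpha> c a (b \<otimes> z) \<cdot> ?\<alpha> (c \<otimes> a) b z \<cdot> ((Sym M a c \<odot> ?id b) \<odot> ?id z) \<cdot> ((inv_arr M (?\<alpha> a c b) \<cdot> ?s) \<odot> ?id z)"
    by (simp add: merge)
  also have "\<dots> = ?\<alpha> c a (b \<otimes> z) \<cdot> (Sym M a c \<odot> ?id (b \<otimes> z)) \<cdot> ?\<alpha> (a \<otimes> c) b z \<cdot> ((inv_arr M (?\<alpha> a c b) \<cdot> ?s) \<odot> ?id z)"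
    using assoc_nat'[of "Sym M a c" "?id b" "?id z" "(inv_arr M (?\<alpha> a c b) \<cdot> ?s) \<odot> ?id z"] by simp
  also have "\<dots> = sw a c (b \<otimes> z) \<cdot> ?\<alpha> a c (b \<otimes> z) \<cdot> ?\<alpha> (a \<otimes> c) b z \<cdot> ((inv_arr M (?\<alpha> a c b) \<cdot> ?s) \<odot> ?id z)"
    by (simp add: swap3_assoc')
  also have "\<dots> = sw a c (b \<otimes> z) \<cdot> (?id a \<odot> ?\<alpha> c b z) \<cdot> ?\<alpha> a (c \<otimes> b) z \<cdot> (?s \<odot> ?id z)"
    by (simp add: pentagon' merge)
  also have "\<dots> = sw a c (b \<otimes> z) \<cdot> (?id a \<odot> ?\<alpha> c b z) \<cdot> ?\<alpha> a (c \<otimes> b) z \<cdot> ((?id a \<odot> Sym M b c) \<odot> ?id z) \<cdot> (?\<alpha> a b c \<odot> ?id z)"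
    by (simp add: merge)
  also have "\<dots> = sw a c (b \<otimes> z) \<cdot> (?id a \<odot> ?\<alpha> c b z) \<cdot> (?id a \<odot> (Sym M b c \<odot> ?id z)) \<cdot> ?\<alpha> a (b \<otimes> c) z \<cdot> (?\<alpha> a b c \<odot> ?id z)"
    using assoc_nat'[of "?id a" "Sym M b c" "?id z" "?\<alpha> a b c \<odot> ?id z"] by simp
  also have "\<dots> = sw a c (b \<otimes> z) \<cdot> (?id a \<odot> sw b c z) \<cdot> (?id a \<odot> ?\<alpha> b c z) \<cdot> ?\<alpha> a (b \<otimes> c) z \<cdot> (?\<alpha> a b c \<odot> ?id z)"
    by (simp add: merge swap3_assoc)
  also have "\<dots> = (sw a c (b \<otimes> z) \<cdot> (?id a \<odot> sw b c z) \<cdot> ?\<alpha> a b (c \<otimes> z)) \<cdot> ?\<alpha> (a \<otimes> b) c z"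
    by (simp add: pentagon)
  finally show "((?id c \<odot> ?\<alpha> a b z) \<cdot> sw (a \<otimes> b) c z) \<cdot> ?\<alpha> (a \<otimes> b) c z =
    (sw a c (b \<otimes> z) \<cdot> (?id a \<odot> sw b c z) \<cdot> ?\<alpha> a b (c \<otimes> z)) \<cdot> ?\<alpha> (a \<otimes> b) c z" .
qed simp_all

text \<open>\<open>swap3_tensor_left\<close> read backwards, since exchanges are inverse to each
  other.\<close>

lemma swap3_tensor_right:
  assumes [simp]: "a \<in> Obj M" "b \<in> Obj M" "c \<in> Obj M" "z \<in> Obj M"
  shows "Assoc M b c (a \<otimes> z) \<cdot> sw a (b \<otimes> c) z = (Id M b \<odot> sw a c z) \<cdot> sw a b (c \<otimes> z) \<cdot> (Id M a \<odot> Assoc M b c z)"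
proof (rule iso_epi[where e = "sw (b \<otimes> c) a z"])
  have "((Id M b \<odot> sw a c z) \<cdot> sw a b (c \<otimes> z) \<cdot> (Id M a \<odot> Assoc M b c z)) \<cdot> sw (b \<otimes> c) a z =
    (Id M b \<odot> sw a c z) \<cdot> (Id M b \<odot> sw c a z) \<cdot> Assoc M b c (a \<otimes> z)"
    by (simp add: swap3_tensor_left)
  also have "\<dots> = (Assoc M b c (a \<otimes> z) \<cdot> sw a (b \<otimes> c) z) \<cdot> sw (b \<otimes> c) a z"
    by (simp add: merge)
  finally show "(Assoc M b c (a \<otimes> z) \<cdot> sw a (b \<otimes> c) z) \<cdot> sw (b \<otimes> c) a z =
    ((Id M b \<odot> sw a c z) \<cdot> sw a b (c \<otimes> z) \<cdot> (Id M a \<odot> Assoc M b c z)) \<cdot> sw (b \<otimes> c) a z" by simp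
qed simp_all

text \<open>The third argument of the exchange is a spectator and may absorb a further factor
  \<open>b\<close>; after cancelling an associator this is the pentagon used twice and
  naturality.\<close>

lemma swap3_tensor_third:
  assumes [simp]: "x \<in> Obj M" "y \<in> Obj M" "a \<in> Obj M" "b \<in> Obj M"
  shows "sw x y (a \<otimes> b) \<cdot> (Id M x \<odot> Assoc M y a b) \<cdot> Assoc M x (y \<otimes> a) b =
    (Id M y \<odot> Assoc M x a b) \<cdot> Assoc M y (x \<otimes> a) b \<cdot> (sw x y a \<odot> Id M b)"
proof (rule iso_epi[where e = "Assoc M x y a \<odot> Id M b"])
  let ?\<alpha> = "Assoc M" and ?id = "Id M"
  have "(sw x y (a \<otimes> b) \<cdot> (?id x \<odot> ?\<alpha> y a b) \<cdot> ?\<alpha> x (y \<otimes> a) b) \<cdot> (?\<alpha> x y a \<odot> ?id b) =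
    sw x y (a \<otimes> b) \<cdot> ?\<alpha> x y (a \<otimes> b) \<cdot> ?\<alpha> (x \<otimes> y) a b" by (simp add: pentagon)
  also have "\<dots> = ?\<alpha> y x (a \<otimes> b) \<cdot> (Sym M x y \<odot> ?id (a \<otimes> b)) \<cdot> ?\<alpha> (x \<otimes> y) a b" by (simp add: swap3_assoc')
  also have "\<dots> = ?\<alpha> y x (a \<otimes> b) \<cdot> ?\<alpha> (y \<otimes> x) a b \<cdot> ((Sym M x y \<odot> ?id a) \<odot> ?id b)"
    using assoc_nat[of "Sym M x y" "?id a" "?id b"] by simp
  also have "\<dots> = (?id y \<odot> ?\<alpha> x a b) \<cdot> ?\<alpha> y (x \<otimes> a) b \<cdot> ((?\<alpha> y x a \<cdot> (Sym M x y \<odot> ?id a)) \<odot> ?id b)"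
    by (simp add: pentagon' merge)
  also have "\<dots> = ((?id y \<odot> ?\<alpha> x a b) \<cdot> ?\<alpha> y (x \<otimes> a) b \<cdot> (sw x y a \<odot> ?id b)) \<cdot> (?\<alpha> x y a \<odot> ?id b)"
    by (simp add: merge swap3_assoc)
  finally show "(sw x y (a \<otimes> b) \<cdot> (?id x \<odot> ?\<alpha> y a b) \<cdot> ?\<alpha> x (y \<otimes> a) b) \<cdot> (?\<alpha> x y a \<odot> ?id b) =
    ((?id y \<odot> ?\<alpha> x a b) \<cdot> ?\<alpha> y (x \<otimes> a) b \<cdot> (sw x y a \<odot> ?id b)) \<cdot> (?\<alpha> x y a \<odot> ?id b)" .
qed simp_all

text \<open>Naturality of \<open>swap3\<close> with respect to the symmetry in its second argument.\<close>
lemma swap3_braid: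
  assumes [simp]: "k \<in> Obj M" "j \<in> Obj M" "l \<in> Obj M" "z \<in> Obj M"
  shows "sw j l (k \<otimes> z) \<cdot> (Id M j \<odot> sw k l z) \<cdot> sw k j (l \<otimes> z) =
    (Id M l \<odot> sw k j z) \<cdot> sw k l (j \<otimes> z) \<cdot> (Id M k \<odot> sw j l z)"
proof (rule iso_epi[where e = "Id M k \<odot> Assoc M j l z"])
  let ?\<alpha> = "Assoc M" and ?id = "Id M"
  have "(sw j l (k \<otimes> z) \<cdot> (?id j \<odot> sw k l z) \<cdot> sw k j (l \<otimes> z)) \<cdot> (?id k \<odot> ?\<alpha> j l z) =
    sw j l (k \<otimes> z) \<cdot> ?\<alpha> j l (k \<otimes> z) \<cdot> sw k (j \<otimes> l) z" by (simp add: swap3_tensor_right)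
  also have "\<dots> = ?\<alpha> l j (k \<otimes> z) \<cdot> (Sym M j l \<odot> ?id (k \<otimes> z)) \<cdot> sw k (j \<otimes> l) z" by (simp add: swap3_assoc')
  also have "\<dots> = ?\<alpha> l j (k \<otimes> z) \<cdot> sw k (l \<otimes> j) z \<cdot> (?id k \<odot> (Sym M j l \<odot> ?id z))"
    using swap3_nat[of "?id k" "Sym M j l" "?id z"] by simp
  also have "\<dots> = (?id l \<odot> sw k j z) \<cdot> sw k l (j \<otimes> z) \<cdot> (?id k \<odot> ?\<alpha> l j z) \<cdot> (?id k \<odot> (Sym M j l \<odot> ?id z))"
    using arg_cong[OF swap3_tensor_right[of k l j z], of "\<lambda>f. f \<cdot> (?id k \<odot> (Sym M j l \<odot> ?id z))"] by simp
  also have "\<dots> = ((?id l \<odot> sw k j z) \<cdot> sw k l (j \<otimes> z) \<cdot> (?id k \<odot> sw j l z)) \<cdot> (?id k \<odot> ?\<alpha> j l z)"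
    by (simp add: merge swap3_assoc)
  finally show "(sw j l (k \<otimes> z) \<cdot> (?id j \<odot> sw k l z) \<cdot> sw k j (l \<otimes> z)) \<cdot> (?id k \<odot> ?\<alpha> j l z) =
    ((?id l \<odot> sw k j z) \<cdot> sw k l (j \<otimes> z) \<cdot> (?id k \<odot> sw j l z)) \<cdot> (?id k \<odot> ?\<alpha> j l z)" .
qed simp_all

end

section \<open>Coherence of the reordering isomorphisms\<close>

context symmetric_monoidal_category begin

lemma T_obj [simp]: "\<forall>x \<in> set xs. x \<in> Obj M \<Longrightarrow> T xs \<in> Obj M"
  by (induction xs) auto

lemma tens_arr_arr [simp]:
  "\<forall>f \<in> set fs. f \<in> Arr M \<Longrightarrow> tens_arr M fs \<in> Arr M"
  "\<forall>f \<in> set fs. f \<in> Arr M \<Longrightarrow> Dom M (tens_arr M fs) = T (map (Dom M) fs)"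
  "\<forall>f \<in> set fs. f \<in> Arr M \<Longrightarrow> Cod M (tens_arr M fs) = T (map (Cod M) fs)"
  by (induction fs) auto

lemma app_arr [simp]:
  assumes "\<forall>x \<in> set xs. x \<in> Obj M" "\<forall>x \<in> set ys. x \<in> Obj M"
  shows "app xs ys \<in> Arr M" "Dom M (app xs ys) = T xs \<otimes> T ys" "Cod M (app xs ys) = T (xs @ ys)"
    "is_iso M (app xs ys)"
  using assms by (induction xs) auto

text \<open>Naturality of the left unitor at itself identifies
  \<open>LUnit M (unit \<otimes> unit)\<close> with \<open>Id M unit \<odot> LUnit M unit\<close>,
  so that \<open>lunit_tensor\<close> and the triangle have the same left side.\<close>

lemma lunit_unit: "LUnit M unit = RUnit M unit"
proof -
  have "LUnit M unit \<cdot> LUnit M (unit \<otimes> unit) = LUnit M unit \<cdot> (Id M unit \<odot> LUnit M unit)"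
    using lunit_nat[of "LUnit M unit"] by simp
  then have "LUnit M (unit \<otimes> unit) = Id M unit \<odot> LUnit M unit" by (rule iso_mono) simp_all
  then have "LUnit M unit \<odot> Id M unit = RUnit M unit \<odot> Id M unit"
    using lunit_tensor[of unit unit] triangle[of unit unit] by simp
  then show ?thesis by (rule tensor_unit_cancel(2)[rotated 4]) simp_all
qed

lemma app_nil_right:
  "\<forall>x \<in> set xs. x \<in> Obj M \<Longrightarrow> app xs [] = RUnit M (T xs)"
proof (induction xs)
  case Nil
  show ?case by (simp add: lunit_unit)
next
  case (Cons x xs)
  then show ?case using runit_tensor[of x "T xs"] by simp
qed

lemma tens_concat_arr [simp]:
  assumes "\<forall>xs \<in> set xss. \<forall>x \<in> set xs. x \<in> Obj M"
  shows "tens_concat M xss \<in> Arr M" "Dom M (tens_concat M xss) = T (map T xss)" "Cod M (tens_concat M xss) = T (concat xss)"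
    "is_iso M (tens_concat M xss)"
  using assms by (induction xss) (auto simp: merge)

lemma pull_arr [simp]:
  assumes "\<And>i. X i \<in> Obj M" "j \<in> set ks"
  shows "pull_front M X j ks \<in> Arr M" "Dom M (pull_front M X j ks) = T (map X ks)"
    "Cod M (pull_front M X j ks) = X j \<otimes> T (map X (remove1 j ks))" "is_iso M (pull_front M X j ks)"
  using assms by (induction ks) auto

text \<open>Rearrangements are expressed by equal multisets. Removing the head of the target list
  from both lists preserves this, which drives every induction on \<open>reorder\<close>.\<close>

lemma mset_ConsD: "mset ks = mset (j # js) \<Longrightarrow> j \<in> set ks \<and> mset (remove1 j ks) = mset js"
  by (metis add_mset_remove_trivial mset.simps(2) mset_remove1 set_mset_mset union_single_eq_member)

lemma reorder_arr':
  assumes [simp]: "\<And>i. X i \<in> Obj M"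
  shows "mset ks = mset js \<Longrightarrow> reorder M X ks js \<in> Arr M \<and> Dom M (reorder M X ks js) = T (map X ks) \<and>
    Cod M (reorder M X ks js) = T (map X js) \<and> is_iso M (reorder M X ks js)"
proof (induction js arbitrary: ks)
  case (Cons j js)
  have [simp]: "j \<in> set ks" using mset_ConsD[OF Cons.prems] by simp
  have IH: "reorder M X (remove1 j ks) js \<in> Arr M" "Dom M (reorder M X (remove1 j ks) js) = T (map X (remove1 j ks))"
    "Cod M (reorder M X (remove1 j ks) js) = T (map X js)" "is_iso M (reorder M X (remove1 j ks) js)"
    using Cons.IH[of "remove1 j ks"] mset_ConsD[OF Cons.prems] by blast+
  show ?case by (simp add: IH)
qed simp

lemma reorder_arr [simp]:
  assumes "\<And>i. X i \<in> Obj M" "mset ks = mset js"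
  shows "reorder M X ks js \<in> Arr M" "Dom M (reorder M X ks js) = T (map X ks)"
    "Cod M (reorder M X ks js) = T (map X js)" "is_iso M (reorder M X ks js)"
proof -
  have "reorder M X ks js \<in> Arr M \<and> Dom M (reorder M X ks js) = T (map X ks) \<and>
    Cod M (reorder M X ks js) = T (map X js) \<and> is_iso M (reorder M X ks js)"
    by (rule reorder_arr') (rule assms)+
  then show "reorder M X ks js \<in> Arr M" "Dom M (reorder M X ks js) = T (map X ks)"
    "Cod M (reorder M X ks js) = T (map X js)" "is_iso M (reorder M X ks js)" by blast+
qed

lemma pull_cong:
  "(\<And>i. i \<in> set ks \<Longrightarrow> X i = X' i) \<Longrightarrow> j \<in> set ks \<Longrightarrow> pull_front M X j ks = pull_front M X' j ks"
proof (induction ks)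
  case (Cons k ks)
  have 1: "map X (remove1 j ks) = map X' (remove1 j ks)" "map X ks = map X' ks"
    by (intro map_cong[OF refl] Cons.prems(1); use set_remove1_subset[of j ks] in force)+
  have 2: "pull_front M X j ks = pull_front M X' j ks" if "k \<noteq> j" using Cons that by simp
  have 3: "X j = X' j" "X k = X' k" using Cons.prems by auto
  show ?case by (simp add: 1 2 3)
qed simp

lemma reorder_cong:
  "(\<And>i. i \<in> set ks \<Longrightarrow> X i = X' i) \<Longrightarrow> mset ks = mset js \<Longrightarrow> reorder M X ks js = reorder M X' ks js"
proof (induction js arbitrary: ks)
  case (Cons j js)
  have "reorder M X (remove1 j ks) js = reorder M X' (remove1 j ks) js"
    by (rule Cons.IH) (use Cons.prems(1) mset_ConsD[OF Cons.prems(2)] set_remove1_subset[of j ks] in blast)+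
  then show ?case using Cons.prems mset_ConsD[OF Cons.prems(2)] pull_cong[of ks X X' j] by simp
qed simp

text \<open>\<open>pull_front\<close> inspects labels only by comparing them with \<open>j\<close>,
  so an injective renaming changes nothing.\<close>

lemma pull_relabel:
  "inj_on h (insert j (set ks)) \<Longrightarrow> j \<in> set ks \<Longrightarrow>
    pull_front M (\<lambda>i. X (h i)) j ks = pull_front M X (h j) (map h ks) \<and> map h (remove1 j ks) = remove1 (h j) (map h ks)"
proof (induction ks)
  case (Cons k ks)
  show ?case
  proof (cases "k = j")
    case False
    then have "h k \<noteq> h j" "inj_on h (insert j (set ks))" "j \<in> set ks"
      using Cons.prems by (auto simp: inj_on_def)
    then have IH: "pull_front M (\<lambda>i. X (h i)) j ks = pull_front M X (h j) (map h ks)"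
      and r: "map h (remove1 j ks) = remove1 (h j) (map h ks)" using Cons.IH by auto
    have "map (\<lambda>i. X (h i)) (remove1 j ks) = map X (remove1 (h j) (map h ks))" by (simp flip: r add: o_def)
    then show ?thesis using \<open>h k \<noteq> h j\<close> False IH r by simp
  qed (simp add: o_def)
qed simp

lemma reorder_relabel:
  "inj_on h (set ks) \<Longrightarrow> mset ks = mset js \<Longrightarrow>
    reorder M (\<lambda>i. X (h i)) ks js = reorder M X (map h ks) (map h js)"
proof (induction js arbitrary: ks)
  case (Cons j js)
  note j = mset_ConsD[OF Cons.prems(2)]
  have "inj_on h (set (remove1 j ks))" using Cons.prems(1) set_remove1_subset by (rule inj_on_subset)
  then have "reorder M (\<lambda>i. X (h i)) (remove1 j ks) js = reorder M X (map h (remove1 j ks)) (map h js)"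
    using Cons.IH j by blast
  then show ?case using pull_relabel[of h j ks X] j Cons.prems(1) by (simp add: insert_absorb)
qed simp

lemma pull_nat:
  assumes [simp]: "\<And>i. f i \<in> Arr M" and "j \<in> set ks"
  shows "pull_front M (\<lambda>i. Cod M (f i)) j ks \<cdot> tens_arr M (map f ks) =
    (f j \<odot> tens_arr M (map f (remove1 j ks))) \<cdot> pull_front M (\<lambda>i. Dom M (f i)) j ks"
  using assms(2)
proof (induction ks)
  case (Cons k ks)
  let ?c = "\<lambda>i. Cod M (f i)" and ?d = "\<lambda>i. Dom M (f i)"
  show ?case
  proof (cases "k = j")
    case True then show ?thesis by (simp add: comp_def)
  next
    case False
    then have [simp]: "j \<in> set ks" using Cons by simp
    have "pull_front M ?c j (k # ks) \<cdot> tens_arr M (map f (k # ks)) =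
      sw (?c k) (?c j) (T (map ?c (remove1 j ks))) \<cdot> (f k \<odot> (f j \<odot> tens_arr M (map f (remove1 j ks)))) \<cdot> (Id M (?d k) \<odot> pull_front M ?d j ks)"
      using False Cons by (simp add: comp_def merge)
    also have "\<dots> = (f j \<odot> tens_arr M (map f (remove1 j (k # ks)))) \<cdot> pull_front M ?d j (k # ks)"
      using False swap3_nat'[of "f k" "f j" "tens_arr M (map f (remove1 j ks))" "Id M (?d k) \<odot> pull_front M ?d j ks"]
      by (simp add: comp_def)
    finally show ?thesis .
  qed
qed simp

lemma reorder_nat:
  assumes [simp]: "\<And>i. f i \<in> Arr M" and "mset ks = mset js"
  shows "reorder M (\<lambda>i. Cod M (f i)) ks js \<cdot> tens_arr M (map f ks) = tens_arr M (map f js) \<cdot> reorder M (\<lambda>i. Dom M (f i)) ks js"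
  using assms(2)
proof (induction js arbitrary: ks)
  case (Cons j js)
  have [simp]: "j \<in> set ks" "mset ks = add_mset j (mset js)" using mset_ConsD[OF Cons.prems] Cons.prems by auto
  show ?case using pull_nat[of f j ks] Cons.IH[of "remove1 j ks"] by (simp add: comp_def merge)
qed simp

text \<open>Extracting two labels in the two possible orders differs by one exchange. If neither of
  them is the head, three exchanges have to be rearranged, and this is the Yang-Baxter relation
  \<open>swap3_braid\<close>.\<close>

lemma pull_pull:
  assumes [simp]: "\<And>i. X i \<in> Obj M" and "j \<in> set ks" "l \<in> set ks" "j \<noteq> l" "distinct ks"
  shows "sw (X j) (X l) (T (map X (remove1 l (remove1 j ks)))) \<cdot> (Id M (X j) \<odot> pull_front M X l (remove1 j ks)) \<cdot> pull_front M X j ks =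
    (Id M (X l) \<odot> pull_front M X j (remove1 l ks)) \<cdot> pull_front M X l ks"
  using assms(2-)
proof (induction ks)
  case (Cons k ks)
  consider "k = j" | "k = l" | "k \<noteq> j" "k \<noteq> l" by blast
  then show ?case
  proof cases
    case 1
    then show ?thesis using Cons.prems by (simp add: merge)
  next
    case 2
    then show ?thesis using Cons.prems by (simp add: merge)
  next
    case 3
    then have [simp]: "j \<in> set ks" "l \<in> set ks" "j \<noteq> l" "l \<noteq> j" "k \<noteq> j" "k \<noteq> l" "j \<noteq> k" "l \<noteq> k" "distinct ks" using Cons.prems by auto
    have [simp]: "l \<in> set (remove1 j ks)" "j \<in> set (remove1 l ks)" by simp_all
    let ?R = "remove1 l (remove1 j ks)"
    have R: "remove1 j (remove1 l ks) = ?R" by (rule remove1_commute)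
    let ?z = "T (map X ?R)"
    let ?p = "pull_front M X"
    have [simp]: "?z \<in> Obj M" by simp
    have "sw (X j) (X l) (T (map X (remove1 l (remove1 j (k # ks))))) \<cdot> (Id M (X j) \<odot> ?p l (remove1 j (k # ks))) \<cdot> ?p j (k # ks) =
      sw (X j) (X l) (X k \<otimes> ?z) \<cdot> (Id M (X j) \<odot> sw (X k) (X l) ?z) \<cdot>
       (Id M (X j) \<odot> (Id M (X k) \<odot> ?p l (remove1 j ks))) \<cdot> sw (X k) (X j) (T (map X (remove1 j ks))) \<cdot> (Id M (X k) \<odot> ?p j ks)"
      by (simp add: merge)
    also have "\<dots> = sw (X j) (X l) (X k \<otimes> ?z) \<cdot> (Id M (X j) \<odot> sw (X k) (X l) ?z) \<cdot> sw (X k) (X j) (X l \<otimes> ?z) \<cdot>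
       (Id M (X k) \<odot> (Id M (X j) \<odot> ?p l (remove1 j ks))) \<cdot> (Id M (X k) \<odot> ?p j ks)"
      using swap3_nat'[of "Id M (X k)" "Id M (X j)" "?p l (remove1 j ks)" "Id M (X k) \<odot> ?p j ks"] by simp
    also have "\<dots> = (sw (X j) (X l) (X k \<otimes> ?z) \<cdot> (Id M (X j) \<odot> sw (X k) (X l) ?z) \<cdot> sw (X k) (X j) (X l \<otimes> ?z)) \<cdot>
       (Id M (X k) \<odot> (Id M (X j) \<odot> ?p l (remove1 j ks))) \<cdot> (Id M (X k) \<odot> ?p j ks)" by simp
    also have "\<dots> = (Id M (X l) \<odot> sw (X k) (X j) ?z) \<cdot> sw (X k) (X l) (X j \<otimes> ?z) \<cdot>
       (Id M (X k) \<odot> (sw (X j) (X l) ?z \<cdot> (Id M (X j) \<odot> ?p l (remove1 j ks)) \<cdot> ?p j ks))"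
      by (subst swap3_braid) (simp_all add: merge)
    also have "\<dots> = (Id M (X l) \<odot> sw (X k) (X j) ?z) \<cdot> sw (X k) (X l) (X j \<otimes> ?z) \<cdot>
       (Id M (X k) \<odot> (Id M (X l) \<odot> ?p j (remove1 l ks))) \<cdot> (Id M (X k) \<odot> ?p l ks)"
      by (simp add: Cons.IH merge R)
    also have "\<dots> = (Id M (X l) \<odot> sw (X k) (X j) ?z) \<cdot> (Id M (X l) \<odot> (Id M (X k) \<odot> ?p j (remove1 l ks))) \<cdot>
       sw (X k) (X l) (T (map X (remove1 l ks))) \<cdot> (Id M (X k) \<odot> ?p l ks)"
      using swap3_nat'[of "Id M (X k)" "Id M (X l)" "?p j (remove1 l ks)" "Id M (X k) \<odot> ?p l ks"] by (simp add: R)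
    also have "\<dots> = (Id M (X l) \<odot> ?p j (remove1 l (k # ks))) \<cdot> ?p l (k # ks)"
      by (simp add: merge R)
    finally show ?thesis .
  qed
qed simp

text \<open>The step behind functoriality of reordering: a label can be extracted before or after
  the others are rearranged. If \<open>l\<close> is not the head of \<open>js\<close>,
  \<open>pull_pull\<close> lets it overtake the head.\<close>

lemma pull_reorder:
  assumes [simp]: "\<And>i. X i \<in> Obj M" and "l \<in> set js" "mset ks = mset js" "distinct js"
  shows "pull_front M X l js \<cdot> reorder M X ks js = (Id M (X l) \<odot> reorder M X (remove1 l ks) (remove1 l js)) \<cdot> pull_front M X l ks"
  using assms(2-)
proof (induction js arbitrary: ks)
  case (Cons j js)
  have [simp]: "j \<in> set ks" "mset ks = add_mset j (mset js)" using mset_ConsD[OF Cons.prems(2)] Cons.prems(2) by auto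
  have s: "set ks = set (j # js)" using Cons.prems(2) by (metis set_mset_mset)
  have d [simp]: "distinct ks" using Cons.prems(2,3) by (metis mset_eq_imp_distinct_iff)
  show ?case
  proof (cases "j = l")
    case True
    then have [simp]: "l = j" by simp
    show ?thesis by (simp add: merge)
  next
    case False
    then have [simp]: "l \<noteq> j" "j \<noteq> l" by auto
    have [simp]: "l \<in> set js" using Cons.prems(1) by simp
    then have [simp]: "l \<in> set ks" using s by simp
    let ?p = "pull_front M X" and ?r = "reorder M X"
    let ?k = "remove1 l (remove1 j ks)"
    have R: "remove1 j (remove1 l ks) = ?k" by (rule remove1_commute)
    have "?p l (j # js) \<cdot> ?r ks (j # js) =
      sw (X j) (X l) (T (map X (remove1 l js))) \<cdot> (Id M (X j) \<odot> (?p l js \<cdot> ?r (remove1 j ks) js)) \<cdot> ?p j ks"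
      by (simp add: merge)
    also have "\<dots> = sw (X j) (X l) (T (map X (remove1 l js))) \<cdot> (Id M (X j) \<odot> (Id M (X l) \<odot> ?r ?k (remove1 l js))) \<cdot>
       (Id M (X j) \<odot> ?p l (remove1 j ks)) \<cdot> ?p j ks"
      using Cons.IH[of "remove1 j ks"] Cons.prems(3) by (simp add: merge)
    also have "\<dots> = (Id M (X l) \<odot> (Id M (X j) \<odot> ?r ?k (remove1 l js))) \<cdot>
       sw (X j) (X l) (T (map X ?k)) \<cdot> (Id M (X j) \<odot> ?p l (remove1 j ks)) \<cdot> ?p j ks"
      using swap3_nat'[of "Id M (X j)" "Id M (X l)" "?r ?k (remove1 l js)" "(Id M (X j) \<odot> ?p l (remove1 j ks)) \<cdot> ?p j ks"] by simp
    also have "\<dots> = (Id M (X l) \<odot> (Id M (X j) \<odot> ?r ?k (remove1 l js))) \<cdot> (Id M (X l) \<odot> ?p j (remove1 l ks)) \<cdot> ?p l ks"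
      using pull_pull[of X j ks l] by simp
    also have "\<dots> = (Id M (X l) \<odot> ?r (remove1 l ks) (remove1 l (j # js))) \<cdot> ?p l ks"
      by (simp add: merge R)
    finally show ?thesis .
  qed
qed simp

text \<open>Induction on the final list: \<open>pull_reorder\<close> carries the extraction of its
  head through the first reordering, and the induction hypothesis composes what remains.\<close>

lemma reorder_reorder:
  assumes [simp]: "\<And>i. X i \<in> Obj M" and "mset ks = mset js" "mset js = mset ls" "distinct ls"
  shows "reorder M X js ls \<cdot> reorder M X ks js = reorder M X ks ls"
  using assms(2-)
proof (induction ls arbitrary: ks js)
  case (Cons l ls)
  have [simp]: "l \<in> set js" "mset js = add_mset l (mset ls)" "l \<in> set ks" "mset ks = add_mset l (mset ls)"
    using mset_ConsD[of js l ls] mset_ConsD[of ks l ls] Cons.prems by auto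
  have d: "distinct js" using Cons.prems mset_eq_imp_distinct_iff by blast
  have 1: "pull_front M X l js \<cdot> reorder M X ks js = (Id M (X l) \<odot> reorder M X (remove1 l ks) (remove1 l js)) \<cdot> pull_front M X l ks"
    using Cons.prems d by (intro pull_reorder) auto
  have 2: "reorder M X (remove1 l js) ls \<cdot> reorder M X (remove1 l ks) (remove1 l js) = reorder M X (remove1 l ks) ls"
    using Cons.prems by (intro Cons.IH) auto
  show ?case by (simp add: 1 2 merge)
qed simp

lemma reorder_id [simp]:
  assumes [simp]: "\<And>i. X i \<in> Obj M" shows "reorder M X ks ks = Id M (T (map X ks))"
  by (induction ks) auto


section \<open>Reordering and concatenation of blocks\<close>

declare ball_Un [simp]

text \<open>A label taken from the first block never meets the second one, which is carried along in
  the spectator position of \<open>swap3_tensor_third\<close>.\<close>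

lemma pull_append:
  assumes [simp]: "\<And>i. X i \<in> Obj M" and "j \<in> set ks"
  shows "pull_front M X j (ks @ ms) \<cdot> app (map X ks) (map X ms) =
    (Id M (X j) \<odot> app (map X (remove1 j ks)) (map X ms)) \<cdot> Assoc M (X j) (T (map X (remove1 j ks))) (T (map X ms)) \<cdot>
    (pull_front M X j ks \<odot> Id M (T (map X ms)))"
  using assms(2)
proof (induction ks)
  case (Cons k ks)
  show ?case
  proof (cases "k = j")
    case True then show ?thesis by simp
  next
    case False
    then have [simp]: "j \<in> set ks" using Cons by simp
    let ?k = "map X (remove1 j ks)" and ?m = "map X ms" and ?id = "Id M" and ?\<alpha> = "Assoc M"
    let ?p = "pull_front M X j ks"
    have "pull_front M X j ((k # ks) @ ms) \<cdot> app (map X (k # ks)) (map X ms) =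
      sw (X k) (X j) (T (?k @ ?m)) \<cdot> (?id (X k) \<odot> (pull_front M X j (ks @ ms) \<cdot> app (map X ks) ?m)) \<cdot> ?\<alpha> (X k) (T (map X ks)) (T ?m)"
      using False by (simp add: merge remove1_append)
    also have "\<dots> = sw (X k) (X j) (T (?k @ ?m)) \<cdot> (?id (X k) \<odot> (?id (X j) \<odot> app ?k ?m)) \<cdot> (?id (X k) \<odot> ?\<alpha> (X j) (T ?k) (T ?m)) \<cdot>
        (?id (X k) \<odot> (?p \<odot> ?id (T ?m))) \<cdot> ?\<alpha> (X k) (T (map X ks)) (T ?m)"
      by (simp add: Cons.IH merge)
    also have "\<dots> = (?id (X j) \<odot> (?id (X k) \<odot> app ?k ?m)) \<cdot> sw (X k) (X j) (T ?k \<otimes> T ?m) \<cdot> (?id (X k) \<odot> ?\<alpha> (X j) (T ?k) (T ?m)) \<cdot>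
        (?id (X k) \<odot> (?p \<odot> ?id (T ?m))) \<cdot> ?\<alpha> (X k) (T (map X ks)) (T ?m)"
      using swap3_nat'[of "?id (X k)" "?id (X j)" "app ?k ?m" "(?id (X k) \<odot> ?\<alpha> (X j) (T ?k) (T ?m)) \<cdot>
        (?id (X k) \<odot> (?p \<odot> ?id (T ?m))) \<cdot> ?\<alpha> (X k) (T (map X ks)) (T ?m)"] by simp
    also have "\<dots> = (?id (X j) \<odot> (?id (X k) \<odot> app ?k ?m)) \<cdot> (sw (X k) (X j) (T ?k \<otimes> T ?m) \<cdot> (?id (X k) \<odot> ?\<alpha> (X j) (T ?k) (T ?m)) \<cdot>
        ?\<alpha> (X k) (X j \<otimes> T ?k) (T ?m)) \<cdot> ((?id (X k) \<odot> ?p) \<odot> ?id (T ?m))"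
      using assoc_nat[of "?id (X k)" ?p "?id (T ?m)"] by simp
    also have "\<dots> = (?id (X j) \<odot> (?id (X k) \<odot> app ?k ?m)) \<cdot> (?id (X j) \<odot> ?\<alpha> (X k) (T ?k) (T ?m)) \<cdot> ?\<alpha> (X j) (X k \<otimes> T ?k) (T ?m) \<cdot>
        ((sw (X k) (X j) (T ?k) \<cdot> (?id (X k) \<odot> ?p)) \<odot> ?id (T ?m))"
      by (subst swap3_tensor_third) (simp_all add: merge)
    finally show ?thesis using False by (simp add: merge)
  qed
qed simp

lemma reorder_append:
  assumes [simp]: "\<And>i. X i \<in> Obj M" and "mset ks = mset js" "mset ms = mset ls"
  shows "reorder M X (ks @ ms) (js @ ls) \<cdot> app (map X ks) (map X ms) =
    app (map X js) (map X ls) \<cdot> (reorder M X ks js \<odot> reorder M X ms ls)"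
  using assms(2)
proof (induction js arbitrary: ks)
  case Nil
  then show ?case using lunit_nat[of "reorder M X ms ls"] by (simp add: assms(3))
next
  case (Cons j js)
  have [simp]: "j \<in> set ks" "mset ks = add_mset j (mset js)" using mset_ConsD[OF Cons.prems] Cons.prems by auto
  note [simp] = assms(3)
  let ?k = "remove1 j ks" and ?id = "Id M" and ?r = "reorder M X" and ?\<alpha> = "Assoc M"
  let ?p = "pull_front M X j ks"
  have "?r (ks @ ms) ((j # js) @ ls) \<cdot> app (map X ks) (map X ms) =
    (?id (X j) \<odot> ?r (?k @ ms) (js @ ls)) \<cdot> (pull_front M X j (ks @ ms) \<cdot> app (map X ks) (map X ms))"
    by (simp add: remove1_append)
  also have "\<dots> = (?id (X j) \<odot> (?r (?k @ ms) (js @ ls) \<cdot> app (map X ?k) (map X ms))) \<cdot>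
     ?\<alpha> (X j) (T (map X ?k)) (T (map X ms)) \<cdot> (?p \<odot> ?id (T (map X ms)))"
    by (subst pull_append) (simp_all add: merge)
  also have "\<dots> = (?id (X j) \<odot> app (map X js) (map X ls)) \<cdot> (?id (X j) \<odot> (?r ?k js \<odot> ?r ms ls)) \<cdot>
     ?\<alpha> (X j) (T (map X ?k)) (T (map X ms)) \<cdot> (?p \<odot> ?id (T (map X ms)))"
    by (simp add: Cons.IH merge)
  also have "\<dots> = (?id (X j) \<odot> app (map X js) (map X ls)) \<cdot> ?\<alpha> (X j) (T (map X js)) (T (map X ls)) \<cdot>
     ((?id (X j) \<odot> ?r ?k js) \<odot> ?r ms ls) \<cdot> (?p \<odot> ?id (T (map X ms)))"
    using assoc_nat'[of "?id (X j)" "?r ?k js" "?r ms ls" "?p \<odot> ?id (T (map X ms))"] by simp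
  also have "\<dots> = app (map X (j # js)) (map X ls) \<cdot> (?r ks (j # js) \<odot> ?r ms ls)"
    by (simp add: merge)
  finally show ?case .
qed

text \<open>The exchanges with the single labels of \<open>K\<close> assemble to one exchange with
  the object \<open>T (map X K)\<close>: the empty block is \<open>swap3_lunit\<close>, and
  \<open>swap3_tensor_left\<close> adds a label.\<close>

lemma pull_past_block:
  assumes [simp]: "\<And>i. X i \<in> Obj M" and "j \<notin> set K"
  shows "pull_front M X j (K @ j # S) \<cdot> app (map X K) (map X (j # S)) =
    (Id M (X j) \<odot> app (map X K) (map X S)) \<cdot> sw (T (map X K)) (X j) (T (map X S))"
  using assms(2)
proof (induction K)
  case Nil
  then show ?case by (simp add: swap3_lunit)
next
  case (Cons k K)
  let ?K = "map X K" and ?S = "map X S" and ?id = "Id M" and ?\<alpha> = "Assoc M"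
  have r: "remove1 j (K @ j # S) = K @ S" using Cons.prems by (simp add: remove1_append)
  have "pull_front M X j ((k # K) @ j # S) \<cdot> app (map X (k # K)) (map X (j # S)) =
    sw (X k) (X j) (T (?K @ ?S)) \<cdot> (?id (X k) \<odot> (pull_front M X j (K @ j # S) \<cdot> app ?K (map X (j # S)))) \<cdot> ?\<alpha> (X k) (T ?K) (X j \<otimes> T ?S)"
    using Cons.prems by (simp add: merge r)
  also have "\<dots> = sw (X k) (X j) (T (?K @ ?S)) \<cdot> (?id (X k) \<odot> (?id (X j) \<odot> app ?K ?S)) \<cdot>
     (?id (X k) \<odot> sw (T ?K) (X j) (T ?S)) \<cdot> ?\<alpha> (X k) (T ?K) (X j \<otimes> T ?S)"
    using Cons by (simp add: merge)
  also have "\<dots> = (?id (X j) \<odot> (?id (X k) \<odot> app ?K ?S)) \<cdot> sw (X k) (X j) (T ?K \<otimes> T ?S) \<cdot>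
     (?id (X k) \<odot> sw (T ?K) (X j) (T ?S)) \<cdot> ?\<alpha> (X k) (T ?K) (X j \<otimes> T ?S)"
    using swap3_nat'[of "?id (X k)" "?id (X j)" "app ?K ?S" "(?id (X k) \<odot> sw (T ?K) (X j) (T ?S)) \<cdot> ?\<alpha> (X k) (T ?K) (X j \<otimes> T ?S)"] by simp
  also have "\<dots> = (Id M (X j) \<odot> app (map X (k # K)) ?S) \<cdot> sw (T (map X (k # K))) (X j) (T ?S)"
    by (simp add: merge swap3_tensor_left[symmetric])
  finally show ?case .
qed

text \<open>Induction on \<open>J\<close>: its head is moved past \<open>K\<close> by
  \<open>pull_past_block\<close>, and \<open>swap3_tensor_right\<close> joins this exchange to the
  one for the remaining labels. These exchanges of whole blocks are what block permutations are made
  of.\<close>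

lemma reorder_swap_blocks:
  assumes [simp]: "\<And>i. X i \<in> Obj M" and "distinct (K @ J @ S)"
  shows "reorder M X (K @ J @ S) (J @ K @ S) \<cdot> app (map X K) (map X (J @ S)) \<cdot> (Id M (T (map X K)) \<odot> app (map X J) (map X S)) =
    app (map X J) (map X (K @ S)) \<cdot> (Id M (T (map X J)) \<odot> app (map X K) (map X S)) \<cdot> sw (T (map X K)) (T (map X J)) (T (map X S))"
  using assms(2)
proof (induction J)
  case Nil
  let ?K = "map X K" and ?S = "map X S"
  have "app ?K ?S \<cdot> (Id M (T ?K) \<odot> LUnit M (T ?S)) = app ?K ?S \<cdot> LUnit M (T ?K \<otimes> T ?S) \<cdot> sw (T ?K) unit (T ?S)"
    by (simp add: swap3_lunit)
  also have "\<dots> = LUnit M (T (?K @ ?S)) \<cdot> (Id M unit \<odot> app ?K ?S) \<cdot> sw (T ?K) unit (T ?S)"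
    using arg_cong[OF lunit_nat[of "app ?K ?S"], of "\<lambda>f. f \<cdot> sw (T ?K) unit (T ?S)"] by simp
  finally show ?case by simp
next
  case (Cons j J)
  let ?K = "map X K" and ?S = "map X S" and ?J = "map X J" and ?id = "Id M" and ?\<alpha> = "Assoc M" and ?r = "reorder M X"
  have [simp]: "j \<notin> set K" "j \<in> set (K @ j # J @ S)" using Cons.prems by auto
  have r: "remove1 j (K @ j # J @ S) = K @ J @ S" by (simp add: remove1_append)
  have "?r (K @ (j # J) @ S) ((j # J) @ K @ S) \<cdot> app ?K (map X ((j # J) @ S)) \<cdot> (?id (T ?K) \<odot> app (map X (j # J)) ?S) =
    (?id (X j) \<odot> ?r (K @ J @ S) (J @ K @ S)) \<cdot> (pull_front M X j (K @ j # J @ S) \<cdot> app ?K (map X (j # J @ S))) \<cdot>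
     (?id (T ?K) \<odot> (?id (X j) \<odot> app ?J ?S)) \<cdot> (?id (T ?K) \<odot> ?\<alpha> (X j) (T ?J) (T ?S))"
    by (simp add: merge r)
  also have "\<dots> = (?id (X j) \<odot> ?r (K @ J @ S) (J @ K @ S)) \<cdot> (?id (X j) \<odot> app ?K (map X (J @ S))) \<cdot> sw (T ?K) (X j) (T (map X (J @ S))) \<cdot>
     (?id (T ?K) \<odot> (?id (X j) \<odot> app ?J ?S)) \<cdot> (?id (T ?K) \<odot> ?\<alpha> (X j) (T ?J) (T ?S))"
    by (subst pull_past_block) simp_all
  also have "\<dots> = (?id (X j) \<odot> ?r (K @ J @ S) (J @ K @ S)) \<cdot> (?id (X j) \<odot> app ?K (map X (J @ S))) \<cdot>
     (?id (X j) \<odot> (?id (T ?K) \<odot> app ?J ?S)) \<cdot> sw (T ?K) (X j) (T ?J \<otimes> T ?S) \<cdot> (?id (T ?K) \<odot> ?\<alpha> (X j) (T ?J) (T ?S))"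
    using swap3_nat'[of "?id (T ?K)" "?id (X j)" "app ?J ?S" "?id (T ?K) \<odot> ?\<alpha> (X j) (T ?J) (T ?S)"] by simp
  also have "\<dots> = (?id (X j) \<odot> (?r (K @ J @ S) (J @ K @ S) \<cdot> app ?K (map X (J @ S)) \<cdot> (?id (T ?K) \<odot> app ?J ?S))) \<cdot>
      sw (T ?K) (X j) (T ?J \<otimes> T ?S) \<cdot> (?id (T ?K) \<odot> ?\<alpha> (X j) (T ?J) (T ?S))"
    by (simp add: merge)
  also have "\<dots> = (?id (X j) \<odot> (app ?J (map X (K @ S)) \<cdot> (?id (T ?J) \<odot> app ?K ?S) \<cdot> sw (T ?K) (T ?J) (T ?S))) \<cdot>
      sw (T ?K) (X j) (T ?J \<otimes> T ?S) \<cdot> (?id (T ?K) \<odot> ?\<alpha> (X j) (T ?J) (T ?S))"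
    using Cons by simp
  also have "\<dots> = (?id (X j) \<odot> app ?J (map X (K @ S))) \<cdot> (?id (X j) \<odot> (?id (T ?J) \<odot> app ?K ?S)) \<cdot>
      ?\<alpha> (X j) (T ?J) (T ?K \<otimes> T ?S) \<cdot> sw (T ?K) (X j \<otimes> T ?J) (T ?S)"
    by (simp add: merge swap3_tensor_right)
  also have "\<dots> = (?id (X j) \<odot> app ?J (map X (K @ S))) \<cdot> ?\<alpha> (X j) (T ?J) (T (?K @ ?S)) \<cdot>
      (?id (X j \<otimes> T ?J) \<odot> app ?K ?S) \<cdot> sw (T ?K) (X j \<otimes> T ?J) (T ?S)"
    using assoc_nat'[of "?id (X j)" "?id (T ?J)" "app ?K ?S" "sw (T ?K) (X j \<otimes> T ?J) (T ?S)"] by simp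
  finally show ?case by simp
qed

lemma mset_concat_map_remove1:
  "j \<in> set ks \<Longrightarrow> mset (concat (map B ks)) = mset (B j) + mset (concat (map B (remove1 j ks)))"
  by (induction ks) auto

lemma mset_concat_map_cong: "mset ks = mset js \<Longrightarrow> mset (concat (map B ks)) = mset (concat (map B js))"
proof -
  have "mset (concat (map B ls)) = sum_mset (image_mset (\<lambda>i. mset (B i)) (mset ls))" for ls
    by (induction ls) auto
  then show "mset ks = mset js \<Longrightarrow> mset (concat (map B ks)) = mset (concat (map B js))" by metis
qed

text \<open>One block is moved to the front. If the head block is \<open>B k\<close> with
  \<open>k \<noteq> j\<close>, the reordering is factored: \<open>B j\<close> is brought to the
  front of the tail, which is the induction hypothesis, and is then exchanged with
  \<open>B k\<close> by \<open>reorder_swap_blocks\<close>.\<close>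

lemma tens_concat_pull:
  assumes [simp]: "\<And>i. X i \<in> Obj M" and "j \<in> set ks" "distinct (concat (map B ks))" "distinct ks"
  shows "reorder M X (concat (map B ks)) (B j @ concat (map B (remove1 j ks))) \<cdot> tens_concat M (map (\<lambda>i. map X (B i)) ks) =
    app (map X (B j)) (map X (concat (map B (remove1 j ks)))) \<cdot>
    (Id M (T (map X (B j))) \<odot> tens_concat M (map (\<lambda>i. map X (B i)) (remove1 j ks))) \<cdot> pull_front M (\<lambda>i. T (map X (B i))) j ks"
  using assms(2-)
proof (induction ks)
  case (Cons k ks)
  have e: "concat (map (\<lambda>i. map X (B i)) ls) = map X (concat (map B ls))" for ls by (simp add: map_concat o_def)
  show ?case
  proof (cases "k = j")
    case True then show ?thesis by (simp add: e o_def)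
  next
    case False
    then have [simp]: "j \<in> set ks" using Cons by simp
    let ?R = "remove1 j ks"
    let ?cB = "\<lambda>ks. concat (map B ks)" and ?tc = "\<lambda>ks. tens_concat M (map (\<lambda>i. map X (B i)) ks)"
    let ?Y = "\<lambda>i. T (map X (B i))" and ?r = "reorder M X" and ?id = "Id M"
    let ?p = "pull_front M ?Y j ks"
    note m [simp] = mset_concat_map_remove1[OF \<open>j \<in> set ks\<close>, of B]
    have d: "distinct (B j @ B k @ ?cB ?R)" "distinct (B k @ B j @ ?cB ?R)"
      using Cons.prems(2) mset_eq_imp_distinct_iff[of "B k @ ?cB ks" "B j @ B k @ ?cB ?R"]
        mset_eq_imp_distinct_iff[of "B k @ ?cB ks" "B k @ B j @ ?cB ?R"] by (simp_all only: mset_append m concat.simps list.map union_ac)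
    have "?r (?cB (k # ks)) (B j @ ?cB (remove1 j (k # ks))) \<cdot> ?tc (k # ks) =
      ?r (B k @ B j @ ?cB ?R) (B j @ B k @ ?cB ?R) \<cdot> (?r (B k @ ?cB ks) (B k @ B j @ ?cB ?R) \<cdot> app (map X (B k)) (map X (?cB ks))) \<cdot> (?id (?Y k) \<odot> ?tc ks)"
      using False reorder_reorder[of X "B k @ ?cB ks" "B k @ B j @ ?cB ?R" "B j @ B k @ ?cB ?R"] d by (simp add: e o_def flip: comp_assoc')
    also have "\<dots> = ?r (B k @ B j @ ?cB ?R) (B j @ B k @ ?cB ?R) \<cdot> app (map X (B k)) (map X (B j @ ?cB ?R)) \<cdot>
       (?id (?Y k) \<odot> (?r (?cB ks) (B j @ ?cB ?R) \<cdot> ?tc ks))"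
      by (subst reorder_append) (simp_all add: merge e o_def)
    also have "\<dots> = (?r (B k @ B j @ ?cB ?R) (B j @ B k @ ?cB ?R) \<cdot> app (map X (B k)) (map X (B j @ ?cB ?R)) \<cdot>
       (?id (?Y k) \<odot> app (map X (B j)) (map X (?cB ?R)))) \<cdot> (?id (?Y k) \<odot> (?id (?Y j) \<odot> ?tc ?R)) \<cdot> (?id (?Y k) \<odot> ?p)"
      using Cons by (simp add: merge e o_def)
    also have "\<dots> = app (map X (B j)) (map X (B k @ ?cB ?R)) \<cdot> (?id (?Y j) \<odot> app (map X (B k)) (map X (?cB ?R))) \<cdot>
       sw (?Y k) (?Y j) (T (map X (?cB ?R))) \<cdot> (?id (?Y k) \<odot> (?id (?Y j) \<odot> ?tc ?R)) \<cdot> (?id (?Y k) \<odot> ?p)"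
      by (subst reorder_swap_blocks) (simp_all add: d[simplified] e o_def)
    also have "\<dots> = app (map X (B j)) (map X (B k @ ?cB ?R)) \<cdot> (?id (?Y j) \<odot> app (map X (B k)) (map X (?cB ?R))) \<cdot>
       (?id (?Y j) \<odot> (?id (?Y k) \<odot> ?tc ?R)) \<cdot> sw (?Y k) (?Y j) (T (map ?Y ?R)) \<cdot> (?id (?Y k) \<odot> ?p)"
      using swap3_nat'[of "?id (?Y k)" "?id (?Y j)" "?tc ?R" "?id (?Y k) \<odot> ?p"] by (simp add: e o_def)
    finally show ?thesis using False by (simp add: merge e o_def)
  qed
qed simp

text \<open>Blocks are put into place one at a time by \<open>tens_concat_pull\<close>. This is the
  coherence behind equivariance for the outer permutation of an operadic composite.\<close>

lemma tens_concat_reorder: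
  assumes [simp]: "\<And>i. X i \<in> Obj M" and "mset ks = mset js" "distinct (concat (map B ks))" "distinct ks"
  shows "reorder M X (concat (map B ks)) (concat (map B js)) \<cdot> tens_concat M (map (\<lambda>i. map X (B i)) ks) =
    tens_concat M (map (\<lambda>i. map X (B i)) js) \<cdot> reorder M (\<lambda>i. T (map X (B i))) ks js"
  using assms(2-)
proof (induction js arbitrary: ks)
  case (Cons j js)
  have e: "concat (map (\<lambda>i. map X (B i)) ls) = map X (concat (map B ls))" for ls by (simp add: map_concat o_def)
  have [simp]: "j \<in> set ks" and js: "mset (remove1 j ks) = mset js" using mset_ConsD[OF Cons.prems(1)] by auto
  let ?R = "remove1 j ks"
  let ?cB = "\<lambda>ks. concat (map B ks)" and ?tc = "\<lambda>ks. tens_concat M (map (\<lambda>i. map X (B i)) ks)"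
  let ?Y = "\<lambda>i. T (map X (B i))" and ?r = "reorder M X" and ?id = "Id M"
  have m1: "mset (?cB ks) = mset (B j @ ?cB ?R)" by (simp add: mset_concat_map_remove1)
  have m2: "mset (?cB ?R) = mset (?cB js)" by (rule mset_concat_map_cong) fact
  have d1: "distinct (B j @ ?cB ?R)" using mset_eq_imp_distinct_iff[OF m1] Cons.prems by simp
  have d2: "distinct (B j @ ?cB js)" 
    using d1 mset_eq_imp_distinct_iff[of "B j @ ?cB ?R" "B j @ ?cB js"] by (simp only: mset_append m2)
  have 1: "?r (?cB ks) (?cB (j # js)) = ?r (B j @ ?cB ?R) (B j @ ?cB js) \<cdot> ?r (?cB ks) (B j @ ?cB ?R)"
    using reorder_reorder[of X "?cB ks" "B j @ ?cB ?R" "B j @ ?cB js"] m1 m2 d2 by simp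
  have t1: "?r (?cB ks) (B j @ ?cB ?R) \<in> Arr M" "Dom M (?r (?cB ks) (B j @ ?cB ?R)) = T (map X (?cB ks))"
    "Cod M (?r (?cB ks) (B j @ ?cB ?R)) = T (map X (B j) @ map X (?cB ?R))" using m1 by simp_all
  have t2: "?r (B j @ ?cB ?R) (B j @ ?cB js) \<in> Arr M" "Dom M (?r (B j @ ?cB ?R) (B j @ ?cB js)) = T (map X (B j) @ map X (?cB ?R))"
    "Cod M (?r (B j @ ?cB ?R) (B j @ ?cB js)) = T (map X (B j) @ map X (?cB js))" using m2 by simp_all
  have t3: "?r (?cB ?R) (?cB js) \<in> Arr M" "Dom M (?r (?cB ?R) (?cB js)) = T (map X (?cB ?R))"
    "Cod M (?r (?cB ?R) (?cB js)) = T (map X (?cB js))" using m2 by simp_all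
  have t4: "reorder M ?Y ?R js \<in> Arr M" "Dom M (reorder M ?Y ?R js) = T (map ?Y ?R)" "Cod M (reorder M ?Y ?R js) = T (map ?Y js)"
    by (rule reorder_arr; use js in simp)+
  note t = t1 t2 t3 t4
  have 2: "?r (B j @ ?cB ?R) (B j @ ?cB js) \<cdot> app (map X (B j)) (map X (?cB ?R)) = app (map X (B j)) (map X (?cB js)) \<cdot> (?id (?Y j) \<odot> ?r (?cB ?R) (?cB js))"
    using reorder_append[of X "B j" "B j" "?cB ?R" "?cB js"] m2 by simp
  have 3: "?r (?cB ?R) (?cB js) \<cdot> ?tc ?R = ?tc js \<cdot> reorder M ?Y ?R js"
    using d1 Cons.prems js by (intro Cons.IH) auto
  have "?r (?cB ks) (?cB (j # js)) \<cdot> ?tc ks = ?r (B j @ ?cB ?R) (B j @ ?cB js) \<cdot> ?r (?cB ks) (B j @ ?cB ?R) \<cdot> ?tc ks"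
    unfolding 1 using t by (intro comp_assoc') (simp_all add: e)
  also have "\<dots> = (?r (B j @ ?cB ?R) (B j @ ?cB js) \<cdot> app (map X (B j)) (map X (?cB ?R))) \<cdot> (?id (?Y j) \<odot> ?tc ?R) \<cdot> pull_front M ?Y j ks"
    unfolding tens_concat_pull[OF assms(1) \<open>j \<in> set ks\<close> Cons.prems(2,3)] using t by (intro comp_assoc'[symmetric]) (simp_all add: e o_def)
  also have "\<dots> = app (map X (B j)) (map X (?cB js)) \<cdot> (?id (?Y j) \<odot> (?tc js \<cdot> reorder M ?Y ?R js)) \<cdot> pull_front M ?Y j ks"
    unfolding 2 3[symmetric] using t by (simp add: e merge o_def)
  also have "\<dots> = ?tc (j # js) \<cdot> reorder M ?Y ks (j # js)"
    using t by (simp add: merge e o_def)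
  finally show ?case .
qed simp

text \<open>The counterpart for the inner permutations: each block keeps its place and is rearranged
  internally, so \<open>reorder_append\<close> suffices at each step.\<close>

lemma tens_concat_reorder_blocks:
  assumes [simp]: "\<And>i. X i \<in> Obj M" and "list_all2 (\<lambda>b c. mset b = mset c) Bs Cs"
  shows "reorder M X (concat Bs) (concat Cs) \<cdot> tens_concat M (map (map X) Bs) =
    tens_concat M (map (map X) Cs) \<cdot> tens_arr M (map2 (reorder M X) Bs Cs)"
  using assms(2)
proof (induction rule: list_all2_induct)
  case (Cons b Bs c Cs)
  have m: "mset (concat Bs) = mset (concat Cs)" using Cons(2) by (induction rule: list_all2_induct) auto
  have t: "\<forall>f\<in>set (map2 (reorder M X) Bs Cs). f \<in> Arr M" "map (Dom M) (map2 (reorder M X) Bs Cs) = map (\<lambda>b. T (map X b)) Bs"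
     "map (Cod M) (map2 (reorder M X) Bs Cs) = map (\<lambda>b. T (map X b)) Cs"
    using Cons(2) by (induction rule: list_all2_induct) auto
  let ?f = "tens_arr M (map2 (reorder M X) Bs Cs)"
  have f [simp]: "?f \<in> Arr M" "Dom M ?f = T (map (\<lambda>b. T (map X b)) Bs)" "Cod M ?f = T (map (\<lambda>b. T (map X b)) Cs)"
    using t by (simp_all only: tens_arr_arr)
  have e [simp]: "concat (map (map X) Bs) = map X (concat Bs)" for Bs :: "nat list list" by (simp add: map_concat)
  have r: "reorder M X (b @ concat Bs) (c @ concat Cs) \<cdot> app (map X b) (map X (concat Bs)) =
     app (map X c) (map X (concat Cs)) \<cdot> (reorder M X b c \<odot> reorder M X (concat Bs) (concat Cs))"
    using Cons(1) m by (intro reorder_append) simp_all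
  have rt: "reorder M X b c \<in> Arr M" "Dom M (reorder M X b c) = T (map X b)" "Cod M (reorder M X b c) = T (map X c)"
    "reorder M X (concat Bs) (concat Cs) \<in> Arr M" "Dom M (reorder M X (concat Bs) (concat Cs)) = T (map X (concat Bs))"
    "Cod M (reorder M X (concat Bs) (concat Cs)) = T (map X (concat Cs))"
    "reorder M X (b @ concat Bs) (c @ concat Cs) \<in> Arr M" "Dom M (reorder M X (b @ concat Bs) (c @ concat Cs)) = T (map X b @ map X (concat Bs))"
    "Cod M (reorder M X (b @ concat Bs) (c @ concat Cs)) = T (map X c @ map X (concat Cs))"
    using Cons(1) m by simp_all
  have "reorder M X (concat (b # Bs)) (concat (c # Cs)) \<cdot> tens_concat M (map (map X) (b # Bs)) =
    (reorder M X (b @ concat Bs) (c @ concat Cs) \<cdot> app (map X b) (map X (concat Bs))) \<cdot> (Id M (T (map X b)) \<odot> tens_concat M (map (map X) Bs))"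
    using rt by (simp add: o_def)
  also have "\<dots> = app (map X c) (map X (concat Cs)) \<cdot> (reorder M X b c \<odot> (tens_concat M (map (map X) Cs) \<cdot> ?f))"
    unfolding r Cons(3)[symmetric] using rt by (simp add: merge o_def)
  also have "\<dots> = tens_concat M (map (map X) (c # Cs)) \<cdot> tens_arr M (map2 (reorder M X) (b # Bs) (c # Cs))"
    using rt by (simp add: merge o_def)
  finally show ?case .
qed simp

end

section \<open>Permutation isomorphisms of arbitrary lists of objects, by means of labels\<close>

lemma ex_blocks: "length l = sum_list ks \<Longrightarrow> \<exists>Bs. concat Bs = l \<and> map length Bs = ks"
proof (induction ks arbitrary: l)
  case (Cons k ks)
  then obtain Bs where "concat Bs = drop k l" "map length Bs = ks" by (metis length_drop sum_list.Cons add_diff_cancel_left')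
  then show ?case using Cons.prems by (intro exI[of _ "take k l # Bs"]) simp
qed simp

lemma mset_map_permutes: "\<sigma> permutes {..<n} \<Longrightarrow> mset (map \<sigma> [0..<n]) = mset [0..<n]"
proof -
  assume s: "\<sigma> permutes {..<n}"
  then have "map \<sigma> [0..<n] = permute_list \<sigma> [0..<n]" by (auto simp: permute_list_def permutes_lt)
  then show ?thesis using mset_permute_list[of \<sigma> "[0..<n]"] s by simp
qed

context symmetric_monoidal_category begin

text \<open>The entries of a list may coincide, whereas functoriality of reordering needs distinct
  labels; positions provide them.\<close>

lemma obtain_labels:
  assumes "\<forall>x \<in> set xs. x \<in> Obj M"
  obtains X where "\<And>i. X i \<in> Obj M" "xs = map X [0..<length xs]"
proof
  \<comment> \<open>Outside the list the value is the unit, because the reordering lemmas ask for an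
    object at every number.\<close>
  let ?X = "\<lambda>i. if i < length xs then xs ! i else unit"
  show "?X i \<in> Obj M" for i using assms by simp
  show "xs = map ?X [0..<length xs]" by (auto intro: nth_equalityI)
qed

lemma obtain_arr_labels:
  assumes "\<forall>f \<in> set fs. f \<in> Arr M"
  obtains F where "\<And>i. F i \<in> Arr M" "fs = map F [0..<length fs]"
proof
  let ?F = "\<lambda>i. if i < length fs then fs ! i else Id M unit"
  show "?F i \<in> Arr M" for i using assms by simp
  show "fs = map ?F [0..<length fs]" by (auto intro: nth_equalityI)
qed

text \<open>The positions in the concatenated list are cut into pieces of the given lengths, so that
  labels are distinct even across different blocks.\<close>

lemma obtain_block_labels:
  assumes "\<forall>xs \<in> set xss. \<forall>x \<in> set xs. x \<in> Obj M"
  obtains X :: "nat \<Rightarrow> 'o" and Bs where "\<And>i. X i \<in> Obj M" "distinct (concat Bs)" "xss = map (map X) Bs"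
proof -
  obtain X where X: "\<And>i. X i \<in> Obj M" "concat xss = map X [0..<length (concat xss)]"
    using obtain_labels[of "concat xss"] assms by auto
  obtain Bs where Bs: "concat Bs = [0..<length (concat xss)]" "map length Bs = map length xss"
    using ex_blocks[of "[0..<length (concat xss)]" "map length xss"] by (auto simp: length_concat)
  have l: "length Bs = length xss" using Bs(2) by (metis length_map)
  have "xss = map (map X) Bs"
  proof (rule concat_injective)
    show "concat xss = concat (map (map X) Bs)" using X(2) Bs(1) by (simp flip: map_concat)
    have "length (xss ! i) = length (Bs ! i)" if "i < length xss" for i
      using arg_cong[OF Bs(2), of "\<lambda>l. l ! i"] that l by simp
    then show "\<forall>(x, y) \<in> set (zip xss (map (map X) Bs)). length x = length y" using l by (auto simp: set_zip)
  qed (simp add: l)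
  then show thesis using that[of X Bs] X Bs by simp
qed

text \<open>\<open>tens_perm\<close> labels the factors by their positions, and after one
  permutation the positions are no longer the original labels. Composites become accessible only
  when any distinct labels are allowed.\<close>

lemma tens_perm_labels:
  assumes "distinct ks" "\<sigma> permutes {..<length ks}"
  shows "tens_perm M \<sigma> (map X ks) = reorder M X ks (permute_list \<sigma> ks)"
proof -
  let ?n = "length ks"
  have m: "mset [0..<?n] = mset (map \<sigma> [0..<?n])" by (rule mset_map_permutes[OF assms(2), symmetric])
  have "tens_perm M \<sigma> (map X ks) = reorder M (\<lambda>i. map X ks ! i) [0..<?n] (map \<sigma> [0..<?n])"
    by (simp add: tens_perm_def)
  also have "\<dots> = reorder M (\<lambda>i. X (ks ! i)) [0..<?n] (map \<sigma> [0..<?n])"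
    by (rule reorder_cong[OF _ m]) simp
  also have "\<dots> = reorder M X (map (\<lambda>i. ks ! i) [0..<?n]) (map (\<lambda>i. ks ! i) (map \<sigma> [0..<?n]))"
    by (rule reorder_relabel[OF _ m]) (use assms(1) in \<open>simp add: inj_on_nth\<close>)
  also have "\<dots> = reorder M X ks (permute_list \<sigma> ks)" by (simp add: permute_list_def map_nth o_def)
  finally show ?thesis .
qed

lemma tens_perm_arr [simp]:
  assumes "\<forall>x \<in> set xs. x \<in> Obj M" "\<sigma> permutes {..<length xs}"
  shows "tens_perm M \<sigma> xs \<in> Arr M" "Dom M (tens_perm M \<sigma> xs) = T xs"
    "Cod M (tens_perm M \<sigma> xs) = T (permute_list \<sigma> xs)" "is_iso M (tens_perm M \<sigma> xs)"
proof -
  obtain X where X: "\<And>i. X i \<in> Obj M" "xs = map X [0..<length xs]" by (rule obtain_labels[OF assms(1)]) iprover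
  let ?k = "[0..<length xs]"
  have p: "tens_perm M \<sigma> (map X ?k) = reorder M X ?k (permute_list \<sigma> ?k)"
    using assms(2) by (intro tens_perm_labels) auto
  have c: "permute_list \<sigma> (map X ?k) = map X (permute_list \<sigma> ?k)" using assms(2) by (simp add: permute_list_map)
  have m: "mset ?k = mset (permute_list \<sigma> ?k)" using assms(2) by simp
  have "tens_perm M \<sigma> (map X ?k) \<in> Arr M \<and> Dom M (tens_perm M \<sigma> (map X ?k)) = T (map X ?k) \<and>
    Cod M (tens_perm M \<sigma> (map X ?k)) = T (permute_list \<sigma> (map X ?k)) \<and> is_iso M (tens_perm M \<sigma> (map X ?k))"
    unfolding p c using reorder_arr[of X ?k "permute_list \<sigma> ?k", OF X(1) m] by blast
  then show "tens_perm M \<sigma> xs \<in> Arr M" "Dom M (tens_perm M \<sigma> xs) = T xs"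
    "Cod M (tens_perm M \<sigma> xs) = T (permute_list \<sigma> xs)" "is_iso M (tens_perm M \<sigma> xs)" unfolding X(2)[symmetric] by auto
qed

lemma tens_perm_id [simp]:
  assumes "\<forall>x \<in> set xs. x \<in> Obj M" shows "tens_perm M id xs = Id M (T xs)"
proof -
  obtain X where X: "\<And>i. X i \<in> Obj M" "xs = map X [0..<length xs]" by (rule obtain_labels[OF assms(1)]) iprover
  have "tens_perm M id (map X [0..<length xs]) = Id M (T (map X [0..<length xs]))"
    using X(1) by (subst tens_perm_labels) (auto simp: permutes_id)
  then show ?thesis unfolding X(2)[symmetric] .
qed

text \<open>Expressed in labels, both sides are reorderings between the same two lists, so
  \<open>reorder_reorder\<close> applies.\<close>

lemma tens_perm_comp:
  assumes "\<forall>x \<in> set xs. x \<in> Obj M" and s: "\<sigma> permutes {..<length xs}" "\<tau> permutes {..<length xs}"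
  shows "tens_perm M \<tau> (permute_list \<sigma> xs) \<cdot> tens_perm M \<sigma> xs = tens_perm M (\<sigma> \<circ> \<tau>) xs"
proof -
  obtain X where X: "\<And>i. X i \<in> Obj M" "xs = map X [0..<length xs]" by (rule obtain_labels[OF assms(1)]) iprover
  let ?k = "[0..<length xs]"
  have c: "permute_list \<sigma> (map X ?k) = map X (permute_list \<sigma> ?k)" using s by (simp add: permute_list_map)
  have "tens_perm M \<tau> (permute_list \<sigma> (map X ?k)) \<cdot> tens_perm M \<sigma> (map X ?k) = tens_perm M (\<sigma> \<circ> \<tau>) (map X ?k)"
    unfolding c using s X(1)
    by (simp add: tens_perm_labels permutes_compose distinct_permute_list reorder_reorder permute_list_compose)
  then show ?thesis unfolding X(2)[symmetric] .
qed

lemma tens_perm_nat: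
  assumes "\<forall>f \<in> set fs. f \<in> Arr M" and s: "\<sigma> permutes {..<length fs}"
  shows "tens_perm M \<sigma> (map (Cod M) fs) \<cdot> tens_arr M fs = tens_arr M (permute_list \<sigma> fs) \<cdot> tens_perm M \<sigma> (map (Dom M) fs)"
proof -
  obtain F where F: "\<And>i. F i \<in> Arr M" "fs = map F [0..<length fs]" by (rule obtain_arr_labels[OF assms(1)]) iprover
  let ?k = "[0..<length fs]"
  have c: "permute_list \<sigma> (map F ?k) = map F (permute_list \<sigma> ?k)" using s by (simp add: permute_list_map)
  have m: "map (h M) (map F ?k) = map (\<lambda>i. h M (F i)) ?k" for h by simp
  have t: "tens_perm M \<sigma> (map X ?k) = reorder M X ?k (permute_list \<sigma> ?k)" for X
    using s by (intro tens_perm_labels) auto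
  have "tens_perm M \<sigma> (map (Cod M) (map F ?k)) \<cdot> tens_arr M (map F ?k) =
    tens_arr M (permute_list \<sigma> (map F ?k)) \<cdot> tens_perm M \<sigma> (map (Dom M) (map F ?k))"
    unfolding c m t using F(1) s by (intro reorder_nat) auto
  then show ?thesis unfolding F(2)[symmetric] .
qed

text \<open>The categorical side of the bottom equivariance axiom: \<open>permute_sum\<close>
  identifies the lists of labels and \<open>tens_concat_reorder_blocks\<close> the arrows.\<close>

lemma tens_perm_concat_bottom:
  assumes "\<forall>xs \<in> set xss. \<forall>x \<in> set xs. x \<in> Obj M" and l: "length \<tau>s = length xss"
    and p: "\<And>i. i < length xss \<Longrightarrow> \<tau>s ! i permutes {..<length (xss ! i)}"
  shows "tens_perm M (sum_perm (map length xss) \<tau>s) (concat xss) \<cdot> tens_concat M xss =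
    tens_concat M (map2 permute_list \<tau>s xss) \<cdot> tens_arr M (map2 (tens_perm M) \<tau>s xss)"
proof -
  obtain X :: "nat \<Rightarrow> 'o" and Bs where X: "\<And>i. X i \<in> Obj M" and d: "distinct (concat Bs)" and xss: "xss = map (map X) Bs"
    by (rule obtain_block_labels[OF assms(1)]) iprover
  have p': "\<tau>s ! i permutes {..<length (Bs ! i)}" if "i < length Bs" for i using p[of i] that xss by simp
  have l': "length \<tau>s = length Bs" using l xss by simp
  let ?C = "map2 permute_list \<tau>s Bs"
  have len: "map length xss = map length Bs" by (simp add: xss)
  have c: "concat xss = map X (concat Bs)" by (simp add: xss map_concat)
  have s: "sum_perm (map length Bs) \<tau>s permutes {..<length (concat Bs)}"
    unfolding length_concat using l' p' by (intro sum_perm_permutes) auto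
  have ps: "permute_list (sum_perm (map length Bs) \<tau>s) (concat Bs) = concat ?C"
    using l' p' by (rule permute_sum)
  have C: "map2 permute_list \<tau>s xss = map (map X) ?C"
    using l' p' by (intro nth_equalityI) (auto simp: xss permute_list_map)
  have dB: "distinct (Bs ! i)" if "i < length Bs" for i using d that by (simp add: distinct_concat_iff)
  have A: "map2 (tens_perm M) \<tau>s xss = map2 (reorder M X) Bs ?C"
    using l' p' dB by (intro nth_equalityI) (auto simp: xss tens_perm_labels)
  have m: "list_all2 (\<lambda>b c. mset b = mset c) Bs ?C" using l' p' by (auto simp: list_all2_conv_all_nth)
  show ?thesis
    unfolding len c tens_perm_labels[OF d s] ps C A unfolding xss by (rule tens_concat_reorder_blocks[OF X m])
qed

text \<open>The categorical side of the top equivariance axiom: \<open>permute_block\<close>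
  identifies the lists of labels and \<open>tens_concat_reorder\<close> the arrows. Two labellings
  are in play, one for the single factors and one, by block numbers, for the blocks.\<close>

lemma tens_perm_concat_top:
  assumes "\<forall>xs \<in> set xss. \<forall>x \<in> set xs. x \<in> Obj M" and p: "\<sigma> permutes {..<length xss}"
  shows "tens_perm M (block_perm \<sigma> (map length (permute_list \<sigma> xss))) (concat xss) \<cdot> tens_concat M xss =
    tens_concat M (permute_list \<sigma> xss) \<cdot> tens_perm M \<sigma> (map T xss)"
proof -
  obtain X :: "nat \<Rightarrow> 'o" and Bs where X: "\<And>i. X i \<in> Obj M" and d: "distinct (concat Bs)" and xss: "xss = map (map X) Bs"
    by (rule obtain_block_labels[OF assms(1)]) iprover
  have p': "\<sigma> permutes {..<length Bs}" using p xss by simp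
  let ?n = "length Bs" let ?B = "\<lambda>i. Bs ! i" and ?js = "map \<sigma> [0..<length Bs]"
  have len: "map length (permute_list \<sigma> xss) = map length (permute_list \<sigma> Bs)" using p' by (simp add: xss permute_list_map o_def)
  have c: "concat xss = map X (concat Bs)" by (simp add: xss map_concat)
  have "sum_list (map length (permute_list \<sigma> Bs)) = length (concat Bs)"
    by (metis length_concat mset_map mset_permute_list p' sum_mset_sum_list)
  then have s: "block_perm \<sigma> (map length (permute_list \<sigma> Bs)) permutes {..<length (concat Bs)}"
    using block_perm_permutes[of \<sigma> "map length (permute_list \<sigma> Bs)"] p' by simp
  have ps: "permute_list (block_perm \<sigma> (map length (permute_list \<sigma> Bs))) (concat Bs) = concat (permute_list \<sigma> Bs)"
    using p' by (rule permute_block)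
  have m: "mset [0..<?n] = mset ?js" by (rule mset_map_permutes[OF p', symmetric])
  have k: "map ?B [0..<?n] = Bs" by (rule map_nth)
  have j: "map ?B ?js = permute_list \<sigma> Bs" by (simp add: permute_list_def)
  have tp: "tens_perm M \<sigma> (map T xss) = reorder M (\<lambda>i. T (map X (?B i))) [0..<?n] ?js"
    unfolding tens_perm_def xss by simp (rule reorder_cong[OF _ m], simp)
  have k2: "map (\<lambda>i. map X (?B i)) [0..<?n] = xss" unfolding xss by (subst k[symmetric]) (simp del: map_nth)
  have j2: "map (\<lambda>i. map X (?B i)) ?js = permute_list \<sigma> xss" unfolding xss using p' permutes_lt[OF p'] by (simp add: permute_list_def)
  show ?thesis
    unfolding len c tens_perm_labels[OF d s] ps tp
    using tens_concat_reorder[of X "[0..<?n]" ?js ?B, OF X m] d unfolding k j k2 j2 by simp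
qed

lemma tens_arr_comp:
  assumes "\<forall>x \<in> set xs. f x \<in> Arr M \<and> g x \<in> Arr M \<and> Cod M (f x) = Dom M (g x)"
  shows "tens_arr M (map g xs) \<cdot> tens_arr M (map f xs) = tens_arr M (map (\<lambda>x. g x \<cdot> f x) xs)"
  using assms
proof (induction xs)
  case (Cons x xs)
  then have [simp]: "map (\<lambda>x. Cod M (f x)) xs = map (\<lambda>x. Dom M (g x)) xs" by simp
  show ?case using Cons by (simp add: merge o_def)
qed simp

lemma tens_arr_id: "\<forall>x \<in> set xs. x \<in> Obj M \<Longrightarrow> tens_arr M (map (Id M) xs) = Id M (T xs)"
  by (induction xs) auto

lemma iso_tens_arr: "\<forall>f \<in> set fs. is_iso M f \<Longrightarrow> is_iso M (tens_arr M fs)"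
  by (induction fs) auto

lemma tens_perm_transpose:
  assumes [simp]: "x \<in> Obj M" "y \<in> Obj M"
  shows "tens_perm M (transpose 0 1) [x, y] = sw x y unit"
  by (simp add: tens_perm_def upt_rec)

end

section \<open>The algebra of a diagram of monoids\<close>

text \<open>Only typing and equivariance are assumed, not the composition axiom. This is enough to
  carry that axiom along both group actions, and it fits a candidate action that is not yet known to
  be an algebra.\<close>

locale operad_action = symmetric_monoidal_category M + O: colored_operad P
  for M :: "('o, 'm, 'z) smc_scheme" (structure) and P :: "('c, 'x, 'y) operad_scheme" +
  fixes car :: "'c \<Rightarrow> 'o" and ao :: "'x \<Rightarrow> 'm"
  assumes car_obj [simp]: "c \<in> Colors P \<Longrightarrow> car c \<in> Obj M"
    and ao_hom: "x \<in> Ops P \<Longrightarrow> ao x \<in> hom M (T (map car (Inp P x))) (car (Out P x))"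
    and ao_act: "x \<in> Ops P \<Longrightarrow> \<sigma> permutes {..<length (Inp P x)} \<Longrightarrow>
      ao (Act P x \<sigma>) \<cdot> tens_perm M \<sigma> (map car (Inp P x)) = ao x"
begin

lemma ao_arr [simp]:
  "x \<in> Ops P \<Longrightarrow> ao x \<in> Arr M" "x \<in> Ops P \<Longrightarrow> Dom M (ao x) = T (map car (Inp P x))"
  "x \<in> Ops P \<Longrightarrow> Cod M (ao x) = car (Out P x)"
  using ao_hom by (auto simp: hom_iff)

lemma car_inp: "x \<in> Ops P \<Longrightarrow> \<forall>a \<in> set (map car (Inp P x)). a \<in> Obj M"
  using O.inp_color[of x] by auto

text \<open>Without \<open>= True\<close> the simplifier would store a conditional rule with an unbound \<open>x\<close>.\<close>
lemma car_inp' [simp]: "x \<in> Ops P \<Longrightarrow> (\<forall>a \<in> set (Inp P x). car a \<in> Obj M) = True"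
  using O.inp_color[of x] by auto

abbreviation "inps ys \<equiv> map (\<lambda>y. map car (Inp P y)) ys"

definition "respects_gam x ys \<longleftrightarrow>
  ao (Gam P x ys) \<cdot> tens_concat M (inps ys) = ao x \<cdot> tens_arr M (map ao ys)"

lemma inps_obj: "set ys \<subseteq> Ops P \<Longrightarrow> \<forall>xs \<in> set (inps ys). \<forall>a \<in> set xs. a \<in> Obj M"
  using car_inp by (simp add: subset_iff)

lemma gam_arr:
  assumes "composable P x ys"
  shows "x \<in> Ops P" "set ys \<subseteq> Ops P" "ao (Gam P x ys) \<in> Arr M" "Dom M (ao (Gam P x ys)) = T (concat (inps ys))"
    "Cod M (ao (Gam P x ys)) = car (Out P x)"
    "tens_arr M (map ao ys) \<in> Arr M" "Dom M (tens_arr M (map ao ys)) = T (map T (inps ys))"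
    "Cod M (tens_arr M (map ao ys)) = T (map car (Inp P x))"
proof -
  show x: "x \<in> Ops P" and ys: "set ys \<subseteq> Ops P" using assms by (auto simp: composable_def)
  note g = O.gam_ops[OF assms]
  show "ao (Gam P x ys) \<in> Arr M" "Dom M (ao (Gam P x ys)) = T (concat (inps ys))"
    "Cod M (ao (Gam P x ys)) = car (Out P x)" using g by (auto simp: map_concat o_def)
  have a: "\<forall>f \<in> set (map ao ys). f \<in> Arr M" using ys by auto
  have 1: "map (Dom M) (map ao ys) = map T (inps ys)" and 2: "map (Cod M) (map ao ys) = map car (map (Out P) ys)"
    using ys by auto
  have "Inp P x = map (Out P) ys" using assms by (simp add: composable_def)
  then show "tens_arr M (map ao ys) \<in> Arr M" "Dom M (tens_arr M (map ao ys)) = T (map T (inps ys))"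
    "Cod M (tens_arr M (map ao ys)) = T (map car (Inp P x))" using tens_arr_arr[OF a] unfolding 1 2 by auto
qed

text \<open>
  The composition axiom is invariant under both group actions, so that it has to be verified only
  for operations with identity permutations.
\<close>
lemma respects_gam_bottom:
  assumes c: "composable P x ys" and \<tau>: "list_all2 (\<lambda>y \<tau>. \<tau> permutes {..<length (Inp P y)}) ys \<tau>s"
    and r: "respects_gam x ys"
  shows "respects_gam x (map2 (Act P) ys \<tau>s)"
proof -
  let ?ys = "map2 (Act P) ys \<tau>s" and ?s = "sum_perm (map (\<lambda>y. length (Inp P y)) ys) \<tau>s"
  note g = gam_arr[OF c]
  have l: "length \<tau>s = length ys" using \<tau> by (simp add: list_all2_lengthD)
  have y: "ys ! i \<in> Ops P" if "i < length ys" for i using g(2) that by auto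
  have p: "\<tau>s ! i permutes {..<length (Inp P (ys ! i))}" if "i < length ys" for i using list_all2_nthD[OF \<tau> that] .
  have A: "Act P (ys ! i) (\<tau>s ! i) \<in> Ops P" "Inp P (Act P (ys ! i) (\<tau>s ! i)) = permute_list (\<tau>s ! i) (Inp P (ys ! i))"
    "Out P (Act P (ys ! i) (\<tau>s ! i)) = Out P (ys ! i)" if "i < length ys" for i
    using O.act_ops[OF y[OF that] p[OF that]] by auto
  have c': "composable P x ?ys" unfolding composable_def
  proof (intro conjI)
    show "x \<in> Ops P" by (rule g)
    show "set ?ys \<subseteq> Ops P" using A l by (auto simp: set_zip)
    have "map (Out P) ?ys = map (Out P) ys" using A l by (intro nth_equalityI) auto
    then show "Inp P x = map (Out P) ?ys" using c by (simp add: composable_def)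
  qed
  note g' = gam_arr[OF c']
  have i: "inps ?ys = map2 permute_list \<tau>s (inps ys)"
    using A l p by (intro nth_equalityI) (auto simp: permute_list_map)
  have tp: "map2 (tens_perm M) \<tau>s (inps ys) = map (\<lambda>(y, \<tau>). tens_perm M \<tau> (map car (Inp P y))) (zip ys \<tau>s)"
    using l by (intro nth_equalityI) auto
  let ?p = "tens_arr M (map2 (tens_perm M) \<tau>s (inps ys))"
  have tpi: "tens_perm M (\<tau>s ! i) (map car (Inp P (ys ! i))) \<in> Arr M"
    "Dom M (tens_perm M (\<tau>s ! i) (map car (Inp P (ys ! i)))) = T (map car (Inp P (ys ! i)))"
    "Cod M (tens_perm M (\<tau>s ! i) (map car (Inp P (ys ! i)))) = T (permute_list (\<tau>s ! i) (map car (Inp P (ys ! i))))"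
    "is_iso M (tens_perm M (\<tau>s ! i) (map car (Inp P (ys ! i))))"
    if "i < length ys" for i
    using tens_perm_arr[OF car_inp[OF y[OF that]], of "\<tau>s ! i"] p[OF that] by simp_all
  then have pa: "\<forall>f \<in> set (map2 (tens_perm M) \<tau>s (inps ys)). f \<in> Arr M \<and> is_iso M f"
    unfolding tp using l by (auto simp: set_zip)
  have pd1: "map (Dom M) (map2 (tens_perm M) \<tau>s (inps ys)) = map T (inps ys)"
    using l tpi by (intro nth_equalityI) simp_all
  have pd2: "map (Cod M) (map2 (tens_perm M) \<tau>s (inps ys)) = map T (inps ?ys)"
    unfolding i using l tpi by (intro nth_equalityI) simp_all
  note pd = pd1 pd2
  have P: "?p \<in> Arr M" "Dom M ?p = T (map T (inps ys))" "Cod M ?p = T (map T (inps ?ys))" "is_iso M ?p"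
    using tens_arr_arr[of "map2 (tens_perm M) \<tau>s (inps ys)"] iso_tens_arr[of "map2 (tens_perm M) \<tau>s (inps ys)"] pa
    unfolding pd by blast+
  have tc: "tens_concat M (inps ?ys) \<in> Arr M" "Dom M (tens_concat M (inps ?ys)) = T (map T (inps ?ys))"
    "Cod M (tens_concat M (inps ?ys)) = T (concat (inps ?ys))"
    by (rule tens_concat_arr; rule inps_obj; rule g')+
  have tc': "tens_concat M (inps ys) \<in> Arr M" "Dom M (tens_concat M (inps ys)) = T (map T (inps ys))"
    "Cod M (tens_concat M (inps ys)) = T (concat (inps ys))"
    by (rule tens_concat_arr; rule inps_obj; rule g)+
  have len: "map length (inps ys) = map (\<lambda>y. length (Inp P y)) ys" by simp
  have G: "Gam P x ys \<in> Ops P" "Inp P (Gam P x ys) = concat (map (Inp P) ys)" using O.gam_ops[OF c] by auto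
  have s: "?s permutes {..<length (Inp P (Gam P x ys))}"
    using sum_perm_permutes[of \<tau>s "map (\<lambda>y. length (Inp P y)) ys"] l p by (simp add: G length_concat o_def)
  have cc: "map car (Inp P (Gam P x ys)) = concat (inps ys)" by (simp add: G map_concat o_def)
  have sp: "tens_perm M ?s (concat (inps ys)) \<in> Arr M" "Dom M (tens_perm M ?s (concat (inps ys))) = T (concat (inps ys))"
    "Cod M (tens_perm M ?s (concat (inps ys))) = T (concat (inps ?ys))"
  proof -
    have o: "\<forall>a \<in> set (concat (inps ys)). a \<in> Obj M" using inps_obj[OF g(2)] by auto
    have s': "?s permutes {..<length (concat (inps ys))}" using s unfolding cc[symmetric] by simp
    show "tens_perm M ?s (concat (inps ys)) \<in> Arr M" "Dom M (tens_perm M ?s (concat (inps ys))) = T (concat (inps ys))"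
      using tens_perm_arr[OF o s'] by auto
    have "permute_list ?s (concat (inps ys)) = concat (inps ?ys)"
      unfolding i len[symmetric] by (rule permute_sum) (use l p in auto)
    then show "Cod M (tens_perm M ?s (concat (inps ys))) = T (concat (inps ?ys))" using tens_perm_arr[OF o s'] by simp
  qed
  have 1: "tens_perm M ?s (concat (inps ys)) \<cdot> tens_concat M (inps ys) = tens_concat M (inps ?ys) \<cdot> ?p"
    unfolding i len[symmetric] by (rule tens_perm_concat_bottom) (use inps_obj[OF g(2)] l p in auto)
  have 2: "ao (Gam P x ?ys) \<cdot> tens_perm M ?s (concat (inps ys)) = ao (Gam P x ys)"
    using ao_act[OF G(1) s] O.equivariance_bottom[OF c \<tau>] cc by simp
  have 3: "tens_arr M (map ao ?ys) \<cdot> ?p = tens_arr M (map ao ys)"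
  proof -
    have z: "y \<in> Ops P \<and> Act P y \<tau> \<in> Ops P \<and> Inp P (Act P y \<tau>) = permute_list \<tau> (Inp P y) \<and> \<tau> permutes {..<length (Inp P y)}"
      if "(y, \<tau>) \<in> set (zip ys \<tau>s)" for y \<tau> using that A y p l by (auto simp: set_zip)
    have "map ao ?ys = map (\<lambda>(y, \<tau>). ao (Act P y \<tau>)) (zip ys \<tau>s)" by auto
    then have "tens_arr M (map ao ?ys) \<cdot> ?p =
      tens_arr M (map (\<lambda>z. (case z of (y, \<tau>) \<Rightarrow> ao (Act P y \<tau>)) \<cdot> (case z of (y, \<tau>) \<Rightarrow> tens_perm M \<tau> (map car (Inp P y)))) (zip ys \<tau>s))"
      unfolding tp by (simp only:) (rule tens_arr_comp, use z in \<open>auto simp: permute_list_map\<close>)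
    also have "map (\<lambda>z. (case z of (y, \<tau>) \<Rightarrow> ao (Act P y \<tau>)) \<cdot> (case z of (y, \<tau>) \<Rightarrow> tens_perm M \<tau> (map car (Inp P y)))) (zip ys \<tau>s) = map ao ys"
      using l y p by (intro nth_equalityI) (auto simp: ao_act)
    finally show ?thesis .
  qed
  \<comment> \<open>The axiom is checked after composing with the isomorphism \<open>?p\<close> of
    all inner permutations: fact 1 moves them across \<open>tens_concat\<close>, fact 2 removes them
    from the composite operation, and fact 3 removes them from the single operations.\<close>
  have "(ao (Gam P x ?ys) \<cdot> tens_concat M (inps ?ys)) \<cdot> ?p = ao (Gam P x ?ys) \<cdot> (tens_perm M ?s (concat (inps ys)) \<cdot> tens_concat M (inps ys))"
    unfolding 1 using g'(3,4) tc P by (intro comp_assoc') simp_all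
  also have "\<dots> = (ao (Gam P x ?ys) \<cdot> tens_perm M ?s (concat (inps ys))) \<cdot> tens_concat M (inps ys)"
    using g'(3,4) tc' sp by (intro comp_assoc'[symmetric]) simp_all
  also have "\<dots> = ao x \<cdot> tens_arr M (map ao ys)"
    unfolding 2 using r by (simp add: respects_gam_def)
  also have "\<dots> = (ao x \<cdot> tens_arr M (map ao ?ys)) \<cdot> ?p"
    unfolding 3[symmetric] using g'(6-8) g(1) P by (intro comp_assoc'[symmetric]) simp_all
  finally have "ao (Gam P x ?ys) \<cdot> tens_concat M (inps ?ys) = ao x \<cdot> tens_arr M (map ao ?ys)"
    by (rule iso_epi) (use P g' g(1) tc in simp_all)
  then show ?thesis by (simp add: respects_gam_def)
qed

text \<open>As for the inner permutations, except that \<open>\<sigma>\<close> also acts on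
  \<open>x\<close>: by naturality of \<open>tens_perm\<close> it is moved between the actions of
  \<open>x\<close> and of \<open>ys\<close>, where equivariance of \<open>ao\<close> at
  \<open>x\<close> absorbs it.\<close>

lemma respects_gam_top:
  assumes c: "composable P x ys" and p: "\<sigma> permutes {..<length ys}" and r: "respects_gam x ys"
  shows "respects_gam (Act P x \<sigma>) (permute_list \<sigma> ys)"
proof -
  let ?ys = "permute_list \<sigma> ys" and ?x = "Act P x \<sigma>"
  let ?s = "block_perm \<sigma> (map (\<lambda>y. length (Inp P y)) ?ys)"
  note g = gam_arr[OF c]
  have l: "Inp P x = map (Out P) ys" using c by (simp add: composable_def)
  have p': "\<sigma> permutes {..<length (Inp P x)}" using p l by simp
  have X: "?x \<in> Ops P" "Inp P ?x = permute_list \<sigma> (Inp P x)" using O.act_ops[OF g(1) p'] by auto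
  have c': "composable P ?x ?ys" using X g(2) p l by (simp add: composable_def permute_list_map)
  note g' = gam_arr[OF c']
  have i: "inps ?ys = permute_list \<sigma> (inps ys)" using p by (simp add: permute_list_map)
  have pi: "\<sigma> permutes {..<length (inps ys)}" using p by simp
  have len: "map length (permute_list \<sigma> (inps ys)) = map (\<lambda>y. length (Inp P y)) ?ys"
    unfolding i[symmetric] by simp
  have G: "Gam P x ys \<in> Ops P" "Inp P (Gam P x ys) = concat (map (Inp P) ys)" using O.gam_ops[OF c] by auto
  have cc: "map car (Inp P (Gam P x ys)) = concat (inps ys)" by (simp add: G map_concat o_def)
  have o: "\<forall>a \<in> set (concat (inps ys)). a \<in> Obj M" using inps_obj[OF g(2)] by auto
  have "sum_list (map (\<lambda>y. length (Inp P y)) ?ys) = length (concat (inps ys))"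
    by (metis len length_concat mset_map mset_permute_list pi sum_mset_sum_list)
  then have s: "?s permutes {..<length (concat (inps ys))}"
    using block_perm_permutes[of \<sigma> "map (\<lambda>y. length (Inp P y)) ?ys"] p by simp
  then have s': "?s permutes {..<length (Inp P (Gam P x ys))}" unfolding cc[symmetric] by simp
  have pb: "permute_list ?s (concat (inps ys)) = concat (inps ?ys)"
    unfolding len[symmetric] i by (rule permute_block) (use p in simp)
  note sp = tens_perm_arr[OF o s, unfolded pb]
  have tc: "tens_concat M (inps ?ys) \<in> Arr M" "Dom M (tens_concat M (inps ?ys)) = T (map T (inps ?ys))"
    "Cod M (tens_concat M (inps ?ys)) = T (concat (inps ?ys))"
    by (rule tens_concat_arr; rule inps_obj; rule g')+
  have tc': "tens_concat M (inps ys) \<in> Arr M" "Dom M (tens_concat M (inps ys)) = T (map T (inps ys))"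
    "Cod M (tens_concat M (inps ys)) = T (concat (inps ys))"
    by (rule tens_concat_arr; rule inps_obj; rule g)+
  have oT: "\<forall>a \<in> set (map T (inps ys)). a \<in> Obj M" using g(2) O.inp_color by auto
  have pT: "\<sigma> permutes {..<length (map T (inps ys))}" using p by simp
  let ?p = "tens_perm M \<sigma> (map T (inps ys))"
  have pq: "permute_list \<sigma> (map T (inps ys)) = map T (inps ?ys)" unfolding i by (rule permute_list_map) (rule pi)
  note P = tens_perm_arr[OF oT pT, unfolded pq]
  have 1: "tens_perm M ?s (concat (inps ys)) \<cdot> tens_concat M (inps ys) = tens_concat M (inps ?ys) \<cdot> ?p"
    unfolding len[symmetric] i by (rule tens_perm_concat_top) (use inps_obj[OF g(2)] p in auto)
  have 2: "ao (Gam P ?x ?ys) \<cdot> tens_perm M ?s (concat (inps ys)) = ao (Gam P x ys)"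
    using ao_act[OF G(1) s'] O.equivariance_top[OF c p] cc by simp
  have 3: "tens_arr M (map ao ?ys) \<cdot> ?p = tens_perm M \<sigma> (map car (Inp P x)) \<cdot> tens_arr M (map ao ys)"
  proof -
    have a: "\<forall>f \<in> set (map ao ys). f \<in> Arr M" using g(2) by auto
    have "map (Dom M) (map ao ys) = map T (inps ys)" "map (Cod M) (map ao ys) = map car (Inp P x)"
      using g(2) by (auto simp: l)
    then show ?thesis using tens_perm_nat[OF a, of \<sigma>] p by (simp add: permute_list_map del: map_map)
  qed
  have q: "tens_perm M \<sigma> (map car (Inp P x)) \<in> Arr M" "Dom M (tens_perm M \<sigma> (map car (Inp P x))) = T (map car (Inp P x))"
    "Cod M (tens_perm M \<sigma> (map car (Inp P x))) = T (map car (Inp P ?x))"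
    using tens_perm_arr[of "map car (Inp P x)" \<sigma>] g(1) p' by (auto simp: X(2) permute_list_map)
  have "(ao (Gam P ?x ?ys) \<cdot> tens_concat M (inps ?ys)) \<cdot> ?p = ao (Gam P ?x ?ys) \<cdot> (tens_perm M ?s (concat (inps ys)) \<cdot> tens_concat M (inps ys))"
    unfolding 1 using g'(3,4) tc P by (intro comp_assoc') simp_all
  also have "\<dots> = (ao (Gam P ?x ?ys) \<cdot> tens_perm M ?s (concat (inps ys))) \<cdot> tens_concat M (inps ys)"
    using g'(3,4) tc' sp by (intro comp_assoc'[symmetric]) simp_all
  also have "\<dots> = ao x \<cdot> tens_arr M (map ao ys)"
    unfolding 2 using r by (simp add: respects_gam_def)
  also have "\<dots> = (ao ?x \<cdot> tens_perm M \<sigma> (map car (Inp P x))) \<cdot> tens_arr M (map ao ys)"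
    by (simp only: ao_act[OF g(1) p'])
  also have "\<dots> = ao ?x \<cdot> (tens_perm M \<sigma> (map car (Inp P x)) \<cdot> tens_arr M (map ao ys))"
    using g(6-8) X q by (intro comp_assoc') simp_all
  also have "\<dots> = (ao ?x \<cdot> tens_arr M (map ao ?ys)) \<cdot> ?p"
    unfolding 3[symmetric] using g'(6-8) X P by (intro comp_assoc'[symmetric]) simp_all
  finally have "ao (Gam P ?x ?ys) \<cdot> tens_concat M (inps ?ys) = ao ?x \<cdot> tens_arr M (map ao ?ys)"
    by (rule iso_epi) (use P g' X tc in simp_all)
  then show ?thesis by (simp add: respects_gam_def)
qed

end

lemma mk_cat_sel [simp]:
  "Obj (mk_cat X H i c) = X"
  "(a, h, b) \<in> Arr (mk_cat X H i c) \<longleftrightarrow> a \<in> X \<and> b \<in> X \<and> h \<in> H a b"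
  "Dom (mk_cat X H i c) (a, h, b) = a"
  "Cod (mk_cat X H i c) (a, h, b) = b"
  "Id (mk_cat X H i c) a = (a, i a, a)"
  "Comp (mk_cat X H i c) (a', g, b') (a, h, b) = (a, c g h, b')"
  by (simp_all add: mk_cat_def)

lemma mk_cat_homE:
  assumes "p \<in> hom (mk_cat X H i c) a b"
  obtains h where "p = (a, h, b)" "a \<in> X" "b \<in> X" "h \<in> H a b"
  using assms by (cases p) (auto simp: hom_def)

lemma mk_cat_hom [simp]:
  "(a, h, b) \<in> hom (mk_cat X H i c) a' b' \<longleftrightarrow> a = a' \<and> b = b' \<and> a \<in> X \<and> b \<in> X \<and> h \<in> H a b"
  by (auto simp: hom_def)

text \<open>Operations with identity permutations are closed under composition, so that for them the
  composition axiom involves no symmetry.\<close>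

lemma as_comp_id: "as_comp id ks (map (\<lambda>_. id) ks) = id"
proof
  fix p show "as_comp id ks (map (\<lambda>_. id) ks) p = id p"
  proof (cases "p < sum_list ks")
    case True
    then obtain i j where "i < length ks" "j < ks ! i" "p = block_off ks i + j" by (rule off_cases)
    then show ?thesis using block_perm_off[of id ks i j] by (simp add: as_comp_def sum_perm_off permutes_id inv_id)
  qed (simp add: as_comp_def sum_perm_def block_perm_def)
qed

section \<open>From diagrams of monoids to algebras over the operad of the category\<close>

locale monoid_diagram = symmetric_monoidal_category M + C: category C
  for M :: "('o, 'm, 'z) smc_scheme" (structure) and C :: "('c, 'k, 'y) cat_scheme" +
  fixes F :: "('c, 'k, ('o, 'm) mon, ('o, 'm) mon \<times> 'm \<times> ('o, 'm) mon) fctr"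
  assumes diagram: "is_functor C (Mon M) F"
begin

abbreviation "car c \<equiv> Car (FO F c)"
abbreviation "mul c \<equiv> Mul (FO F c)"
abbreviation "one c \<equiv> One (FO F c)"
abbreviation "ar f \<equiv> mon_arr (FM F f)"

lemma is_mon_FO: "c \<in> Obj C \<Longrightarrow> is_mon M (FO F c)"
  using diagram by (auto simp: is_functor_def Mon_def)

lemma FM_eq:
  assumes "f \<in> Arr C"
  shows "FM F f = (FO F (Dom C f), ar f, FO F (Cod C f))" "ar f \<in> mon_hom M (FO F (Dom C f)) (FO F (Cod C f))"
proof -
  have "FM F f \<in> hom (Mon M) (FO F (Dom C f)) (FO F (Cod C f))" using diagram assms by (simp add: is_functor_def)
  then show "FM F f = (FO F (Dom C f), ar f, FO F (Cod C f))" "ar f \<in> mon_hom M (FO F (Dom C f)) (FO F (Cod C f))"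
    unfolding Mon_def by (auto elim!: mk_cat_homE simp: mon_arr_def)
qed

lemma monoid_arr [simp]:
  assumes "c \<in> Obj C"
  shows "car c \<in> Obj M"
    "mul c \<in> Arr M" "Dom M (mul c) = car c \<otimes> car c" "Cod M (mul c) = car c"
    "one c \<in> Arr M" "Dom M (one c) = unit" "Cod M (one c) = car c"
  using is_mon_FO[OF assms] by (auto simp: is_mon_def hom_iff)

lemma monoid_laws:
  assumes "c \<in> Obj C"
  shows "mul c \<cdot> (mul c \<odot> Id M (car c)) = mul c \<cdot> (Id M (car c) \<odot> mul c) \<cdot> Assoc M (car c) (car c) (car c)"
    "mul c \<cdot> (one c \<odot> Id M (car c)) = LUnit M (car c)"
    "mul c \<cdot> (Id M (car c) \<odot> one c) = RUnit M (car c)"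
  using is_mon_FO[OF assms] by (auto simp: is_mon_def)

lemma ar_arr [simp]:
  assumes "f \<in> Arr C"
  shows "ar f \<in> Arr M" "Dom M (ar f) = car (Dom C f)" "Cod M (ar f) = car (Cod C f)"
  using FM_eq(2)[OF assms] by (auto simp: mon_hom_def hom_iff)

lemma ar_mul:
  assumes "f \<in> Arr C"
  shows "ar f \<cdot> mul (Dom C f) = mul (Cod C f) \<cdot> (ar f \<odot> ar f)" "ar f \<cdot> one (Dom C f) = one (Cod C f)"
  using FM_eq(2)[OF assms] by (auto simp: mon_hom_def)

lemma ar_id [simp]: "c \<in> Obj C \<Longrightarrow> ar (Id C c) = Id M (car c)"
  using diagram by (simp add: is_functor_def Mon_def mon_arr_def)

lemma ar_comp:
  assumes "f \<in> Arr C" "g \<in> Arr C" "Cod C f = Dom C g"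
  shows "ar (Comp C g f) = ar g \<cdot> ar f"
proof -
  have "FM F (Comp C g f) = Comp (Mon M) (FM F g) (FM F f)" using diagram assms by (simp add: is_functor_def)
  moreover have "mon_arr (Comp (Mon M) p q) = mon_arr p \<cdot> mon_arr q" for p q
    by (cases p; cases q) (simp add: Mon_def mon_arr_def)
  ultimately show ?thesis by simp
qed

primrec bigmul :: "'c \<Rightarrow> 'k list \<Rightarrow> 'm" where
  "bigmul t [] = one t"
| "bigmul t (f # fs) = mul t \<cdot> (ar f \<odot> bigmul t fs)"

abbreviation "into t fs \<equiv> \<forall>f \<in> set fs. f \<in> Arr C \<and> Cod C f = t"
abbreviation "dm fs \<equiv> map (\<lambda>f. car (Dom C f)) fs"

lemma bigmul_arr [simp]:
  assumes "t \<in> Obj C" "into t fs"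
  shows "bigmul t fs \<in> Arr M" "Dom M (bigmul t fs) = T (dm fs)" "Cod M (bigmul t fs) = car t"
  using assms by (induction fs) auto

text \<open>Generalised associativity: the left unit law starts the induction, and each further
  factor costs one use of associativity.\<close>

lemma bigmul_append:
  assumes [simp]: "t \<in> Obj C" and "into t fs" and g: "into t gs"
  shows "bigmul t (fs @ gs) \<cdot> app (dm fs) (dm gs) = mul t \<cdot> (bigmul t fs \<odot> bigmul t gs)"
  using assms(2)
proof (induction fs)
  case Nil
  let ?g = "bigmul t gs"
  have [simp]: "?g \<in> Arr M" "Dom M ?g = T (dm gs)" "Cod M ?g = car t" using bigmul_arr[OF assms(1) g] by auto
  have "?g \<cdot> LUnit M (T (dm gs)) = LUnit M (car t) \<cdot> (Id M unit \<odot> ?g)" using lunit_nat[of ?g] by simp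
  also have "\<dots> = mul t \<cdot> (one t \<odot> ?g)" by (simp add: monoid_laws(2)[symmetric] merge)
  finally show ?case by simp
next
  case (Cons f fs)
  have f [simp]: "f \<in> Arr C" "Cod C f = t" "into t fs" using Cons.prems by auto
  let ?f = "bigmul t fs" and ?g = "bigmul t gs" and ?fg = "bigmul t (fs @ gs)"
  have t [simp]: "?f \<in> Arr M" "Dom M ?f = T (dm fs)" "Cod M ?f = car t"
    "?g \<in> Arr M" "Dom M ?g = T (dm gs)" "Cod M ?g = car t"
    "?fg \<in> Arr M" "Dom M ?fg = T (dm fs @ dm gs)" "Cod M ?fg = car t"
    using bigmul_arr[OF assms(1) g] bigmul_arr[OF assms(1) f(3)] bigmul_arr[OF assms(1), of "fs @ gs"] f(3) g by auto
  have [simp]: "\<forall>x \<in> set (dm fs). x \<in> Obj M" "\<forall>x \<in> set (dm gs). x \<in> Obj M" using f(3) g by auto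
  have a: "app (dm fs) (dm gs) \<in> Arr M" "Dom M (app (dm fs) (dm gs)) = T (dm fs) \<otimes> T (dm gs)" "Cod M (app (dm fs) (dm gs)) = T (dm fs @ dm gs)"
    "T (dm fs) \<in> Obj M" "T (dm gs) \<in> Obj M"
    by simp_all
  note [simp] = a
  have "bigmul t ((f # fs) @ gs) \<cdot> app (dm (f # fs)) (dm gs) =
    mul t \<cdot> (ar f \<odot> (?fg \<cdot> app (dm fs) (dm gs))) \<cdot> Assoc M (car (Dom C f)) (T (dm fs)) (T (dm gs))"
    by (simp add: merge)
  also have "\<dots> = mul t \<cdot> (Id M (car t) \<odot> mul t) \<cdot> (ar f \<odot> (?f \<odot> ?g)) \<cdot> Assoc M (car (Dom C f)) (T (dm fs)) (T (dm gs))"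
    by (simp add: merge Cons.IH)
  also have "\<dots> = (mul t \<cdot> (Id M (car t) \<odot> mul t) \<cdot> Assoc M (car t) (car t) (car t)) \<cdot> ((ar f \<odot> ?f) \<odot> ?g)"
    using assoc_nat[of "ar f" ?f ?g] by simp
  also have "\<dots> = mul t \<cdot> (bigmul t (f # fs) \<odot> ?g)"
    by (simp add: monoid_laws(1)[symmetric] merge)
  finally show ?case .
qed

text \<open>\<open>ar f\<close> is a morphism of monoids, so it passes through the unit and through
  each multiplication.\<close>

lemma bigmul_post:
  assumes [simp]: "f \<in> Arr C" and "into (Dom C f) gs"
  shows "bigmul (Cod C f) (map (Comp C f) gs) = ar f \<cdot> bigmul (Dom C f) gs"
  using assms(2)
proof (induction gs)
  case Nil then show ?case by (simp add: ar_mul)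
next
  case (Cons g gs)
  then have [simp]: "g \<in> Arr C" "Cod C g = Dom C f" "into (Dom C f) gs" by auto
  let ?g = "bigmul (Dom C f) gs"
  have [simp]: "?g \<in> Arr M" "Dom M ?g = T (dm gs)" "Cod M ?g = car (Dom C f)"
    using bigmul_arr[of "Dom C f" gs] by auto
  have "bigmul (Cod C f) (map (Comp C f) (g # gs)) = mul (Cod C f) \<cdot> (ar f \<odot> ar f) \<cdot> (ar g \<odot> ?g)"
    using Cons by (simp add: ar_comp merge)
  also have "\<dots> = ar f \<cdot> bigmul (Dom C f) (g # gs)" by (simp add: ar_mul(1)[symmetric] flip: comp_assoc')
  finally show ?case .
qed

lemma dm_obj: "into t fs \<Longrightarrow> \<forall>x \<in> set (dm fs). x \<in> Obj M"
  by auto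

text \<open>This is the composition axiom for identity permutations. \<open>bigmul_post\<close>
  absorbs an outer arrow into its block, and \<open>bigmul_append\<close> joins the block to the
  rest.\<close>

lemma bigmul_concat:
  assumes [simp]: "t \<in> Obj C" and "list_all2 (\<lambda>f gs. f \<in> Arr C \<and> Cod C f = t \<and> into (Dom C f) gs) fs gss"
  shows "bigmul t (concat (map2 (\<lambda>f. map (Comp C f)) fs gss)) \<cdot> tens_concat M (map dm gss) =
    bigmul t fs \<cdot> tens_arr M (map2 (\<lambda>f. bigmul (Dom C f)) fs gss)"
  using assms(2)
proof (induction rule: list_all2_induct)
  case Nil then show ?case by simp
next
  case (Cons f fs gs gss)
  let ?h = "map2 (\<lambda>f. map (Comp C f)) fs gss" and ?b = "map2 (\<lambda>f. bigmul (Dom C f)) fs gss"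
  have f [simp]: "f \<in> Arr C" "Cod C f = t" and gs: "into (Dom C f) gs" using Cons(1) by auto
  have fs: "into t fs" using Cons(2) by (induction rule: list_all2_induct) auto
  have gss: "\<forall>gs \<in> set gss. \<exists>t. into t gs" using Cons(2) by (induction rule: list_all2_induct) auto
  have h: "into t (concat ?h) \<and> dm (concat ?h) = concat (map dm gss)" using Cons(2)
    by (induction rule: list_all2_induct) (auto simp: o_def)
  have b: "(\<forall>g \<in> set ?b. g \<in> Arr M) \<and> map (Dom M) ?b = map T (map dm gss) \<and> map (Cod M) ?b = dm fs" using Cons(2)
    by (induction rule: list_all2_induct) auto
  have tb: "tens_arr M ?b \<in> Arr M" "Dom M (tens_arr M ?b) = T (map T (map dm gss))" "Cod M (tens_arr M ?b) = T (dm fs)"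
    using tens_arr_arr[of ?b] b by (simp_all del: map_map)
  have o: "\<forall>xs \<in> set (map dm gss). \<forall>x \<in> set xs. x \<in> Obj M" using gss by fastforce
  have tc: "tens_concat M (map dm gss) \<in> Arr M" "Dom M (tens_concat M (map dm gss)) = T (map T (map dm gss))"
    "Cod M (tens_concat M (map dm gss)) = T (concat (map dm gss))" by (rule tens_concat_arr; rule o)+
  have oc: "\<forall>x \<in> set (concat (map dm gss)). x \<in> Obj M" using o by auto
  have hm: "into t (map (Comp C f) gs)" "dm (map (Comp C f) gs) = dm gs" using gs by auto
  have og: "\<forall>x \<in> set (dm gs). x \<in> Obj M" using gs by auto
  note ap = app_arr[OF og oc]
  let ?g = "bigmul (Dom C f) gs" and ?f = "bigmul t fs" and ?H = "bigmul t (concat ?h)"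
  have g: "?g \<in> Arr M" "Dom M ?g = T (dm gs)" "Cod M ?g = car (Dom C f)" using bigmul_arr[OF _ gs] by auto
  have F: "?f \<in> Arr M" "Dom M ?f = T (dm fs)" "Cod M ?f = car t" using bigmul_arr[OF assms(1) fs] by auto
  have H: "?H \<in> Arr M" "Dom M ?H = T (concat (map dm gss))" "Cod M ?H = car t" using bigmul_arr[OF assms(1) conjunct1[OF h]] h by auto
  have 1: "bigmul t (map (Comp C f) gs @ concat ?h) \<cdot> app (dm gs) (concat (map dm gss)) = mul t \<cdot> ((ar f \<cdot> ?g) \<odot> ?H)"
    using bigmul_append[OF assms(1) hm(1) conjunct1[OF h]] bigmul_post[OF f(1) gs] unfolding hm(2) conjunct2[OF h] f(2) by (simp only:)
  have L: "bigmul t (map (Comp C f) gs @ concat ?h) \<in> Arr M" "Dom M (bigmul t (map (Comp C f) gs @ concat ?h)) = T (dm gs @ concat (map dm gss))"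
    "Cod M (bigmul t (map (Comp C f) gs @ concat ?h)) = car t"
  proof -
    have "into t (map (Comp C f) gs @ concat ?h)" 
      unfolding set_append ball_Un by (rule conjI[OF hm(1) conjunct1[OF h]])
    note b = bigmul_arr[OF assms(1) this]
    have "dm (map (Comp C f) gs @ concat ?h) = dm gs @ concat (map dm gss)" by (simp only: map_append hm(2) h)
    then show "bigmul t (map (Comp C f) gs @ concat ?h) \<in> Arr M" "Dom M (bigmul t (map (Comp C f) gs @ concat ?h)) = T (dm gs @ concat (map dm gss))"
      "Cod M (bigmul t (map (Comp C f) gs @ concat ?h)) = car t" using b by (simp_all only:)
  qed
  have "bigmul t (concat (map2 (\<lambda>f. map (Comp C f)) (f # fs) (gs # gss))) \<cdot> tens_concat M (map dm (gs # gss)) =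
    (bigmul t (map (Comp C f) gs @ concat ?h) \<cdot> app (dm gs) (concat (map dm gss))) \<cdot> (Id M (T (dm gs)) \<odot> tens_concat M (map dm gss))"
    using L ap tc T_obj[OF og] by simp
  also have "\<dots> = mul t \<cdot> ((ar f \<cdot> ?g) \<odot> (?H \<cdot> tens_concat M (map dm gss)))"
    unfolding 1 using g H tc T_obj[OF og] by (simp add: merge)
  also have "\<dots> = mul t \<cdot> ((ar f \<cdot> ?g) \<odot> (?f \<cdot> tens_arr M ?b))" unfolding Cons(3) ..
  also have "\<dots> = bigmul t (f # fs) \<cdot> tens_arr M (map2 (\<lambda>f. bigmul (Dom C f)) (f # fs) (gs # gss))"
    using g F tb by (simp add: merge)
  finally show ?case .
qed

text \<open>The action axiom forces this formula: \<open>(t, \<sigma>, fs)\<close> is \<open>(t, id, permute_list (inv \<sigma>) fs)\<close> acted on by \<open>\<sigma>\<close>.\<close>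
definition fun_op :: "('c, 'k) cat_op \<Rightarrow> 'm" where
  "fun_op = (\<lambda>(t, \<sigma>, fs). bigmul t (permute_list (inv \<sigma>) fs) \<cdot> tens_perm M (inv \<sigma>) (dm fs))"

lemma fun_op_id: "t \<in> Obj C \<Longrightarrow> into t fs \<Longrightarrow> fun_op (t, id, fs) = bigmul t fs"
  using dm_obj[of fs t] bigmul_arr[of t fs] by (simp add: fun_op_def inv_id)

text \<open>Equivariance holds by the design of \<open>fun_op\<close>: inverting
  \<open>\<sigma> \<circ> \<tau>\<close> produces \<open>inv \<tau> \<circ> inv \<sigma>\<close>,
  whose \<open>inv \<tau>\<close> cancels the \<open>\<tau>\<close> of the action, in the list of
  arrows (fact 1) and in the symmetry (fact 2).\<close>

sublocale act: operad_action M "cat_operad C" car fun_op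
proof (intro_locales, rule C.cat_operad, unfold_locales)
  show "c \<in> Colors (cat_operad C) \<Longrightarrow> car c \<in> Obj M" for c by simp
next
  fix x assume x: "x \<in> Ops (cat_operad C)"
  obtain t \<sigma> fs where [simp]: "x = (t, \<sigma>, fs)" by (cases x)
  have t: "t \<in> Obj C" "\<sigma> permutes {..<length fs}" "into t fs" using x by auto
  have i: "inv \<sigma> permutes {..<length fs}" "inv \<sigma> permutes {..<length (dm fs)}" using t permutes_inv by auto
  have "into t (permute_list (inv \<sigma>) fs)" using t(3) i(1) by simp
  note b = bigmul_arr[OF t(1) this]
  note p = tens_perm_arr[OF dm_obj[OF t(3)] i(2)]
  show "fun_op x \<in> hom M (T (map car (Inp (cat_operad C) x))) (car (Out (cat_operad C) x))"
    using b p i by (simp add: hom_iff fun_op_def permute_list_map o_def)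
  fix \<tau> assume "\<tau> permutes {..<length (Inp (cat_operad C) x)}"
  then have \<tau>: "\<tau> permutes {..<length fs}" "\<tau> permutes {..<length (dm fs)}" by auto
  have bij: "bij \<sigma>" "bij \<tau>" using t \<tau> permutes_bij by auto
  have iv: "inv (\<sigma> \<circ> \<tau>) = inv \<tau> \<circ> inv \<sigma>" using bij by (rule o_inv_distrib)
  have st: "inv \<tau> \<circ> inv \<sigma> permutes {..<length fs}" using i(1) permutes_inv[OF \<tau>(1)] by (rule permutes_compose)
  have \<tau>\<tau>: "\<tau> \<circ> (inv \<tau> \<circ> inv \<sigma>) = inv \<sigma>" using permutes_inv_o(1)[OF \<tau>(1)] by (simp add: o_assoc)
  have 1: "permute_list (inv \<tau> \<circ> inv \<sigma>) (permute_list \<tau> fs) = permute_list (inv \<sigma>) fs"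
    using permute_list_compose[OF st, of \<tau>] \<tau>\<tau> by simp
  have 2: "tens_perm M (inv \<tau> \<circ> inv \<sigma>) (permute_list \<tau> (dm fs)) \<cdot> tens_perm M \<tau> (dm fs) = tens_perm M (inv \<sigma>) (dm fs)"
    using tens_perm_comp[OF dm_obj[OF t(3)] \<tau>(2), of "inv \<tau> \<circ> inv \<sigma>"] st \<tau>\<tau> by simp
  have 3: "dm (permute_list \<tau> fs) = permute_list \<tau> (dm fs)" using \<tau> by (simp add: permute_list_map)
  note p2 = tens_perm_arr[OF dm_obj[OF t(3)] \<tau>(2)]
  have o4: "\<forall>x \<in> set (permute_list \<tau> (dm fs)). x \<in> Obj M" using dm_obj[OF t(3)] \<tau>(2) by simp
  have s4: "inv \<tau> \<circ> inv \<sigma> permutes {..<length (permute_list \<tau> (dm fs))}" using st by simp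
  note p3 = tens_perm_arr[OF o4 s4]
  have "permute_list (inv \<tau> \<circ> inv \<sigma>) (permute_list \<tau> (dm fs)) = dm (permute_list (inv \<sigma>) fs)"
    unfolding 1[symmetric] using \<tau> st by (simp add: permute_list_map 3[symmetric])
  note p3 = p3[unfolded this]
  have m: "map car (Inp (cat_operad C) x) = dm fs" by (simp add: o_def)
  have "fun_op (Act (cat_operad C) x \<tau>) \<cdot> tens_perm M \<tau> (map car (Inp (cat_operad C) x)) =
    (bigmul t (permute_list (inv \<sigma>) fs) \<cdot> tens_perm M (inv \<tau> \<circ> inv \<sigma>) (permute_list \<tau> (dm fs))) \<cdot> tens_perm M \<tau> (dm fs)"
    unfolding m \<open>x = _\<close> cat_operad_sel fun_op_def case_prod_conv iv 1 3 by (simp add: comp_def)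
  also have "\<dots> = bigmul t (permute_list (inv \<sigma>) fs) \<cdot> tens_perm M (inv \<tau> \<circ> inv \<sigma>) (permute_list \<tau> (dm fs)) \<cdot> tens_perm M \<tau> (dm fs)"
    using b p2 p3 by (intro comp_assoc') simp_all
  also have "\<dots> = fun_op x" unfolding 2 by (simp add: fun_op_def)
  finally show "fun_op (Act (cat_operad C) x \<tau>) \<cdot> tens_perm M \<tau> (map car (Inp (cat_operad C) x)) = fun_op x" .
qed

abbreviation (input) "arrows y \<equiv> snd (snd y)"

lemma respects_gam_id:
  assumes c: "composable (cat_operad C) (t, id, fs) ys" and ids: "\<forall>y \<in> set ys. prm3 y = id"
  shows "act.respects_gam (t, id, fs) ys"
proof -
  let ?P = "cat_operad C"
  note cc = comp_cat[OF c]
  have t: "t \<in> Obj C" "into t fs" using c by (auto simp: composable_def)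
  have y: "ys ! i = (Dom C (fs ! i), id, arrows (ys ! i))" "into (Dom C (fs ! i)) (arrows (ys ! i))" "Dom C (fs ! i) \<in> Obj C"
    if "i < length ys" for i
  proof -
    obtain a b gs where e: "ys ! i = (a, b, gs)" by (cases "ys ! i")
    have "prm3 (ys ! i) = id" using ids nth_mem[OF that] by (rule bspec)
    then have "b = id" by (simp add: e)
    then show "ys ! i = (Dom C (fs ! i), id, arrows (ys ! i))" "into (Dom C (fs ! i)) (arrows (ys ! i))" "Dom C (fs ! i) \<in> Obj C"
      using cc(2,3)[of i] that e cc(1) by auto
  qed
  let ?gss = "map (\<lambda>y. arrows y) ys"
  have p: "map2 (post C) fs ys = map2 (\<lambda>f. map (Comp C f)) fs ?gss"
    using cc(1) by (intro nth_equalityI) (auto simp: split_def)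
  have ks: "map prm3 ys = map (\<lambda>_. id) (map len3 ys)" using ids by auto
  have G: "Gam ?P (t, id, fs) ys = (t, id, concat (map2 (\<lambda>f. map (Comp C f)) fs ?gss))"
    unfolding cat_operad_sel ks as_comp_id p ..
  have g: "Gam ?P (t, id, fs) ys \<in> Ops ?P" by (rule conjunct1[OF act.O.gam_ops[OF c]])
  have gi: "into t (concat (map2 (\<lambda>f. map (Comp C f)) fs ?gss))"
    using g unfolding G unfolding cat_operad_sel(2) by (elim conjE)
  have l: "list_all2 (\<lambda>f gs. f \<in> Arr C \<and> Cod C f = t \<and> into (Dom C f) gs) fs ?gss"
    unfolding list_all2_conv_all_nth
  proof (intro conjI allI impI)
    fix i assume i: "i < length fs"
    then have "fs ! i \<in> set fs" by simp
    then show "fs ! i \<in> Arr C" "Cod C (fs ! i) = t" using t(2) by auto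
    show "into (Dom C (fs ! i)) (map (\<lambda>y. arrows y) ys ! i)" using y(2)[of i] i cc(1) by simp
  qed (use cc(1) in simp)
  have i: "act.inps ys = map dm ?gss"
  proof (rule nth_equalityI)
    fix i assume "i < length (act.inps ys)"
    then have "i < length ys" by simp
    then show "act.inps ys ! i = map dm ?gss ! i" using y(1)[of i] by (cases "ys ! i") (simp add: o_def)
  qed simp
  have a: "map fun_op ys = map2 (\<lambda>f. bigmul (Dom C f)) fs ?gss"
  proof (rule nth_equalityI)
    fix i assume "i < length (map fun_op ys)"
    then have il: "i < length ys" by simp
    have "fun_op (ys ! i) = bigmul (Dom C (fs ! i)) (arrows (ys ! i))"
      by (subst y(1)[OF il]) (rule fun_op_id[OF y(3)[OF il] y(2)[OF il]])
    then show "map fun_op ys ! i = map2 (\<lambda>f. bigmul (Dom C f)) fs ?gss ! i" using il cc(1) by simp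
  qed (use cc(1) in simp)
  show ?thesis unfolding act.respects_gam_def i a G fun_op_id[OF t(1) gi] fun_op_id[OF t]
    by (rule bigmul_concat[OF t(1) l])
qed

text \<open>Every operation is one with identity permutation acted on by its permutation. Starting
  from \<open>respects_gam_id\<close>, the inner permutations are restored by
  \<open>respects_gam_bottom\<close> and the outer one by \<open>respects_gam_top\<close>.\<close>

lemma respects_gam:
  assumes c: "composable (cat_operad C) x ys"
  shows "act.respects_gam x ys"
proof -
  let ?P = "cat_operad C"
  obtain t \<sigma> fs where x: "x = (t, \<sigma>, fs)" by (cases x)
  note cc = comp_cat[OF c[unfolded x]]
  have t: "t \<in> Obj C" "\<sigma> permutes {..<length fs}" "into t fs" using c by (auto simp: composable_def x)
  have \<sigma>: "\<sigma> permutes {..<length ys}" "inv \<sigma> permutes {..<length ys}" "inv \<sigma> permutes {..<length fs}"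
    using t cc(1) permutes_inv by auto
  let ?x = "(t, id, permute_list (inv \<sigma>) fs)"
  \<comment> \<open>The inputs are listed in the order matching \<open>?x\<close>; restoring
    \<open>\<sigma>\<close> at the end permutes this list back to \<open>ys\<close>.\<close>
  let ?ys = "permute_list (inv \<sigma>) ys"
  let ?z = "\<lambda>(t', \<sigma>', gs). (t', id, permute_list (inv \<sigma>') gs)"
  let ?zs = "map ?z ?ys"
  have inv1: "permute_list \<tau> (permute_list (inv \<tau>) xs) = xs" if "\<tau> permutes {..<length xs}" for \<tau> and xs :: "'d list"
    using permute_list_compose[OF that, of "inv \<tau>"] permutes_inv_o(2)[OF that] by simp
  have ysO: "set ys \<subseteq> Ops ?P" using c by (simp add: composable_def)
  have ysO': "set ?ys \<subseteq> Ops ?P" using ysO \<sigma> by simp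
  have z: "?z y \<in> Ops ?P" "Act ?P (?z y) (prm3 y) = y" "Out ?P (?z y) = Out ?P y" "prm3 y permutes {..<length (Inp ?P (?z y))}"
    "prm3 (?z y) = id" if "y \<in> Ops ?P" for y
  proof -
    obtain a b gs where e: "y = (a, b, gs)" by (cases y)
    have b: "b permutes {..<length gs}" using that e by simp
    show "?z y \<in> Ops ?P" "Act ?P (?z y) (prm3 y) = y" "Out ?P (?z y) = Out ?P y" "prm3 y permutes {..<length (Inp ?P (?z y))}"
      "prm3 (?z y) = id"
      using that b permutes_inv[OF b] inv1[OF b] by (auto simp: e permutes_id)
  qed
  have cx: "composable ?P ?x ?zs"
    unfolding composable_def
  proof (intro conjI)
    show "?x \<in> Ops ?P" using t \<sigma> by (simp add: permutes_id)
    show "set ?zs \<subseteq> Ops ?P" using z(1) ysO' by auto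
    have "map (Dom C) fs = map (Out ?P) ys" using c by (simp add: composable_def x)
    then have "permute_list (inv \<sigma>) (map (Dom C) fs) = permute_list (inv \<sigma>) (map (Out ?P) ys)" by simp
    then have "map (Dom C) (permute_list (inv \<sigma>) fs) = map (Out ?P) ?ys" using \<sigma> by (simp add: permute_list_map)
    moreover have "map (Out ?P) ?zs = map (Out ?P) ?ys" using z(3) ysO' by auto
    ultimately show "Inp ?P ?x = map (Out ?P) ?zs" by simp
  qed
  have "act.respects_gam ?x ?zs"
    by (rule respects_gam_id[OF cx]) (use z(5) ysO' in auto)
  then have 1: "act.respects_gam ?x (map2 (Act ?P) ?zs (map prm3 ?ys))"
    by (rule act.respects_gam_bottom[OF cx, rotated])
      (unfold list_all2_map1 list_all2_map2 list_all2_same, use z(4) ysO' in blast)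
  have 2: "map2 (Act ?P) ?zs (map prm3 ?ys) = ?ys"
  proof -
    have "map2 (Act ?P) (map ?z qs) (map prm3 qs) = map (\<lambda>y. Act ?P (?z y) (prm3 y)) qs" for qs
      by (induction qs) simp_all
    also have "map (\<lambda>y. Act ?P (?z y) (prm3 y)) ?ys = ?ys" by (rule map_idI, rule z(2)) (use ysO' in blast)
    finally show ?thesis .
  qed
  have "composable ?P ?x ?ys"
  proof -
    have "map (Out ?P) ?zs = map (Out ?P) ?ys" using z(3) ysO' by auto
    then show ?thesis using cx ysO' by (simp add: composable_def)
  qed
  from act.respects_gam_top[OF this _ 1[unfolded 2], of \<sigma>] \<sigma>
  have "act.respects_gam (Act ?P ?x \<sigma>) (permute_list \<sigma> ?ys)" by simp
  then show ?thesis using inv1[OF t(2)] inv1[OF \<sigma>(1)] by (simp add: x)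
qed

definition diagram_alg :: "('c, ('c, 'k) cat_op, 'o, 'm) alg" where
  "diagram_alg = \<lparr>ACar = (\<lambda>c \<in> Obj C. car c), AOp = (\<lambda>x \<in> Ops (cat_operad C). fun_op x)\<rparr>"

lemma inp_diagram_alg: "x \<in> Ops (cat_operad C) \<Longrightarrow> map (ACar diagram_alg) (Inp (cat_operad C) x) = map car (Inp (cat_operad C) x)"
  using act.O.inp_color[of x] by (auto simp: diagram_alg_def)

theorem is_algebra_diagram_alg: "is_algebra (cat_operad C) M diagram_alg"
  unfolding is_algebra_def
proof (intro conjI ballI allI impI)
  let ?P = "cat_operad C"
  have car: "ACar diagram_alg c = car c" if "c \<in> Obj C" for c using that by (simp add: diagram_alg_def)
  have op: "AOp diagram_alg x = fun_op x" if "x \<in> Ops ?P" for x using that by (simp add: diagram_alg_def)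
  show "ACar diagram_alg \<in> Colors ?P \<rightarrow>\<^sub>E Obj M" by (simp add: diagram_alg_def)
  show "AOp diagram_alg \<in> (\<Pi>\<^sub>E x \<in> Ops ?P. hom M (T (map (ACar diagram_alg) (Inp ?P x))) (ACar diagram_alg (Out ?P x)))"
  proof (rule PiE_I)
    fix x assume x: "x \<in> Ops ?P"
    have "Out ?P x \<in> Obj C" using act.O.out_color[OF x] by simp
    then show "AOp diagram_alg x \<in> hom M (T (map (ACar diagram_alg) (Inp ?P x))) (ACar diagram_alg (Out ?P x))"
      unfolding inp_diagram_alg[OF x] op[OF x] using act.ao_hom[OF x] car by simp
  qed (simp add: diagram_alg_def)
  show "AOp diagram_alg (Act ?P x \<sigma>) \<cdot> tens_perm M \<sigma> (map (ACar diagram_alg) (Inp ?P x)) = AOp diagram_alg x"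
    if "x \<in> Ops ?P" "\<sigma> permutes {..<length (Inp ?P x)}" for x \<sigma>
    unfolding inp_diagram_alg[OF that(1)] op[OF that(1)] op[OF conjunct1[OF act.O.act_ops[OF that]]] by (rule act.ao_act[OF that])
  show "AOp diagram_alg (Gam ?P x ys) \<cdot> tens_concat M (map (\<lambda>y. map (ACar diagram_alg) (Inp ?P y)) ys) =
    AOp diagram_alg x \<cdot> tens_arr M (map (AOp diagram_alg) ys)" if c: "composable ?P x ys" for x ys
  proof -
    have x: "x \<in> Ops ?P" "set ys \<subseteq> Ops ?P" using c by (auto simp: composable_def)
    have 1: "map (\<lambda>y. map (ACar diagram_alg) (Inp ?P y)) ys = act.inps ys"
      by (rule map_cong[OF refl], rule inp_diagram_alg) (use x(2) in blast)
    have 2: "map (AOp diagram_alg) ys = map fun_op ys"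
      by (rule map_cong[OF refl], rule op) (use x(2) in blast)
    show ?thesis unfolding 1 2 op[OF x(1)] op[OF conjunct1[OF act.O.gam_ops[OF c]]]
      using respects_gam[OF c] unfolding act.respects_gam_def .
  qed
  show "AOp diagram_alg (OpUnit ?P c) = RUnit M (ACar diagram_alg c)" if "c \<in> Colors ?P" for c
  proof -
    have c: "c \<in> Obj C" using that by simp
    have "OpUnit ?P c \<in> Ops ?P" using act.O.un_ops[OF that] by blast
    then have "AOp diagram_alg (OpUnit ?P c) = fun_op (c, id, [Id C c])" unfolding op[OF \<open>OpUnit ?P c \<in> Ops ?P\<close>] by simp
    also have "\<dots> = bigmul c [Id C c]" by (rule fun_op_id) (use c in simp_all)
    also have "\<dots> = RUnit M (car c)" using c monoid_laws(3)[OF c] by simp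
    finally show ?thesis using car[OF c] by simp
  qed
qed

text \<open>An equality and not just an isomorphism: the comparison of adjoints asks for a diagram
  that lies strictly in the image of the passage from algebras. Functors are extensional, so their
  values on objects and arrows decide.\<close>

theorem alg_diagram_diagram_alg: "alg_diagram C M diagram_alg = F"
proof -
  let ?P = "cat_operad C"
  have car: "ACar diagram_alg c = car c" if "c \<in> Obj C" for c using that by (simp add: diagram_alg_def)
  have op: "AOp diagram_alg (t, id, fs) = bigmul t fs" if "t \<in> Obj C" "into t fs" for t fs
    using that fun_op_id[OF that] by (simp add: diagram_alg_def permutes_id)
  have m: "alg_monoid C M diagram_alg c = FO F c" if c: "c \<in> Obj C" for c
  proof -
    \<comment> \<open>A binary operation carries an innermost \<open>Id \<odot> one\<close>, which
      the right unit law turns into a right unitor; the inverse unitor in \<open>alg_monoid\<close>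
      cancels it.\<close>
    have "mul c \<cdot> (Id M (car c) \<odot> (mul c \<cdot> (Id M (car c) \<odot> one c))) \<cdot> (Id M (car c) \<odot> inv_arr M (RUnit M (car c))) = mul c"
      unfolding monoid_laws(3)[OF c] using c by (simp add: merge)
    then show ?thesis using c car[OF c] op[OF c] by (simp add: alg_monoid_def)
  qed
  have a: "AOp diagram_alg (Cod C f, id, [f]) \<cdot> inv_arr M (RUnit M (ACar diagram_alg (Dom C f))) = ar f" if f: "f \<in> Arr C" for f
  proof -
    have "AOp diagram_alg (Cod C f, id, [f]) = mul (Cod C f) \<cdot> (ar f \<odot> one (Cod C f))" using f by (simp add: op)
    also have "\<dots> = (mul (Cod C f) \<cdot> (Id M (car (Cod C f)) \<odot> one (Cod C f))) \<cdot> (ar f \<odot> Id M unit)" using f by (simp add: merge)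
    also have "\<dots> = ar f \<cdot> RUnit M (car (Dom C f))" using f runit_nat[of "ar f"] monoid_laws(3)[of "Cod C f"] by simp
    finally show ?thesis using f by (simp add: car)
  qed
  have "FO (alg_diagram C M diagram_alg) = FO F"
    by (rule extensionalityI[of _ "Obj C"]) (use diagram m in \<open>auto simp: alg_diagram_def is_functor_def PiE_def\<close>)
  moreover have "FM (alg_diagram C M diagram_alg) = FM F"
  proof (rule extensionalityI[of _ "Arr C"])
    show "FM F \<in> extensional (Arr C)" using diagram by (auto simp: is_functor_def PiE_def)
    show "FM (alg_diagram C M diagram_alg) f = FM F f" if "f \<in> Arr C" for f
      using that m a FM_eq(1)[OF that] by (simp add: alg_diagram_def)
  qed (simp add: alg_diagram_def)
  ultimately show ?thesis by simp
qed

text \<open>The transposed operation multiplies \<open>g\<close> and \<open>f\<close> after an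
  exchange. By \<open>swap3_runit\<close> and naturality of \<open>Sym\<close> it is the opposite
  multiplication applied to \<open>f\<close> and \<open>g\<close>, up to the same right unitor as
  the untransposed one.\<close>

lemma fun_op_perp:
  assumes "f \<in> Arr C" "g \<in> Arr C" "Cod C f = c" "Cod C g = c"
    and "mul c \<cdot> (ar f \<odot> ar g) = (mul c \<cdot> Sym M (car c) (car c)) \<cdot> (ar f \<odot> ar g)"
  shows "fun_op (c, id, [f, g]) = fun_op (c, transpose 0 1, [f, g])"
proof -
  have c [simp]: "c \<in> Obj C" using assms by auto
  note [simp] = assms(1-4)
  let ?x = "car (Dom C f)" and ?y = "car (Dom C g)"
  have t: "transpose (0::nat) 1 permutes {..<2}" by (rule permutes_swap_id) auto
  have r: "h \<cdot> RUnit M (Dom M h) = mul c \<cdot> (h \<odot> one c)" if "h \<in> Arr M" "Cod M h = car c" for h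
  proof -
    have "mul c \<cdot> (h \<odot> one c) = (mul c \<cdot> (Id M (car c) \<odot> one c)) \<cdot> (h \<odot> Id M unit)" using that by (simp add: merge)
    also have "\<dots> = h \<cdot> RUnit M (Dom M h)" unfolding monoid_laws(3)[OF c] using runit_nat[of h] that by simp
    finally show ?thesis ..
  qed
  have b: "bigmul c [f, g] = mul c \<cdot> (ar f \<odot> ar g) \<cdot> (Id M (car (Dom C f)) \<odot> RUnit M (car (Dom C g)))"
    if "f \<in> Arr C" "g \<in> Arr C" "Cod C f = c" "Cod C g = c" for f g
    using that r[of "ar g"] by (simp add: merge)
  have p: "permute_list (transpose 0 1) [f, g] = [g, f]"
    by (simp add: permute_list_def upt_rec)
  have i: "inv (transpose (0::nat) 1) = transpose 0 1" by simp
  have "fun_op (c, transpose 0 1, [f, g]) = bigmul c [g, f] \<cdot> sw ?x ?y unit"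
    unfolding fun_op_def case_prod_conv i p using tens_perm_transpose[of ?x ?y] by simp
  also have "\<dots> = mul c \<cdot> (ar g \<odot> ar f) \<cdot> Sym M ?x ?y \<cdot> (Id M ?x \<odot> RUnit M ?y)"
    by (simp add: b swap3_runit del: bigmul.simps)
  also have "\<dots> = ((mul c \<cdot> Sym M (car c) (car c)) \<cdot> (ar f \<odot> ar g)) \<cdot> (Id M ?x \<odot> RUnit M ?y)"
    using arg_cong[OF sym_nat[of "ar f" "ar g"], of "\<lambda>h. h \<cdot> (Id M ?x \<odot> RUnit M ?y)"] by simp
  also have "\<dots> = bigmul c [f, g]" unfolding assms(5)[symmetric] by (simp add: b del: bigmul.simps)
  also have "\<dots> = fun_op (c, id, [f, g])" by (rule fun_op_id[symmetric]) auto
  finally show ?thesis ..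
qed

end

section \<open>Categories of monoids, diagrams and algebras\<close>

lemma mk_cat_category:
  assumes "\<And>a. a \<in> X \<Longrightarrow> i a \<in> H a a"
    and "\<And>a b d f g. a \<in> X \<Longrightarrow> b \<in> X \<Longrightarrow> d \<in> X \<Longrightarrow> f \<in> H a b \<Longrightarrow> g \<in> H b d \<Longrightarrow> c g f \<in> H a d"
    and "\<And>a b f. a \<in> X \<Longrightarrow> b \<in> X \<Longrightarrow> f \<in> H a b \<Longrightarrow> c f (i a) = f"
    and "\<And>a b f. a \<in> X \<Longrightarrow> b \<in> X \<Longrightarrow> f \<in> H a b \<Longrightarrow> c (i b) f = f"
    and "\<And>a b d e f g h. a \<in> X \<Longrightarrow> b \<in> X \<Longrightarrow> d \<in> X \<Longrightarrow> e \<in> X \<Longrightarrow> f \<in> H a b \<Longrightarrow> g \<in> H b d \<Longrightarrow> h \<in> H d e \<Longrightarrow>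
      c (c h g) f = c h (c g f)"
  shows "category (mk_cat X H i c)"
proof
  show "f \<in> Arr (mk_cat X H i c) \<Longrightarrow> Dom (mk_cat X H i c) f \<in> Obj (mk_cat X H i c)" for f by (cases f) auto
  show "f \<in> Arr (mk_cat X H i c) \<Longrightarrow> Cod (mk_cat X H i c) f \<in> Obj (mk_cat X H i c)" for f by (cases f) auto
  show "a \<in> Obj (mk_cat X H i c) \<Longrightarrow> Id (mk_cat X H i c) a \<in> hom (mk_cat X H i c) a a" for a using assms(1) by auto
  show "Comp (mk_cat X H i c) g f \<in> hom (mk_cat X H i c) a d"
    if "f \<in> hom (mk_cat X H i c) a b" "g \<in> hom (mk_cat X H i c) b d" for f g a b d
    using that assms(2) by (auto elim!: mk_cat_homE)
  show "Comp (mk_cat X H i c) f (Id (mk_cat X H i c) a) = f" if "f \<in> hom (mk_cat X H i c) a b" for f a b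
    using that assms(3) by (auto elim!: mk_cat_homE)
  show "Comp (mk_cat X H i c) (Id (mk_cat X H i c) b) f = f" if "f \<in> hom (mk_cat X H i c) a b" for f a b
    using that assms(4) by (auto elim!: mk_cat_homE)
  show "Comp (mk_cat X H i c) (Comp (mk_cat X H i c) h g) f = Comp (mk_cat X H i c) h (Comp (mk_cat X H i c) g f)"
    if "f \<in> hom (mk_cat X H i c) a b" "g \<in> hom (mk_cat X H i c) b d" "h \<in> hom (mk_cat X H i c) d e" for f g h a b d e
    using that assms(5) by (auto elim!: mk_cat_homE)
qed

context symmetric_monoidal_category begin

lemma Mon_category: "category (Mon M)"
  unfolding Mon_def
proof (rule mk_cat_category)
  fix A assume "A \<in> {A. is_mon M A}"
  then show "Id M (Car A) \<in> mon_hom M A A" by (auto simp: is_mon_def mon_hom_def hom_iff)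
next
  fix A B D f g assume "A \<in> {A. is_mon M A}" "B \<in> {A. is_mon M A}" "D \<in> {A. is_mon M A}"
    and f: "f \<in> mon_hom M A B" and g: "g \<in> mon_hom M B D"
  then have t [simp]: "Car A \<in> Obj M" "Mul A \<in> Arr M" "Dom M (Mul A) = Car A \<otimes> Car A" "Cod M (Mul A) = Car A"
    "One A \<in> Arr M" "Dom M (One A) = unit" "Cod M (One A) = Car A"
    "Mul B \<in> Arr M" "Dom M (Mul B) = Car B \<otimes> Car B" "Cod M (Mul B) = Car B"
    "Mul D \<in> Arr M" "Dom M (Mul D) = Car D \<otimes> Car D" "Cod M (Mul D) = Car D"
    "f \<in> Arr M" "Dom M f = Car A" "Cod M f = Car B" "g \<in> Arr M" "Dom M g = Car B" "Cod M g = Car D"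
    by (auto simp: is_mon_def mon_hom_def hom_iff)
  have e: "f \<cdot> Mul A = Mul B \<cdot> (f \<odot> f)" "f \<cdot> One A = One B" "g \<cdot> Mul B = Mul D \<cdot> (g \<odot> g)" "g \<cdot> One B = One D"
    using f g by (auto simp: mon_hom_def)
  have "g \<cdot> Mul B \<cdot> (f \<odot> f) = (Mul D \<cdot> (g \<odot> g)) \<cdot> (f \<odot> f)" by (simp flip: e(3))
  then show "g \<cdot> f \<in> mon_hom M A D" by (simp add: mon_hom_def hom_iff e merge)
qed (auto simp: mon_hom_def hom_iff)

end

lemma nat_transD:
  assumes "\<eta> \<in> nat_trans C D F G"
  shows "a \<in> Obj C \<Longrightarrow> \<eta> a \<in> hom D (FO F a) (FO G a)" "\<eta> \<in> extensional (Obj C)"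
    "f \<in> Arr C \<Longrightarrow> \<eta> (Cod C f) \<cdot>\<^bsub>D\<^esub> FM F f = FM G f \<cdot>\<^bsub>D\<^esub> \<eta> (Dom C f)"
  using assms by (auto simp: nat_trans_def PiE_def)

lemma fun_cat_category:
  assumes "category C" "category D"
  shows "category (fun_cat C D)"
proof -
  interpret C: category C by fact
  interpret D: category D by fact
  have F: "FM F f \<in> Arr D" "Dom D (FM F f) = FO F (Dom C f)" "Cod D (FM F f) = FO F (Cod C f)"
    if "is_functor C D F" "f \<in> Arr C" for F f using that by (auto simp: is_functor_def hom_iff)
  have FO: "FO F a \<in> Obj D" if "is_functor C D F" "a \<in> Obj C" for F a using that by (auto simp: is_functor_def)
  have n: "\<eta> a \<in> Arr D" "Dom D (\<eta> a) = FO F a" "Cod D (\<eta> a) = FO G a" if "\<eta> \<in> nat_trans C D F G" "a \<in> Obj C" for \<eta> F G a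
    using nat_transD(1)[OF that] by (auto simp: hom_iff)
  show ?thesis unfolding fun_cat_def
  proof (rule mk_cat_category)
    fix F assume "F \<in> {F. is_functor C D F}"
    then show "(\<lambda>a \<in> Obj C. Id D (FO F a)) \<in> nat_trans C D F F"
      using F FO by (auto simp: nat_trans_def D.id_hom)
  next
    fix F G H \<eta> \<theta> assume a: "F \<in> {F. is_functor C D F}" "G \<in> {F. is_functor C D F}" "H \<in> {F. is_functor C D F}"
      and e: "\<eta> \<in> nat_trans C D F G" and t: "\<theta> \<in> nat_trans C D G H"
    have "(\<theta> (Cod C f) \<cdot>\<^bsub>D\<^esub> \<eta> (Cod C f)) \<cdot>\<^bsub>D\<^esub> FM F f = FM H f \<cdot>\<^bsub>D\<^esub> \<theta> (Dom C f) \<cdot>\<^bsub>D\<^esub> \<eta> (Dom C f)" if f: "f \<in> Arr C" for f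
    proof -
      have "(\<theta> (Cod C f) \<cdot>\<^bsub>D\<^esub> \<eta> (Cod C f)) \<cdot>\<^bsub>D\<^esub> FM F f = \<theta> (Cod C f) \<cdot>\<^bsub>D\<^esub> FM G f \<cdot>\<^bsub>D\<^esub> \<eta> (Dom C f)"
        using a f n[OF e] n[OF t] F nat_transD(3)[OF e f] by simp
      also have "\<dots> = (\<theta> (Cod C f) \<cdot>\<^bsub>D\<^esub> FM G f) \<cdot>\<^bsub>D\<^esub> \<eta> (Dom C f)" using a f n[OF e] n[OF t] F by simp
      also have "\<dots> = FM H f \<cdot>\<^bsub>D\<^esub> \<theta> (Dom C f) \<cdot>\<^bsub>D\<^esub> \<eta> (Dom C f)"
        unfolding nat_transD(3)[OF t f] using a f n[OF e] n[OF t] F by simp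
      finally show ?thesis .
    qed
    then show "(\<lambda>a \<in> Obj C. \<theta> a \<cdot>\<^bsub>D\<^esub> \<eta> a) \<in> nat_trans C D F H"
      using n[OF e] n[OF t] by (auto simp: nat_trans_def hom_iff)
  next
    fix F G \<eta> assume "\<eta> \<in> nat_trans C D F G"
    then show "(\<lambda>a \<in> Obj C. \<eta> a \<cdot>\<^bsub>D\<^esub> (\<lambda>a \<in> Obj C. Id D (FO F a)) a) = \<eta>" "(\<lambda>a \<in> Obj C. (\<lambda>a \<in> Obj C. Id D (FO G a)) a \<cdot>\<^bsub>D\<^esub> \<eta> a) = \<eta>"
      using n[of \<eta> F G] nat_transD(2)[of \<eta> C D F G] by (auto intro!: extensionalityI[of _ "Obj C"])
  next
    fix F G H K \<eta> \<theta> \<zeta> assume "\<eta> \<in> nat_trans C D F G" "\<theta> \<in> nat_trans C D G H" "\<zeta> \<in> nat_trans C D H K"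
    then show "(\<lambda>a \<in> Obj C. (\<lambda>a \<in> Obj C. \<zeta> a \<cdot>\<^bsub>D\<^esub> \<theta> a) a \<cdot>\<^bsub>D\<^esub> \<eta> a) = (\<lambda>a \<in> Obj C. \<zeta> a \<cdot>\<^bsub>D\<^esub> (\<lambda>a \<in> Obj C. \<theta> a \<cdot>\<^bsub>D\<^esub> \<eta> a) a)"
      using n by (intro restrict_ext) simp
  qed
qed

lemma is_algebraD:
  assumes "is_algebra P M A"
  shows "c \<in> Colors P \<Longrightarrow> ACar A c \<in> Obj M"
    "x \<in> Ops P \<Longrightarrow> AOp A x \<in> hom M (tens M (map (ACar A) (Inp P x))) (ACar A (Out P x))"
    "x \<in> Ops P \<Longrightarrow> \<sigma> permutes {..<length (Inp P x)} \<Longrightarrow> AOp A (Act P x \<sigma>) \<cdot>\<^bsub>M\<^esub> tens_perm M \<sigma> (map (ACar A) (Inp P x)) = AOp A x"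
    "composable P x ys \<Longrightarrow> AOp A (Gam P x ys) \<cdot>\<^bsub>M\<^esub> tens_concat M (map (\<lambda>y. map (ACar A) (Inp P y)) ys) = AOp A x \<cdot>\<^bsub>M\<^esub> tens_arr M (map (AOp A) ys)"
    "c \<in> Colors P \<Longrightarrow> AOp A (OpUnit P c) = RUnit M (ACar A c)"
    "ACar A \<in> extensional (Colors P)" "AOp A \<in> extensional (Ops P)"
  using assms by (auto simp: is_algebra_def PiE_def)

lemma operad_morphismD:
  assumes "operad_morphism P Q \<phi>"
  shows "c \<in> Colors P \<Longrightarrow> ColMap \<phi> c \<in> Colors Q" "x \<in> Ops P \<Longrightarrow> OpMap \<phi> x \<in> Ops Q"
    "x \<in> Ops P \<Longrightarrow> Out Q (OpMap \<phi> x) = ColMap \<phi> (Out P x)" "x \<in> Ops P \<Longrightarrow> Inp Q (OpMap \<phi> x) = map (ColMap \<phi>) (Inp P x)"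
    "x \<in> Ops P \<Longrightarrow> \<sigma> permutes {..<length (Inp P x)} \<Longrightarrow> OpMap \<phi> (Act P x \<sigma>) = Act Q (OpMap \<phi> x) \<sigma>"
    "composable P x ys \<Longrightarrow> OpMap \<phi> (Gam P x ys) = Gam Q (OpMap \<phi> x) (map (OpMap \<phi>) ys)"
    "c \<in> Colors P \<Longrightarrow> OpMap \<phi> (OpUnit P c) = OpUnit Q (ColMap \<phi> c)"
  using assms unfolding operad_morphism_def by (blast dest: PiE_mem)+

lemma alg_homD:
  assumes "\<phi> \<in> alg_hom P M A B"
  shows "c \<in> Colors P \<Longrightarrow> \<phi> c \<in> hom M (ACar A c) (ACar B c)" "\<phi> \<in> extensional (Colors P)"
    "x \<in> Ops P \<Longrightarrow> \<phi> (Out P x) \<cdot>\<^bsub>M\<^esub> AOp A x = AOp B x \<cdot>\<^bsub>M\<^esub> tens_arr M (map \<phi> (Inp P x))"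
  using assms by (auto simp: alg_hom_def PiE_def)

lemma (in symmetric_monoidal_category) algebra_operad_action:
  assumes "colored_operad P" "is_algebra P M A"
  shows "operad_action M P (ACar A) (AOp A)"
  using assms is_algebraD(1-3)[OF assms(2)]
  by (simp add: operad_action_def operad_action_axioms_def symmetric_monoidal_category_axioms)

lemma (in symmetric_monoidal_category) Alg_category:
  assumes "colored_operad P"
  shows "category (Alg P M)"
proof -
  interpret P: colored_operad P by fact
  have h: "\<phi> c \<in> Arr M" "Dom M (\<phi> c) = ACar A c" "Cod M (\<phi> c) = ACar B c"
    if "\<phi> \<in> alg_hom P M A B" "c \<in> Colors P" for \<phi> A B c
    using alg_homD(1)[OF that] by (auto simp: hom_iff)
  have o: "AOp A x \<in> Arr M" "Dom M (AOp A x) = T (map (ACar A) (Inp P x))" "Cod M (AOp A x) = ACar A (Out P x)"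
    if "is_algebra P M A" "x \<in> Ops P" for A x
    using is_algebraD(2)[OF that] by (auto simp: hom_iff)
  have i: "c \<in> Colors P" if "x \<in> Ops P" "c \<in> set (Inp P x)" for x c using P.inp_color that by blast
  have ta: "tens_arr M (map \<phi> (Inp P x)) \<in> Arr M" "Dom M (tens_arr M (map \<phi> (Inp P x))) = T (map (ACar A) (Inp P x))"
    "Cod M (tens_arr M (map \<phi> (Inp P x))) = T (map (ACar B) (Inp P x))"
    if "\<phi> \<in> alg_hom P M A B" "x \<in> Ops P" for \<phi> A B x
  proof -
    have a: "\<forall>f \<in> set (map \<phi> (Inp P x)). f \<in> Arr M" using h[OF that(1)] i[OF that(2)] by auto
    have "map (Dom M) (map \<phi> (Inp P x)) = map (ACar A) (Inp P x)" "map (Cod M) (map \<phi> (Inp P x)) = map (ACar B) (Inp P x)"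
      using h[OF that(1)] i[OF that(2)] by auto
    then show "tens_arr M (map \<phi> (Inp P x)) \<in> Arr M" "Dom M (tens_arr M (map \<phi> (Inp P x))) = T (map (ACar A) (Inp P x))"
      "Cod M (tens_arr M (map \<phi> (Inp P x))) = T (map (ACar B) (Inp P x))" using tens_arr_arr[OF a] by (simp_all only:)
  qed
  show ?thesis unfolding Alg_def
  proof (rule mk_cat_category)
    fix A assume "A \<in> {A. is_algebra P M A}"
    then have A: "is_algebra P M A" by simp
    have "tens_arr M (map (\<lambda>c \<in> Colors P. Id M (ACar A c)) (Inp P x)) = Id M (T (map (ACar A) (Inp P x)))" if "x \<in> Ops P" for x
    proof -
      have "map (\<lambda>c \<in> Colors P. Id M (ACar A c)) (Inp P x) = map (Id M) (map (ACar A) (Inp P x))" using i[OF that] by auto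
      then show ?thesis using i[OF that] is_algebraD(1)[OF A] by (simp add: tens_arr_id del: map_map)
    qed
    then show "(\<lambda>c \<in> Colors P. Id M (ACar A c)) \<in> alg_hom P M A A"
      using o[OF A] is_algebraD(1)[OF A] P.out_color by (auto simp: alg_hom_def hom_iff)
  next
    fix A B D \<phi> \<psi> assume "A \<in> {A. is_algebra P M A}" "B \<in> {A. is_algebra P M A}" "D \<in> {A. is_algebra P M A}"
      and f: "\<phi> \<in> alg_hom P M A B" and g: "\<psi> \<in> alg_hom P M B D"
    then have A: "is_algebra P M A" and B: "is_algebra P M B" and D: "is_algebra P M D" by auto
    have "(\<psi> (Out P x) \<cdot> \<phi> (Out P x)) \<cdot> AOp A x = AOp D x \<cdot> tens_arr M (map (\<lambda>c \<in> Colors P. \<psi> c \<cdot> \<phi> c) (Inp P x))"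
      if x: "x \<in> Ops P" for x
    proof -
      note c = P.out_color[OF x]
      have "(\<psi> (Out P x) \<cdot> \<phi> (Out P x)) \<cdot> AOp A x = \<psi> (Out P x) \<cdot> (\<phi> (Out P x) \<cdot> AOp A x)"
        using h[OF f c] h[OF g c] o[OF A x] by simp
      also have "\<dots> = (\<psi> (Out P x) \<cdot> AOp B x) \<cdot> tens_arr M (map \<phi> (Inp P x))"
        unfolding alg_homD(3)[OF f x] using h[OF g c] o[OF B x] ta[OF f x] by simp
      also have "\<dots> = AOp D x \<cdot> (tens_arr M (map \<psi> (Inp P x)) \<cdot> tens_arr M (map \<phi> (Inp P x)))"
        unfolding alg_homD(3)[OF g x] using o[OF D x] ta[OF f x] ta[OF g x] by simp
      also have "tens_arr M (map \<psi> (Inp P x)) \<cdot> tens_arr M (map \<phi> (Inp P x)) = tens_arr M (map (\<lambda>c. \<psi> c \<cdot> \<phi> c) (Inp P x))"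
        by (rule tens_arr_comp) (use h[OF f] h[OF g] i[OF x] in auto)
      also have "map (\<lambda>c. \<psi> c \<cdot> \<phi> c) (Inp P x) = map (\<lambda>c \<in> Colors P. \<psi> c \<cdot> \<phi> c) (Inp P x)" using i[OF x] by auto
      finally show ?thesis .
    qed
    then show "(\<lambda>c \<in> Colors P. \<psi> c \<cdot> \<phi> c) \<in> alg_hom P M A D"
      using h[OF f] h[OF g] P.out_color by (auto simp: alg_hom_def hom_iff)
  next
    fix A B \<phi> assume f: "\<phi> \<in> alg_hom P M A B"
    show "(\<lambda>c \<in> Colors P. \<phi> c \<cdot> (\<lambda>c \<in> Colors P. Id M (ACar A c)) c) = \<phi>"
      by (rule extensionalityI[of _ "Colors P"]) (use h[OF f] alg_homD(2)[OF f] in auto)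
    show "(\<lambda>c \<in> Colors P. (\<lambda>c \<in> Colors P. Id M (ACar B c)) c \<cdot> \<phi> c) = \<phi>"
      by (rule extensionalityI[of _ "Colors P"]) (use h[OF f] alg_homD(2)[OF f] in auto)
  next
    fix A B D E \<phi> \<psi> \<chi> assume "\<phi> \<in> alg_hom P M A B" "\<psi> \<in> alg_hom P M B D" "\<chi> \<in> alg_hom P M D E"
    then show "(\<lambda>c \<in> Colors P. (\<lambda>c \<in> Colors P. \<chi> c \<cdot> \<psi> c) c \<cdot> \<phi> c) = (\<lambda>c \<in> Colors P. \<chi> c \<cdot> (\<lambda>c \<in> Colors P. \<psi> c \<cdot> \<phi> c) c)"
      using h by (intro restrict_ext) simp
  qed
qed

lemma is_functorD:
  assumes "is_functor C D F"
  shows "a \<in> Obj C \<Longrightarrow> FO F a \<in> Obj D"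
    "f \<in> hom C a b \<Longrightarrow> FM F f \<in> hom D (FO F a) (FO F b)"
    "a \<in> Obj C \<Longrightarrow> FM F (Id C a) = Id D (FO F a)"
    "f \<in> hom C a b \<Longrightarrow> g \<in> hom C b c \<Longrightarrow> FM F (g \<cdot>\<^bsub>C\<^esub> f) = FM F g \<cdot>\<^bsub>D\<^esub> FM F f"
  using assms by (auto simp: is_functor_def hom_iff)

text \<open>Both sides corepresent \<open>b \<mapsto> hom A1 a (FO G1 b)\<close> on the essential image of \<open>pD\<close>.\<close>
lemma left_adjoint_restrict:
  assumes "category A1" "category B1" "category A2" "category B2"
    and pC: "is_functor A1 A2 pC" and pD: "is_functor B1 B2 pD"
    and ffC: "\<And>x y. x \<in> Obj A1 \<Longrightarrow> y \<in> Obj A1 \<Longrightarrow> bij_betw (FM pC) (hom A1 x y) (hom A2 (FO pC x) (FO pC y))"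
    and ffD: "\<And>x y. x \<in> Obj B1 \<Longrightarrow> y \<in> Obj B1 \<Longrightarrow> bij_betw (FM pD) (hom B1 x y) (hom B2 (FO pD x) (FO pD y))"
    and adj1: "left_adjoint A1 B1 L1 G1" and adj2: "left_adjoint A2 B2 L2 G2"
    and sqO: "\<And>b. b \<in> Obj B1 \<Longrightarrow> FO G2 (FO pD b) = FO pC (FO G1 b)"
    and sqM: "\<And>f. f \<in> Arr B1 \<Longrightarrow> FM G2 (FM pD f) = FM pC (FM G1 f)"
    and a: "a \<in> Obj A1" and b: "b \<in> Obj B1" and eq: "FO L2 (FO pC a) = FO pD b"
  shows "isomorphic B2 (FO L2 (FO pC a)) (FO pD (FO L1 a))"
proof -
  interpret A1: category A1 by fact
  interpret B1: category B1 by fact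
  interpret A2: category A2 by fact
  interpret B2: category B2 by fact
  have L1: "is_functor A1 B1 L1" and G1: "is_functor B1 A1 G1" and L2: "is_functor A2 B2 L2" and G2: "is_functor B2 A2 G2"
    using adj1 adj2 by (auto simp: left_adjoint_def)
  obtain \<eta>1 where \<eta>1: "\<forall>x \<in> Obj A1. \<eta>1 x \<in> hom A1 x (FO G1 (FO L1 x))"
    and u1: "\<forall>x \<in> Obj A1. \<forall>y \<in> Obj B1. \<forall>f \<in> hom A1 x (FO G1 y). \<exists>!g. g \<in> hom B1 (FO L1 x) y \<and> FM G1 g \<cdot>\<^bsub>A1\<^esub> \<eta>1 x = f"
    using adj1 by (auto simp: left_adjoint_def)
  obtain \<eta>2 where \<eta>2: "\<forall>x \<in> Obj A2. \<eta>2 x \<in> hom A2 x (FO G2 (FO L2 x))"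
    and u2: "\<forall>x \<in> Obj A2. \<forall>y \<in> Obj B2. \<forall>f \<in> hom A2 x (FO G2 y). \<exists>!g. g \<in> hom B2 (FO L2 x) y \<and> FM G2 g \<cdot>\<^bsub>A2\<^esub> \<eta>2 x = f"
    using adj2 by (auto simp: left_adjoint_def)
  let ?l = "FO L1 a" and ?X = "FO pD b" and ?e1 = "\<eta>1 a" and ?e2 = "\<eta>2 (FO pC a)" and ?Y = "FO pD (FO L1 a)"
  have l: "?l \<in> Obj B1" using is_functorD(1)[OF L1 a] .
  have pa: "FO pC a \<in> Obj A2" using is_functorD(1)[OF pC a] .
  have X: "?X \<in> Obj B2" and Y: "?Y \<in> Obj B2" using is_functorD(1)[OF pD] b l by auto
  have e1: "?e1 \<in> hom A1 a (FO G1 ?l)" using \<eta>1 a by blast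
  have e2: "?e2 \<in> hom A2 (FO pC a) (FO G2 ?X)" using \<eta>2 pa eq by metis
  have e2': "?e2 \<in> hom A2 (FO pC a) (FO pC (FO G1 b))" using e2 sqO[OF b] by simp
  have pe1: "FM pC ?e1 \<in> hom A2 (FO pC a) (FO G2 ?Y)" using is_functorD(2)[OF pC e1] sqO[OF l] by simp
  \<comment> \<open>By \<open>eq\<close> and \<open>sqO\<close> the second unit ends in the image of
    \<open>pC\<close>, so fullness of \<open>pC\<close> lifts it to \<open>h\<close>, which the
    first adjunction transposes to \<open>g\<close>.\<close>
  obtain h where h: "h \<in> hom A1 a (FO G1 b)" "FM pC h = ?e2"
    using bij_betw_imp_surj_on[OF ffC[OF a is_functorD(1)[OF G1 b]]] e2' by (metis imageE)
  obtain g where g: "g \<in> hom B1 ?l b" "FM G1 g \<cdot>\<^bsub>A1\<^esub> ?e1 = h" using u1 a b h(1) by metis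
  \<comment> \<open>The opposite direction: the image under \<open>pC\<close> of the first unit is
    transposed along the second adjunction.\<close>
  obtain k where k: "k \<in> hom B2 ?X ?Y" "FM G2 k \<cdot>\<^bsub>A2\<^esub> ?e2 = FM pC ?e1" using u2 pa Y pe1 eq by metis
  let ?g = "FM pD g"
  have pg: "?g \<in> hom B2 ?Y ?X" using is_functorD(2)[OF pD g(1)] .
  have ge: "FM G2 ?g \<cdot>\<^bsub>A2\<^esub> FM pC ?e1 = ?e2"
  proof -
    have "FM G2 ?g = FM pC (FM G1 g)" using sqM g(1) by (simp add: hom_iff)
    then have "FM G2 ?g \<cdot>\<^bsub>A2\<^esub> FM pC ?e1 = FM pC (FM G1 g \<cdot>\<^bsub>A1\<^esub> ?e1)"
      using is_functorD(4)[OF pC e1 is_functorD(2)[OF G1 g(1)]] by simp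
    then show ?thesis using g(2) h(2) by simp
  qed
  note G2h = is_functorD(2)[OF G2]
  have gk: "?g \<cdot>\<^bsub>B2\<^esub> k \<in> hom B2 ?X ?X" "k \<cdot>\<^bsub>B2\<^esub> ?g \<in> hom B2 ?Y ?Y" using B2.comp_hom k(1) pg by blast+
  have "FM G2 (?g \<cdot>\<^bsub>B2\<^esub> k) \<cdot>\<^bsub>A2\<^esub> ?e2 = FM G2 ?g \<cdot>\<^bsub>A2\<^esub> (FM G2 k \<cdot>\<^bsub>A2\<^esub> ?e2)"
    using is_functorD(4)[OF G2 k(1) pg] A2.comp_assoc[OF e2 G2h[OF k(1)] G2h[OF pg]] by simp
  then have 1: "FM G2 (?g \<cdot>\<^bsub>B2\<^esub> k) \<cdot>\<^bsub>A2\<^esub> ?e2 = ?e2" using k(2) ge by simp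
  have 2: "FM G2 (Id B2 ?X) \<cdot>\<^bsub>A2\<^esub> ?e2 = ?e2" using is_functorD(3)[OF G2 X] A2.id_comp[OF e2] by simp
  have "\<exists>!u. u \<in> hom B2 (FO L2 (FO pC a)) ?X \<and> FM G2 u \<cdot>\<^bsub>A2\<^esub> ?e2 = ?e2" using u2 pa X e2 by blast
  then have inv1: "?g \<cdot>\<^bsub>B2\<^esub> k = Id B2 ?X" using gk(1) 1 2 B2.id_hom[OF X] unfolding eq by blast
  \<comment> \<open>The source of this endomorphism is \<open>?Y\<close>, where the second
    adjunction gives no uniqueness. Fullness of \<open>pD\<close> lifts it to an endomorphism of
    \<open>?l\<close>, which the first adjunction forces to be the identity.\<close>
  obtain m where m: "m \<in> hom B1 ?l ?l" "FM pD m = k \<cdot>\<^bsub>B2\<^esub> ?g"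
    using bij_betw_imp_surj_on[OF ffD[OF l l]] gk(2) by (metis imageE)
  have Gm: "FM G1 m \<in> hom A1 (FO G1 ?l) (FO G1 ?l)" using is_functorD(2)[OF G1 m(1)] .
  have "FM pC (FM G1 m \<cdot>\<^bsub>A1\<^esub> ?e1) = FM pC (FM G1 m) \<cdot>\<^bsub>A2\<^esub> FM pC ?e1" using is_functorD(4)[OF pC e1 Gm] .
  also have "\<dots> = FM G2 (k \<cdot>\<^bsub>B2\<^esub> ?g) \<cdot>\<^bsub>A2\<^esub> FM pC ?e1" using sqM[of m] m by (simp add: hom_iff)
  also have "\<dots> = FM G2 k \<cdot>\<^bsub>A2\<^esub> (FM G2 ?g \<cdot>\<^bsub>A2\<^esub> FM pC ?e1)"
    using is_functorD(4)[OF G2 pg k(1)] A2.comp_assoc[OF pe1 G2h[OF pg] G2h[OF k(1)]] by simp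
  also have "\<dots> = FM pC ?e1" using ge k(2) by simp
  finally have "FM G1 m \<cdot>\<^bsub>A1\<^esub> ?e1 = ?e1"
    using bij_betw_imp_inj_on[OF ffC[OF a is_functorD(1)[OF G1 l]]] e1 A1.comp_hom[OF e1 Gm] by (metis inj_onD)
  moreover have "FM G1 (Id B1 ?l) \<cdot>\<^bsub>A1\<^esub> ?e1 = ?e1" using is_functorD(3)[OF G1 l] A1.id_comp[OF e1] by simp
  moreover have "\<exists>!u. u \<in> hom B1 ?l ?l \<and> FM G1 u \<cdot>\<^bsub>A1\<^esub> ?e1 = ?e1" using u1 a l e1 by blast
  ultimately have "m = Id B1 ?l" using m(1) B1.id_hom[OF l] by blast
  then have inv2: "k \<cdot>\<^bsub>B2\<^esub> ?g = Id B2 ?Y" using m(2) is_functorD(3)[OF pD l] by simp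
  have "inverse_arrows B2 k ?g" using k(1) pg inv1 inv2 by (auto simp: inverse_arrows_def hom_iff)
  then show ?thesis using k(1) unfolding isomorphic_def is_iso_def eq by blast
qed

section \<open>Pulling algebras back along operad morphisms and descending them to quotients\<close>

context symmetric_monoidal_category begin

lemma is_algebra_pull:
  assumes "colored_operad P" and m: "operad_morphism P Q \<phi>" and B: "is_algebra Q M B"
  shows "is_algebra P M (pull_alg P \<phi> B)"
proof -
  interpret P: colored_operad P by fact
  note d = operad_morphismD[OF m] and a = is_algebraD[OF B]
  have car: "ACar (pull_alg P \<phi> B) c = ACar B (ColMap \<phi> c)" if "c \<in> Colors P" for c using that by (simp add: pull_alg_def)
  have op: "AOp (pull_alg P \<phi> B) x = AOp B (OpMap \<phi> x)" if "x \<in> Ops P" for x using that by (simp add: pull_alg_def)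
  have inp: "map (ACar (pull_alg P \<phi> B)) (Inp P x) = map (ACar B) (Inp Q (OpMap \<phi> x))" if "x \<in> Ops P" for x
    using P.inp_color[OF that] d(4)[OF that] by (auto simp: car)
  show ?thesis unfolding is_algebra_def
  proof (intro conjI ballI allI impI)
    show "ACar (pull_alg P \<phi> B) \<in> Colors P \<rightarrow>\<^sub>E Obj M" using a(1) d(1) by (auto simp: pull_alg_def)
    show "AOp (pull_alg P \<phi> B) \<in> (\<Pi>\<^sub>E x \<in> Ops P. hom M (T (map (ACar (pull_alg P \<phi> B)) (Inp P x))) (ACar (pull_alg P \<phi> B) (Out P x)))"
    proof (rule PiE_I)
      fix x assume x: "x \<in> Ops P"
      show "AOp (pull_alg P \<phi> B) x \<in> hom M (T (map (ACar (pull_alg P \<phi> B)) (Inp P x))) (ACar (pull_alg P \<phi> B) (Out P x))"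
        unfolding inp[OF x] op[OF x] car[OF P.out_color[OF x]] d(3)[OF x, symmetric] by (rule a(2)[OF d(2)[OF x]])
    qed (simp add: pull_alg_def)
  next
    fix x \<sigma> assume x: "x \<in> Ops P" and s: "\<sigma> permutes {..<length (Inp P x)}"
    have s': "\<sigma> permutes {..<length (Inp Q (OpMap \<phi> x))}" using s d(4)[OF x] by simp
    show "AOp (pull_alg P \<phi> B) (Act P x \<sigma>) \<cdot> tens_perm M \<sigma> (map (ACar (pull_alg P \<phi> B)) (Inp P x)) = AOp (pull_alg P \<phi> B) x"
      unfolding inp[OF x] op[OF x] op[OF conjunct1[OF P.act_ops[OF x s]]] d(5)[OF x s] by (rule a(3)[OF d(2)[OF x] s'])
  next
    fix x ys assume c: "composable P x ys"
    then have x: "x \<in> Ops P" "set ys \<subseteq> Ops P" "Inp P x = map (Out P) ys" by (auto simp: composable_def)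
    have "map (ColMap \<phi>) (Inp P x) = map (\<lambda>y. Out Q (OpMap \<phi> y)) ys" using x d(3) by auto
    then have c': "composable Q (OpMap \<phi> x) (map (OpMap \<phi>) ys)" using x d(2) d(4)[OF x(1)] by (auto simp: composable_def)
    have 1: "map (\<lambda>y. map (ACar (pull_alg P \<phi> B)) (Inp P y)) ys = map (\<lambda>y. map (ACar B) (Inp Q y)) (map (OpMap \<phi>) ys)"
      unfolding map_map comp_def by (rule map_cong[OF refl], rule inp) (use x in blast)
    have 2: "map (AOp (pull_alg P \<phi> B)) ys = map (AOp B) (map (OpMap \<phi>) ys)"
      unfolding map_map comp_def by (rule map_cong[OF refl], rule op) (use x in blast)
    show "AOp (pull_alg P \<phi> B) (Gam P x ys) \<cdot> tens_concat M (map (\<lambda>y. map (ACar (pull_alg P \<phi> B)) (Inp P y)) ys) =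
      AOp (pull_alg P \<phi> B) x \<cdot> tens_arr M (map (AOp (pull_alg P \<phi> B)) ys)"
      unfolding 1 2 op[OF x(1)] op[OF conjunct1[OF P.gam_ops[OF c]]] d(6)[OF c] by (rule a(4)[OF c'])
  next
    fix c assume c: "c \<in> Colors P"
    show "AOp (pull_alg P \<phi> B) (OpUnit P c) = RUnit M (ACar (pull_alg P \<phi> B) c)"
      unfolding car[OF c] op[OF conjunct1[OF P.un_ops[OF c]]] d(7)[OF c] by (rule a(5)[OF d(1)[OF c]])
  qed
qed

text \<open>The axioms determine the actions of \<open>Act P x \<sigma>\<close> and
  \<open>Gam P x xs\<close> up to composition with \<open>tens_perm\<close> and
  \<open>tens_concat\<close>, which are isomorphisms and cancel. A generated congruence acts
  trivially as soon as its generators lie in this kernel.\<close>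

lemma algebra_kernel_congruence:
  assumes "colored_operad P" and A: "is_algebra P M A"
  shows "operad_congruence P {(x, y) \<in> colored_operad.same_profile P. AOp A x = AOp A y}"
    (is "operad_congruence P ?K")
proof -
  interpret operad_action M P "ACar A" "AOp A" by (rule algebra_operad_action) fact+
  note a = is_algebraD[OF A]
  show ?thesis unfolding operad_congruence_def
  proof (intro conjI allI impI ballI, goal_cases)
    case 1 show ?case by (rule equivI) (auto simp: O.same_profile_def refl_on_def sym_def trans_def)
  next
    case (3 z)
    obtain x y where z: "z = (x, y)" by (cases z)
    then have x: "x \<in> Ops P" "y \<in> Ops P" "Out P x = Out P y" "Inp P x = Inp P y" "AOp A x = AOp A y"
      using 3 by (auto simp: O.same_profile_def)
    have "(Act P x \<sigma>, Act P y \<sigma>) \<in> ?K" if s: "\<sigma> permutes {..<length (Inp P x)}" for \<sigma>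
    proof -
      have s': "\<sigma> permutes {..<length (Inp P y)}" using s x(4) by simp
      note ax = O.act_ops[OF x(1) s] and ay = O.act_ops[OF x(2) s']
      have p: "is_iso M (tens_perm M \<sigma> (map (ACar A) (Inp P x)))" "Cod M (tens_perm M \<sigma> (map (ACar A) (Inp P x))) = T (permute_list \<sigma> (map (ACar A) (Inp P x)))"
        using tens_perm_arr[OF car_inp[OF x(1)], of \<sigma>] s by simp_all
      have "AOp A (Act P x \<sigma>) \<cdot> tens_perm M \<sigma> (map (ACar A) (Inp P x)) = AOp A (Act P y \<sigma>) \<cdot> tens_perm M \<sigma> (map (ACar A) (Inp P x))"
        using a(3)[OF x(1) s] a(3)[OF x(2) s'] x(4,5) by simp
      then have "AOp A (Act P x \<sigma>) = AOp A (Act P y \<sigma>)"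
        by (rule iso_epi) (use p ax ay s s' x(4) in \<open>simp_all add: permute_list_map\<close>)
      then show ?thesis using ax ay x(3,4) by (simp add: O.same_profile_def)
    qed
    then show ?case unfolding z by simp
  next
    case (4 x y xs ys)
    have "list_all2 (\<lambda>a b. (a, b) \<in> O.same_profile) xs ys" using 4(3) by (elim list_all2_mono) simp
    note sp = O.same_profile_list[OF this]
    have m: "map (AOp A) xs = map (AOp A) ys" using 4(3) by (induction rule: list_all2_induct) auto
    have x: "x \<in> Ops P" "y \<in> Ops P" "Out P x = Out P y" "Inp P x = Inp P y" "AOp A x = AOp A y"
      using 4(2) by (auto simp: O.same_profile_def)
    have cx: "composable P x xs" by (rule 4(1))
    then have c: "composable P y ys" using x sp by (simp add: composable_def)
    have i: "inps xs = inps ys" using arg_cong[OF sp(2), of "map (map (ACar A))"] by (simp add: o_def)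
    note gx = gam_arr[OF cx] and gy = gam_arr[OF c]
    have tc: "is_iso M (tens_concat M (inps xs))" "Cod M (tens_concat M (inps xs)) = T (concat (inps xs))"
      by (rule tens_concat_arr; rule inps_obj; rule gx)+
    have "AOp A (Gam P x xs) \<cdot> tens_concat M (inps xs) = AOp A (Gam P y ys) \<cdot> tens_concat M (inps xs)"
      using a(4)[OF cx] a(4)[OF c] unfolding i m x(5) by (simp only:)
    then have "AOp A (Gam P x xs) = AOp A (Gam P y ys)"
      by (rule iso_epi) (use tc gx gy i in simp_all)
    then show ?case using O.gam_ops[OF cx] O.gam_ops[OF c] x sp by (simp add: O.same_profile_def)
  qed (auto simp: O.same_profile_def)
qed

text \<open>The carriers stay the same and a class acts through a chosen representative, whose
  choice is immaterial by \<open>k\<close>; each axiom for classes is the axiom for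
  representatives.\<close>

lemma algebra_descends:
  fixes P :: "('c, 'x, 'y) operad_scheme"
  assumes "colored_operad P" and r: "operad_congruence P r" and A: "is_algebra P M A"
    and k: "\<And>x y. (x, y) \<in> r \<Longrightarrow> AOp A x = AOp A y"
  obtains B where "is_algebra (quotient_operad P r) M B" "pull_alg P (quotient_map P r) B = A"
proof -
  interpret op_cong P r using assms(1) r by (simp add: op_cong_def op_cong_axioms_def)
  note a = is_algebraD[OF A]
  let ?B = "\<lparr>ACar = ACar A, AOp = (\<lambda>q \<in> Ops Q. AOp A (SOME x. x \<in> q))\<rparr>"
  have op: "AOp ?B (cls x) = AOp A x" if x: "x \<in> Ops P" for x
  proof -
    have "(SOME y. y \<in> cls x) \<in> cls x" using r_refl[OF x] by (metis Image_singleton_iff someI)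
    then have "AOp A x = AOp A (SOME y. y \<in> cls x)" by (intro k) simp
    then show ?thesis using x Q_ops by auto
  qed
  have qm: "OpMap (quotient_map P r) x = cls x" if "x \<in> Ops P" for x using that by (simp add: quotient_map_def)
  have "is_algebra Q M ?B" unfolding is_algebra_def
  proof (intro conjI ballI allI impI)
    show "ACar ?B \<in> Colors Q \<rightarrow>\<^sub>E Obj M" using A by (simp add: is_algebra_def Q_col)
    show "AOp ?B \<in> (\<Pi>\<^sub>E q \<in> Ops Q. hom M (T (map (ACar ?B) (Inp Q q))) (ACar ?B (Out Q q)))"
    proof (rule PiE_I)
      fix q assume "q \<in> Ops Q"
      then obtain x where x: "x \<in> Ops P" "q = cls x" by (auto simp: Q_ops)
      show "AOp ?B q \<in> hom M (T (map (ACar ?B) (Inp Q q))) (ACar ?B (Out Q q))"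
        unfolding x(2) op[OF x(1)] Q_inp[OF x(1)] Q_out[OF x(1)] using a(2)[OF x(1)] by simp
    qed simp
  next
    fix q \<sigma> assume "q \<in> Ops Q" and s: "\<sigma> permutes {..<length (Inp Q q)}"
    then obtain x where x: "x \<in> Ops P" "q = cls x" by (auto simp: Q_ops)
    have s': "\<sigma> permutes {..<length (Inp P x)}" using s x Q_inp by simp
    show "AOp ?B (Act Q q \<sigma>) \<cdot> tens_perm M \<sigma> (map (ACar ?B) (Inp Q q)) = AOp ?B q"
      unfolding x(2) Q_act[OF x(1) s'] op[OF conjunct1[OF act_ops[OF x(1) s']]] op[OF x(1)] Q_inp[OF x(1)]
      using a(3)[OF x(1) s'] by simp
  next
    fix q qs assume "composable Q q qs"
    then obtain x xs where x: "q = cls x" "qs = map cls xs" and c: "composable P x xs" by (rule Q_compE)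
    then have xO: "x \<in> Ops P" "set xs \<subseteq> Ops P" by (auto simp: composable_def)
    have 1: "map (\<lambda>y. map (ACar ?B) (Inp Q y)) (map cls xs) = map (\<lambda>y. map (ACar A) (Inp P y)) xs"
      using xO Q_inp by auto
    have 2: "map (AOp ?B) (map cls xs) = map (AOp A) xs"
      unfolding map_map comp_def by (rule map_cong[OF refl], rule op) (use xO in blast)
    show "AOp ?B (Gam Q q qs) \<cdot> tens_concat M (map (\<lambda>y. map (ACar ?B) (Inp Q y)) qs) = AOp ?B q \<cdot> tens_arr M (map (AOp ?B) qs)"
      unfolding x Q_gam[OF c] 1 2 op[OF xO(1)] op[OF conjunct1[OF gam_ops[OF c]]] by (rule a(4)[OF c])
  next
    fix c assume "c \<in> Colors Q"
    then have c: "c \<in> Colors P" by (simp add: Q_col)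
    show "AOp ?B (OpUnit Q c) = RUnit M (ACar ?B c)"
      unfolding Q_un op[OF conjunct1[OF un_ops[OF c]]] using a(5)[OF c] by simp
  qed
  moreover have "pull_alg P (quotient_map P r) ?B = A"
  proof -
    have "AOp (pull_alg P (quotient_map P r) B) x = AOp B (cls x)" if "x \<in> Ops P" for x and B :: "('c, 'x set, 'o, 'm) alg"
      using that by (simp add: pull_alg_def qm)
    note pull = trans[OF this op]
    have "ACar (pull_alg P (quotient_map P r) ?B) = ACar A"
      by (rule extensionalityI[OF _ a(6)]) (auto simp: pull_alg_def quotient_map_def)
    moreover have "AOp (pull_alg P (quotient_map P r) ?B) = AOp A"
      by (rule extensionalityI[OF _ a(7)]) (simp add: pull_alg_def, rule pull)
    ultimately show ?thesis by simp
  qed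
  ultimately show thesis by (rule that)
qed

end

section \<open>The diagram of monoids of an algebra\<close>

locale cat_algebra = symmetric_monoidal_category M + C: category C
  for M :: "('o, 'm, 'z) smc_scheme" (structure) and C :: "('c, 'k, 'y) cat_scheme" +
  fixes A :: "('c, ('c, 'k) cat_op, 'o, 'm) alg"
  assumes algebra: "is_algebra (cat_operad C) M A"
begin

abbreviation "car \<equiv> ACar A"
abbreviation "prd t fs \<equiv> AOp A (t, id, fs)"
abbreviation "into t fs \<equiv> \<forall>f \<in> set fs. f \<in> Arr C \<and> Cod C f = t"
abbreviation "dm fs \<equiv> map (\<lambda>f. car (Dom C f)) fs"
abbreviation "mul c \<equiv> Mul (alg_monoid C M A c)"
abbreviation "one c \<equiv> One (alg_monoid C M A c)"

text \<open>The middle component of \<open>FM (alg_diagram C M A) f\<close>. A unary operation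
  starts at \<open>car (Dom C f) \<otimes> unit\<close>, which the inverse unitor corrects.\<close>

definition "ar f = AOp A (Cod C f, id, [f]) \<cdot> inv_arr M (RUnit M (car (Dom C f)))"

lemma car_obj [simp]: "c \<in> Obj C \<Longrightarrow> car c \<in> Obj M"
  using is_algebraD(1)[OF algebra] by simp

lemma dm_obj: "into t fs \<Longrightarrow> \<forall>x \<in> set (dm fs). x \<in> Obj M"
  by auto

lemma prd_arr [simp]:
  assumes "t \<in> Obj C" "into t fs"
  shows "prd t fs \<in> Arr M" "Dom M (prd t fs) = T (dm fs)" "Cod M (prd t fs) = car t"
  using is_algebraD(2)[OF algebra, of "(t, id, fs)"] assms by (auto simp: permutes_id hom_iff o_def)

text \<open>The equivariance axiom for \<open>inv \<sigma>\<close>. It shows that an algebra is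
  determined by its operations with identity permutations.\<close>

lemma op_eq:
  assumes t: "t \<in> Obj C" "\<sigma> permutes {..<length fs}" "into t fs"
  shows "AOp A (t, \<sigma>, fs) = prd t (permute_list (inv \<sigma>) fs) \<cdot> tens_perm M (inv \<sigma>) (dm fs)"
proof -
  have "(t, \<sigma>, fs) \<in> Ops (cat_operad C)" "inv \<sigma> permutes {..<length (Inp (cat_operad C) (t, \<sigma>, fs))}"
    using t permutes_inv[OF t(2)] by auto
  from is_algebraD(3)[OF algebra this] show ?thesis using permutes_inv_o(1)[OF t(2)] by (simp add: o_def)
qed

text \<open>The composition axiom where every permutation is the identity, so that
  \<open>as_comp_id\<close> applies. Together with the unit axiom it is the source of all monoid
  laws below.\<close>

lemma prd_concat:
  assumes t: "t \<in> Obj C" and l: "list_all2 (\<lambda>f gs. f \<in> Arr C \<and> Cod C f = t \<and> into (Dom C f) gs) fs gss"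
  shows "prd t (concat (map2 (\<lambda>f. map (Comp C f)) fs gss)) \<cdot> tens_concat M (map dm gss) =
    prd t fs \<cdot> tens_arr M (map2 (\<lambda>f. prd (Dom C f)) fs gss)"
proof -
  let ?P = "cat_operad C" and ?ys = "map2 (\<lambda>f gs. (Dom C f, id :: nat \<Rightarrow> nat, gs)) fs gss"
  have n: "fs ! i \<in> Arr C" "Cod C (fs ! i) = t" "into (Dom C (fs ! i)) (gss ! i)" if "i < length fs" for i
    using list_all2_nthD[OF l that] by auto
  have len: "length gss = length fs" using l by (simp add: list_all2_lengthD)
  have x: "(t, id, fs) \<in> Ops ?P" using t n by (auto simp: permutes_id in_set_conv_nth)
  have y: "set ?ys \<subseteq> Ops ?P"
  proof
    fix y assume "y \<in> set ?ys"
    then obtain i where "i < length fs" "y = (Dom C (fs ! i), id, gss ! i)" using len by (auto simp: set_zip)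
    then show "y \<in> Ops ?P" using n[of i] by (simp add: permutes_id)
  qed
  have "Inp ?P (t, id, fs) = map (Out ?P) ?ys" using len by (auto intro!: nth_equalityI)
  then have c: "composable ?P (t, id, fs) ?ys" using x y by (simp add: composable_def)
  have ks: "map prm3 ?ys = map (\<lambda>_. id) (map len3 ?ys)" by auto
  have p: "map2 (post C) fs ?ys = map2 (\<lambda>f. map (Comp C f)) fs gss"
    using len by (intro nth_equalityI) auto
  have G: "Gam ?P (t, id, fs) ?ys = (t, id, concat (map2 (\<lambda>f. map (Comp C f)) fs gss))"
    unfolding cat_operad_sel ks as_comp_id p ..
  have i: "map (\<lambda>y. map car (Inp ?P y)) ?ys = map dm gss" using len by (auto intro!: nth_equalityI simp: o_def)
  have o: "map (AOp A) ?ys = map2 (\<lambda>f. prd (Dom C f)) fs gss" by auto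
  show ?thesis using is_algebraD(4)[OF algebra c] unfolding G i o .
qed

end

context cat_algebra begin

lemma prd_unit: "t \<in> Obj C \<Longrightarrow> prd t [Id C t] = RUnit M (car t)"
  using is_algebraD(5)[OF algebra, of t] by simp

lemma mul_eq: "c \<in> Obj C \<Longrightarrow> mul c = prd c [Id C c, Id C c] \<cdot> (Id M (car c) \<odot> inv_arr M (RUnit M (car c)))"
  by (simp add: alg_monoid_def)

lemma one_eq: "one c = prd c []"
  by (simp add: alg_monoid_def)

lemma Car_alg_monoid [simp]: "Car (alg_monoid C M A c) = car c"
  by (simp add: alg_monoid_def)

lemma mul_arr [simp]:
  assumes "c \<in> Obj C"
  shows "mul c \<in> Arr M" "Dom M (mul c) = car c \<otimes> car c" "Cod M (mul c) = car c"
    "one c \<in> Arr M" "Dom M (one c) = unit" "Cod M (one c) = car c"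
  using assms by (simp_all add: alg_monoid_def)

text \<open>The binary operation composed with two arbitrary ones. Because of the trailing unit,
  \<open>tens_concat\<close> of two blocks carries a right unitor on the second; naturality matches
  it with the unitor in \<open>mul\<close>, and it is cancelled.\<close>

lemma prd_append:
  assumes t [simp]: "t \<in> Obj C" and fs: "into t fs" and gs: "into t gs"
  shows "prd t (fs @ gs) \<cdot> app (dm fs) (dm gs) = mul t \<cdot> (prd t fs \<odot> prd t gs)"
proof -
  let ?f = "prd t fs" and ?g = "prd t gs" and ?i = "Id C t" and ?\<rho> = "RUnit M (T (dm gs))"
  note f = prd_arr[OF t fs] and g = prd_arr[OF t gs]
  have fg: "into t (fs @ gs)" using fs gs by auto
  note p = prd_arr[OF t fg]
  have o: "T (dm fs) \<in> Obj M" "T (dm gs) \<in> Obj M" using T_obj[OF dm_obj] fs gs by blast+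
  note a = app_arr[OF dm_obj[OF fs] dm_obj[OF gs]]
  have i: "map (Comp C ?i) hs = hs" if "into t hs" for hs using that by (intro map_idI) auto
  have "prd t (concat (map2 (\<lambda>f. map (Comp C f)) [?i, ?i] [fs, gs])) \<cdot> tens_concat M (map dm [fs, gs]) =
    prd t [?i, ?i] \<cdot> tens_arr M (map2 (\<lambda>f. prd (Dom C f)) [?i, ?i] [fs, gs])"
    by (rule prd_concat) (use fs gs in auto)
  then have e: "prd t (fs @ gs) \<cdot> app (dm fs) (dm gs) \<cdot> (Id M (T (dm fs)) \<odot> ?\<rho>) = prd t [?i, ?i] \<cdot> (?f \<odot> (?g \<odot> Id M unit))"
    using i[OF fs] i[OF gs] app_nil_right[OF dm_obj[OF gs]] o by simp
  have "(prd t (fs @ gs) \<cdot> app (dm fs) (dm gs)) \<cdot> (Id M (T (dm fs)) \<odot> ?\<rho>) = prd t [?i, ?i] \<cdot> (?f \<odot> (?g \<odot> Id M unit))"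
    unfolding e[symmetric] using p a o by simp
  also have "\<dots> = mul t \<cdot> (Id M (car t) \<odot> RUnit M (car t)) \<cdot> (?f \<odot> (?g \<odot> Id M unit))"
    using f g by (simp add: mul_eq merge)
  also have "\<dots> = (mul t \<cdot> (?f \<odot> ?g)) \<cdot> (Id M (T (dm fs)) \<odot> ?\<rho>)"
    using f g o runit_nat[of ?g] by (simp add: merge)
  finally show ?thesis by (rule iso_epi) (use f g p a o in simp_all)
qed

lemma ar_arr [simp]:
  assumes "f \<in> Arr C"
  shows "ar f \<in> Arr M" "Dom M (ar f) = car (Dom C f)" "Cod M (ar f) = car (Cod C f)"
  using assms by (simp_all add: ar_def)

lemma prd_single: "f \<in> Arr C \<Longrightarrow> prd (Cod C f) [f] = ar f \<cdot> RUnit M (car (Dom C f))"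
  by (simp add: ar_def)

text \<open>The recursion of \<open>bigmul\<close>, now derived instead of imposed: operations with
  identity permutations are iterated products in the monoids of the algebra.\<close>

lemma prd_Cons:
  assumes f: "f \<in> Arr C" and fs: "into (Cod C f) fs"
  shows "prd (Cod C f) (f # fs) = mul (Cod C f) \<cdot> (ar f \<odot> prd (Cod C f) fs)"
proof -
  let ?t = "Cod C f" and ?x = "car (Dom C f)" and ?y = "T (dm fs)"
  have t: "?t \<in> Obj C" "into ?t [f]" "into ?t ([f] @ fs)" using f fs by auto
  note p = prd_arr[OF t(1) fs] prd_arr[OF t(1) t(3)] ar_arr[OF f]
  have y: "?y \<in> Obj M" using T_obj[OF dm_obj[OF fs]] .
  have "prd ?t ([f] @ fs) \<cdot> (RUnit M ?x \<odot> Id M ?y) = prd ?t ([f] @ fs) \<cdot> app (dm [f]) (dm fs)"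
    using f y triangle[of ?x ?y] by simp
  also have "\<dots> = mul ?t \<cdot> (prd ?t [f] \<odot> prd ?t fs)" by (rule prd_append[OF t(1,2) fs])
  also have "\<dots> = (mul ?t \<cdot> (ar f \<odot> prd ?t fs)) \<cdot> (RUnit M ?x \<odot> Id M ?y)"
    unfolding prd_single[OF f] using f p y by (simp add: merge)
  finally have "prd ?t ([f] @ fs) = mul ?t \<cdot> (ar f \<odot> prd ?t fs)"
    by (rule iso_epi) (use f p y in simp_all)
  then show ?thesis by simp
qed

text \<open>Composition with a unary operation. At lists of length zero, one and two it says that
  \<open>ar f\<close> preserves units, that \<open>ar\<close> preserves composites, and that
  \<open>ar f\<close> preserves products.\<close>

lemma prd_post:
  assumes f: "f \<in> Arr C" and gs: "into (Dom C f) gs"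
  shows "prd (Cod C f) (map (Comp C f) gs) = ar f \<cdot> prd (Dom C f) gs"
proof -
  let ?t = "Cod C f" and ?g = "prd (Dom C f) gs" and ?y = "T (dm gs)"
  have t: "?t \<in> Obj C" "Dom C f \<in> Obj C" "into ?t (map (Comp C f) gs)" "dm (map (Comp C f) gs) = dm gs" using f gs by auto
  note p = prd_arr[OF t(1,3), unfolded t(4)] prd_arr[OF t(2) gs] ar_arr[OF f]
  have y: "?y \<in> Obj M" using T_obj[OF dm_obj[OF gs]] .
  have "prd ?t (concat (map2 (\<lambda>f. map (Comp C f)) [f] [gs])) \<cdot> tens_concat M (map dm [gs]) =
    prd ?t [f] \<cdot> tens_arr M (map2 (\<lambda>f. prd (Dom C f)) [f] [gs])"
    by (rule prd_concat) (use f gs in auto)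
  then have "prd ?t (map (Comp C f) gs) \<cdot> RUnit M ?y = prd ?t [f] \<cdot> (?g \<odot> Id M unit)"
    using app_nil_right[OF dm_obj[OF gs]] y by simp
  also have "\<dots> = (ar f \<cdot> ?g) \<cdot> RUnit M ?y"
    unfolding prd_single[OF f] using f p y runit_nat[of ?g] by simp
  finally show ?thesis by (rule iso_epi) (use f p y in simp_all)
qed

lemma ar_id [simp]: "c \<in> Obj C \<Longrightarrow> ar (Id C c) = Id M (car c)"
  by (simp add: ar_def prd_unit)

lemma ar_comp:
  assumes "f \<in> Arr C" "g \<in> Arr C" "Cod C f = Dom C g"
  shows "ar (Comp C g f) = ar g \<cdot> ar f"
  using prd_post[of g "[f]"] assms by (simp add: ar_def)

text \<open>The right unit law is \<open>prd_Cons\<close> at the empty list, the left one is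
  \<open>prd_append\<close> with an empty first list, and associativity compares two ways of
  splitting three identity arrows. Composing with unitors adjusts the trailing units.\<close>

lemma is_mon_alg_monoid:
  assumes c [simp]: "c \<in> Obj C"
  shows "is_mon M (alg_monoid C M A c)"
proof -
  let ?i = "Id C c" and ?x = "car c" and ?\<rho> = "RUnit M (car c)" and ?id = "Id M (car c)"
  have r: "mul c \<cdot> (?id \<odot> one c) = ?\<rho>" using prd_Cons[of ?i "[]"] by (simp add: prd_unit one_eq)
  have two: "prd c [?i, ?i] = mul c \<cdot> (?id \<odot> ?\<rho>)" using prd_Cons[of ?i "[?i]"] by (simp add: prd_unit)
  have l: "mul c \<cdot> (one c \<odot> ?id) = LUnit M ?x"
  proof (rule iso_epi[where e = "Id M unit \<odot> ?\<rho>"])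
    have "(mul c \<cdot> (one c \<odot> ?id)) \<cdot> (Id M unit \<odot> ?\<rho>) = mul c \<cdot> (prd c [] \<odot> prd c [?i])"
      by (simp add: merge prd_unit one_eq)
    also have "\<dots> = prd c ([] @ [?i]) \<cdot> app (dm []) (dm [?i])" by (rule prd_append[symmetric]) simp_all
    also have "\<dots> = LUnit M ?x \<cdot> (Id M unit \<odot> ?\<rho>)" using lunit_nat[of ?\<rho>] by (simp add: prd_unit)
    finally show "(mul c \<cdot> (one c \<odot> ?id)) \<cdot> (Id M unit \<odot> ?\<rho>) = LUnit M ?x \<cdot> (Id M unit \<odot> ?\<rho>)" .
  qed simp_all
  have a: "mul c \<cdot> (mul c \<odot> ?id) = mul c \<cdot> (?id \<odot> mul c) \<cdot> Assoc M ?x ?x ?x"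
  proof (rule iso_epi[where e = "(?id \<odot> ?\<rho>) \<odot> ?\<rho>"])
    have "(mul c \<cdot> (mul c \<odot> ?id)) \<cdot> ((?id \<odot> ?\<rho>) \<odot> ?\<rho>) = mul c \<cdot> (prd c [?i, ?i] \<odot> prd c [?i])"
      by (simp add: merge prd_unit two)
    also have "\<dots> = prd c ([?i, ?i] @ [?i]) \<cdot> app (dm [?i, ?i]) (dm [?i])" by (rule prd_append[symmetric]) simp_all
    also have "\<dots> = (mul c \<cdot> (?id \<odot> (mul c \<cdot> (?id \<odot> ?\<rho>)))) \<cdot> (?id \<odot> (?\<rho> \<odot> Id M (?x \<otimes> unit))) \<cdot> Assoc M ?x (?x \<otimes> unit) (?x \<otimes> unit)"
      using prd_Cons[of ?i "[?i, ?i]"] triangle[of ?x "?x \<otimes> unit"] by (simp add: two prd_unit)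
    also have "\<dots> = mul c \<cdot> (?id \<odot> mul c) \<cdot> (?id \<odot> (?\<rho> \<odot> ?\<rho>)) \<cdot> Assoc M ?x (?x \<otimes> unit) (?x \<otimes> unit)"
      by (simp add: merge)
    also have "\<dots> = mul c \<cdot> (?id \<odot> mul c) \<cdot> Assoc M ?x ?x ?x \<cdot> ((?id \<odot> ?\<rho>) \<odot> ?\<rho>)"
      using assoc_nat[of ?id ?\<rho> ?\<rho>] by simp
    finally show "(mul c \<cdot> (mul c \<odot> ?id)) \<cdot> ((?id \<odot> ?\<rho>) \<odot> ?\<rho>) = (mul c \<cdot> (?id \<odot> mul c) \<cdot> Assoc M ?x ?x ?x) \<cdot> ((?id \<odot> ?\<rho>) \<odot> ?\<rho>)"
      by simp
  qed simp_all
  show ?thesis unfolding is_mon_def using l r a by (simp add: hom_iff)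
qed

text \<open>For products, both sides composed with a unitor are the operation with identity
  permutation and arrows \<open>[f, f]\<close>.\<close>

lemma ar_mon_hom:
  assumes f: "f \<in> Arr C"
  shows "ar f \<in> mon_hom M (alg_monoid C M A (Dom C f)) (alg_monoid C M A (Cod C f))"
proof -
  let ?c = "Dom C f" and ?d = "Cod C f" and ?i = "Id C (Dom C f)" and ?id = "Id M (car (Dom C f))"
  let ?\<rho> = "RUnit M (car ?c)"
  have c [simp]: "?c \<in> Obj C" "?d \<in> Obj C" using f by auto
  note t = ar_arr[OF f]
  have 1: "ar f \<cdot> one ?c = one ?d" using prd_post[OF f, of "[]"] by (simp add: one_eq)
  have "ar f \<cdot> mul ?c = mul ?d \<cdot> (ar f \<odot> ar f)"
  proof (rule iso_epi[where e = "?id \<odot> ?\<rho>"])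
    have "prd ?c [?i, ?i] = mul ?c \<cdot> (?id \<odot> ?\<rho>)" using prd_Cons[of ?i "[?i]"] by (simp add: prd_unit)
    then have "(ar f \<cdot> mul ?c) \<cdot> (?id \<odot> ?\<rho>) = ar f \<cdot> prd ?c [?i, ?i]" using t by simp
    also have "\<dots> = prd ?d [f, f]" using prd_post[OF f, of "[?i, ?i]"] f by simp
    also have "\<dots> = mul ?d \<cdot> (ar f \<odot> prd ?d [f])" by (rule prd_Cons) (use f in auto)
    also have "\<dots> = (mul ?d \<cdot> (ar f \<odot> ar f)) \<cdot> (?id \<odot> ?\<rho>)"
      unfolding prd_single[OF f] using f t by (simp add: merge)
    finally show "(ar f \<cdot> mul ?c) \<cdot> (?id \<odot> ?\<rho>) = (mul ?d \<cdot> (ar f \<odot> ar f)) \<cdot> (?id \<odot> ?\<rho>)" .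
  qed (use f t in simp_all)
  then show ?thesis using 1 t by (simp add: mon_hom_def hom_iff)
qed

theorem alg_diagram_functor: "is_functor C (Mon M) (alg_diagram C M A)"
  unfolding is_functor_def
proof (intro conjI ballI impI)
  let ?F = "alg_diagram C M A"
  have FO: "FO ?F c = alg_monoid C M A c" if "c \<in> Obj C" for c using that by (simp add: alg_diagram_def)
  have FM: "FM ?F f = (alg_monoid C M A (Dom C f), ar f, alg_monoid C M A (Cod C f))" if "f \<in> Arr C" for f
    using that by (simp add: alg_diagram_def ar_def)
  show "FO ?F \<in> Obj C \<rightarrow>\<^sub>E Obj (Mon M)" using is_mon_alg_monoid by (auto simp: alg_diagram_def Mon_def)
  show "FM ?F \<in> Arr C \<rightarrow>\<^sub>E Arr (Mon M)" using is_mon_alg_monoid ar_mon_hom by (auto simp: alg_diagram_def Mon_def simp flip: ar_def)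
  show "FM ?F f \<in> hom (Mon M) (FO ?F (Dom C f)) (FO ?F (Cod C f))" if "f \<in> Arr C" for f
    using that FM[OF that] FO is_mon_alg_monoid ar_mon_hom by (simp add: Mon_def)
  show "FM ?F (Id C c) = Id (Mon M) (FO ?F c)" if c: "c \<in> Obj C" for c
    using FM[of "Id C c"] ar_id[OF c] c FO by (simp add: Mon_def del: ar_id)
  show "FM ?F (Comp C g f) = Comp (Mon M) (FM ?F g) (FM ?F f)" if "f \<in> Arr C" "g \<in> Arr C" "Cod C f = Dom C g" for f g
    using FM[of f] FM[of g] FM[of "Comp C g f"] ar_comp[OF that] that by (simp add: Mon_def)
qed

end

section \<open>Algebra morphisms as natural transformations\<close>

locale cat_algebra_pair = A: cat_algebra M C A + B: cat_algebra M C B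
  for M :: "('o, 'm, 'z) smc_scheme" (structure) and C :: "('c, 'k, 'y) cat_scheme"
    and A B :: "('c, ('c, 'k) cat_op, 'o, 'm) alg"
begin

abbreviation "diagram_hom \<phi> \<equiv> \<lambda>c \<in> Obj C. (alg_monoid C M A c, \<phi> c, alg_monoid C M B c)"

text \<open>Compatibility with operations of arity zero and two makes each component a morphism of
  monoids, and arity one gives naturality; the unitors slide past \<open>\<phi>\<close> because they
  are natural.\<close>

lemma alg_hom_diagram:
  assumes \<phi>: "\<phi> \<in> alg_hom (cat_operad C) M A B"
  shows "diagram_hom \<phi> \<in> nat_trans C (Mon M) (alg_diagram C M A) (alg_diagram C M B)"
proof -
  let ?P = "cat_operad C"
  have h [simp]: "\<phi> c \<in> Arr M" "Dom M (\<phi> c) = A.car c" "Cod M (\<phi> c) = B.car c" if "c \<in> Obj C" for c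
    using alg_homD(1)[OF \<phi>] that by (auto simp: hom_iff)
  have e: "\<phi> t \<cdot> A.prd t fs = B.prd t fs \<cdot> tens_arr M (map (\<lambda>f. \<phi> (Dom C f)) fs)" if "t \<in> Obj C" "A.into t fs" for t fs
    using alg_homD(3)[OF \<phi>, of "(t, id, fs)"] that by (simp add: permutes_id o_def)
  have m: "\<phi> c \<in> mon_hom M (alg_monoid C M A c) (alg_monoid C M B c)" if c [simp]: "c \<in> Obj C" for c
  proof -
    let ?i = "Id C c"
    have 1: "\<phi> c \<cdot> A.one c = B.one c" using e[of c "[]"] by (simp add: A.one_eq B.one_eq)
    have "\<phi> c \<cdot> A.mul c = (\<phi> c \<cdot> A.prd c [?i, ?i]) \<cdot> (Id M (A.car c) \<odot> inv_arr M (RUnit M (A.car c)))"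
      by (simp add: A.mul_eq)
    also have "\<dots> = B.prd c [?i, ?i] \<cdot> (\<phi> c \<odot> ((\<phi> c \<odot> Id M (TUnit M)) \<cdot> inv_arr M (RUnit M (A.car c))))"
      by (subst e) (simp_all add: A.merge)
    also have "(\<phi> c \<odot> Id M (TUnit M)) \<cdot> inv_arr M (RUnit M (A.car c)) = inv_arr M (RUnit M (B.car c)) \<cdot> \<phi> c"
      by (rule A.iso_mono[where e = "RUnit M (B.car c)"])
        (use arg_cong[OF A.runit_nat[of "\<phi> c"], of "\<lambda>f. f \<cdot> inv_arr M (RUnit M (A.car c))"] in simp_all)
    also have "B.prd c [?i, ?i] \<cdot> (\<phi> c \<odot> (inv_arr M (RUnit M (B.car c)) \<cdot> \<phi> c)) = B.mul c \<cdot> (\<phi> c \<odot> \<phi> c)"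
      by (simp add: B.mul_eq A.merge)
    finally show ?thesis using 1 by (simp add: mon_hom_def hom_iff)
  qed
  have n: "\<phi> (Cod C f) \<cdot> A.ar f = B.ar f \<cdot> \<phi> (Dom C f)" if f [simp]: "f \<in> Arr C" for f
  proof (rule A.iso_epi[where e = "RUnit M (A.car (Dom C f))"])
    have "(\<phi> (Cod C f) \<cdot> A.ar f) \<cdot> RUnit M (A.car (Dom C f)) = \<phi> (Cod C f) \<cdot> A.prd (Cod C f) [f]" by (simp add: A.ar_def)
    also have "\<dots> = B.prd (Cod C f) [f] \<cdot> (\<phi> (Dom C f) \<odot> Id M (TUnit M))" by (subst e) simp_all
    also have "\<dots> = B.ar f \<cdot> (RUnit M (B.car (Dom C f)) \<cdot> (\<phi> (Dom C f) \<odot> Id M (TUnit M)))" by (simp add: B.prd_single)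
    also have "\<dots> = (B.ar f \<cdot> \<phi> (Dom C f)) \<cdot> RUnit M (A.car (Dom C f))"
      using A.runit_nat[of "\<phi> (Dom C f)"] by simp
    finally show "(\<phi> (Cod C f) \<cdot> A.ar f) \<cdot> RUnit M (A.car (Dom C f)) = (B.ar f \<cdot> \<phi> (Dom C f)) \<cdot> RUnit M (A.car (Dom C f))" .
  qed simp_all
  show ?thesis
    unfolding nat_trans_def
    using m n A.is_mon_alg_monoid B.is_mon_alg_monoid by (auto simp: Mon_def alg_diagram_def simp flip: A.ar_def B.ar_def)
qed

text \<open>Units, products and single arrows generate all operations: an induction with
  \<open>prd_Cons\<close> settles identity permutations, and \<open>op_eq\<close> with naturality of
  \<open>tens_perm\<close> settles the others.\<close>

lemma diagram_hom_alg:
  assumes \<eta>: "\<eta> \<in> nat_trans C (Mon M) (alg_diagram C M A) (alg_diagram C M B)"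
  defines "\<phi> \<equiv> \<lambda>c \<in> Obj C. mon_arr (\<eta> c)"
  shows "\<phi> \<in> alg_hom (cat_operad C) M A B" "diagram_hom \<phi> = \<eta>"
proof -
  let ?P = "cat_operad C"
  have \<eta>h: "\<eta> c \<in> hom (Mon M) (alg_monoid C M A c) (alg_monoid C M B c)" if "c \<in> Obj C" for c
    using nat_transD(1)[OF \<eta> that] that by (simp add: alg_diagram_def)
  have \<eta>c: "\<eta> c = (alg_monoid C M A c, \<phi> c, alg_monoid C M B c)" "\<phi> c \<in> mon_hom M (alg_monoid C M A c) (alg_monoid C M B c)"
    if "c \<in> Obj C" for c
    using that by (auto intro: mk_cat_homE[OF \<eta>h[OF that, unfolded Mon_def]] simp: mon_arr_def \<phi>_def)
  show "diagram_hom \<phi> = \<eta>"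
    by (rule extensionalityI[OF _ nat_transD(2)[OF \<eta>]]) (use \<eta>c in auto)
  have h [simp]: "\<phi> c \<in> Arr M" "Dom M (\<phi> c) = A.car c" "Cod M (\<phi> c) = B.car c" if "c \<in> Obj C" for c
    using \<eta>c(2)[OF that] by (auto simp: mon_hom_def hom_iff)
  have mh: "\<phi> c \<cdot> A.mul c = B.mul c \<cdot> (\<phi> c \<odot> \<phi> c)" "\<phi> c \<cdot> A.one c = B.one c" if "c \<in> Obj C" for c
    using \<eta>c(2)[OF that] by (auto simp: mon_hom_def)
  have n: "\<phi> (Cod C f) \<cdot> A.ar f = B.ar f \<cdot> \<phi> (Dom C f)" if f: "f \<in> Arr C" for f
    using nat_transD(3)[OF \<eta> f] \<eta>c(1)[of "Cod C f"] \<eta>c(1)[of "Dom C f"] f by (simp add: Mon_def alg_diagram_def flip: A.ar_def B.ar_def)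
  let ?t = "\<lambda>fs. tens_arr M (map (\<lambda>f. \<phi> (Dom C f)) fs)"
  have t: "?t fs \<in> Arr M" "Dom M (?t fs) = tens M (A.dm fs)" "Cod M (?t fs) = tens M (B.dm fs)" if "A.into t fs" for t fs
  proof -
    have a: "\<forall>g \<in> set (map (\<lambda>f. \<phi> (Dom C f)) fs). g \<in> Arr M" using that by auto
    have "map (Dom M) (map (\<lambda>f. \<phi> (Dom C f)) fs) = A.dm fs" "map (Cod M) (map (\<lambda>f. \<phi> (Dom C f)) fs) = B.dm fs" using that by auto
    then show "?t fs \<in> Arr M" "Dom M (?t fs) = tens M (A.dm fs)" "Cod M (?t fs) = tens M (B.dm fs)"
      using A.tens_arr_arr[OF a] by (simp_all only:)
  qed
  have e: "\<phi> t \<cdot> A.prd t fs = B.prd t fs \<cdot> ?t fs" if tO [simp]: "t \<in> Obj C" and "A.into t fs" for t fs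
    using that(2)
  proof (induction fs)
    case Nil
    have "B.prd t [] \<cdot> Id M (TUnit M) = B.prd t []"
      by (rule A.comp_id') (use B.prd_arr[OF tO, of "[]"] in simp_all)
    then show ?case using mh(2)[OF tO] unfolding A.one_eq B.one_eq by (simp only: list.map tens_arr.simps)
  next
    case (Cons f fs)
    then have f: "f \<in> Arr C" "Cod C f = t" "A.into t fs" by auto
    have pA: "A.prd t (f # fs) = A.mul t \<cdot> (A.ar f \<odot> A.prd t fs)" using A.prd_Cons[OF f(1)] f by simp
    have pB: "B.prd t (f # fs) = B.mul t \<cdot> (B.ar f \<odot> B.prd t fs)" using B.prd_Cons[OF f(1)] f by simp
    note ty = t[OF f(3)] A.prd_arr[OF tO f(3)] B.prd_arr[OF tO f(3)] A.ar_arr[OF f(1), unfolded f(2)] B.ar_arr[OF f(1), unfolded f(2)]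
    have dO: "Dom C f \<in> Obj C" using f by auto
    have "\<phi> t \<cdot> A.prd t (f # fs) = (\<phi> t \<cdot> A.mul t) \<cdot> (A.ar f \<odot> A.prd t fs)" unfolding pA using ty f(2) by simp
    also have "\<dots> = B.mul t \<cdot> ((\<phi> t \<cdot> A.ar f) \<odot> (\<phi> t \<cdot> A.prd t fs))"
      unfolding mh(1)[OF tO] using ty f(2) by (simp add: A.merge)
    also have "\<dots> = B.mul t \<cdot> ((B.ar f \<cdot> \<phi> (Dom C f)) \<odot> (B.prd t fs \<cdot> ?t fs))"
      unfolding Cons.IH[OF f(3)] using n[OF f(1)] f(2) by simp
    also have "\<dots> = B.prd t (f # fs) \<cdot> ?t (f # fs)"
      unfolding pB using ty f(2) dO by (simp add: A.merge)
    finally show ?case .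
  qed
  show "\<phi> \<in> alg_hom ?P M A B" unfolding alg_hom_def
  proof (intro CollectI conjI ballI)
    show "\<phi> \<in> (\<Pi>\<^sub>E c \<in> Colors ?P. hom M (A.car c) (B.car c))"
      using h by (auto simp: hom_iff) (simp add: \<phi>_def)
    fix x assume xO: "x \<in> Ops ?P"
    obtain t \<sigma> fs where x: "x = (t, \<sigma>, fs)" by (cases x)
    have tt: "t \<in> Obj C" "\<sigma> permutes {..<length fs}" "A.into t fs" using xO x by auto
    have i: "inv \<sigma> permutes {..<length fs}" using permutes_inv[OF tt(2)] .
    let ?fs = "permute_list (inv \<sigma>) fs"
    have tf: "A.into t ?fs" using tt(3) i by simp
    have iA: "inv \<sigma> permutes {..<length (A.dm fs)}" and iB: "inv \<sigma> permutes {..<length (B.dm fs)}" using i by auto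
    note pA = A.tens_perm_arr[OF A.dm_obj[OF tt(3)] iA] and pB = A.tens_perm_arr[OF B.dm_obj[OF tt(3)] iB]
    have dA: "permute_list (inv \<sigma>) (A.dm fs) = A.dm ?fs" and dB: "permute_list (inv \<sigma>) (B.dm fs) = B.dm ?fs"
      using i by (simp_all add: permute_list_map)
    have a: "\<forall>g \<in> set (map (\<lambda>f. \<phi> (Dom C f)) fs). g \<in> Arr M" using tt(3) by auto
    have m: "map (Dom M) (map (\<lambda>f. \<phi> (Dom C f)) fs) = A.dm fs" "map (Cod M) (map (\<lambda>f. \<phi> (Dom C f)) fs) = B.dm fs"
      using tt(3) by auto
    have nat: "tens_perm M (inv \<sigma>) (B.dm fs) \<cdot> ?t fs = ?t ?fs \<cdot> tens_perm M (inv \<sigma>) (A.dm fs)"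
      using A.tens_perm_nat[OF a, of "inv \<sigma>"] i unfolding m by (simp add: permute_list_map)
    note ty = t[OF tf] t[OF tt(3)] A.prd_arr[OF tt(1) tf] B.prd_arr[OF tt(1) tf] pA[unfolded dA] pB[unfolded dB]
    have "\<phi> t \<cdot> AOp A x = (\<phi> t \<cdot> A.prd t ?fs) \<cdot> tens_perm M (inv \<sigma>) (A.dm fs)"
      unfolding x A.op_eq[OF tt] using tt(1) ty by simp
    also have "\<dots> = B.prd t ?fs \<cdot> (?t ?fs \<cdot> tens_perm M (inv \<sigma>) (A.dm fs))"
      unfolding e[OF tt(1) tf] using ty by simp
    also have "\<dots> = AOp B x \<cdot> ?t fs"
      unfolding nat[symmetric] x B.op_eq[OF tt] using ty by simp
    finally show "\<phi> (Out ?P x) \<cdot> AOp A x = AOp B x \<cdot> tens_arr M (map \<phi> (Inp ?P x))"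
      by (simp add: x o_def)
  qed
qed

end

section \<open>Algebras over the operad of an orthogonal category\<close>

lemma generated_congruence_least: "operad_congruence P K \<Longrightarrow> R \<subseteq> K \<Longrightarrow> generated_congruence P R \<subseteq> K"
  unfolding generated_congruence_def by (rule Inter_lower) simp

lemma (in orthogonal_category) op_cong_perp: "op_cong (cat_operad C) (perp_congruence C perp)"
proof -
  interpret P: colored_operad "cat_operad C" by (rule cat_operad)
  show ?thesis
    unfolding perp_congruence_def by unfold_locales (rule P.gen_cong[OF perp_generators_prof])
qed

locale orthogonal_algebras = symmetric_monoidal_category M + orthogonal_category C perp
  for M :: "('o, 'm, 'z) smc_scheme" (structure) and C :: "('c, 'k, 'y) cat_scheme" and perp
begin

abbreviation "P \<equiv> cat_operad C"
abbreviation "Q \<equiv> orth_operad C perp"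
abbreviation "Pull B \<equiv> pull_alg P (orth_proj C perp) B"

sublocale P: colored_operad P by (rule cat_operad)
sublocale q: op_cong P "perp_congruence C perp" by (rule op_cong_perp)
sublocale Q: colored_operad Q by (rule orth_operad_coequalizer)

lemma Q_eq: "quotient_operad P (perp_congruence C perp) = Q"
  by (simp add: orth_operad_def)

lemma proj_cls: "x \<in> Ops P \<Longrightarrow> OpMap (orth_proj C perp) x = q.cls x"
  by (simp add: orth_proj_def quotient_map_def del: cat_operad_sel)

lemma Pull_sel:
  "c \<in> Obj C \<Longrightarrow> ACar (Pull B) c = ACar B c" "x \<in> Ops P \<Longrightarrow> AOp (Pull B) x = AOp B (q.cls x)"
  using proj_cls[of x] by (simp_all add: pull_alg_def orth_proj_def quotient_map_def del: cat_operad_sel(2))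

lemma Pull_algebra: "is_algebra Q M B \<Longrightarrow> is_algebra P M (Pull B)"
  by (rule is_algebra_pull[OF P.colored_operad_axioms orth_operad_coequalizer(2)])

lemma Pull_cat_algebra: "is_algebra Q M B \<Longrightarrow> cat_algebra M C (Pull B)"
  using Pull_algebra by (simp add: cat_algebra_def cat_algebra_axioms_def symmetric_monoidal_category_axioms category_axioms)

lemma diagram_eq: "is_algebra Q M B \<Longrightarrow> orth_alg_diagram C perp M B = alg_diagram C M (Pull B)"
  by (simp add: orth_alg_diagram_def alg_pullback_def Alg_def)

text \<open>The projection is the identity on colors, surjective on operations and compatible with
  profiles, so both sides impose the same equations on the same families. Pulling back along it is
  therefore fully faithful.\<close>

lemma alg_hom_Pull:
  assumes A: "is_algebra Q M A" and B: "is_algebra Q M B"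
  shows "alg_hom Q M A B = alg_hom P M (Pull A) (Pull B)"
proof -
  have col: "Colors Q = Obj C" using q.Q_col unfolding Q_eq by simp
  have "(\<Pi>\<^sub>E c \<in> Colors Q. hom M (ACar A c) (ACar B c)) = (\<Pi>\<^sub>E c \<in> Colors P. hom M (ACar (Pull A) c) (ACar (Pull B) c))"
    unfolding col cat_operad_sel(1) by (rule PiE_cong) (simp only: Pull_sel)
  moreover have "(\<forall>x \<in> Ops Q. \<phi> (Out Q x) \<cdot> AOp A x = AOp B x \<cdot> tens_arr M (map \<phi> (Inp Q x))) \<longleftrightarrow>
    (\<forall>x \<in> Ops P. \<phi> (Out P x) \<cdot> AOp (Pull A) x = AOp (Pull B) x \<cdot> tens_arr M (map \<phi> (Inp P x)))" for \<phi>
  proof -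
    have oq: "Ops Q = q.cls ` Ops P" using q.Q_ops unfolding Q_eq by auto
    have "(\<forall>x \<in> Ops Q. \<phi> (Out Q x) \<cdot> AOp A x = AOp B x \<cdot> tens_arr M (map \<phi> (Inp Q x))) \<longleftrightarrow>
      (\<forall>x \<in> Ops P. \<phi> (Out Q (q.cls x)) \<cdot> AOp A (q.cls x) = AOp B (q.cls x) \<cdot> tens_arr M (map \<phi> (Inp Q (q.cls x))))"
      by (simp only: oq ball_simps)
    also have "\<dots> \<longleftrightarrow> (\<forall>x \<in> Ops P. \<phi> (Out P x) \<cdot> AOp (Pull A) x = AOp (Pull B) x \<cdot> tens_arr M (map \<phi> (Inp P x)))"
    proof (rule ball_cong[OF refl])
      fix x assume x: "x \<in> Ops P"
      show "(\<phi> (Out Q (q.cls x)) \<cdot> AOp A (q.cls x) = AOp B (q.cls x) \<cdot> tens_arr M (map \<phi> (Inp Q (q.cls x)))) \<longleftrightarrow>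
        (\<phi> (Out P x) \<cdot> AOp (Pull A) x = AOp (Pull B) x \<cdot> tens_arr M (map \<phi> (Inp P x)))"
        unfolding Pull_sel(2)[OF x] q.Q_out[OF x, unfolded Q_eq] q.Q_inp[OF x, unfolded Q_eq] ..
    qed
    finally show ?thesis .
  qed
  ultimately show ?thesis by (simp only: alg_hom_def)
qed

text \<open>Pullback along the projection and the identification of algebras with diagrams, combined
  into one functor. Each component carries its two monoids because arrows of \<open>Mon M\<close>
  are triples.\<close>

definition diagram_functor where
  "diagram_functor =
     \<lparr>FO = (\<lambda>B \<in> Obj (Alg Q M). orth_alg_diagram C perp M B),
      FM = (\<lambda>(A, \<phi>, B) \<in> Arr (Alg Q M).
              (orth_alg_diagram C perp M A,
               \<lambda>c \<in> Obj C. (FO (orth_alg_diagram C perp M A) c, \<phi> c, FO (orth_alg_diagram C perp M B) c),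
               orth_alg_diagram C perp M B))\<rparr>"

lemma diagram_functor_FO: "is_algebra Q M B \<Longrightarrow> FO diagram_functor B = alg_diagram C M (Pull B)"
  by (simp add: diagram_functor_def Alg_def diagram_eq)

lemma diagram_functor_FM:
  assumes "is_algebra Q M A" "is_algebra Q M B" "\<phi> \<in> alg_hom Q M A B"
  shows "FM diagram_functor (A, \<phi>, B) =
    (alg_diagram C M (Pull A), \<lambda>c \<in> Obj C. (alg_monoid C M (Pull A) c, \<phi> c, alg_monoid C M (Pull B) c), alg_diagram C M (Pull B))"
  using assms by (auto simp: diagram_functor_def Alg_def diagram_eq alg_diagram_def intro!: restrict_ext)

lemma Pull_pair:
  assumes "is_algebra Q M A" "is_algebra Q M B"
  shows "cat_algebra_pair M C (Pull A) (Pull B)"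
  using Pull_cat_algebra assms by (simp add: cat_algebra_pair_def)

lemma is_functor_diagram: "is_functor (Alg Q M) (fun_cat C (Mon M)) diagram_functor"
proof -
  have FO: "is_functor C (Mon M) (alg_diagram C M (Pull B))" if "is_algebra Q M B" for B
    by (rule cat_algebra.alg_diagram_functor[OF Pull_cat_algebra[OF that]])
  have FM: "(\<lambda>c \<in> Obj C. (alg_monoid C M (Pull A) c, \<phi> c, alg_monoid C M (Pull B) c)) \<in> nat_trans C (Mon M) (alg_diagram C M (Pull A)) (alg_diagram C M (Pull B))"
    if "is_algebra Q M A" "is_algebra Q M B" "\<phi> \<in> alg_hom Q M A B" for A B \<phi>
    using cat_algebra_pair.alg_hom_diagram[OF Pull_pair[OF that(1,2)]] that(3) unfolding alg_hom_Pull[OF that(1,2)] .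
  have col: "Colors Q = Obj C" using q.Q_col unfolding Q_eq by simp
  have F1: "FM diagram_functor f \<in> hom (fun_cat C (Mon M)) (FO diagram_functor (Dom (Alg Q M) f)) (FO diagram_functor (Cod (Alg Q M) f))"
    if "f \<in> Arr (Alg Q M)" for f
  proof -
    obtain A \<phi> B where f: "f = (A, \<phi>, B)" by (cases f)
    have a: "is_algebra Q M A" "is_algebra Q M B" "\<phi> \<in> alg_hom Q M A B" using that by (auto simp: f Alg_def)
    show ?thesis using FO[OF a(1)] FO[OF a(2)] FM[OF a]
      unfolding f diagram_functor_FM[OF a] by (simp add: Alg_def fun_cat_def diagram_functor_FO a)
  qed
  show ?thesis unfolding is_functor_def
  proof (intro conjI ballI impI)
    show "FO diagram_functor \<in> Obj (Alg Q M) \<rightarrow>\<^sub>E Obj (fun_cat C (Mon M))"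
    proof (rule PiE_I)
      fix B assume "B \<in> Obj (Alg Q M)"
      then have "is_algebra Q M B" by (simp add: Alg_def)
      then show "FO diagram_functor B \<in> Obj (fun_cat C (Mon M))" using FO by (simp add: diagram_functor_FO fun_cat_def)
    qed (simp add: diagram_functor_def)
    show "FM diagram_functor \<in> Arr (Alg Q M) \<rightarrow>\<^sub>E Arr (fun_cat C (Mon M))"
    proof (rule PiE_I)
      show "FM diagram_functor f \<in> Arr (fun_cat C (Mon M))" if "f \<in> Arr (Alg Q M)" for f
        using F1[OF that] by (simp add: hom_iff)
    qed (simp add: diagram_functor_def)
    show "FM diagram_functor f \<in> hom (fun_cat C (Mon M)) (FO diagram_functor (Dom (Alg Q M) f)) (FO diagram_functor (Cod (Alg Q M) f))"
      if "f \<in> Arr (Alg Q M)" for f by (rule F1[OF that])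
    show "FM diagram_functor (Id (Alg Q M) B) = Id (fun_cat C (Mon M)) (FO diagram_functor B)" if "B \<in> Obj (Alg Q M)" for B
    proof -
      have a: "is_algebra Q M B" using that by (simp add: Alg_def)
      have i: "Id (Alg Q M) B = (B, \<lambda>c \<in> Obj C. Id M (ACar B c), B)" by (simp add: Alg_def col)
      interpret Alg: category "Alg Q M" by (rule Alg_category) (rule Q.colored_operad_axioms)
      have "Id (Alg Q M) B \<in> hom (Alg Q M) B B" by (rule Alg.id_hom[OF that])
      then have h: "(\<lambda>c \<in> Obj C. Id M (ACar B c)) \<in> alg_hom Q M B B" unfolding i by (simp add: Alg_def)
      show ?thesis unfolding i diagram_functor_FM[OF a a h] diagram_functor_FO[OF a]
        by (auto simp: fun_cat_def alg_diagram_def Mon_def alg_monoid_def Pull_sel intro!: restrict_ext)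
    qed
    show "FM diagram_functor (Comp (Alg Q M) g f) = Comp (fun_cat C (Mon M)) (FM diagram_functor g) (FM diagram_functor f)"
      if f: "f \<in> Arr (Alg Q M)" and g: "g \<in> Arr (Alg Q M)" and c: "Cod (Alg Q M) f = Dom (Alg Q M) g" for f g
    proof -
      obtain A \<phi> B where fe: "f = (A, \<phi>, B)" by (cases f)
      obtain B' \<psi> D where ge0: "g = (B', \<psi>, D)" by (cases g)
      then have ge: "g = (B, \<psi>, D)" using c fe by (simp add: Alg_def)
      have a: "is_algebra Q M A" "is_algebra Q M B" "\<phi> \<in> alg_hom Q M A B" "is_algebra Q M D" "\<psi> \<in> alg_hom Q M B D"
        using f g by (auto simp: fe ge Alg_def)
      have gf: "Comp (Alg Q M) g f = (A, \<lambda>c \<in> Obj C. \<psi> c \<cdot> \<phi> c, D)" by (simp add: Alg_def fe ge col)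
      interpret Alg: category "Alg Q M" by (rule Alg_category) (rule Q.colored_operad_axioms)
      have "Comp (Alg Q M) g f \<in> Arr (Alg Q M)" using f g c by (rule Alg.comp_arr')
      then have h: "(\<lambda>c \<in> Obj C. \<psi> c \<cdot> \<phi> c) \<in> alg_hom Q M A D" unfolding gf by (simp add: Alg_def)
      show ?thesis unfolding gf diagram_functor_FM[OF a(1,4) h] unfolding fe ge diagram_functor_FM[OF a(1,2,3)] diagram_functor_FM[OF a(2,4,5)]
        by (auto simp: fun_cat_def Mon_def intro!: restrict_ext)
    qed
  qed
qed

text \<open>Algebra morphisms are extensional families, hence determined by their components;
  fullness is \<open>diagram_hom_alg\<close> transported along \<open>alg_hom_Pull\<close>.\<close>

lemma diagram_functor_full_faithful:
  assumes A: "A \<in> Obj (Alg Q M)" and B: "B \<in> Obj (Alg Q M)"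
  shows "bij_betw (FM diagram_functor) (hom (Alg Q M) A B) (hom (fun_cat C (Mon M)) (FO diagram_functor A) (FO diagram_functor B))"
proof -
  have a: "is_algebra Q M A" "is_algebra Q M B" using A B by (auto simp: Alg_def)
  interpret cat_algebra_pair M C "Pull A" "Pull B" by (rule Pull_pair[OF a])
  note hp = alg_hom_Pull[OF a]
  have col: "Colors Q = Obj C" using q.Q_col unfolding Q_eq by simp
  show ?thesis
  proof (rule bij_betwI')
    fix x y assume "x \<in> hom (Alg Q M) A B" "y \<in> hom (Alg Q M) A B"
    then obtain \<phi> \<psi> where x: "x = (A, \<phi>, B)" "\<phi> \<in> alg_hom Q M A B" and y: "y = (A, \<psi>, B)" "\<psi> \<in> alg_hom Q M A B"
      unfolding Alg_def by (auto elim!: mk_cat_homE)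
    show "FM diagram_functor x = FM diagram_functor y \<longleftrightarrow> x = y"
    proof
      assume "FM diagram_functor x = FM diagram_functor y"
      then have eq: "(\<lambda>c \<in> Obj C. (alg_monoid C M (Pull A) c, \<phi> c, alg_monoid C M (Pull B) c)) =
        (\<lambda>c \<in> Obj C. (alg_monoid C M (Pull A) c, \<psi> c, alg_monoid C M (Pull B) c))"
        unfolding x(1) y(1) diagram_functor_FM[OF a x(2)] diagram_functor_FM[OF a y(2)] by simp
      have "\<phi> c = \<psi> c" if "c \<in> Obj C" for c using fun_cong[OF eq, of c] that by simp
      then have "\<phi> = \<psi>" using alg_homD(2)[OF x(2)] alg_homD(2)[OF y(2)] unfolding col by (intro extensionalityI[of _ "Obj C"])
      then show "x = y" by (simp add: x y)
    qed simp
  next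
    fix x assume "x \<in> hom (Alg Q M) A B"
    then show "FM diagram_functor x \<in> hom (fun_cat C (Mon M)) (FO diagram_functor A) (FO diagram_functor B)"
      by (rule is_functorD(2)[OF is_functor_diagram])
  next
    fix z assume "z \<in> hom (fun_cat C (Mon M)) (FO diagram_functor A) (FO diagram_functor B)"
    then obtain \<eta> where z: "z = (alg_diagram C M (Pull A), \<eta>, alg_diagram C M (Pull B))"
      and \<eta>: "\<eta> \<in> nat_trans C (Mon M) (alg_diagram C M (Pull A)) (alg_diagram C M (Pull B))"
      unfolding fun_cat_def diagram_functor_FO[OF a(1)] diagram_functor_FO[OF a(2)] by (auto elim!: mk_cat_homE)
    let ?\<phi> = "\<lambda>c \<in> Obj C. mon_arr (\<eta> c)"
    note h = diagram_hom_alg[OF \<eta>]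
    have \<phi>: "?\<phi> \<in> alg_hom Q M A B" unfolding hp by (rule h)
    have "(A, ?\<phi>, B) \<in> hom (Alg Q M) A B" using a \<phi> by (simp add: Alg_def)
    moreover have "z = FM diagram_functor (A, ?\<phi>, B)" unfolding z diagram_functor_FM[OF a \<phi>] h(2) ..
    ultimately show "\<exists>x \<in> hom (Alg Q M) A B. z = FM diagram_functor x" by blast
  qed
qed

text \<open>The congruence is generated by the orthogonal pairs, so it lies in the kernel of
  \<open>diagram_alg\<close>, itself a congruence, once the generators do. For these, commutativity
  is converted by \<open>fun_op_perp\<close>, and the algebra descends.\<close>

lemma perp_commutative_algebra:
  assumes F: "is_functor C (Mon M) F" and p: "perp_commutative C perp M F"
  obtains B where "B \<in> Obj (Alg Q M)" "FO diagram_functor B = F"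
proof -
  interpret F: monoid_diagram M C F by unfold_locales (rule F)
  note A = F.is_algebra_diagram_alg
  let ?K = "{(x, y) \<in> P.same_profile. AOp F.diagram_alg x = AOp F.diagram_alg y}"
  have K: "operad_congruence P ?K" by (rule algebra_kernel_congruence[OF P.colored_operad_axioms A])
  have "perp_generators C perp \<subseteq> ?K"
  proof
    fix z assume z: "z \<in> perp_generators C perp"
    then obtain f g where e: "z = ((Cod C f, id, [f, g]), (Cod C f, transpose 0 1, [f, g]))" and fg: "(f, g) \<in> perp"
      by (auto simp: perp_generators_def)
    have a: "f \<in> Arr C" "g \<in> Arr C" "Cod C f = Cod C g" using perp_arr[OF fg] by auto
    have s: "z \<in> P.same_profile" using z perp_generators_prof by blast
    then have o: "(Cod C f, id, [f, g]) \<in> Ops P" "(Cod C f, transpose 0 1, [f, g]) \<in> Ops P"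
      unfolding e by (simp_all add: P.same_profile_def del: cat_operad_sel)
    have "F.fun_op (Cod C f, id, [f, g]) = F.fun_op (Cod C f, transpose 0 1, [f, g])"
      by (rule F.fun_op_perp) (use a p fg in \<open>auto simp: perp_commutative_def Let_def\<close>)
    then have "AOp F.diagram_alg (Cod C f, id, [f, g]) = AOp F.diagram_alg (Cod C f, transpose 0 1, [f, g])"
      using o by (simp add: F.diagram_alg_def del: cat_operad_sel)
    then show "z \<in> ?K" using s e by simp
  qed
  with K have "perp_congruence C perp \<subseteq> ?K" unfolding perp_congruence_def by (rule generated_congruence_least)
  then have k: "AOp F.diagram_alg x = AOp F.diagram_alg y" if "(x, y) \<in> perp_congruence C perp" for x y using that by blast
  obtain B where B: "is_algebra Q M B" "Pull B = F.diagram_alg"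
    by (rule algebra_descends[OF P.colored_operad_axioms q.cong A k, unfolded Q_eq, folded orth_proj_def])
  show thesis
    by (rule that[of B]) (use B F.alg_diagram_diagram_alg in \<open>simp_all add: Alg_def diagram_functor_FO\<close>)
qed

end

section \<open>Restriction along an orthogonal functor\<close>

text \<open>The restriction to equal profiles is essential: a morphism may identify colors, so
  related images do not force equal inputs and outputs.\<close>

lemma operad_congruence_preimage:
  assumes "colored_operad P" "colored_operad P'" and m: "operad_morphism P P' \<phi>" and r: "operad_congruence P' r"
  shows "operad_congruence P {(x, y) \<in> colored_operad.same_profile P. (OpMap \<phi> x, OpMap \<phi> y) \<in> r}"
proof -
  interpret P: colored_operad P by fact
  interpret r: op_cong P' r using assms(2) r by (simp add: op_cong_def op_cong_axioms_def)
  note d = operad_morphismD[OF m]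
  let ?K = "{(x, y) \<in> P.same_profile. (OpMap \<phi> x, OpMap \<phi> y) \<in> r}"
  show ?thesis unfolding operad_congruence_def
  proof (intro conjI allI impI ballI, goal_cases)
    case 1
    have "sym r" "trans r" using r.eqv by (simp_all add: equiv_def)
    then have rs: "(b, a) \<in> r" if "(a, b) \<in> r" for a b using that by (meson symD)
    have rt: "(a, c) \<in> r" if "(a, b) \<in> r" "(b, c) \<in> r" for a b c using transD[OF \<open>trans r\<close> that] .
    show ?case
    proof (rule equivI)
      show "?K \<subseteq> Ops P \<times> Ops P" by (auto simp: P.same_profile_def)
      show "refl_on (Ops P) ?K" using r.r_refl d(2) by (auto simp: P.same_profile_def refl_on_def)
      show "sym ?K" using rs by (auto simp: P.same_profile_def sym_def)
      show "trans ?K" by (rule transI) (auto simp: P.same_profile_def intro: rt)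
    qed
  next
    case (3 z)
    obtain x y where z: "z = (x, y)" by (cases z)
    then have x: "x \<in> Ops P" "y \<in> Ops P" "Out P x = Out P y" "Inp P x = Inp P y" "(OpMap \<phi> x, OpMap \<phi> y) \<in> r"
      using 3 by (auto simp: P.same_profile_def)
    have "(Act P x \<sigma>, Act P y \<sigma>) \<in> ?K" if s: "\<sigma> permutes {..<length (Inp P x)}" for \<sigma>
    proof -
      have s': "\<sigma> permutes {..<length (Inp P y)}" "\<sigma> permutes {..<length (Inp P' (OpMap \<phi> x))}" using s x(4) d(4)[OF x(1)] by simp_all
      show ?thesis using P.act_ops[OF x(1) s] P.act_ops[OF x(2) s'(1)] x r.r_act[OF x(5) s'(2)] d(5)[OF x(1) s] d(5)[OF x(2) s'(1)]
        by (simp add: P.same_profile_def)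
    qed
    then show ?case unfolding z by simp
  next
    case (4 x y xs ys)
    have "list_all2 (\<lambda>a b. (a, b) \<in> P.same_profile) xs ys" using 4(3) by (elim list_all2_mono) simp
    note sp = P.same_profile_list[OF this]
    have x: "x \<in> Ops P" "y \<in> Ops P" "Out P x = Out P y" "Inp P x = Inp P y" "(OpMap \<phi> x, OpMap \<phi> y) \<in> r"
      using 4(2) by (auto simp: P.same_profile_def)
    have cx: "composable P x xs" by (rule 4(1))
    then have c: "composable P y ys" using x sp by (simp add: composable_def)
    have "map (ColMap \<phi>) (Inp P x) = map (\<lambda>y. Out P' (OpMap \<phi> y)) xs" using cx d(3) by (auto simp: composable_def)
    then have c': "composable P' (OpMap \<phi> x) (map (OpMap \<phi>) xs)" using x sp d(2) d(4)[OF x(1)] by (auto simp: composable_def)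
    have "list_all2 (\<lambda>a b. (a, b) \<in> r) (map (OpMap \<phi>) xs) (map (OpMap \<phi>) ys)"
      using 4(3) by (simp add: list_all2_map1 list_all2_map2) (elim list_all2_mono, simp)
    from r.r_gam[OF c' x(5) this]
    have "(OpMap \<phi> (Gam P x xs), OpMap \<phi> (Gam P y ys)) \<in> r" using d(6)[OF cx] d(6)[OF c] by simp
    then show ?case using P.gam_ops[OF cx] P.gam_ops[OF c] x sp by (simp add: P.same_profile_def)
  qed (auto simp: P.same_profile_def)
qed

definition functor_op :: "('o1, 'm1, 'o2, 'm2) fctr \<Rightarrow> ('o1, 'm1) cat_op \<Rightarrow> ('o2, 'm2) cat_op" where
  "functor_op j = (\<lambda>(t, \<sigma>, fs). (FO j t, \<sigma>, map (FM j) fs))"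

text \<open>A functor leaves permutations and arities unchanged, so only lists of arrows have to be
  compared; for composition this is functoriality applied inside each block.\<close>

lemma cat_operad_functor:
  assumes "category C" "category D" and j: "is_functor C D j"
  shows "operad_morphism (cat_operad C) (cat_operad D)
    \<lparr>ColMap = (\<lambda>c \<in> Obj C. FO j c), OpMap = (\<lambda>x \<in> Ops (cat_operad C). functor_op j x)\<rparr>"
    (is "operad_morphism ?P ?Q ?\<phi>")
proof -
  interpret C: category C by fact
  interpret D: category D by fact
  interpret P: colored_operad ?P by (rule C.cat_operad)
  have jO: "FO j c \<in> Obj D" if "c \<in> Obj C" for c using is_functorD(1)[OF j that] .
  have jM: "FM j f \<in> Arr D" "Dom D (FM j f) = FO j (Dom C f)" "Cod D (FM j f) = FO j (Cod C f)" if "f \<in> Arr C" for f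
    using is_functorD(2)[OF j homI[OF that]] by (auto simp: hom_iff)
  have jC: "FM j (Comp C g f) = Comp D (FM j g) (FM j f)" if "f \<in> Arr C" "g \<in> Arr C" "Cod C f = Dom C g" for f g
    using j that by (simp add: is_functor_def)
  have op: "OpMap ?\<phi> x = functor_op j x" if "x \<in> Ops ?P" for x using that by simp
  have ops: "functor_op j x \<in> Ops ?Q" if "x \<in> Ops ?P" for x
    using that jO jM by (cases x) (auto simp: functor_op_def)
  show ?thesis unfolding operad_morphism_def
  proof (intro conjI ballI allI impI)
    show "ColMap ?\<phi> \<in> Colors ?P \<rightarrow>\<^sub>E Colors ?Q" using jO by auto
    show "OpMap ?\<phi> \<in> Ops ?P \<rightarrow>\<^sub>E Ops ?Q" using ops by simp
    show "Out ?Q (OpMap ?\<phi> x) = ColMap ?\<phi> (Out ?P x)" if "x \<in> Ops ?P" for x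
      unfolding op[OF that] using that by (cases x) (auto simp: functor_op_def)
    show "Inp ?Q (OpMap ?\<phi> x) = map (ColMap ?\<phi>) (Inp ?P x)" if "x \<in> Ops ?P" for x
      unfolding op[OF that] using that jM by (cases x) (auto simp: functor_op_def)
    show "OpMap ?\<phi> (Act ?P x \<sigma>) = Act ?Q (OpMap ?\<phi> x) \<sigma>" if "x \<in> Ops ?P" "\<sigma> permutes {..<length (Inp ?P x)}" for x \<sigma>
      unfolding op[OF that(1)] op[OF conjunct1[OF P.act_ops[OF that]]] using that
      by (cases x) (auto simp: functor_op_def permute_list_map)
    show "OpMap ?\<phi> (Gam ?P x ys) = Gam ?Q (OpMap ?\<phi> x) (map (OpMap ?\<phi>) ys)" if c: "composable ?P x ys" for x ys
    proof -
      obtain t \<sigma> fs where x: "x = (t, \<sigma>, fs)" by (cases x)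
      note cc = comp_cat[OF c[unfolded x]]
      have xO: "x \<in> Ops ?P" "set ys \<subseteq> Ops ?P" using c by (auto simp: composable_def)
      have m: "map (OpMap ?\<phi>) ys = map (functor_op j) ys" by (rule map_cong[OF refl], rule op) (use xO in blast)
      have k: "map len3 (map (functor_op j) ys) = map len3 ys" "map prm3 (map (functor_op j) ys) = map prm3 ys"
        by (auto simp: functor_op_def)
      have "map (map (FM j)) (map2 (post C) fs ys) = map2 (post D) (map (FM j) fs) (map (functor_op j) ys)"
      proof (rule nth_equalityI)
        fix i assume "i < length (map (map (FM j)) (map2 (post C) fs ys))"
        then have i: "i < length fs" "i < length ys" using cc(1) by auto
        obtain a b gs where y: "ys ! i = (a, b, gs)" by (cases "ys ! i")
        have f: "fs ! i \<in> Arr C" using xO(1) i(1) by (auto simp: x)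
        have g: "g \<in> Arr C" "Cod C g = Dom C (fs ! i)" if "g \<in> set gs" for g
          using cc(2,3)[OF i(1)] that by (auto simp: y)
        show "map (map (FM j)) (map2 (post C) fs ys) ! i = map2 (post D) (map (FM j) fs) (map (functor_op j) ys) ! i"
          using i y f g jC by (simp add: functor_op_def)
      qed (use cc(1) in simp)
      then have e: "map (FM j) (concat (map2 (post C) fs ys)) = concat (map2 (post D) (map (FM j) fs) (map (functor_op j) ys))"
        by (simp only: map_concat)
      have J: "functor_op j (t, s, hs) = (FO j t, s, map (FM j) hs)" for t s hs by (simp add: functor_op_def)
      show ?thesis unfolding op[OF xO(1)] op[OF conjunct1[OF P.gam_ops[OF c]]] m
        unfolding x J cat_operad_sel k e ..
    qed
    show "OpMap ?\<phi> (OpUnit ?P c) = OpUnit ?Q (ColMap ?\<phi> c)" if "c \<in> Colors ?P" for c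
      unfolding op[OF conjunct1[OF P.un_ops[OF that]]] using that is_functorD(3)[OF j, of c] by (simp add: functor_op_def)
  qed
qed

lemma orthogonal_pullback:
  assumes "category C" "orthogonal_category D perp" and j: "is_functor C D j"
  shows "orthogonal_category C (pullback_perp C j perp)"
proof -
  interpret C: category C by fact
  interpret D: orthogonal_category D perp by fact
  have jM: "FM j f \<in> Arr D" "Dom D (FM j f) = FO j (Dom C f)" "Cod D (FM j f) = FO j (Cod C f)" if "f \<in> Arr C" for f
    using is_functorD(2)[OF j homI[OF that]] by (auto simp: hom_iff)
  have jC: "FM j (Comp C g f) = Comp D (FM j g) (FM j f)" if "f \<in> Arr C" "g \<in> Arr C" "Cod C f = Dom C g" for f g
    using j that by (simp add: is_functor_def)
  show ?thesis
    by unfold_locales (auto simp: pullback_perp_def jM jC intro: D.perp_sym D.perp_post D.perp_pre)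
qed

text \<open>\<open>orth_operad_map\<close> takes the image of a whole class, and this lemma is its
  well-definedness. The relation on \<open>C\<close> is pulled back along \<open>j\<close>, so its
  generators lie in the preimage of the congruence on \<open>D\<close>, and with them the congruence
  they generate.\<close>

lemma orth_operad_map_class:
  assumes "category C" "orthogonal_category D perp" and j: "is_functor C D j" and x: "x \<in> Ops (cat_operad C)"
  shows "OpMap (orth_operad_map C (pullback_perp C j perp) D perp j) (perp_congruence C (pullback_perp C j perp) `` {x}) =
    perp_congruence D perp `` {functor_op j x}"
proof -
  let ?p = "pullback_perp C j perp"
  interpret C: orthogonal_category C ?p by (rule orthogonal_pullback) fact+
  interpret D: orthogonal_category D perp by fact
  interpret c: op_cong "cat_operad C" "perp_congruence C ?p" by (rule C.op_cong_perp)
  interpret d: op_cong "cat_operad D" "perp_congruence D perp" by (rule D.op_cong_perp)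
  let ?\<phi> = "\<lparr>ColMap = (\<lambda>c \<in> Obj C. FO j c), OpMap = (\<lambda>x \<in> Ops (cat_operad C). functor_op j x)\<rparr>"
  have m: "operad_morphism (cat_operad C) (cat_operad D) ?\<phi>"
    by (rule cat_operad_functor) (rule C.category_axioms D.category_axioms j)+
  let ?K = "{(x, y) \<in> c.same_profile. (OpMap ?\<phi> x, OpMap ?\<phi> y) \<in> perp_congruence D perp}"
  have K: "operad_congruence (cat_operad C) ?K"
    by (rule operad_congruence_preimage[OF C.cat_operad D.cat_operad m d.cong])
  have gD: "perp_generators D perp \<subseteq> perp_congruence D perp"
    unfolding perp_congruence_def by (rule d.gen_cong[OF D.perp_generators_prof])
  have "perp_generators C ?p \<subseteq> ?K"
  proof
    fix z assume z: "z \<in> perp_generators C ?p"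
    then obtain f g where e: "z = ((Cod C f, id, [f, g]), (Cod C f, transpose 0 1, [f, g]))" and fg: "(f, g) \<in> ?p"
      by (auto simp: perp_generators_def)
    have a: "f \<in> Arr C" "(FM j f, FM j g) \<in> perp" using fg by (auto simp: pullback_perp_def)
    have s: "z \<in> c.same_profile" using z C.perp_generators_prof by blast
    then have o: "(Cod C f, id, [f, g]) \<in> Ops (cat_operad C)" "(Cod C f, transpose 0 1, [f, g]) \<in> Ops (cat_operad C)"
      unfolding e by (simp_all add: c.same_profile_def del: cat_operad_sel)
    have "Cod D (FM j f) = FO j (Cod C f)" using is_functorD(2)[OF j homI[OF a(1)]] by (simp add: hom_iff)
    then have "((FO j (Cod C f), id, [FM j f, FM j g]), (FO j (Cod C f), transpose 0 1, [FM j f, FM j g])) \<in> perp_generators D perp"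
      using a(2) unfolding perp_generators_def by force
    then have "(functor_op j (Cod C f, id, [f, g]), functor_op j (Cod C f, transpose 0 1, [f, g])) \<in> perp_congruence D perp"
      using gD by (auto simp: functor_op_def)
    then show "z \<in> ?K" using s o by (simp add: e del: cat_operad_sel)
  qed
  with K have sub: "perp_congruence C ?p \<subseteq> ?K" unfolding perp_congruence_def by (rule generated_congruence_least)
  have q: "c.cls x \<in> Ops (orth_operad C ?p)" using c.Q_ops x unfolding orth_operad_def by blast
  have "OpMap (orth_operad_map C ?p D perp j) (c.cls x) = perp_congruence D perp `` (functor_op j ` c.cls x)"
    using q by (simp add: orth_operad_map_def functor_op_def)
  also have "\<dots> = d.cls (functor_op j x)"
  proof (rule d.Image_cls)
    show "functor_op j ` c.cls x \<noteq> {}" using c.r_refl[OF x] by blast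
    fix y assume "y \<in> functor_op j ` c.cls x"
    then obtain z where z: "(x, z) \<in> perp_congruence C ?p" "y = functor_op j z" by blast
    then have "(OpMap ?\<phi> x, OpMap ?\<phi> z) \<in> perp_congruence D perp" using sub by blast
    then show "(functor_op j x, y) \<in> perp_congruence D perp" using x c.r_ops[OF z(1)] z(2) by (simp del: cat_operad_sel)
  qed
  finally show ?thesis .
qed

text \<open>A diagram is built from the carriers and from operations with identity permutations of
  arity at most two. If these correspond under \<open>functor_op\<close>, restriction along
  \<open>j\<close> yields the same functor on the nose.\<close>

lemma functor_comp_alg_diagram:
  assumes "category C" and j: "is_functor C D j"
    and car: "\<And>c. c \<in> Obj C \<Longrightarrow> ACar A c = ACar B (FO j c)"
    and op: "\<And>x. x \<in> Ops (cat_operad C) \<Longrightarrow> AOp A x = AOp B (functor_op j x)"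
  shows "functor_comp C (alg_diagram D M B) j = alg_diagram C M A"
proof -
  interpret C: category C by fact
  have jO: "FO j c \<in> Obj D" if "c \<in> Obj C" for c using is_functorD(1)[OF j that] .
  have jM: "FM j f \<in> Arr D" "Dom D (FM j f) = FO j (Dom C f)" "Cod D (FM j f) = FO j (Cod C f)" if "f \<in> Arr C" for f
    using is_functorD(2)[OF j homI[OF that]] by (auto simp: hom_iff)
  have op': "AOp A (t, id, fs) = AOp B (FO j t, id, map (FM j) fs)" if "t \<in> Obj C" "\<forall>f \<in> set fs. f \<in> Arr C \<and> Cod C f = t" for t fs
    using op[of "(t, id, fs)"] that by (simp add: permutes_id functor_op_def)
  have m: "alg_monoid D M B (FO j c) = alg_monoid C M A c" if c: "c \<in> Obj C" for c
  proof -
    have "AOp A (c, id, []) = AOp B (FO j c, id, map (FM j) [])" "AOp A (c, id, [Id C c, Id C c]) = AOp B (FO j c, id, map (FM j) [Id C c, Id C c])"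
      by (rule op'; use c in simp)+
    then show ?thesis unfolding alg_monoid_def car[OF c] list.map is_functorD(3)[OF j c] by (simp only:)
  qed
  have a: "AOp B (Cod D (FM j f), id, [FM j f]) = AOp A (Cod C f, id, [f])" if "f \<in> Arr C" for f
  proof -
    have "AOp A (Cod C f, id, [f]) = AOp B (FO j (Cod C f), id, map (FM j) [f])"
      by (rule op') (use that in simp_all)
    then show ?thesis unfolding jM(3)[OF that] list.map by (rule sym)
  qed
  have "FO (functor_comp C (alg_diagram D M B) j) = FO (alg_diagram C M A)"
    unfolding functor_comp_def alg_diagram_def fctr.select_convs by (rule restrict_ext) (simp add: m jO)
  moreover have "FM (functor_comp C (alg_diagram D M B) j) = FM (alg_diagram C M A)"
    unfolding functor_comp_def alg_diagram_def fctr.select_convs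
  proof (rule restrict_ext)
    fix f assume f: "f \<in> Arr C"
    show "(\<lambda>f \<in> Arr D. (alg_monoid D M B (Dom D f), AOp B (Cod D f, id, [f]) \<cdot>\<^bsub>M\<^esub> inv_arr M (RUnit M (ACar B (Dom D f))), alg_monoid D M B (Cod D f))) (FM j f) =
      (alg_monoid C M A (Dom C f), AOp A (Cod C f, id, [f]) \<cdot>\<^bsub>M\<^esub> inv_arr M (RUnit M (ACar A (Dom C f))), alg_monoid C M A (Cod C f))"
      using jM[OF f] m[of "Dom C f"] m[of "Cod C f"] a[OF f] car[of "Dom C f"] f by simp
  qed
  ultimately show ?thesis by simp
qed

theorem proposition5p1:
  fixes M :: "('o, 'm) smc"
    and C D :: "('u, 'u) cat"
    and perp :: "('u \<times> 'u) set"
    and j :: "('u, 'u, 'u, 'u) fctr"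
    and Lan Oj_shriek A
  assumes "symmetric_monoidal_category M" and "closed_monoidal M" and "bicomplete TYPE('u) M"
    and "orthogonal_category D perp"
    and "category C" and "full_embedding C D j"
    and "left_adjoint (fun_cat C (Mon M)) (fun_cat D (Mon M)) Lan (precomp C D (Mon M) j)"
    and "left_adjoint
           (Alg (orth_operad C (pullback_perp C j perp)) M) (Alg (orth_operad D perp) M) Oj_shriek
           (alg_pullback (orth_operad C (pullback_perp C j perp)) (orth_operad D perp) M
              (orth_operad_map C (pullback_perp C j perp) D perp j))"
    and "A \<in> Obj (Alg (orth_operad C (pullback_perp C j perp)) M)"
    and "perp_commutative D perp M (FO Lan (orth_alg_diagram C (pullback_perp C j perp) M A))"
  shows "isomorphic (fun_cat D (Mon M))
           (FO Lan (orth_alg_diagram C (pullback_perp C j perp) M A))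
           (orth_alg_diagram D perp M (FO Oj_shriek A))"
proof -
  let ?p = "pullback_perp C j perp"
  let ?G1 = "alg_pullback (orth_operad C ?p) (orth_operad D perp) M (orth_operad_map C ?p D perp j)"
  let ?G2 = "precomp C D (Mon M) j"
  have j: "is_functor C D j" using assms(6) by (simp add: full_embedding_def)
  interpret M: symmetric_monoidal_category M by fact
  interpret D: orthogonal_algebras M D perp using assms(1,4) by (simp add: orthogonal_algebras_def)
  interpret C: orthogonal_algebras M C ?p
    using assms(1) orthogonal_pullback[OF assms(5,4) j] by (simp add: orthogonal_algebras_def)
  let ?pC = "C.diagram_functor" and ?pD = "D.diagram_functor"
  have aA: "is_algebra C.Q M A" using assms(9) by (simp add: Alg_def)
  have pA: "orth_alg_diagram C ?p M A = FO ?pC A" by (simp add: C.diagram_functor_FO[OF aA] C.diagram_eq[OF aA])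
  have L: "is_functor (Alg C.Q M) (Alg D.Q M) Oj_shriek" "is_functor (fun_cat C (Mon M)) (fun_cat D (Mon M)) Lan"
    and G1: "is_functor (Alg D.Q M) (Alg C.Q M) ?G1"
    using assms(7,8) by (auto simp: left_adjoint_def)
  have "FO Lan (FO ?pC A) \<in> Obj (fun_cat D (Mon M))"
    by (rule is_functorD(1)[OF L(2) is_functorD(1)[OF C.is_functor_diagram assms(9)]])
  then have "is_functor D (Mon M) (FO Lan (FO ?pC A))" by (simp add: fun_cat_def)
  \<comment> \<open>Commutativity of the Kan extension enters here: the extension is the diagram of
    an algebra \<open>B\<close>, which can then be a target in the universal property of
    \<open>Oj_shriek\<close>.\<close>
  then obtain B where B: "B \<in> Obj (Alg D.Q M)" "FO ?pD B = FO Lan (FO ?pC A)"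
    using D.perp_commutative_algebra assms(10)[unfolded pA] by blast
  have colC: "Colors C.Q = Obj C" and colD: "Colors D.Q = Obj D"
    using C.q.Q_col D.q.Q_col unfolding C.Q_eq D.Q_eq by simp_all
  let ?pull = "pull_alg C.Q (orth_operad_map C ?p D perp j)"
  \<comment> \<open>The square of right adjoints commutes strictly on objects, because on
    representatives the operad morphism is \<open>functor_op\<close>.\<close>
  have sq: "functor_comp C (alg_diagram D M (D.Pull E)) j = alg_diagram C M (C.Pull (?pull E))" for E
  proof (rule functor_comp_alg_diagram[OF assms(5) j])
    fix c assume c: "c \<in> Obj C"
    show "ACar (C.Pull (?pull E)) c = ACar (D.Pull E) (FO j c)"
      unfolding C.Pull_sel(1)[OF c] D.Pull_sel(1)[OF is_functorD(1)[OF j c]]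
      using c by (simp add: pull_alg_def colC orth_operad_map_def)
  next
    fix x assume x: "x \<in> Ops C.P"
    have q: "C.q.cls x \<in> Ops C.Q" using C.q.Q_ops x unfolding C.Q_eq by blast
    have jx: "functor_op j x \<in> Ops D.P"
      using operad_morphismD(2)[OF cat_operad_functor[OF assms(5) D.category_axioms j] x] x by (simp del: cat_operad_sel)
    show "AOp (C.Pull (?pull E)) x = AOp (D.Pull E) (functor_op j x)"
      unfolding C.Pull_sel(2)[OF x] D.Pull_sel(2)[OF jx] orth_operad_map_class[OF assms(5,4) j x, symmetric]
      using q by (simp add: pull_alg_def)
  qed
  have G1O: "FO ?G1 E = ?pull E" if "is_algebra D.Q M E" for E using that by (simp add: alg_pullback_def Alg_def)
  have G1a: "is_algebra C.Q M (?pull E)" if "is_algebra D.Q M E" for E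
    using is_functorD(1)[OF G1, of E] that unfolding G1O[OF that] by (simp add: Alg_def)
  have sqO: "FO ?G2 (FO ?pD E) = FO ?pC (FO ?G1 E)" if "E \<in> Obj (Alg D.Q M)" for E
  proof -
    have a: "is_algebra D.Q M E" using that by (simp add: Alg_def)
    have "FO ?pD E \<in> Obj (fun_cat D (Mon M))" by (rule is_functorD(1)[OF D.is_functor_diagram that])
    then show ?thesis
      by (simp add: precomp_def G1O[OF a] D.diagram_functor_FO[OF a] C.diagram_functor_FO[OF G1a[OF a]] sq)
  qed
  have sqM: "FM ?G2 (FM ?pD f) = FM ?pC (FM ?G1 f)" if f: "f \<in> Arr (Alg D.Q M)" for f
  proof -
    obtain E \<beta> E' where e: "f = (E, \<beta>, E')" by (cases f)
    have a: "is_algebra D.Q M E" "is_algebra D.Q M E'" "\<beta> \<in> alg_hom D.Q M E E'" using f by (auto simp: e Alg_def)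
    let ?\<beta> = "\<lambda>c \<in> Obj C. \<beta> (FO j c)"
    have g: "FM ?G1 f = (?pull E, ?\<beta>, ?pull E')"
      using f by (auto simp: e alg_pullback_def colC orth_operad_map_def intro!: restrict_ext)
    \<comment> \<open>The adjunction hypothesis contains functoriality of \<open>?G1\<close>, which
      yields without computation that the restricted family is a morphism of algebras.\<close>
    have "FM ?G1 f \<in> hom (Alg C.Q M) (FO ?G1 E) (FO ?G1 E')"
      by (rule is_functorD(2)[OF G1]) (use a in \<open>simp add: e Alg_def\<close>)
    then have h: "?\<beta> \<in> alg_hom C.Q M (?pull E) (?pull E')"
      unfolding g G1O[OF a(1)] G1O[OF a(2)] by (simp add: Alg_def)
    have "FM ?pD f \<in> Arr (fun_cat D (Mon M))" using is_functorD(2)[OF D.is_functor_diagram homI[OF f]] by (simp add: hom_iff)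
    then have "FM ?G2 (FM ?pD f) = (functor_comp C (alg_diagram D M (D.Pull E)) j,
       \<lambda>c \<in> Obj C. (alg_monoid D M (D.Pull E) (FO j c), \<beta> (FO j c), alg_monoid D M (D.Pull E') (FO j c)),
       functor_comp C (alg_diagram D M (D.Pull E')) j)"
      unfolding e D.diagram_functor_FM[OF a] using is_functorD(1)[OF j] by (auto simp: precomp_def intro!: restrict_ext)
    also have "\<dots> = FM ?pC (?pull E, ?\<beta>, ?pull E')"
    proof -
      \<comment> \<open>The monoids inside the components are compared by evaluating the square on
        objects at \<open>c\<close>.\<close>
      have "alg_monoid D M (D.Pull E) (FO j c) = alg_monoid C M (C.Pull (?pull E)) c" if c: "c \<in> Obj C" for c E
        using arg_cong[OF sq[of E], of "\<lambda>F. FO F c"] c is_functorD(1)[OF j c] by (simp add: functor_comp_def alg_diagram_def)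
      then show ?thesis unfolding C.diagram_functor_FM[OF G1a[OF a(1)] G1a[OF a(2)] h] sq
        by (auto intro!: restrict_ext)
    qed
    finally show ?thesis unfolding g .
  qed
  have cats: "category (Alg C.Q M)" "category (Alg D.Q M)" "category (fun_cat C (Mon M))" "category (fun_cat D (Mon M))"
    using M.Alg_category[OF C.Q.colored_operad_axioms] M.Alg_category[OF D.Q.colored_operad_axioms]
      fun_cat_category[OF C.category_axioms M.Mon_category] fun_cat_category[OF D.category_axioms M.Mon_category] by auto
  have "is_algebra D.Q M (FO Oj_shriek A)" using is_functorD(1)[OF L(1) assms(9)] by (simp add: Alg_def)
  then have pL: "orth_alg_diagram D perp M (FO Oj_shriek A) = FO ?pD (FO Oj_shriek A)"
    by (simp add: D.diagram_functor_FO D.diagram_eq)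
  show ?thesis unfolding pA pL
    by (rule left_adjoint_restrict[OF cats(1,2,3,4) C.is_functor_diagram D.is_functor_diagram
          C.diagram_functor_full_faithful D.diagram_functor_full_faithful assms(8,7) sqO sqM assms(9) B(1) B(2)[symmetric]])
qed

end
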